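(* Let $f\in L^2(I;V^* )$, $u_0\in H$, and let $u\in\mathcal{W}(I)$ be the solution of the unsteady Navier--Lam\'e equations $\partial_tu(t)+(-\operatorname{div}\mathbb{C}\operatorname{sym}\nabla)u(t)=f(t)$ in $V^*$ for a.e. $t\in I$, $u(0)=u_0$ in $H$. Then, for every $v\in\mathcal{W}(I)$ with $v(0)=u_0$ in $H$, $$\begin{aligned}&\tfrac12\|\mathbb{C}^{1/2}\operatorname{sym}\nabla(v-u)\|_Q^2+\tfrac12\|\partial_t(v-u)\|_{L^2(I;V_{\mathbb{C}}^* )}^2+\tfrac12\|(v-u)(T)\|_H^2\\&\qquad=\inf\bigl\{\tfrac12\|\mathbb{C}^{-1/2}(y-\mathbb{C}\operatorname{sym}\nabla v)\|_Q^2\;\bigm|\;y\in L^2(I;Y^*_{\mathrm{sym}}),\ L^*y=f-\partial_tv\text{ in }L^2(I;V^* )\bigr\}\\&\qquad=\tfrac12\|\partial_tv+(-\operatorname{div}\mathbb{C}\operatorname{sym}\nabla)v-f\|_{L^2(I;V_{\mathbb{C}}^* )}^2 .\end{aligned}$$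
   Context: $\Omega\subseteq\mathbb{R}^d$ is a bounded Lipschitz domain; $I=(0,T)$, $0<T<\infty$; $Q=I\times\Omega$. $V=W^{1,2}_0(\Omega;\mathbb{R}^d)$ (full Dirichlet boundary), $H=L^2(\Omega;\mathbb{R}^d)$, $Y=Y^*=L^2(\Omega;\mathbb{R}^{d\times d})$, $Y^*_{\mathrm{sym}}=\{y\in Y^*\mid y=y^\top\text{ a.e. in }\Omega\}$. $V\hookrightarrow H\cong H^*\hookrightarrow V^*$ is the usual evolution triple and $\mathcal{W}(I)=\{v\in L^2(I;V)\mid\partial_tv\in L^2(I;V^* )\}\hookrightarrow C^0(\overline I;H)$. $L=\nabla\colon V\to Y$, $\langle L^*y,v\rangle_V=\int_\Omega y:\nabla v\,dx$. $\operatorname{sym}A=\frac12(A+A^\top)$. Elasticity tensor: for $\mu_{\mathrm L}>0$ and $\lambda_{\mathrm L}>-\frac2d\mu_{\mathrm L}$, $\mathbb{C}A=2\mu_{\mathrm L}A+\lambda_{\mathrm L}\operatorname{tr}(A)\mathrm{I}_d$ for symmetric $A\in\mathbb{R}^{d\times d}$; $\mathbb{C}^{\pm1/2}$ are the powers of this positive definite map. $\langle-\operatorname{div}\mathbb{C}\operatorname{sym}\nabla v,w\rangle_V=\int_\Omega\mathbb{C}\operatorname{sym}\nabla v:\operatorname{sym}\nabla w\,dx$. $V_{\mathbb{C}}$ is $V$ with the (equivalent) norm $\|\mathbb{C}^{1/2}\operatorname{sym}\nabla\cdot\|_{L^2(\Omega)}$, $V_{\mathbb{C}}^*$ its dual with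 the dual norm. Operators act pointwise in time. $\|\cdot\|_Q$ is the $L^2(Q)$-norm. *)

theory Defs
  imports "HOL-Analysis.Analysis"
begin

text \<open>
  Elements of Lebesgue, Sobolev and Bochner spaces are represented by functions; the norms below
  are therefore seminorms on representatives, and equality in a space is equality almost
  everywhere.  A function of time with values in a space of functions on \<open>\<Omega>\<close> is curried, as in
  \<open>v t x\<close>, and an element of \<open>V\<^sup>*\<close> is a function \<open>\<phi>\<close> of which only the values on \<open>V\<close> matter.
  Throughout, \<open>I\<close> is \<open>{0<..<T}\<close> and \<open>Q\<close> is \<open>I \<times> \<Omega>\<close>.
\<close>

subsection \<open>Domains, smooth functions\<close>

text \<open>
  Near each boundary point, \<open>\<Omega>\<close> is the strict epigraph, in some unit direction \<open>\<nu>\<close>, of a Lipschitz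
  function of the coordinates orthogonal to \<open>\<nu>\<close>.  Such a function is encoded as a function \<open>g\<close> on
  the whole space that is constant along \<open>\<nu>\<close>.
\<close>
definition bounded_lipschitz_domain :: "(real^'d) set \<Rightarrow> bool" where
  "bounded_lipschitz_domain \<Omega> \<longleftrightarrow>
     open \<Omega> \<and> connected \<Omega> \<and> \<Omega> \<noteq> {} \<and> bounded \<Omega> \<and>
     (\<forall>p\<in>frontier \<Omega>. \<exists>U \<nu> g C. open U \<and> p \<in> U \<and> norm \<nu> = 1 \<and>
        C-lipschitz_on UNIV g \<and> (\<forall>x s. g (x + s *\<^sub>R \<nu>) = g x) \<and>
        \<Omega> \<inter> U = {x \<in> U. g x < x \<bullet> \<nu>})"

primrec C_k :: "nat \<Rightarrow> ('a::euclidean_space \<Rightarrow> 'b::real_normed_vector) \<Rightarrow> bool" where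
  "C_k 0 f \<longleftrightarrow> continuous_on UNIV f"
| "C_k (Suc k) f \<longleftrightarrow>
     (\<forall>x. f differentiable at x) \<and> (\<forall>b\<in>Basis. C_k k (\<lambda>x. frechet_derivative f (at x) b))"

text \<open>\<open>C\<^sub>c\<^sup>\<infinity>(S)\<close>, with functions extended by zero to the whole space.\<close>
definition test_functions :: "'a::euclidean_space set \<Rightarrow> ('a \<Rightarrow> 'b::real_normed_vector) set" where
  "test_functions S =
     {\<phi>. (\<forall>k. C_k k \<phi>) \<and> (\<exists>K. compact K \<and> K \<subseteq> S \<and> (\<forall>x. x \<notin> K \<longrightarrow> \<phi> x = 0))}"

subsection \<open>Lebesgue and Sobolev spaces\<close>

definition L2_space :: "'a measure \<Rightarrow> ('a \<Rightarrow> 'b::euclidean_space) set" where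
  "L2_space M = {f \<in> borel_measurable M. integrable M (\<lambda>x. (norm (f x))\<^sup>2)}"

definition L2_norm :: "'a measure \<Rightarrow> ('a \<Rightarrow> 'b::euclidean_space) \<Rightarrow> real" where
  "L2_norm M f = sqrt (\<integral>x. (norm (f x))\<^sup>2 \<partial>M)"

definition has_weak_gradient ::
    "(real^'d) set \<Rightarrow> (real^'d \<Rightarrow> real^'d) \<Rightarrow> (real^'d \<Rightarrow> real^'d^'d) \<Rightarrow> bool" where
  "has_weak_gradient \<Omega> w G \<longleftrightarrow>
     (\<forall>\<psi>\<in>test_functions \<Omega>. \<forall>i j.
        (\<integral>x. w x $ i * frechet_derivative \<psi> (at x) (axis j 1) \<partial>lebesgue_on \<Omega>)
        = - (\<integral>x. G x $ i $ j * \<psi> x \<partial>lebesgue_on \<Omega>))"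

definition W12 :: "(real^'d) set \<Rightarrow> (real^'d \<Rightarrow> real^'d) set" where
  "W12 \<Omega> = {w \<in> L2_space (lebesgue_on \<Omega>). \<exists>G\<in>L2_space (lebesgue_on \<Omega>). has_weak_gradient \<Omega> w G}"

text \<open>Determined up to a null set for \<open>w \<in> W12 \<Omega>\<close>; this is the operator \<open>L\<close>.\<close>
definition weak_grad :: "(real^'d) set \<Rightarrow> (real^'d \<Rightarrow> real^'d) \<Rightarrow> real^'d \<Rightarrow> real^'d^'d" where
  "weak_grad \<Omega> w = (SOME G. G \<in> L2_space (lebesgue_on \<Omega>) \<and> has_weak_gradient \<Omega> w G)"

definition W12_norm :: "(real^'d) set \<Rightarrow> (real^'d \<Rightarrow> real^'d) \<Rightarrow> real" where
  "W12_norm \<Omega> w =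
     sqrt ((L2_norm (lebesgue_on \<Omega>) w)\<^sup>2 + (L2_norm (lebesgue_on \<Omega>) (weak_grad \<Omega> w))\<^sup>2)"

definition V_space :: "(real^'d) set \<Rightarrow> (real^'d \<Rightarrow> real^'d) set" where
  "V_space \<Omega> =
     {w \<in> W12 \<Omega>. \<exists>\<phi>. (\<forall>n. \<phi> n \<in> test_functions \<Omega>) \<and> (\<lambda>n. W12_norm \<Omega> (\<phi> n - w)) \<longlonglongrightarrow> 0}"

definition Y_sym :: "(real^'d) set \<Rightarrow> (real^'d \<Rightarrow> real^'d^'d) set" where
  "Y_sym \<Omega> = {y \<in> L2_space (lebesgue_on \<Omega>). AE x in lebesgue_on \<Omega>. y x = transpose (y x)}"

subsection \<open>Dual spaces, Bochner spaces\<close>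

definition dual_space ::
    "('a \<Rightarrow> 'b::real_vector) set \<Rightarrow> (('a \<Rightarrow> 'b) \<Rightarrow> real) \<Rightarrow> (('a \<Rightarrow> 'b) \<Rightarrow> real) set" where
  "dual_space X N =
     {\<phi>. (\<forall>v\<in>X. \<forall>w\<in>X. \<forall>a b. \<phi> (\<lambda>x. a *\<^sub>R v x + b *\<^sub>R w x) = a * \<phi> v + b * \<phi> w) \<and>
         (\<exists>C. \<forall>w\<in>X. \<bar>\<phi> w\<bar> \<le> C * N w)}"

definition dual_norm ::
    "('a \<Rightarrow> 'b) set \<Rightarrow> (('a \<Rightarrow> 'b) \<Rightarrow> real) \<Rightarrow> (('a \<Rightarrow> 'b) \<Rightarrow> real) \<Rightarrow> real" where
  "dual_norm X N \<phi> = (SUP w\<in>{w \<in> X. N w \<le> 1}. \<bar>\<phi> w\<bar>)"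

text \<open>
  \<open>L\<^sup>2\<close> functions with values in the space \<open>X\<close> seminormed by \<open>N\<close>, with strong (Bochner)
  measurability: \<open>v\<close> is almost everywhere the \<open>N\<close>-limit of simple functions with values in \<open>X\<close>.
\<close>
definition L2_Bochner ::
    "'t measure \<Rightarrow> ('a \<Rightarrow> 'b::real_vector) set \<Rightarrow> (('a \<Rightarrow> 'b) \<Rightarrow> real) \<Rightarrow> ('t \<Rightarrow> 'a \<Rightarrow> 'b) set" where
  "L2_Bochner M X N =
     {v. (AE t in M. v t \<in> X) \<and>
         (\<exists>s. (\<forall>n. simple_function M (s n) \<and> s n ` space M \<subseteq> X) \<and>
              (AE t in M. (\<lambda>n. N (s n t - v t)) \<longlonglongrightarrow> 0)) \<and>
         integrable M (\<lambda>t. (N (v t))\<^sup>2)}"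

definition L2_Bochner_norm ::
    "'t measure \<Rightarrow> (('a \<Rightarrow> 'b) \<Rightarrow> real) \<Rightarrow> ('t \<Rightarrow> 'a \<Rightarrow> 'b) \<Rightarrow> real" where
  "L2_Bochner_norm M N v = sqrt (\<integral>t. (N (v t))\<^sup>2 \<partial>M)"

text \<open>
  The norm of \<open>L\<^sup>2(Q)\<close>, which is identified with \<open>L\<^sup>2(I; L\<^sup>2(\<Omega>))\<close>: the representatives used here need
  not be jointly measurable, so the integral over \<open>Q\<close> is written as an iterated one.
\<close>
definition Q_norm ::
    "(real^'d) set \<Rightarrow> real \<Rightarrow> (real \<Rightarrow> real^'d \<Rightarrow> 'b::euclidean_space) \<Rightarrow> real" where
  "Q_norm \<Omega> T F = sqrt (\<integral>t. (\<integral>x. (norm (F t x))\<^sup>2 \<partial>lebesgue_on \<Omega>) \<partial>lebesgue_on {0<..<T})"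

abbreviation L2V :: "(real^'d) set \<Rightarrow> real \<Rightarrow> (real \<Rightarrow> real^'d \<Rightarrow> real^'d) set" where
  "L2V \<Omega> T \<equiv> L2_Bochner (lebesgue_on {0<..<T}) (V_space \<Omega>) (W12_norm \<Omega>)"

abbreviation L2V_dual ::
    "(real^'d) set \<Rightarrow> real \<Rightarrow> (real \<Rightarrow> (real^'d \<Rightarrow> real^'d) \<Rightarrow> real) set" where
  "L2V_dual \<Omega> T \<equiv>
     L2_Bochner (lebesgue_on {0<..<T}) (dual_space (V_space \<Omega>) (W12_norm \<Omega>))
       (dual_norm (V_space \<Omega>) (W12_norm \<Omega>))"

abbreviation L2Y_sym :: "(real^'d) set \<Rightarrow> real \<Rightarrow> (real \<Rightarrow> real^'d \<Rightarrow> real^'d^'d) set" where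
  "L2Y_sym \<Omega> T \<equiv> L2_Bochner (lebesgue_on {0<..<T}) (Y_sym \<Omega>) (L2_norm (lebesgue_on \<Omega>))"

subsection \<open>The space \<open>\<W>(I)\<close>\<close>

text \<open>
  \<open>\<integral> \<eta>' v dt = - \<integral> \<eta> g dt\<close> in \<open>V\<^sup>*\<close> for all \<open>\<eta> \<in> C\<^sub>c\<^sup>\<infinity>(I)\<close>.  The \<open>V\<^sup>*\<close>-valued integrals are applied to
  an arbitrary \<open>w \<in> V\<close>, and \<open>V\<close> is embedded into \<open>V\<^sup>*\<close> through the inner product of \<open>H\<close>.
\<close>
definition has_time_deriv ::
    "(real^'d) set \<Rightarrow> real \<Rightarrow> (real \<Rightarrow> real^'d \<Rightarrow> real^'d) \<Rightarrow>
     (real \<Rightarrow> (real^'d \<Rightarrow> real^'d) \<Rightarrow> real) \<Rightarrow> bool" where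
  "has_time_deriv \<Omega> T v g \<longleftrightarrow>
     (\<forall>\<eta>\<in>test_functions {0<..<T}. \<forall>w\<in>V_space \<Omega>.
        (\<integral>t. deriv \<eta> t * (\<integral>x. v t x \<bullet> w x \<partial>lebesgue_on \<Omega>) \<partial>lebesgue_on {0<..<T})
        = - (\<integral>t. \<eta> t * g t w \<partial>lebesgue_on {0<..<T}))"

definition W_space :: "(real^'d) set \<Rightarrow> real \<Rightarrow> (real \<Rightarrow> real^'d \<Rightarrow> real^'d) set" where
  "W_space \<Omega> T = {v \<in> L2V \<Omega> T. \<exists>g\<in>L2V_dual \<Omega> T. has_time_deriv \<Omega> T v g}"

text \<open>For \<open>v \<in> W_space \<Omega> T\<close>, determined on \<open>V\<close> at almost every time.\<close>
definition time_deriv ::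
    "(real^'d) set \<Rightarrow> real \<Rightarrow> (real \<Rightarrow> real^'d \<Rightarrow> real^'d) \<Rightarrow>
     real \<Rightarrow> (real^'d \<Rightarrow> real^'d) \<Rightarrow> real" where
  "time_deriv \<Omega> T v = (SOME g. g \<in> L2V_dual \<Omega> T \<and> has_time_deriv \<Omega> T v g)"

text \<open>
  The representative of \<open>v\<close> in \<open>C\<^sup>0([0,T]; H)\<close>; its value at each time in \<open>[0,T]\<close> is determined up to
  a null set in \<open>\<Omega>\<close>.
\<close>
definition cont_rep ::
    "(real^'d) set \<Rightarrow> real \<Rightarrow> (real \<Rightarrow> real^'d \<Rightarrow> real^'d) \<Rightarrow> real \<Rightarrow> real^'d \<Rightarrow> real^'d" where
  "cont_rep \<Omega> T v = (SOME c.
     (\<forall>t\<in>{0..T}. c t \<in> L2_space (lebesgue_on \<Omega>) \<and>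
        ((\<lambda>s. L2_norm (lebesgue_on \<Omega>) (c s - c t)) \<longlongrightarrow> 0) (at t within {0..T})) \<and>
     (AE t in lebesgue_on {0<..<T}. AE x in lebesgue_on \<Omega>. c t x = v t x))"

subsection \<open>The elasticity tensor\<close>

definition sym_matrices :: "(real^'d^'d) set" where
  "sym_matrices = {A. transpose A = A}"

definition sym_part :: "real^'d^'d \<Rightarrow> real^'d^'d" where
  "sym_part A = (1/2) *\<^sub>R (A + transpose A)"

definition elast :: "real \<Rightarrow> real \<Rightarrow> real^'d^'d \<Rightarrow> real^'d^'d" where
  "elast mu lam A = (2 * mu) *\<^sub>R A + (lam * trace A) *\<^sub>R mat 1"

text \<open>\<open>B\<close> is a positive definite square root, on the subspace \<open>S\<close>, of the map \<open>F\<close>.\<close>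
definition is_pos_sqrt_on :: "'a::real_inner set \<Rightarrow> ('a \<Rightarrow> 'a) \<Rightarrow> ('a \<Rightarrow> 'a) \<Rightarrow> bool" where
  "is_pos_sqrt_on S F B \<longleftrightarrow>
     (\<forall>x\<in>S. B x \<in> S \<and> B (B x) = F x) \<and>
     (\<forall>x\<in>S. \<forall>y\<in>S. \<forall>a b. B (a *\<^sub>R x + b *\<^sub>R y) = a *\<^sub>R B x + b *\<^sub>R B y) \<and>
     (\<forall>x\<in>S. \<forall>y\<in>S. B x \<bullet> y = x \<bullet> B y) \<and>
     (\<forall>x\<in>S. x \<noteq> 0 \<longrightarrow> 0 < B x \<bullet> x)"

text \<open>
  The powers \<open>1/2\<close> and \<open>-1/2\<close> of the elasticity tensor, as a map on symmetric matrices; the lemma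
  \<open>elast_half_eq\<close> below shows that the first is well-defined.  The values on other matrices are
  irrelevant.
\<close>
definition elast_half :: "real \<Rightarrow> real \<Rightarrow> real^'d^'d \<Rightarrow> real^'d^'d" where
  "elast_half mu lam = (SOME B. is_pos_sqrt_on sym_matrices (elast mu lam) B)"

definition elast_neg_half :: "real \<Rightarrow> real \<Rightarrow> real^'d^'d \<Rightarrow> real^'d^'d" where
  "elast_neg_half mu lam = inv_into sym_matrices (elast_half mu lam)"

subsection \<open>The operators of the Navier--Lame equations\<close>

definition sym_grad :: "(real^'d) set \<Rightarrow> (real^'d \<Rightarrow> real^'d) \<Rightarrow> real^'d \<Rightarrow> real^'d^'d" where
  "sym_grad \<Omega> v x = sym_part (weak_grad \<Omega> v x)"

text \<open>The operator \<open>v \<mapsto> -div \<C> sym \<nabla> v\<close> from \<open>V\<close> to \<open>V\<^sup>*\<close>.\<close>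
definition lame_op ::
    "(real^'d) set \<Rightarrow> real \<Rightarrow> real \<Rightarrow> (real^'d \<Rightarrow> real^'d) \<Rightarrow> (real^'d \<Rightarrow> real^'d) \<Rightarrow> real" where
  "lame_op \<Omega> mu lam v w = (\<integral>x. elast mu lam (sym_grad \<Omega> v x) \<bullet> sym_grad \<Omega> w x \<partial>lebesgue_on \<Omega>)"

definition grad_adj ::
    "(real^'d) set \<Rightarrow> (real^'d \<Rightarrow> real^'d^'d) \<Rightarrow> (real^'d \<Rightarrow> real^'d) \<Rightarrow> real" where
  "grad_adj \<Omega> y w = (\<integral>x. y x \<bullet> weak_grad \<Omega> w x \<partial>lebesgue_on \<Omega>)"

definition VC_norm :: "(real^'d) set \<Rightarrow> real \<Rightarrow> real \<Rightarrow> (real^'d \<Rightarrow> real^'d) \<Rightarrow> real" where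
  "VC_norm \<Omega> mu lam v = L2_norm (lebesgue_on \<Omega>) (\<lambda>x. elast_half mu lam (sym_grad \<Omega> v x))"

definition L2VC_dual_norm ::
    "(real^'d) set \<Rightarrow> real \<Rightarrow> real \<Rightarrow> real \<Rightarrow> (real \<Rightarrow> (real^'d \<Rightarrow> real^'d) \<Rightarrow> real) \<Rightarrow> real" where
  "L2VC_dual_norm \<Omega> T mu lam =
     L2_Bochner_norm (lebesgue_on {0<..<T}) (dual_norm (V_space \<Omega>) (VC_norm \<Omega> mu lam))"

definition navier_lame_solution ::
    "(real^'d) set \<Rightarrow> real \<Rightarrow> real \<Rightarrow> real \<Rightarrow> (real \<Rightarrow> (real^'d \<Rightarrow> real^'d) \<Rightarrow> real) \<Rightarrow>
     (real^'d \<Rightarrow> real^'d) \<Rightarrow> (real \<Rightarrow> real^'d \<Rightarrow> real^'d) \<Rightarrow> bool" where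
  "navier_lame_solution \<Omega> T mu lam f u0 u \<longleftrightarrow>
     u \<in> W_space \<Omega> T \<and>
     (AE t in lebesgue_on {0<..<T}. \<forall>w\<in>V_space \<Omega>.
        time_deriv \<Omega> T u t w + lame_op \<Omega> mu lam (u t) w = f t w) \<and>
     (AE x in lebesgue_on \<Omega>. cont_rep \<Omega> T u 0 x = u0 x)"

definition admissible_fluxes ::
    "(real^'d) set \<Rightarrow> real \<Rightarrow> (real \<Rightarrow> (real^'d \<Rightarrow> real^'d) \<Rightarrow> real) \<Rightarrow>
     (real \<Rightarrow> real^'d \<Rightarrow> real^'d) \<Rightarrow> (real \<Rightarrow> real^'d \<Rightarrow> real^'d^'d) set" where
  "admissible_fluxes \<Omega> T f v =
     {y \<in> L2Y_sym \<Omega> T. AE t in lebesgue_on {0<..<T}. \<forall>w\<in>V_space \<Omega>.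
        grad_adj \<Omega> (y t) w = f t w - time_deriv \<Omega> T v t w}"

subsection \<open>Well-definedness of the square root\<close>

lemma matrix_inner_mat1:
  fixes A :: "real^'d^'d"
  shows "A \<bullet> mat 1 = trace A" and "mat 1 \<bullet> A = trace A"
proof -
  show "A \<bullet> mat 1 = trace A"
    by (simp add: inner_vec_def trace_def mat_def if_distrib cong: if_cong)
  then show "mat 1 \<bullet> A = trace A"
    by (simp add: inner_commute)
qed

lemma pos_sqrt_eigen:
  assumes B: "is_pos_sqrt_on S F B" and S: "subspace S"
    and x: "x \<in> S" "F x = c\<^sup>2 *\<^sub>R x" and c: "c > 0"
  shows "B x = c *\<^sub>R x"
proof (rule ccontr)
  assume neq: "B x \<noteq> c *\<^sub>R x"
  define y where "y = 1 *\<^sub>R B x + (- c) *\<^sub>R x"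
  have Bx: "B x \<in> S" "B (B x) = c\<^sup>2 *\<^sub>R x"
    using B x by (auto simp: is_pos_sqrt_on_def)
  have yS: "y \<in> S"
    unfolding y_def by (intro subspace_add[OF S] subspace_scale[OF S] Bx x)
  have "B y = 1 *\<^sub>R B (B x) + (- c) *\<^sub>R B x"
    using conjunct1[OF conjunct2[OF B[unfolded is_pos_sqrt_on_def]]] Bx(1) x(1)
    unfolding y_def by metis
  also have "\<dots> = - (c *\<^sub>R y)"
    by (simp add: Bx y_def algebra_simps power2_eq_square)
  finally have By: "B y = - (c *\<^sub>R y)" .
  have y0: "y \<noteq> 0"
    using neq by (simp add: y_def)
  then have "0 < B y \<bullet> y"
    using B yS by (auto simp: is_pos_sqrt_on_def)
  moreover have "c * (y \<bullet> y) > 0"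
    using c y0 by simp
  ultimately show False
    by (simp add: By)
qed

lemma subspace_sym_matrices: "subspace sym_matrices"
  by (auto simp: subspace_def sym_matrices_def transpose_def vec_eq_iff)

lemma elast_half_eq:
  fixes A :: "real^'d^'d"
  assumes mu: "mu > 0" and lam: "lam > - (2 / real CARD('d)) * mu" and A: "A \<in> sym_matrices"
  shows "is_pos_sqrt_on (sym_matrices :: (real^'d^'d) set) (elast mu lam) (elast_half mu lam)"
    and "elast_half mu lam A =
      sqrt (2 * mu) *\<^sub>R (A - (trace A / real CARD('d)) *\<^sub>R mat 1)
      + (sqrt (2 * mu + real CARD('d) * lam) * trace A / real CARD('d)) *\<^sub>R mat 1"
proof -
  let ?S = "sym_matrices :: (real^'d^'d) set"
  define d where "d = real CARD('d)"
  have d: "d > 0" by (simp add: d_def)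
  define c1 where "c1 = sqrt (2 * mu)"
  define c2 where "c2 = sqrt (2 * mu + d * lam)"
  have pos: "2 * mu + d * lam > 0"
    using lam d unfolding d_def[symmetric] by (simp add: field_simps)
  have c1: "c1 > 0" "c1\<^sup>2 = 2 * mu" and c2: "c2 > 0" "c2\<^sup>2 = 2 * mu + d * lam"
    using mu pos by (auto simp: c1_def c2_def)
  have trI: "trace (mat 1 :: real^'d^'d) = d"
    by (simp add: trace_def mat_def d_def)
  have tr_add: "trace (X + Y) = trace X + trace Y" and tr_sc: "trace (a *\<^sub>R X) = a * trace X"
    for X Y :: "real^'d^'d" and a
    by (simp_all add: trace_def sum.distrib sum_distrib_left)
  have tr_diff: "trace (X - Y) = trace X - trace Y" for X Y :: "real^'d^'d"
    by (simp add: trace_def sum_subtractf)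
  have IS: "mat 1 \<in> ?S"
    by (simp add: sym_matrices_def)
  define k where "k = (c2 - c1) / d"
  define F where "F = (\<lambda>X::real^'d^'d. c1 *\<^sub>R X + (k * trace X) *\<^sub>R mat 1)"
  have kd: "k * d = c2 - c1"
    using d by (simp add: k_def)
  have FS: "F X \<in> ?S" if "X \<in> ?S" for X
    unfolding F_def by (intro subspace_add subspace_scale subspace_sym_matrices IS that)
  have trF: "trace (F X) = c2 * trace X" for X
  proof -
    have "trace (F X) = (c1 + k * d) * trace X"
      by (simp add: F_def tr_add tr_sc trI algebra_simps)
    then show ?thesis by (simp add: kd)
  qed
  have FF: "F (F X) = elast mu lam X" for X
  proof -
    have "F (F X) = c1\<^sup>2 *\<^sub>R X + (c1 * k * trace X + k * c2 * trace X) *\<^sub>R mat 1"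
      unfolding F_def[THEN fun_cong, of "F X"] trF
      by (simp add: F_def algebra_simps power2_eq_square)
    moreover have "c1 * k + k * c2 = lam"
    proof -
      have "(c1 * k + k * c2) * d = (k * d) * (c1 + c2)"
        by (simp add: algebra_simps)
      also have "\<dots> = c2\<^sup>2 - c1\<^sup>2"
        unfolding kd by (simp add: algebra_simps power2_eq_square)
      also have "\<dots> = lam * d"
        by (simp add: c1 c2)
      finally show ?thesis using d by simp
    qed
    ultimately show ?thesis
      by (simp add: elast_def c1 flip: distrib_right)
  qed
  have Fpos: "0 < F X \<bullet> X" if "X \<noteq> 0" for X
  proof -
    define D where "D = X - (trace X / d) *\<^sub>R mat 1"
    have II: "mat 1 \<bullet> (mat 1 :: real^'d^'d) = d"
      by (simp add: matrix_inner_mat1 trI)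
    have DI: "D \<bullet> mat 1 = 0"
      using d by (simp add: D_def matrix_inner_mat1 tr_diff tr_sc trI)
    have DI': "mat 1 \<bullet> D = 0"
      using DI by (simp add: inner_commute)
    have X: "X = D + (trace X / d) *\<^sub>R mat 1"
      by (simp add: D_def)
    have "F X \<bullet> X = c1 * (X \<bullet> X) + k * (trace X)\<^sup>2"
      by (simp add: F_def inner_add_left matrix_inner_mat1
          power2_eq_square)
    also have "X \<bullet> X = D \<bullet> D + (trace X)\<^sup>2 / d"
    proof -
      have "X \<bullet> X = (D + (trace X / d) *\<^sub>R mat 1) \<bullet> (D + (trace X / d) *\<^sub>R mat 1)"
        using X by metis
      also have "\<dots> = D \<bullet> D + (trace X)\<^sup>2 / d"
        using d by (simp add: inner_add_left inner_add_right DI DI' II power2_eq_square)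
      finally show ?thesis .
    qed
    finally have eq: "F X \<bullet> X = c1 * (D \<bullet> D) + c2 / d * (trace X)\<^sup>2"
      by (simp add: k_def distrib_left diff_divide_distrib left_diff_distrib)
    have "D \<noteq> 0 \<or> trace X \<noteq> 0"
      using that X by auto
    then show ?thesis
    proof
      assume "D \<noteq> 0"
      then show ?thesis using eq c1 c2 d by (simp add: add_pos_nonneg)
    next
      assume "trace X \<noteq> 0"
      then show ?thesis using eq c1 c2 d by (simp add: add_nonneg_pos)
    qed
  qed
  have Fsa: "F X \<bullet> Y = X \<bullet> F Y" for X Y
    by (simp add: F_def inner_add_left inner_add_right matrix_inner_mat1)
  have Flin: "F (a *\<^sub>R X + b *\<^sub>R Y) = a *\<^sub>R F X + b *\<^sub>R F Y" for X Y a b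
    by (simp add: F_def tr_add tr_sc algebra_simps)
  have "is_pos_sqrt_on ?S (elast mu lam) F"
    unfolding is_pos_sqrt_on_def using FS FF Flin Fsa Fpos by blast
  then show B: "is_pos_sqrt_on ?S (elast mu lam) (elast_half mu lam)"
    unfolding elast_half_def by (rule someI[where P = "is_pos_sqrt_on ?S (elast mu lam)"])
  let ?D = "A - (trace A / d) *\<^sub>R mat 1"
  have DS: "?D \<in> ?S"
    by (intro subspace_diff subspace_scale subspace_sym_matrices IS A)
  have trD: "trace ?D = 0"
    using d by (simp add: tr_diff tr_sc trI)
  have "elast_half mu lam ?D = c1 *\<^sub>R ?D"
    by (rule pos_sqrt_eigen[OF B subspace_sym_matrices DS _ c1(1)]) (simp add: elast_def trD c1)
  moreover have "elast_half mu lam (mat 1 :: real^'d^'d) = c2 *\<^sub>R mat 1"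
    by (rule pos_sqrt_eigen[OF B subspace_sym_matrices IS _ c2(1)])
      (simp add: elast_def trI c2 algebra_simps)
  moreover have "elast_half mu lam (1 *\<^sub>R ?D + (trace A / d) *\<^sub>R mat 1)
      = 1 *\<^sub>R elast_half mu lam ?D + (trace A / d) *\<^sub>R elast_half mu lam (mat 1 :: real^'d^'d)"
    using B DS IS unfolding is_pos_sqrt_on_def by blast
  ultimately show "elast_half mu lam A =
      sqrt (2 * mu) *\<^sub>R (A - (trace A / real CARD('d)) *\<^sub>R mat 1)
      + (sqrt (2 * mu + real CARD('d) * lam) * trace A / real CARD('d)) *\<^sub>R mat 1"
    by (simp add: c1_def c2_def flip: d_def)
qed

end

theory Submission
  imports Defs
begin

text \<open>
  Let \<open>e = v - u\<close> and let \<open>R\<close> be the Riesz isomorphism of \<open>V\<^sub>\<C>\<^sup>*\<close> onto \<open>V\<^sub>\<C>\<close>. The residual of \<open>v\<close> is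
  represented by \<open>R \<partial>\<^sub>t e + e\<close>, whose squared norm is \<open>|\<partial>\<^sub>t e|\<^sup>2 + 2 \<langle>\<partial>\<^sub>t e, e\<rangle> + |e|\<^sup>2\<close>; the integral of the
  mixed term is \<open>|e(T)|\<^sup>2 - |e(0)|\<^sup>2\<close> by the Lions--Magenes lemma, and \<open>e(0) = 0\<close>. On the dual side,
  the constraint on \<open>y\<close> says that \<open>\<C>\<^sup>-\<^sup>1\<^sup>/\<^sup>2 (\<C> sym \<nabla> v - y)\<close> has orthogonal projection
  \<open>\<C>\<^sup>1\<^sup>/\<^sup>2 sym \<nabla> (R \<partial>\<^sub>t e + e)\<close> onto \<open>\<C>\<^sup>1\<^sup>/\<^sup>2 sym \<nabla> V\<close>. So the norm of the residual is a lower bound, and it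
  is attained at \<open>y = \<C> sym \<nabla> \<xi>\<close> with \<open>\<xi> = R (f - \<partial>\<^sub>t v)\<close>. That \<open>V\<^sub>\<C>\<close> is a Hilbert space rests on the
  inequalities of Korn and Poincare for functions with zero boundary values.
\<close>

subsection \<open>Bump functions and the fundamental lemma\<close>

text \<open>Elements of V and of its dual are given by representatives with mere seminorms and
  arbitrary choices (\<open>SOME\<close>), while Riesz representation and the Lions--Magenes
  argument want a complete inner product space. Therefore everything is transported once:
  \<open>cls\<close> sends functions to classes in the Hilbert space type \<open>l2\<close>,
  \<open>E\<close> makes V the subspace \<open>VV\<close> of it, and \<open>rho\<close> does the
  same for functionals. After that only inner products in \<open>l2\<close> occur. The
  Lions--Magenes lemma is proved without vector-valued integrals and without regularization in time.
  Tested with a fixed vector, an increment of the solution is a scalar integral; and a function of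
  time whose increments are bounded by the squared increments of one continuous monotone function is
  constant. The energy balance itself has no such bound, since v(t) - v(s) is small only in a weak
  norm; replacing v by \<open>J n v\<close> in one factor repairs this for each n, and n goes to
  infinity afterwards. The same principle yields partial integration for integrands that are merely
  integrable.\<close>

lemma C_k_cong_fd:
  assumes "\<And>x. (f has_derivative f' x) (at x)" "\<And>b. b \<in> Basis \<Longrightarrow> C_k k (\<lambda>x. f' x b)"
  shows "C_k (Suc k) f"
proof -
  have "frechet_derivative f (at x) = f' x" for x
    using frechet_derivative_at[OF assms(1)] by simp
  then show ?thesis
    using assms by (auto simp: differentiable_def)
qed

text \<open>Leibniz terms contain the undifferentiated factors, which are then needed at one order
  lower.\<close>

lemma C_k_SucD: "C_k (Suc k) f \<Longrightarrow> C_k k f"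
proof (induction k arbitrary: f)
  case 0
  then show ?case
    by (auto intro!: continuous_at_imp_continuous_on differentiable_imp_continuous_within)
next
  case (Suc k)
  have "\<forall>b\<in>Basis. C_k k (\<lambda>x. frechet_derivative f (at x) b)"
    using Suc.IH Suc.prems by (metis C_k.simps(2))
  with Suc.prems show ?case by simp
qed

lemma C_k_const: "C_k k (\<lambda>x. c)"
proof (induction k arbitrary: c)
  case (Suc k)
  show ?case
    by (rule C_k_cong_fd[where f' = "\<lambda>x h. 0"]) (auto intro: Suc)
qed auto

lemma C_k_Suc_has_derivative:
  "C_k (Suc k) f \<Longrightarrow> (f has_derivative frechet_derivative f (at x)) (at x)"
  using frechet_derivative_works by auto

lemma C_k_add: "C_k k f \<Longrightarrow> C_k k g \<Longrightarrow> C_k k (\<lambda>x. f x + g x)"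
proof (induction k arbitrary: f g)
  case 0
  then show ?case by (auto intro: continuous_on_add)
next
  case (Suc k)
  show ?case
  proof (rule C_k_cong_fd)
    show "((\<lambda>x. f x + g x) has_derivative
      (\<lambda>h. frechet_derivative f (at x) h + frechet_derivative g (at x) h)) (at x)" for x
      by (intro has_derivative_add C_k_Suc_has_derivative[OF Suc.prems(1)] C_k_Suc_has_derivative[OF Suc.prems(2)])
  qed (use Suc.prems in \<open>auto intro!: Suc.IH\<close>)
qed

lemma C_k_mult:
  fixes f g :: "'a::euclidean_space \<Rightarrow> real"
  shows "C_k k f \<Longrightarrow> C_k k g \<Longrightarrow> C_k k (\<lambda>x. f x * g x)"
proof (induction k arbitrary: f g)
  case 0
  then show ?case by (auto intro: continuous_on_mult)
next
  case (Suc k)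
  show ?case
  proof (rule C_k_cong_fd)
    show "((\<lambda>x. f x * g x) has_derivative
      (\<lambda>h. f x * frechet_derivative g (at x) h + frechet_derivative f (at x) h * g x)) (at x)" for x
      by (intro has_derivative_mult C_k_Suc_has_derivative[OF Suc.prems(1)] C_k_Suc_has_derivative[OF Suc.prems(2)])
    show "C_k k (\<lambda>x. f x * frechet_derivative g (at x) b + frechet_derivative f (at x) b * g x)"
      if "b \<in> Basis" for b
      using that Suc.prems
      by (intro C_k_add Suc.IH C_k_SucD[OF Suc.prems(1)] C_k_SucD[OF Suc.prems(2)]) auto
  qed
qed

lemma C_k_prod:
  fixes f :: "'i \<Rightarrow> 'a::euclidean_space \<Rightarrow> real"
  assumes "finite A" "\<And>i. i \<in> A \<Longrightarrow> C_k k (f i)"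
  shows "C_k k (\<lambda>x. \<Prod>i\<in>A. f i x)"
  using assms by (induction A rule: finite_induct) (auto intro: C_k_const C_k_mult)

text \<open>The derivative is a function of the same kind, \<open>?g'\<close> at the affine argument
  times a constant, so the induction runs over all \<open>g\<close>.\<close>

lemma C_k_affine:
  fixes g :: "real \<Rightarrow> real"
  shows "C_k k g \<Longrightarrow> C_k k (\<lambda>x::'a::euclidean_space. g (x \<bullet> e + a))"
proof (induction k arbitrary: g)
  case 0
  have "continuous_on UNIV (g \<circ> (\<lambda>x::'a. x \<bullet> e + a))"
    using 0 by (intro continuous_on_compose continuous_intros) (auto intro: continuous_on_subset)
  then show ?case by (simp add: comp_def)
next
  case (Suc k)
  let ?g' = "\<lambda>x. frechet_derivative g (at x)"
  have lin: "?g' y h = h * ?g' y 1" for y h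
    using linear_frechet_derivative[of g "at y"] Suc.prems linear_scale[of "?g' y" h 1] by auto
  show ?case
  proof (rule C_k_cong_fd)
    show "((\<lambda>x::'a. g (x \<bullet> e + a)) has_derivative (\<lambda>h. ?g' (x \<bullet> e + a) 1 * (h \<bullet> e))) (at x)" for x
    proof -
      have "((\<lambda>x::'a. x \<bullet> e + a) has_derivative (\<lambda>h. h \<bullet> e)) (at x)"
        by (auto intro!: derivative_eq_intros)
      from has_derivative_compose[OF this C_k_Suc_has_derivative[OF Suc.prems]]
      show ?thesis by (subst (asm) lin) (simp add: mult.commute)
    qed
    show "C_k k (\<lambda>x::'a. ?g' (x \<bullet> e + a) 1 * (b \<bullet> e))" for b
      using Suc by (intro C_k_mult C_k_const) auto
  qed
qed

lemma C_k_real_derivI: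
  fixes f :: "real \<Rightarrow> real"
  assumes "\<And>x. (f has_real_derivative f' x) (at x)" "C_k k f'"
  shows "C_k (Suc k) f"
  by (rule C_k_cong_fd[where f' = "\<lambda>x h. f' x * h"])
    (use assms in \<open>auto simp: has_field_derivative_def\<close>)

text \<open>For m = 0 this is the standard smooth function exp(-1/x), flat at 0. The factor
  \<open>inverse x ^ m\<close> makes the family closed under differentiation up to linear
  combinations, so one induction over all m gives smoothness.\<close>

definition flat_exp :: "nat \<Rightarrow> real \<Rightarrow> real" where
  "flat_exp m x = (if x > 0 then inverse x ^ m * exp (- inverse x) else 0)"

text \<open>This is the difference quotient at 0. With y = 1/x, the limit from the right is that of
  y^(m+1) / exp y at infinity; on the left the function is 0.\<close>

lemma flat_exp_div_tendsto: "((\<lambda>x. flat_exp m x / x) \<longlongrightarrow> 0) (at 0)"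
proof -
  have "((\<lambda>x. inverse x ^ Suc m / exp (inverse x)) \<longlongrightarrow> (0::real)) (at_right 0)"
    by (rule filterlim_compose[OF tendsto_power_div_exp_0 filterlim_inverse_at_top_right])
  then have "((\<lambda>x. flat_exp m x / x) \<longlongrightarrow> 0) (at_right 0)"
    by (rule Lim_transform_eventually)
      (auto simp: eventually_at_right_less flat_exp_def exp_minus field_simps
        intro!: eventually_mono[OF eventually_at_right_less])
  moreover have "((\<lambda>x. flat_exp m x / x) \<longlongrightarrow> 0) (at_left 0)"
    by (rule Lim_transform_eventually[OF tendsto_const])
      (auto simp: flat_exp_def eventually_at_left_field intro!: exI[of _ "-1"])
  ultimately show ?thesis by (simp add: filterlim_split_at)
qed

lemma flat_exp_deriv:
  "(flat_exp m has_real_derivative flat_exp (m + 2) x - real m * flat_exp (Suc m) x) (at x)"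
proof (cases x "0::real" rule: linorder_cases)
  case greater
  have "((\<lambda>x. inverse x ^ m * exp (- inverse x)) has_real_derivative
      flat_exp (m + 2) x - real m * flat_exp (Suc m) x) (at x)"
  proof (cases m)
    case (Suc n)
    show ?thesis
      using greater unfolding Suc
      by (auto intro!: derivative_eq_intros simp: flat_exp_def field_simps power2_eq_square) (cases n; simp)
  qed (use greater in \<open>auto intro!: derivative_eq_intros simp: flat_exp_def field_simps power2_eq_square\<close>)
  then show ?thesis
    by (rule has_field_derivative_transform_within_open[of _ _ _ "{0<..}"])
      (use greater in \<open>auto simp: flat_exp_def\<close>)
next
  case less
  have "((\<lambda>x. 0) has_real_derivative flat_exp (m + 2) x - real m * flat_exp (Suc m) x) (at x)"
    using less by (auto simp: flat_exp_def)
  then show ?thesis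
    by (rule has_field_derivative_transform_within_open[of _ _ _ "{..<0}"])
      (use less in \<open>auto simp: flat_exp_def\<close>)
next
  case equal
  then show ?thesis
    using flat_exp_div_tendsto[of m] by (simp add: has_field_derivative_iff flat_exp_def)
qed

lemma C_k_flat_exp: "C_k k (flat_exp m)"
proof (induction k arbitrary: m)
  case 0
  show ?case
    using flat_exp_deriv by (auto intro!: continuous_at_imp_continuous_on DERIV_isCont)
next
  case (Suc k)
  have "C_k k (\<lambda>x. flat_exp (m + 2) x + (- real m) * flat_exp (Suc m) x)"
    by (intro C_k_add C_k_mult C_k_const Suc)
  then show ?case
    by (intro C_k_real_derivI[OF flat_exp_deriv]) auto
qed

text \<open>Each coordinate contributes one factor per face of the box. The scale
  \<open>Suc n\<close> steepens the flanks: exp(-1/((n+1) y)) tends to 1 for y > 0, so the limit is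
  the indicator of the open box. The arguments are written as inner product plus constant to fit
  \<open>C_k_affine\<close>; \<open>box_bump_alt\<close> is the readable form.\<close>

definition box_bump :: "'a::euclidean_space \<Rightarrow> 'a \<Rightarrow> nat \<Rightarrow> 'a \<Rightarrow> real" where
  "box_bump a b n x = (\<Prod>i\<in>Basis. flat_exp 0 (x \<bullet> (real (Suc n) *\<^sub>R i) + (- real (Suc n) * (a \<bullet> i)))
     * flat_exp 0 (x \<bullet> (- real (Suc n) *\<^sub>R i) + real (Suc n) * (b \<bullet> i)))"

lemma flat_exp_bounds: "0 \<le> flat_exp 0 x" "flat_exp 0 x \<le> 1"
  by (auto simp: flat_exp_def)

lemma box_bump_bounds: "0 \<le> box_bump a b n x" "box_bump a b n x \<le> 1"
  unfolding box_bump_def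
  by (auto intro!: prod_nonneg prod_le_1 mult_nonneg_nonneg mult_le_one flat_exp_bounds)

lemma box_bump_alt:
  "box_bump a b n x = (\<Prod>i\<in>Basis. flat_exp 0 (real (Suc n) * (x \<bullet> i - a \<bullet> i))
     * flat_exp 0 (real (Suc n) * (b \<bullet> i - x \<bullet> i)))"
  unfolding box_bump_def
  by (intro prod.cong refl arg_cong2[where f = "(*)"] arg_cong[where f = "flat_exp 0"])
    (simp_all add: algebra_simps)

lemma box_bump_pos: "x \<in> box a b \<Longrightarrow> box_bump a b n x > 0"
  unfolding box_bump_alt by (intro prod_pos) (auto simp: mem_box flat_exp_def)

lemma box_bump_eq_0: assumes "x \<notin> box a b" shows "box_bump a b n x = 0"
proof -
  obtain i where "i \<in> Basis" "x \<bullet> i \<le> a \<bullet> i \<or> b \<bullet> i \<le> x \<bullet> i"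
    using assms by (auto simp: mem_box not_less)
  then show ?thesis
    unfolding box_bump_alt
    by (intro prod_zero bexI[of _ i]) (auto simp: flat_exp_def mult_le_0_iff not_less zero_less_mult_iff)
qed

lemma box_bump_tendsto: "(\<lambda>n. box_bump a b n x) \<longlonglongrightarrow> indicator (box a b) x"
proof (cases "x \<in> box a b")
  case True
  have *: "(\<lambda>n. flat_exp 0 (real (Suc n) * y)) \<longlonglongrightarrow> 1" if "y > 0" for y
  proof -
    have "(\<lambda>n. exp (- (inverse (real (Suc n)) * inverse y))) \<longlonglongrightarrow> exp (- (0 * inverse y))"
      by (intro tendsto_intros LIMSEQ_inverse_real_of_nat)
    then show ?thesis using that by (simp add: flat_exp_def)
  qed
  have "(\<lambda>n. box_bump a b n x) \<longlonglongrightarrow> (\<Prod>i\<in>(Basis::'a set). 1 * 1)"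
    unfolding box_bump_alt
    by (intro tendsto_prod tendsto_mult *) (use True in \<open>auto simp: mem_box\<close>)
  then show ?thesis using True by simp
qed (auto simp: box_bump_eq_0)

lemma box_bump_test:
  assumes "cbox a b \<subseteq> S"
  shows "box_bump a b n \<in> test_functions S"
proof -
  have "C_k k (box_bump a b n)" for k
    unfolding box_bump_def[abs_def]
    by (intro C_k_prod finite_Basis C_k_mult C_k_affine C_k_flat_exp)
  moreover have "\<exists>K. compact K \<and> K \<subseteq> S \<and> (\<forall>x. x \<notin> K \<longrightarrow> box_bump a b n x = 0)"
    using assms box_subset_cbox[of a b] by (intro exI[of _ "cbox a b"]) (auto intro!: box_bump_eq_0)
  ultimately show ?thesis by (auto simp: test_functions_def)
qed

section \<open>Closure properties, bounds and measurability of test functions\<close>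

lemma test_functions_Ck: "\<phi> \<in> test_functions S \<Longrightarrow> C_k k \<phi>"
  by (simp add: test_functions_def)

lemma test_functions_continuous: "\<phi> \<in> test_functions S \<Longrightarrow> continuous_on A \<phi>"
  using test_functions_Ck[of \<phi> S 0] by (auto intro: continuous_on_subset)

lemma test_functions_add: assumes "\<phi> \<in> test_functions S" "\<psi> \<in> test_functions S"
  shows "(\<lambda>x. \<phi> x + \<psi> x) \<in> test_functions S"
proof -
  obtain K L where "compact K" "K \<subseteq> S" "\<forall>x. x \<notin> K \<longrightarrow> \<phi> x = 0" "compact L" "L \<subseteq> S" "\<forall>x. x \<notin> L \<longrightarrow> \<psi> x = 0"
    using assms by (auto simp: test_functions_def)
  then have "\<exists>K. compact K \<and> K \<subseteq> S \<and> (\<forall>x. x \<notin> K \<longrightarrow> \<phi> x + \<psi> x = 0)"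
    by (intro exI[of _ "K \<union> L"]) auto
  then show ?thesis
    using assms by (auto simp: test_functions_def intro!: C_k_add)
qed

lemma test_functions_mult:
  fixes \<phi> \<psi> :: "'a::euclidean_space \<Rightarrow> real"
  assumes "\<phi> \<in> test_functions S" "\<And>k. C_k k \<psi>"
  shows "(\<lambda>x. \<psi> x * \<phi> x) \<in> test_functions S"
proof -
  obtain K where "compact K" "K \<subseteq> S" "\<forall>x. x \<notin> K \<longrightarrow> \<phi> x = 0"
    using assms by (auto simp: test_functions_def)
  then have "\<exists>K. compact K \<and> K \<subseteq> S \<and> (\<forall>x. x \<notin> K \<longrightarrow> \<psi> x * \<phi> x = 0)"
    by (intro exI[of _ K]) auto
  then show ?thesis
    using assms by (auto simp: test_functions_def intro!: C_k_mult)
qed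

lemma test_functions_scale:
  fixes \<phi> :: "'a::euclidean_space \<Rightarrow> real"
  shows "\<phi> \<in> test_functions S \<Longrightarrow> (\<lambda>x. c * \<phi> x) \<in> test_functions S"
  by (rule test_functions_mult) (auto intro: C_k_const)

lemma test_functions_bounded:
  assumes "\<phi> \<in> test_functions S"
  obtains B where "B > 0" "\<And>x. norm (\<phi> x) \<le> B"
proof -
  obtain K where K: "compact K" "\<forall>x. x \<notin> K \<longrightarrow> \<phi> x = 0"
    using assms by (auto simp: test_functions_def)
  have "bounded (\<phi> ` K)"
    by (intro compact_imp_bounded compact_continuous_image test_functions_continuous[OF assms] K)
  then obtain B where "B > 0" "\<forall>x\<in>K. norm (\<phi> x) \<le> B" by (auto simp: bounded_pos)
  then show ?thesis using K that by (metis norm_zero less_imp_le)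
qed

lemma borel_measurable_lebesgue_onI:
  "f \<in> borel_measurable borel \<Longrightarrow> f \<in> borel_measurable (lebesgue_on S)"
  by (simp add: measurable_completion measurable_restrict_space1)

lemma continuous_borel_lebesgue_on:
  fixes f :: "'a::euclidean_space \<Rightarrow> 'b::topological_space"
  shows "continuous_on UNIV f \<Longrightarrow> f \<in> borel_measurable (lebesgue_on S)"
  by (intro borel_measurable_lebesgue_onI borel_measurable_continuous_onI)

lemma test_functions_borel:
  "\<phi> \<in> test_functions S \<Longrightarrow> \<phi> \<in> borel_measurable (lebesgue_on A)"
  by (rule continuous_borel_lebesgue_on) (rule test_functions_continuous)

lemma integrable_mult_bounded:
  fixes f g :: "'a \<Rightarrow> real"
  assumes "integrable M f" "g \<in> borel_measurable M" "\<And>x. x \<in> space M \<Longrightarrow> \<bar>g x\<bar> \<le> B"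
  shows "integrable M (\<lambda>x. f x * g x)" "integrable M (\<lambda>x. g x * f x)"
proof -
  show "integrable M (\<lambda>x. f x * g x)"
  proof (rule Bochner_Integration.integrable_bound[where f = "\<lambda>x. B * f x"])
    show "AE x in M. norm (f x * g x) \<le> norm (B * f x)"
    proof (intro AE_I2)
      fix x assume "x \<in> space M"
      then have "\<bar>g x\<bar> \<le> \<bar>B\<bar>" using assms(3)[of x] by linarith
      then show "norm (f x * g x) \<le> norm (B * f x)"
        using mult_left_mono[of "\<bar>g x\<bar>" "\<bar>B\<bar>" "\<bar>f x\<bar>"] by (simp add: abs_mult mult.commute)
    qed
  qed (use assms in auto)
  then show "integrable M (\<lambda>x. g x * f x)" by (simp add: mult.commute)
qed

text \<open>The integrals of \<open>f\<close> over boxes vanish by dominated convergence along bumps; by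
  inclusion-exclusion and limits so do those over open sets, which generate the Borel sets.\<close>
lemma fundamental_lemma_lborel:
  fixes f :: "'a::euclidean_space \<Rightarrow> real"
  assumes S[measurable]: "open S" and f[measurable]: "integrable lborel f"
    and fS: "\<And>x. x \<notin> S \<Longrightarrow> f x = 0"
    and zero: "\<And>\<psi>. \<psi> \<in> test_functions S \<Longrightarrow> (\<integral>x. f x * \<psi> x \<partial>lborel) = 0"
  shows "AE x in lborel. f x = 0"
proof -
  let ?M = "lborel :: 'a measure"
  have fm[measurable]: "f \<in> borel_measurable borel"
    using f by auto
  have int: "integrable ?M (\<lambda>x. f x * indicator A x)" if "A \<in> sets borel" for A
    using integrable_mult_indicator[of A ?M f] f that by (simp add: mult.commute)
  have dct: "(\<lambda>n. \<integral>x. f x * g n x \<partial>?M) \<longlonglongrightarrow> (\<integral>x. f x * h x \<partial>?M)"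
    if "\<And>n. g n \<in> borel_measurable borel" "h \<in> borel_measurable borel" "\<And>n x. \<bar>g n x\<bar> \<le> 1"
      "\<And>x. (\<lambda>n. g n x) \<longlonglongrightarrow> h x" for g :: "nat \<Rightarrow> 'a \<Rightarrow> real" and h
  proof (rule integral_dominated_convergence[where w = "\<lambda>x. norm (f x)"])
    show "AE x in ?M. (\<lambda>n. f x * g n x) \<longlonglongrightarrow> f x * h x"
      by (intro AE_I2 tendsto_mult tendsto_const that)
    show "AE x in ?M. norm (f x * g n x) \<le> norm (f x)" for n
      using that(3) by (intro AE_I2) (auto simp: abs_mult mult_left_le)
  qed (use f that in \<open>auto intro!: borel_measurable_times\<close>)
  have box0: "(\<integral>x. f x * indicator (cbox a b) x \<partial>?M) = 0" if "cbox a b \<subseteq> S" for a b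
  proof -
    have "box_bump a b n \<in> borel_measurable borel" for n
      by (intro borel_measurable_continuous_onI test_functions_continuous[OF box_bump_test[OF that]])
    then have "(\<lambda>n. \<integral>x. f x * box_bump a b n x \<partial>?M) \<longlonglongrightarrow> (\<integral>x. f x * indicator (box a b) x \<partial>?M)"
      using box_bump_bounds[of a b] by (intro dct box_bump_tendsto) auto
    moreover have "(\<integral>x. f x * box_bump a b n x \<partial>?M) = 0" for n
      by (rule zero[OF box_bump_test[OF that]])
    ultimately have "(\<integral>x. f x * indicator (box a b) x \<partial>?M) = 0" by (simp add: LIMSEQ_const_iff)
    moreover have "(\<integral>x. f x * indicator (cbox a b) x \<partial>?M) = (\<integral>x. f x * indicator (box a b) x \<partial>?M)"
    proof (rule integral_cong_AE)
      \<comment> \<open>Open and closed box have the same volume, so the faces form a null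
        set.\<close>
      have "cbox a b - box a b \<in> null_sets lborel"
        using box_subset_cbox[of a b]
        by (auto simp: null_sets_def emeasure_Diff emeasure_lborel_cbox_eq emeasure_lborel_box_eq)
      then show "AE x in ?M. f x * indicator (cbox a b) x = f x * indicator (box a b) x"
        using box_subset_cbox[of a b] by (intro AE_I'[where N = "cbox a b - box a b"]) (auto simp: indicator_def)
    qed auto
    ultimately show ?thesis by simp
  qed
  have fin0: "(\<integral>x. f x * indicator (\<Union>i<n. cbox (a i) (b i)) x \<partial>?M) = 0"
    if "\<And>i. i < n \<Longrightarrow> cbox (a i) (b i) \<subseteq> S" for a b :: "nat \<Rightarrow> 'a" and n
    using that
  proof (induction n arbitrary: a b)
    case (Suc n)
    let ?U = "\<Union>i<n. cbox (a i) (b i)"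
    \<comment> \<open>Corners of the intersections with the last box. Inclusion-exclusion needs the
      claim for these boxes too, hence the induction over arbitrary \<open>a\<close> and
      \<open>b\<close>.\<close>
    define l where "l i = (\<Sum>k\<in>Basis. max (a i\<bullet>k) (a n\<bullet>k) *\<^sub>R k)" for i
    define u where "u i = (\<Sum>k\<in>Basis. min (b i\<bullet>k) (b n\<bullet>k) *\<^sub>R k)" for i
    have I: "cbox (a i) (b i) \<inter> cbox (a n) (b n) = cbox (l i) (u i)" for i
      by (simp add: Int_interval l_def u_def)
    have "(\<integral>x. f x * indicator (\<Union>i<Suc n. cbox (a i) (b i)) x \<partial>?M)
      = (\<integral>x. (f x * indicator ?U x + f x * indicator (cbox (a n) (b n)) x)
          - f x * indicator (\<Union>i<n. cbox (l i) (u i)) x \<partial>?M)"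
      by (intro Bochner_Integration.integral_cong refl)
        (auto simp: indicator_def lessThan_Suc I[symmetric])
    also have "\<dots> = (\<integral>x. f x * indicator ?U x \<partial>?M) + (\<integral>x. f x * indicator (cbox (a n) (b n)) x \<partial>?M)
        - (\<integral>x. f x * indicator (\<Union>i<n. cbox (l i) (u i)) x \<partial>?M)"
      using int by simp
    also have "\<dots> = 0"
    proof -
      have "cbox (l i) (u i) \<subseteq> S" if "i < n" for i
        using Suc.prems[of n] I[of i] by auto
      then have "(\<integral>x. f x * indicator (\<Union>i<n. cbox (l i) (u i)) x \<partial>?M) = 0"
        by (rule Suc.IH)
      moreover have "(\<integral>x. f x * indicator ?U x \<partial>?M) = 0"
        using Suc.prems by (intro Suc.IH) auto
      ultimately show ?thesis using Suc.prems[of n] by (simp add: box0)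
    qed
    finally show ?case .
  qed auto
  have open0: "(\<integral>x. f x * indicator U x \<partial>?M) = 0" if U: "open U" "U \<subseteq> S" for U
  proof (cases "U = {}")
    case False
    obtain D where D: "countable D" "D \<subseteq> Pow U" "\<And>X. X \<in> D \<Longrightarrow> \<exists>a b. X = cbox a b" "\<Union>D = U"
      using open_countable_Union_open_cbox[OF U(1)] by metis
    have "D \<noteq> {}" using False D(4) by auto
    then have rD: "range (from_nat_into D) = D" by (rule range_from_nat_into) (rule D(1))
    have "\<exists>a b. from_nat_into D i = cbox a b" for i
      by (rule D(3)) (rule from_nat_into[OF \<open>D \<noteq> {}\<close>])
    then obtain a b where ab: "\<And>i. from_nat_into D i = cbox (a i) (b i)" by metis
    have Ueq: "U = (\<Union>i. cbox (a i) (b i))" using D(4) rD ab by simp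
    have "(\<lambda>n. \<integral>x. f x * indicator (\<Union>i<n. cbox (a i) (b i)) x \<partial>?M) \<longlonglongrightarrow> (\<integral>x. f x * indicator U x \<partial>?M)"
      unfolding Ueq by (intro dct LIMSEQ_indicator_UN) (auto simp: indicator_def)
    moreover have "(\<integral>x. f x * indicator (\<Union>i<n. cbox (a i) (b i)) x \<partial>?M) = 0" for n
      by (rule fin0) (use Ueq U(2) in auto)
    ultimately show ?thesis by (simp add: LIMSEQ_const_iff)
  qed auto
  have all: "(\<integral>x. f x * indicator A x \<partial>?M) = 0" if "A \<in> sigma_sets UNIV (Collect open)" for A
  proof (rule sigma_sets_induct_disjoint[OF _ _ that])
    \<comment> \<open>Complements need the total integral, which is an integral over S because f
      vanishes elsewhere.\<close>
    have tot: "(\<integral>x. f x \<partial>?M) = 0"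
    proof -
      have "(\<integral>x. f x \<partial>?M) = (\<integral>x. f x * indicator S x \<partial>?M)"
        using fS by (intro Bochner_Integration.integral_cong) (auto simp: indicator_def)
      then show ?thesis using open0[OF S] by simp
    qed
    show "Int_stable (Collect open :: 'a set set)" by (auto simp: Int_stable_def)
    show "(\<integral>x. f x * indicator A x \<partial>?M) = 0" if "A \<in> Collect open" for A
    proof -
      have "(\<integral>x. f x * indicator A x \<partial>?M) = (\<integral>x. f x * indicator (A \<inter> S) x \<partial>?M)"
        using fS by (intro Bochner_Integration.integral_cong) (auto simp: indicator_def)
      then show ?thesis using that open0[of "A \<inter> S"] S by auto
    qed
    fix A :: "'a set"
    assume A: "A \<in> sigma_sets UNIV (Collect open)" "(\<integral>x. f x * indicator A x \<partial>?M) = 0"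
    then have [measurable]: "A \<in> sets borel" by (simp add: borel_def)
    have "(\<integral>x. f x * indicator (UNIV - A) x \<partial>?M) = (\<integral>x. f x - f x * indicator A x \<partial>?M)"
      by (intro Bochner_Integration.integral_cong) (auto simp: indicator_def)
    then show "(\<integral>x. f x * indicator (UNIV - A) x \<partial>?M) = 0"
      using A int[of A] f tot by simp
  next
    fix A :: "nat \<Rightarrow> 'a set"
    assume A: "disjoint_family A" "range A \<subseteq> sigma_sets UNIV (Collect open)"
      "\<And>i. (\<integral>x. f x * indicator (A i) x \<partial>?M) = 0"
    then have [measurable]: "A i \<in> sets borel" for i by (auto simp: borel_def)
    have "(\<lambda>n. \<integral>x. f x * indicator (\<Union>i<n. A i) x \<partial>?M) \<longlonglongrightarrow> (\<integral>x. f x * indicator (\<Union>i. A i) x \<partial>?M)"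
      by (intro dct LIMSEQ_indicator_UN) (auto simp: indicator_def)
    moreover have "(\<integral>x. f x * indicator (\<Union>i<n. A i) x \<partial>?M) = 0" for n
    proof -
      have "disjoint_family_on A {..<n}" using A(1) by (rule disjoint_family_on_mono[rotated]) auto
      then have "(\<integral>x. f x * indicator (\<Union>i<n. A i) x \<partial>?M) = (\<integral>x. (\<Sum>i<n. f x * indicator (A i) x) \<partial>?M)"
        by (intro Bochner_Integration.integral_cong refl)
          (simp add: indicator_UN_disjoint sum_distrib_left)
      also have "\<dots> = 0" using A int by (subst Bochner_Integration.integral_sum) auto
      finally show ?thesis .
    qed
    ultimately show "(\<integral>x. f x * indicator (\<Union>i. A i) x \<partial>?M) = 0" by (simp add: LIMSEQ_const_iff)
  qed auto
  have "AE x in ?M. f x = (\<lambda>x. 0) x"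
  proof (rule density_unique_real[OF f])
    fix A :: "'a set" assume "A \<in> sets lborel"
    then have "A \<in> sigma_sets UNIV (Collect open)" by (simp add: borel_def)
    from all[OF this] show "(\<integral>x\<in>A. f x \<partial>?M) = (\<integral>x\<in>A. 0 \<partial>?M)"
      by (simp add: set_lebesgue_integral_def mult.commute)
  qed auto
  then show ?thesis by simp
qed

text \<open>Lebesgue measure is the completion of \<open>lborel\<close>: f is replaced by a Borel
  function equal to it almost everywhere and set to 0 off S, to which the version above
  applies.\<close>

lemma fundamental_lemma:
  fixes f :: "'a::euclidean_space \<Rightarrow> real"
  assumes S: "open S" and f: "integrable (lebesgue_on S) f"
    and zero: "\<And>\<psi>. \<psi> \<in> test_functions S \<Longrightarrow> (\<integral>x. f x * \<psi> x \<partial>lebesgue_on S) = 0"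
  shows "AE x in lebesgue_on S. f x = 0"
proof -
  have SM: "S \<in> sets lebesgue" using S by simp
  define F where "F x = indicator S x * f x" for x :: 'a
  have F: "integrable lebesgue F"
    using f SM integrable_restrict_space[of S lebesgue f] by (simp add: F_def[abs_def])
  then obtain g where g: "g \<in> borel_measurable lborel" "AE x in lborel. F x = g x"
    using completion_ex_borel_measurable_real[of F lborel] by auto
  define h where "h x = indicator S x * g x" for x :: 'a
  have hm: "h \<in> borel_measurable lborel" using g S by (auto simp: h_def[abs_def])
  have hF: "AE x in lborel. F x = h x"
    using g(2) by eventually_elim (auto simp: F_def h_def indicator_def)
  then have hF': "AE x in lebesgue. F x = h x" by (rule AE_completion)
  have hm': "h \<in> borel_measurable lebesgue" using hm by (simp add: measurable_completion)
  have Fm: "F \<in> borel_measurable lebesgue" using F by auto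
  have hi: "integrable lebesgue h"
    using integrable_cong_AE[OF Fm hm' hF'] F by simp
  have "AE x in lborel. h x = 0"
  proof (rule fundamental_lemma_lborel[OF S])
    show "integrable lborel h" using hi hm by (simp add: integrable_completion)
    show "h x = 0" if "x \<notin> S" for x using that by (simp add: h_def)
    fix \<psi> :: "'a \<Rightarrow> real" assume \<psi>: "\<psi> \<in> test_functions S"
    have pm: "\<psi> \<in> borel_measurable borel"
      by (intro borel_measurable_continuous_onI test_functions_continuous[OF \<psi>])
    have "(\<integral>x. h x * \<psi> x \<partial>lborel) = (\<integral>x. h x * \<psi> x \<partial>lebesgue)"
      using hm pm by (subst integral_completion) auto
    also have "\<dots> = (\<integral>x. F x * \<psi> x \<partial>lebesgue)"
    proof (rule integral_cong_AE)
      have "\<psi> \<in> borel_measurable lebesgue" using pm by (intro measurable_completion) simp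
      then show "(\<lambda>x. h x * \<psi> x) \<in> borel_measurable lebesgue" "(\<lambda>x. F x * \<psi> x) \<in> borel_measurable lebesgue"
        by (auto intro: borel_measurable_times hm' Fm)
      show "AE x in lebesgue. h x * \<psi> x = F x * \<psi> x"
        using hF' by eventually_elim simp
    qed
    also have "\<dots> = (\<integral>x. f x * \<psi> x \<partial>lebesgue_on S)"
      using SM by (subst integral_restrict_space) (auto simp: F_def mult.assoc)
    also have "\<dots> = 0" by (rule zero[OF \<psi>])
    finally show "(\<integral>x. h x * \<psi> x \<partial>lborel) = 0" .
  qed
  then have "AE x in lebesgue. h x = 0" by (rule AE_completion)
  with hF' have "AE x in lebesgue. F x = 0" by eventually_elim simp
  then show ?thesis
    using SM by (subst AE_restrict_space_iff) (auto simp: F_def elim!: eventually_mono)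
qed

subsection \<open>The space \<open>L\<^sup>2\<close> as a Hilbert space\<close>

lemma L2_space_measurable: "f \<in> L2_space M \<Longrightarrow> f \<in> borel_measurable M"
  and L2_space_integrable: "f \<in> L2_space M \<Longrightarrow> integrable M (\<lambda>x. (norm (f x))\<^sup>2)"
  by (auto simp: L2_space_def)

lemma L2_space_bound:
  assumes "g \<in> borel_measurable M" "integrable M h" "AE x in M. (norm (g x))\<^sup>2 \<le> h x"
  shows "g \<in> L2_space M"
proof -
  have "integrable M (\<lambda>x. (norm (g x))\<^sup>2)"
    using assms by (intro Bochner_Integration.integrable_bound[OF assms(2)]) (auto elim!: eventually_mono)
  then show ?thesis using assms by (simp add: L2_space_def)
qed

lemma norm_add_sqr_le: "(norm (x + y))\<^sup>2 \<le> 2 * (norm x)\<^sup>2 + 2 * (norm y)\<^sup>2"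
  for x y :: "'a::real_normed_vector"
proof -
  have "(norm (x + y))\<^sup>2 \<le> (norm x + norm y)\<^sup>2" by (intro power_mono norm_triangle_ineq) auto
  also have "\<dots> \<le> 2 * (norm x)\<^sup>2 + 2 * (norm y)\<^sup>2"
    using sum_squares_bound[of "norm x" "norm y"] by (simp add: power2_sum)
  finally show ?thesis .
qed

lemma L2_space_scale: "f \<in> L2_space M \<Longrightarrow> (\<lambda>x. c *\<^sub>R f x) \<in> L2_space M"
  by (auto simp: L2_space_def power_mult_distrib)

lemma L2_space_add: assumes "f \<in> L2_space M" "g \<in> L2_space M"
  shows "(\<lambda>x. f x + g x) \<in> L2_space M"
proof (rule L2_space_bound)
  show "integrable M (\<lambda>x. 2 * (norm (f x))\<^sup>2 + 2 * (norm (g x))\<^sup>2)"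
    using assms by (auto simp: L2_space_def)
qed (use assms norm_add_sqr_le in \<open>auto simp: L2_space_def\<close>)

lemma L2_space_0: "(\<lambda>x. 0) \<in> L2_space M"
  by (simp add: L2_space_def)

lemma L2_space_lincomb:
  "f \<in> L2_space M \<Longrightarrow> g \<in> L2_space M \<Longrightarrow> (\<lambda>x. a *\<^sub>R f x + b *\<^sub>R g x) \<in> L2_space M"
  by (intro L2_space_add L2_space_scale)

lemma L2_space_diff:
  "f \<in> L2_space M \<Longrightarrow> g \<in> L2_space M \<Longrightarrow> (\<lambda>x. f x - g x) \<in> L2_space M"
  using L2_space_lincomb[of f M g 1 "-1"] by simp

lemma L2_space_linear:
  assumes "f \<in> L2_space M" "linear A"
  shows "(\<lambda>x. A (f x)) \<in> L2_space M"
proof -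
  obtain B where B: "\<And>x. norm (A x) \<le> B * norm x"
    using linear_bounded[OF assms(2)] by blast
  have "A \<in> borel_measurable borel"
    using assms(2) by (intro borel_measurable_continuous_onI linear_continuous_on linear_linear[THEN iffD2])
  then have m: "(\<lambda>x. A (f x)) \<in> borel_measurable M"
    using assms(1) by (auto simp: L2_space_def)
  have "(norm (A x))\<^sup>2 \<le> B\<^sup>2 * (norm x)\<^sup>2" for x
    using power_mono[OF B norm_ge_zero, of x 2] by (simp add: power_mult_distrib)
  then show ?thesis
    using assms(1) by (intro L2_space_bound[OF m, of "\<lambda>x. B\<^sup>2 * (norm (f x))\<^sup>2"]) (auto simp: L2_space_def)
qed

lemma L2_space_inner_integrable:
  assumes "f \<in> L2_space M" "g \<in> L2_space M"
  shows "integrable M (\<lambda>x. f x \<bullet> g x)"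
proof (rule Bochner_Integration.integrable_bound)
  show "integrable M (\<lambda>x. (norm (f x))\<^sup>2 + (norm (g x))\<^sup>2)"
    using assms by (auto simp: L2_space_def)
  have "\<bar>x \<bullet> y\<bar> \<le> (norm x)\<^sup>2 + (norm y)\<^sup>2" for x y :: 'b
    using Cauchy_Schwarz_ineq2[of x y] sum_squares_bound[of "norm x" "norm y"]
      mult_nonneg_nonneg[of "norm x" "norm y"] by (auto intro: order_trans)
  then show "AE x in M. norm (f x \<bullet> g x) \<le> norm ((norm (f x))\<^sup>2 + (norm (g x))\<^sup>2)"
    by (intro AE_I2) auto
qed (use assms in \<open>auto simp: L2_space_def\<close>)

text \<open>Functions on the whole space, since a type cannot depend on the domain; functions on a
  measurable set enter through extension by zero (\<open>cls\<close>). The relation is partial: a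
  function outside L^2 belongs to no class.\<close>

definition l2_rel :: "('a::euclidean_space \<Rightarrow> 'b::euclidean_space) \<Rightarrow> ('a \<Rightarrow> 'b) \<Rightarrow> bool" where
  "l2_rel f g \<longleftrightarrow> f \<in> L2_space lebesgue \<and> g \<in> L2_space lebesgue \<and> (AE x in lebesgue. f x = g x)"

quotient_type (overloaded) ('a, 'b) l2 = "'a::euclidean_space \<Rightarrow> 'b::euclidean_space" / partial: l2_rel
proof (rule part_equivpI)
  show "\<exists>f. l2_rel f f" by (auto simp: l2_rel_def intro!: exI[of _ "\<lambda>x. 0"] L2_space_0)
  show "symp l2_rel" by (auto simp: symp_def l2_rel_def elim: eventually_mono)
  show "transp l2_rel" by (auto simp: transp_def l2_rel_def elim: eventually_elim2)
qed

lemma l2_rel_refl: "l2_rel f f \<longleftrightarrow> f \<in> L2_space lebesgue"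
  by (auto simp: l2_rel_def)

instantiation l2 :: (euclidean_space, euclidean_space) real_vector
begin

lift_definition zero_l2 :: "('a, 'b) l2" is "\<lambda>x. 0"
  by (simp add: l2_rel_refl L2_space_0)

lift_definition plus_l2 :: "('a, 'b) l2 \<Rightarrow> ('a, 'b) l2 \<Rightarrow> ('a, 'b) l2" is "\<lambda>f g x. f x + g x"
  by (auto simp: l2_rel_def intro: L2_space_add)

lift_definition minus_l2 :: "('a, 'b) l2 \<Rightarrow> ('a, 'b) l2 \<Rightarrow> ('a, 'b) l2" is "\<lambda>f g x. f x - g x"
  by (auto simp: l2_rel_def intro: L2_space_diff)

lift_definition uminus_l2 :: "('a, 'b) l2 \<Rightarrow> ('a, 'b) l2" is "\<lambda>f x. - f x"
  using L2_space_scale[of _ _ "-1"] by (auto simp: l2_rel_def)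

lift_definition scaleR_l2 :: "real \<Rightarrow> ('a, 'b) l2 \<Rightarrow> ('a, 'b) l2" is "\<lambda>c f x. c *\<^sub>R f x"
  by (auto simp: l2_rel_def intro: L2_space_scale elim: eventually_mono)

instance
proof
  fix x y z :: "('a, 'b) l2" and a b :: real
  show "x + y + z = x + (y + z)"
    by transfer (auto simp: l2_rel_def algebra_simps intro!: L2_space_add)
  show "x + y = y + x"
    by transfer (auto simp: l2_rel_def algebra_simps intro!: L2_space_add)
  show "0 + x = x"
    by transfer (auto simp: l2_rel_def)
  show "- x + x = 0"
    by transfer (use L2_space_scale[of _ _ "-1"] in \<open>auto simp: l2_rel_def L2_space_0\<close>)
  show "x - y = x + - y"
    by transfer (auto simp: l2_rel_def intro!: L2_space_diff)
  show "a *\<^sub>R (x + y) = a *\<^sub>R x + a *\<^sub>R y"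
    by transfer (auto simp: l2_rel_def scaleR_add_right intro!: L2_space_lincomb L2_space_scale
        L2_space_add[OF L2_space_scale L2_space_scale, unfolded scaleR_add_right[symmetric]])
  show "(a + b) *\<^sub>R x = a *\<^sub>R x + b *\<^sub>R x"
    by transfer (auto simp: l2_rel_def scaleR_add_left intro!: L2_space_lincomb)
  show "a *\<^sub>R b *\<^sub>R x = (a * b) *\<^sub>R x"
    by transfer (auto simp: l2_rel_def intro!: L2_space_scale)
  show "1 *\<^sub>R x = x"
    by transfer (auto simp: l2_rel_def)
qed

end

instantiation l2 :: (euclidean_space, euclidean_space) real_inner
begin

lift_definition inner_l2 :: "('a, 'b) l2 \<Rightarrow> ('a, 'b) l2 \<Rightarrow> real" is "\<lambda>f g. \<integral>x. f x \<bullet> g x \<partial>lebesgue"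
proof -
  fix f f' g g' :: "'a \<Rightarrow> 'b" assume *: "l2_rel f f'" "l2_rel g g'"
  then have "AE x in lebesgue. f x = f' x" "AE x in lebesgue. g x = g' x" by (auto simp: l2_rel_def)
  then have "AE x in lebesgue. f x \<bullet> g x = f' x \<bullet> g' x" by eventually_elim simp
  then show "(\<integral>x. f x \<bullet> g x \<partial>lebesgue) = (\<integral>x. f' x \<bullet> g' x \<partial>lebesgue)"
    using * by (intro integral_cong_AE) (auto simp: l2_rel_def L2_space_def)
qed

definition norm_l2 :: "('a, 'b) l2 \<Rightarrow> real" where "norm_l2 x = sqrt (x \<bullet> x)"
definition dist_l2 :: "('a, 'b) l2 \<Rightarrow> ('a, 'b) l2 \<Rightarrow> real" where "dist_l2 x y = norm (x - y)"
definition sgn_l2 :: "('a, 'b) l2 \<Rightarrow> ('a, 'b) l2" where "sgn_l2 x = x /\<^sub>R norm x"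
definition uniformity_l2 :: "(('a, 'b) l2 \<times> ('a, 'b) l2) filter" where
  "uniformity_l2 = (INF e\<in>{0<..}. principal {(x, y). dist x y < e})"
definition open_l2 :: "('a, 'b) l2 set \<Rightarrow> bool" where
  "open_l2 U \<longleftrightarrow> (\<forall>x\<in>U. eventually (\<lambda>(x', y). x' = x \<longrightarrow> y \<in> U) uniformity)"

instance
proof
  fix x y z :: "('a, 'b) l2" and a :: real
  show "x \<bullet> y = y \<bullet> x"
    by transfer (simp add: inner_commute)
  show "(x + y) \<bullet> z = x \<bullet> z + y \<bullet> z"
    by transfer (simp add: l2_rel_refl inner_add_left L2_space_inner_integrable)
  show "(a *\<^sub>R x) \<bullet> y = a * (x \<bullet> y)"
    by transfer simp
  show "0 \<le> x \<bullet> x"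
    by transfer (auto intro: integral_nonneg_AE)
  show "x \<bullet> x = 0 \<longleftrightarrow> x = 0"
  proof transfer
    fix f :: "'a \<Rightarrow> 'b" assume "l2_rel f f"
    then have f: "f \<in> L2_space lebesgue" by (simp add: l2_rel_refl)
    have "(\<integral>x. f x \<bullet> f x \<partial>lebesgue) = 0 \<longleftrightarrow> (AE x in lebesgue. f x \<bullet> f x = 0)"
      by (intro integral_nonneg_eq_0_iff_AE L2_space_inner_integrable f) auto
    also have "\<dots> \<longleftrightarrow> l2_rel f (\<lambda>x. 0)" using f by (simp add: l2_rel_def L2_space_0)
    finally show "(\<integral>x. f x \<bullet> f x \<partial>lebesgue) = 0 \<longleftrightarrow> l2_rel f (\<lambda>x. 0)" .
  qed
qed (simp_all add: norm_l2_def dist_l2_def sgn_l2_def uniformity_l2_def open_l2_def)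

end

section \<open>Passing between functions and their classes\<close>

lemma rep_l2_L2: "rep_l2 X \<in> L2_space lebesgue"
  using Quotient3_rep_reflp[OF Quotient3_l2, of X] by (simp add: l2_rel_refl)

lemma abs_rep_l2 [simp]: "abs_l2 (rep_l2 X) = X"
  by (rule Quotient3_abs_rep[OF Quotient3_l2])

lemma abs_l2_eq_iff:
  "f \<in> L2_space lebesgue \<Longrightarrow> g \<in> L2_space lebesgue \<Longrightarrow>
    abs_l2 f = abs_l2 g \<longleftrightarrow> (AE x in lebesgue. f x = g x)"
  using Quotient3_rel[OF Quotient3_l2, of f g] by (auto simp: l2_rel_def)

lemma inner_abs_l2:
  "f \<in> L2_space lebesgue \<Longrightarrow> g \<in> L2_space lebesgue \<Longrightarrow>
    abs_l2 f \<bullet> abs_l2 g = (\<integral>x. f x \<bullet> g x \<partial>lebesgue)"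
  by (rule inner_l2.abs_eq) (simp_all add: l2_rel_refl)

lemma norm_abs_l2:
  "f \<in> L2_space lebesgue \<Longrightarrow> (norm (abs_l2 f))\<^sup>2 = (\<integral>x. (norm (f x))\<^sup>2 \<partial>lebesgue)"
  by (simp add: power2_norm_eq_inner inner_abs_l2)

lemma abs_l2_diff:
  "f \<in> L2_space lebesgue \<Longrightarrow> g \<in> L2_space lebesgue \<Longrightarrow>
    abs_l2 f - abs_l2 g = abs_l2 (\<lambda>x. f x - g x)"
  by (rule minus_l2.abs_eq) (simp_all add: l2_rel_refl)

lemma abs_l2_lincomb:
  "f \<in> L2_space lebesgue \<Longrightarrow> g \<in> L2_space lebesgue \<Longrightarrow>
    abs_l2 (\<lambda>x. a *\<^sub>R f x + b *\<^sub>R g x) = a *\<^sub>R abs_l2 f + b *\<^sub>R abs_l2 g"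
  by (simp add: scaleR_l2.abs_eq plus_l2.abs_eq l2_rel_refl L2_space_scale)

text \<open>Lower semicontinuity of the norm under convergence almost everywhere. The bound is asked
  for only from \<open>N\<close> on, so that the tail of a Cauchy sequence qualifies.\<close>

lemma L2_Fatou:
  assumes f: "\<And>n. f n \<in> L2_space M" and g: "g \<in> borel_measurable M"
    and lim: "AE x in M. (\<lambda>n. f n x) \<longlonglongrightarrow> g x"
    and C: "\<And>n. n \<ge> N \<Longrightarrow> (\<integral>x. (norm (f n x))\<^sup>2 \<partial>M) \<le> C"
  shows "g \<in> L2_space M" "(\<integral>x. (norm (g x))\<^sup>2 \<partial>M) \<le> C"
proof -
  have "0 \<le> (\<integral>x. (norm (f N x))\<^sup>2 \<partial>M)" by simp
  then have C0: "0 \<le> C" using C[of N] by linarith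
  have gm: "(\<lambda>x. (norm (g x))\<^sup>2) \<in> borel_measurable M" using g by auto
  have "(\<integral>\<^sup>+x. ennreal ((norm (g x))\<^sup>2) \<partial>M) = (\<integral>\<^sup>+x. liminf (\<lambda>n. ennreal ((norm (f n x))\<^sup>2)) \<partial>M)"
  proof (rule nn_integral_cong_AE)
    show "AE x in M. ennreal ((norm (g x))\<^sup>2) = liminf (\<lambda>n. ennreal ((norm (f n x))\<^sup>2))"
      using lim
    proof eventually_elim
      case (elim x)
      then have "(\<lambda>n. ennreal ((norm (f n x))\<^sup>2)) \<longlonglongrightarrow> ennreal ((norm (g x))\<^sup>2)"
        by (intro tendsto_ennrealI tendsto_intros)
      from lim_imp_Liminf[OF trivial_limit_sequentially this] show ?case by simp
    qed
  qed
  also have "\<dots> \<le> liminf (\<lambda>n. \<integral>\<^sup>+x. ennreal ((norm (f n x))\<^sup>2) \<partial>M)"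
    using f[THEN L2_space_measurable] by (intro nn_integral_liminf) auto
  also have "\<dots> \<le> liminf (\<lambda>n. ennreal C)"
  proof (rule Liminf_mono)
    show "\<forall>\<^sub>F n in sequentially. (\<integral>\<^sup>+x. ennreal ((norm (f n x))\<^sup>2) \<partial>M) \<le> ennreal C"
      using eventually_ge_at_top[of N]
    proof eventually_elim
      case (elim n)
      then show ?case
        using C[of n] L2_space_integrable[OF f] by (subst nn_integral_eq_integral) (auto intro: ennreal_leI)
    qed
  qed
  also have "\<dots> = ennreal C" by (simp add: Liminf_const)
  finally have le: "(\<integral>\<^sup>+x. ennreal ((norm (g x))\<^sup>2) \<partial>M) \<le> ennreal C" .
  then have int: "integrable M (\<lambda>x. (norm (g x))\<^sup>2)"
    using gm by (intro integrableI_bounded) (auto simp: le_less_trans[OF le])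
  then show "g \<in> L2_space M" using g by (simp add: L2_space_def)
  have "ennreal (\<integral>x. (norm (g x))\<^sup>2 \<partial>M) \<le> ennreal C"
    using le int by (subst (asm) nn_integral_eq_integral) auto
  then show "(\<integral>x. (norm (g x))\<^sup>2 \<partial>M) \<le> C" using C0 by simp
qed

text \<open>Riesz--Fischer: along a subsequence with geometrically small differences \<open>\<Delta>\<^sub>n\<close>, the
  function \<open>\<Sum>n. 4\<^sup>n |\<Delta>\<^sub>n|\<^sup>2\<close> is integrable, hence finite almost everywhere.\<close>
lemma L2_AE_convergent:
  fixes f :: "nat \<Rightarrow> 'a \<Rightarrow> 'b::euclidean_space"
  assumes f: "\<And>n. f n \<in> L2_space M"
    and small: "\<And>n. (\<integral>x. (norm (f (Suc n) x - f n x))\<^sup>2 \<partial>M) \<le> (1/8) ^ n"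
  shows "AE x in M. convergent (\<lambda>n. f n x)"
proof -
  \<comment> \<open>The weight 4^n balances two needs: 4^n (1/8)^n = 2^-n is summable, and
    \<open>d n x\<close> \<le> C leaves increments of size at most sqrt C 2^-n, again
    summable.\<close>
  define d where "d n x = 4 ^ n * (norm (f (Suc n) x - f n x))\<^sup>2" for n x
  have dL: "integrable M (d n)" for n
    unfolding d_def[abs_def] using L2_space_integrable[OF L2_space_diff[OF f f]] by simp
  have dm: "(\<lambda>x. ennreal (d n x)) \<in> borel_measurable M" for n using dL[of n] by auto
  have "(\<integral>\<^sup>+x. (\<Sum>n. ennreal (d n x)) \<partial>M) = (\<Sum>n. \<integral>\<^sup>+x. ennreal (d n x) \<partial>M)"
    by (rule nn_integral_suminf[OF dm])
  also have "\<dots> \<le> (\<Sum>n. ennreal ((1/2) ^ n))"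
  proof (rule suminf_le)
    show "(\<integral>\<^sup>+x. ennreal (d n x) \<partial>M) \<le> ennreal ((1/2) ^ n)" for n
    proof -
      have "(\<integral>\<^sup>+x. ennreal (d n x) \<partial>M) = ennreal (\<integral>x. d n x \<partial>M)"
        by (rule nn_integral_eq_integral[OF dL]) (auto simp: d_def)
      also have "(\<integral>x. d n x \<partial>M) \<le> 4 ^ n * (1/8) ^ n"
        unfolding d_def using small[of n] by simp
      also have "(4::real) ^ n * (1/8) ^ n = (1/2) ^ n" by (simp flip: power_mult_distrib)
      finally show ?thesis by (simp add: ennreal_leI)
    qed
  qed auto
  also have "\<dots> < top"
    by (subst suminf_ennreal2) (auto simp: summable_geometric_iff)
  finally have "(\<integral>\<^sup>+x. (\<Sum>n. ennreal (d n x)) \<partial>M) \<noteq> \<infinity>" by simp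
  then have "AE x in M. (\<Sum>n. ennreal (d n x)) \<noteq> \<infinity>"
    by (intro nn_integral_PInf_AE) (use dm in auto)
  then show ?thesis
  proof eventually_elim
    case (elim x)
    then obtain C where C: "C \<ge> 0" "(\<Sum>n. ennreal (d n x)) = ennreal C"
      by (metis ennreal_cases infinity_ennreal_def)
    have dC: "d n x \<le> C" for n
    proof -
      have "ennreal (d n x) \<le> (\<Sum>n. ennreal (d n x))"
        using sum_le_suminf[of "\<lambda>n. ennreal (d n x)" "{n}"] by simp
      then show ?thesis using C by simp
    qed
    have bound: "norm (f (Suc n) x - f n x) \<le> sqrt C * (1/2) ^ n" for n
    proof (rule power2_le_imp_le)
      have "(norm (f (Suc n) x - f n x))\<^sup>2 = d n x * (1/4) ^ n"
        by (simp add: d_def power_divide)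
      also have "\<dots> \<le> C * (1/4) ^ n" using dC[of n] by (intro mult_right_mono) auto
      also have "\<dots> = (sqrt C * (1/2) ^ n)\<^sup>2"
      proof -
        have "((1/2::real) ^ n)\<^sup>2 = (1/4) ^ n"
          by (subst power_mult[symmetric], subst mult.commute, subst power_mult) (simp add: power2_eq_square)
        then show ?thesis using C(1) by (simp add: power_mult_distrib)
      qed
      finally show "(norm (f (Suc n) x - f n x))\<^sup>2 \<le> (sqrt C * (1/2) ^ n)\<^sup>2" .
    qed (use C(1) in auto)
    have "summable (\<lambda>n. f (Suc n) x - f n x)"
      by (rule summable_comparison_test'[where g = "\<lambda>n. sqrt C * (1/2) ^ n" and N = 0])
        (use bound in \<open>auto intro!: summable_mult simp: summable_geometric_iff\<close>)
    then have "convergent (\<lambda>n. f n x - f 0 x)"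
      by (simp add: summable_iff_convergent sum_lessThan_telescope[of "\<lambda>i. f i x"])
    then have "convergent (\<lambda>n. (f n x - f 0 x) + f 0 x)"
      by (intro convergent_add convergent_const)
    then show ?case by simp
  qed
qed

text \<open>A rapidly converging subsequence has a pointwise limit almost everywhere, Fatou turns it
  into a limit in norm, and a Cauchy sequence with a convergent subsequence converges.\<close>

instance l2 :: (euclidean_space, euclidean_space) complete_space
proof
  fix X :: "nat \<Rightarrow> ('a, 'b) l2" assume X: "Cauchy X"
  have "\<forall>n. \<exists>N. \<forall>k\<ge>N. \<forall>l\<ge>N. dist (X k) (X l) < sqrt ((1/8) ^ n)"
    using X by (auto simp: Cauchy_def)
  then obtain N where N: "\<And>n k l. N n \<le> k \<Longrightarrow> N n \<le> l \<Longrightarrow> dist (X k) (X l) < sqrt ((1/8) ^ n)" by metis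
  \<comment> \<open>The sum dominates \<open>N n\<close>, and the summand \<open>n\<close> keeps r
    strictly increasing where some \<open>N i\<close> are 0.\<close>
  define r where "r n = (\<Sum>i\<le>n. N i) + n" for n :: nat
  have r: "strict_mono r" by (rule strict_monoI_Suc) (simp add: r_def)
  have rN: "N n \<le> r n" for n by (simp add: r_def member_le_sum trans_le_add1)
  define f where "f n = rep_l2 (X (r n))" for n
  have f: "f n \<in> L2_space lebesgue" for n by (simp add: f_def rep_l2_L2)
  have absf: "abs_l2 (f n) = X (r n)" for n by (simp add: f_def)
  have fd: "(\<integral>x. (norm (f n x - f m x))\<^sup>2 \<partial>lebesgue) = (dist (X (r n)) (X (r m)))\<^sup>2" for n m
    using norm_abs_l2[OF L2_space_diff[OF f f, of n m]] by (simp add: dist_norm absf flip: abs_l2_diff[OF f f])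
  have "(\<integral>x. (norm (f (Suc n) x - f n x))\<^sup>2 \<partial>lebesgue) \<le> (1/8) ^ n" for n
  proof -
    have "dist (X (r (Suc n))) (X (r n)) < sqrt ((1/8) ^ n)"
      using rN[of n] strict_monoD[OF r, of n "Suc n"] by (intro N) auto
    then have "(dist (X (r (Suc n))) (X (r n)))\<^sup>2 \<le> (sqrt ((1/8) ^ n))\<^sup>2" by (intro power_mono) auto
    then show ?thesis by (simp add: fd)
  qed
  from L2_AE_convergent[OF f this] have conv: "AE x in lebesgue. convergent (\<lambda>n. f n x)" .
  define g where "g x = lim (\<lambda>n. f n x)" for x
  have gm: "g \<in> borel_measurable lebesgue"
    unfolding g_def[abs_def] by (intro borel_measurable_lim_metric L2_space_measurable f)
  have fg: "AE x in lebesgue. (\<lambda>n. f n x) \<longlonglongrightarrow> g x"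
    using conv by eventually_elim (simp add: g_def convergent_LIMSEQ_iff)
  \<comment> \<open>Fatou in n with m fixed turns the Cauchy estimate into an estimate of the
    distance to the limit.\<close>
  have fat: "(\<lambda>x. g x - f m x) \<in> L2_space lebesgue \<and> (\<integral>x. (norm (g x - f m x))\<^sup>2 \<partial>lebesgue) \<le> e\<^sup>2"
    if K: "\<And>n. n \<ge> K \<Longrightarrow> dist (X (r n)) (X (r m)) \<le> e" for m K e
  proof -
    have 1: "(\<lambda>x. f n x - f m x) \<in> L2_space lebesgue" for n by (intro L2_space_diff f)
    have 2: "(\<lambda>x. g x - f m x) \<in> borel_measurable lebesgue"
      using gm L2_space_measurable[OF f] by auto
    have 3: "AE x in lebesgue. (\<lambda>n. f n x - f m x) \<longlonglongrightarrow> g x - f m x"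
      using fg by eventually_elim (intro tendsto_intros)
    have 4: "(\<integral>x. (norm (f n x - f m x))\<^sup>2 \<partial>lebesgue) \<le> e\<^sup>2" if "n \<ge> K" for n
      unfolding fd using K[OF that] by (intro power_mono) auto
    show ?thesis using L2_Fatou[OF 1 2 3 4] by simp
  qed
  have tail: "\<exists>K. \<forall>m\<ge>K. \<forall>n\<ge>K. dist (X (r n)) (X (r m)) \<le> e" if e: "e > 0" for e
  proof -
    obtain K where K: "\<forall>k\<ge>K. \<forall>l\<ge>K. dist (X k) (X l) < e" using metric_CauchyD[OF X e] by blast
    show ?thesis
    proof (intro exI allI impI)
      fix m n assume "K \<le> m" "K \<le> n"
      then have "K \<le> r m" "K \<le> r n" using seq_suble[OF r] order_trans by blast+
      then show "dist (X (r n)) (X (r m)) \<le> e" using K by (simp add: less_imp_le)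
    qed
  qed
  have gL: "g \<in> L2_space lebesgue"
  proof -
    obtain K where "\<forall>m\<ge>K. \<forall>n\<ge>K. dist (X (r n)) (X (r m)) \<le> 1" using tail[of 1] by auto
    then have "(\<lambda>x. g x - f K x) \<in> L2_space lebesgue" using fat[of K K 1] by auto
    from L2_space_add[OF this f[of K]] show ?thesis by simp
  qed
  have "(X \<circ> r) \<longlonglongrightarrow> abs_l2 g"
  proof (rule metric_LIMSEQ_I)
    fix e :: real assume "e > 0"
    then obtain K where K: "\<forall>m\<ge>K. \<forall>n\<ge>K. dist (X (r n)) (X (r m)) \<le> e / 2" using tail[of "e/2"] by auto
    show "\<exists>K. \<forall>m\<ge>K. dist ((X \<circ> r) m) (abs_l2 g) < e"
    proof (intro exI allI impI)
      fix m assume "K \<le> m"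
      then have "(\<integral>x. (norm (g x - f m x))\<^sup>2 \<partial>lebesgue) \<le> (e/2)\<^sup>2" using fat[of K m "e/2"] K by auto
      moreover have "(dist (abs_l2 g) (X (r m)))\<^sup>2 = (\<integral>x. (norm (g x - f m x))\<^sup>2 \<partial>lebesgue)"
        using norm_abs_l2[OF L2_space_diff[OF gL f, of m]] by (simp add: dist_norm absf flip: abs_l2_diff[OF gL f])
      ultimately have "(dist (abs_l2 g) (X (r m)))\<^sup>2 \<le> (e/2)\<^sup>2" by simp
      then have "dist (abs_l2 g) (X (r m)) \<le> e / 2"
        by (rule power2_le_imp_le) (use \<open>e > 0\<close> in simp)
      then show "dist ((X \<circ> r) m) (abs_l2 g) < e" using \<open>e > 0\<close> by (simp add: dist_commute)
    qed
  qed
  then show "convergent X" using Cauchy_converges_subseq[OF X r] by (auto simp: convergent_def comp_def)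
qed

subsection \<open>Classes of functions on a measurable subset\<close>

text \<open>Extension by zero embeds L^2(S) isometrically into \<open>l2\<close>, so that all
  domains share one type. Values of f off S are ignored.\<close>

definition cls :: "'a::euclidean_space set \<Rightarrow> ('a \<Rightarrow> 'b::euclidean_space) \<Rightarrow> ('a, 'b) l2" where
  "cls S f = abs_l2 (\<lambda>x. indicator S x *\<^sub>R f x)"

context
  fixes S :: "'a::euclidean_space set"
  assumes S: "S \<in> sets lebesgue"
begin

lemma L2_space_extend:
  "f \<in> L2_space (lebesgue_on S) \<longleftrightarrow> (\<lambda>x. indicator S x *\<^sub>R f x) \<in> L2_space lebesgue"
  for f :: "'a \<Rightarrow> 'b::euclidean_space"
proof -
  have *: "(norm (indicator S x *\<^sub>R f x))\<^sup>2 = indicator S x *\<^sub>R (norm (f x))\<^sup>2" for x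
    by (auto simp: indicator_def)
  show ?thesis
    unfolding L2_space_def mem_Collect_eq *
    using S by (simp add: borel_measurable_restrict_space_iff integrable_restrict_space)
qed

lemma inner_cls:
  fixes f g :: "'a \<Rightarrow> 'b::euclidean_space"
  assumes "f \<in> L2_space (lebesgue_on S)" "g \<in> L2_space (lebesgue_on S)"
  shows "cls S f \<bullet> cls S g = (\<integral>x. f x \<bullet> g x \<partial>lebesgue_on S)"
proof -
  have "cls S f \<bullet> cls S g = (\<integral>x. (indicator S x *\<^sub>R f x) \<bullet> (indicator S x *\<^sub>R g x) \<partial>lebesgue)"
    using assms unfolding cls_def L2_space_extend by (rule inner_abs_l2)
  also have "\<dots> = (\<integral>x. indicator S x *\<^sub>R (f x \<bullet> g x) \<partial>lebesgue)"
    by (intro Bochner_Integration.integral_cong refl) (auto simp: indicator_def)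
  also have "\<dots> = (\<integral>x. f x \<bullet> g x \<partial>lebesgue_on S)"
    using S by (subst integral_restrict_space) auto
  finally show ?thesis .
qed

lemma norm_cls:
  fixes f :: "'a \<Rightarrow> 'b::euclidean_space"
  assumes "f \<in> L2_space (lebesgue_on S)"
  shows "norm (cls S f) = L2_norm (lebesgue_on S) f"
  by (simp add: L2_norm_def norm_eq_sqrt_inner[of "cls S f"] inner_cls[OF assms assms] power2_norm_eq_inner)

lemma cls_lincomb:
  fixes f g :: "'a \<Rightarrow> 'b::euclidean_space"
  assumes "f \<in> L2_space (lebesgue_on S)" "g \<in> L2_space (lebesgue_on S)"
  shows "cls S (\<lambda>x. a *\<^sub>R f x + b *\<^sub>R g x) = a *\<^sub>R cls S f + b *\<^sub>R cls S g"
proof -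
  have "cls S (\<lambda>x. a *\<^sub>R f x + b *\<^sub>R g x)
     = abs_l2 (\<lambda>x. a *\<^sub>R (indicator S x *\<^sub>R f x) + b *\<^sub>R (indicator S x *\<^sub>R g x))"
    by (simp add: cls_def scaleR_add_right mult.commute)
  also have "\<dots> = a *\<^sub>R cls S f + b *\<^sub>R cls S g"
    unfolding cls_def by (rule abs_l2_lincomb) (use assms in \<open>simp_all only: L2_space_extend\<close>)
  finally show ?thesis .
qed

lemma cls_diff:
  fixes f g :: "'a \<Rightarrow> 'b::euclidean_space"
  shows "f \<in> L2_space (lebesgue_on S) \<Longrightarrow> g \<in> L2_space (lebesgue_on S) \<Longrightarrow>
    cls S (\<lambda>x. f x - g x) = cls S f - cls S g"
  using cls_lincomb[of f g 1 "-1"] by simp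

lemma cls_eq_iff:
  fixes f g :: "'a \<Rightarrow> 'b::euclidean_space"
  assumes "f \<in> L2_space (lebesgue_on S)" "g \<in> L2_space (lebesgue_on S)"
  shows "cls S f = cls S g \<longleftrightarrow> (AE x in lebesgue_on S. f x = g x)"
proof -
  have "cls S f = cls S g \<longleftrightarrow> (AE x in lebesgue. indicator S x *\<^sub>R f x = indicator S x *\<^sub>R g x)"
    using assms unfolding cls_def L2_space_extend by (rule abs_l2_eq_iff)
  also have "\<dots> \<longleftrightarrow> (AE x in lebesgue. x \<in> S \<longrightarrow> f x = g x)"
  proof -
    have "(indicator S x *\<^sub>R f x = indicator S x *\<^sub>R g x) = (x \<in> S \<longrightarrow> f x = g x)" for x
      by (auto simp: indicator_def)
    then show ?thesis by (simp only:)
  qed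
  also have "\<dots> \<longleftrightarrow> (AE x in lebesgue_on S. f x = g x)"
    using S by (subst AE_restrict_space_iff) auto
  finally show ?thesis .
qed

lemma rep_l2_restrict: "rep_l2 X \<in> L2_space (lebesgue_on S)"
  for X :: "('a, 'b::euclidean_space) l2"
  unfolding L2_space_extend
proof (rule L2_space_bound)
  show "integrable lebesgue (\<lambda>x. (norm (rep_l2 X x))\<^sup>2)" by (intro L2_space_integrable rep_l2_L2)
  show "(\<lambda>x. indicator S x *\<^sub>R rep_l2 X x) \<in> borel_measurable lebesgue"
    using S L2_space_measurable[OF rep_l2_L2] by (intro borel_measurable_scaleR) auto
qed (auto simp: indicator_def)

lemma rep_l2_AE:
  fixes f :: "'a \<Rightarrow> 'b::euclidean_space"
  assumes "f \<in> L2_space (lebesgue_on S)"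
  shows "AE x in lebesgue_on S. rep_l2 (cls S f) x = f x"
proof -
  have "abs_l2 (rep_l2 (cls S f)) = abs_l2 (\<lambda>x. indicator S x *\<^sub>R f x)" by (simp add: cls_def)
  then have "AE x in lebesgue. rep_l2 (cls S f) x = indicator S x *\<^sub>R f x"
    using assms abs_l2_eq_iff[OF rep_l2_L2, of "\<lambda>x. indicator S x *\<^sub>R f x"] by (simp add: L2_space_extend)
  then show ?thesis
    using S by (subst AE_restrict_space_iff) (auto elim!: eventually_mono)
qed

lemma cls_rep_cls:
  fixes f :: "'a \<Rightarrow> 'b::euclidean_space"
  assumes "f \<in> L2_space (lebesgue_on S)"
  shows "cls S (rep_l2 (cls S f)) = cls S f"
  using rep_l2_AE[OF assms] by (subst cls_eq_iff) (auto simp: assms rep_l2_restrict)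

text \<open>A representative of an arbitrary class need not vanish off S; \<open>cls S\<close> cuts
  it off, and the cutoff is a contraction.\<close>

lemma cls_rep_dist:
  fixes X Y :: "('a, 'b::euclidean_space) l2"
  shows "norm (cls S (rep_l2 X) - cls S (rep_l2 Y)) \<le> norm (X - Y)"
proof (rule power2_le_imp_le)
  have *: "cls S (rep_l2 X) - cls S (rep_l2 Y) = abs_l2 (\<lambda>x. indicator S x *\<^sub>R (rep_l2 X x - rep_l2 Y x))"
    unfolding cls_diff[OF rep_l2_restrict rep_l2_restrict, symmetric] by (simp add: cls_def)
  have L: "(\<lambda>x. indicator S x *\<^sub>R (rep_l2 X x - rep_l2 Y x)) \<in> L2_space lebesgue"
    unfolding L2_space_extend[symmetric] by (intro L2_space_diff rep_l2_restrict)
  have XY: "X - Y = abs_l2 (\<lambda>x. rep_l2 X x - rep_l2 Y x)"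
    using abs_l2_diff[OF rep_l2_L2 rep_l2_L2, of X Y] by simp
  show "(norm (cls S (rep_l2 X) - cls S (rep_l2 Y)))\<^sup>2 \<le> (norm (X - Y))\<^sup>2"
    unfolding * norm_abs_l2[OF L] XY norm_abs_l2[OF L2_space_diff[OF rep_l2_L2 rep_l2_L2]]
    by (intro integral_mono L2_space_integrable L L2_space_diff rep_l2_L2) (auto simp: indicator_def)
qed auto

lemma norm_cls_linear_le:
  fixes f :: "'a \<Rightarrow> 'b::euclidean_space" and A :: "'b \<Rightarrow> 'c::euclidean_space"
  assumes "f \<in> L2_space (lebesgue_on S)" "linear A" "\<And>x. norm (A x) \<le> K * norm x" "K \<ge> 0"
  shows "norm (cls S (\<lambda>x. A (f x))) \<le> K * norm (cls S f)"
proof (rule power2_le_imp_le)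
  have AL: "(\<lambda>x. A (f x)) \<in> L2_space (lebesgue_on S)" by (rule L2_space_linear) fact+
  have "(norm (cls S (\<lambda>x. A (f x))))\<^sup>2 = (\<integral>x. (norm (A (f x)))\<^sup>2 \<partial>lebesgue_on S)"
    by (simp add: norm_cls[OF AL] L2_norm_def)
  also have "\<dots> \<le> (\<integral>x. K\<^sup>2 * (norm (f x))\<^sup>2 \<partial>lebesgue_on S)"
    using power_mono[OF assms(3) norm_ge_zero, of _ 2] L2_space_integrable[OF assms(1)]
    by (intro integral_mono L2_space_integrable[OF AL]) (auto simp: power_mult_distrib)
  also have "\<dots> = (K * norm (cls S f))\<^sup>2"
    by (simp add: norm_cls[OF assms(1)] L2_norm_def power_mult_distrib)
  finally show "(norm (cls S (\<lambda>x. A (f x))))\<^sup>2 \<le> (K * norm (cls S f))\<^sup>2" .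
qed (use assms in auto)

end

subsection \<open>Strong measurability\<close>

text \<open>In this form measurability survives all continuous operations in one or two arguments,
  without separability of the target, and it matches the approximation demanded by
  \<open>L2_Bochner\<close>.\<close>

definition smeas :: "'t measure \<Rightarrow> ('t \<Rightarrow> 'v::topological_space) \<Rightarrow> bool" where
  "smeas M f \<longleftrightarrow> (\<exists>s. (\<forall>n. simple_function M (s n)) \<and> (AE t in M. (\<lambda>n. s n t) \<longlonglongrightarrow> f t))"

lemma smeasI:
  assumes "\<And>n. simple_function M (s n)" "AE t in M. (\<lambda>n. s n t) \<longlonglongrightarrow> f t"
  shows "smeas M f"
  unfolding smeas_def by (rule exI[of _ s]) (simp add: assms)

lemma smeasE:
  assumes "smeas M f"
  obtains s where "\<forall>n. simple_function M (s n)" "AE t in M. (\<lambda>n. s n t) \<longlonglongrightarrow> f t"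
  using assms unfolding smeas_def by (elim exE conjE)

lemma smeas_compose2:
  assumes "smeas M f" "smeas M g" "\<And>a b. isCont (\<lambda>(x, y). h x y) (a, b)"
  shows "smeas M (\<lambda>t. h (f t) (g t))"
proof -
  obtain s where s: "\<forall>n. simple_function M (s n)" "AE t in M. (\<lambda>n. s n t) \<longlonglongrightarrow> f t"
    by (rule smeasE[OF assms(1)])
  obtain r where r: "\<forall>n. simple_function M (r n)" "AE t in M. (\<lambda>n. r n t) \<longlonglongrightarrow> g t"
    by (rule smeasE[OF assms(2)])
  have "AE t in M. (\<lambda>n. h (s n t) (r n t)) \<longlonglongrightarrow> h (f t) (g t)"
    using s(2) r(2)
  proof eventually_elim
    case (elim t)
    then show ?case
      using isCont_tendsto_compose[OF assms(3) tendsto_Pair[OF elim(1) elim(2)]] by simp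
  qed
  moreover have "simple_function M (\<lambda>t. h (s n t) (r n t))" for n
    by (rule simple_function_compose2[OF s(1)[rule_format] r(1)[rule_format]])
  ultimately show ?thesis
    by (rule smeasI[rotated])
qed

lemma smeas_compose:
  assumes "smeas M f" "\<And>a. isCont h a"
  shows "smeas M (\<lambda>t. h (f t))"
proof -
  obtain s where s: "\<forall>n. simple_function M (s n)" "AE t in M. (\<lambda>n. s n t) \<longlonglongrightarrow> f t"
    by (rule smeasE[OF assms(1)])
  have "AE t in M. (\<lambda>n. h (s n t)) \<longlonglongrightarrow> h (f t)"
    using s(2) by eventually_elim (rule isCont_tendsto_compose[OF assms(2)])
  moreover have "simple_function M (\<lambda>t. h (s n t))" for n
    by (rule simple_function_compose1[OF s(1)[rule_format]])
  ultimately show ?thesis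
    by (rule smeasI[rotated])
qed

lemma smeas_const: "smeas M (\<lambda>t. c)"
  by (rule smeasI[of _ "\<lambda>n t. c"]) simp_all

lemma smeas_diff: "smeas M f \<Longrightarrow> smeas M g \<Longrightarrow> smeas M (\<lambda>t. f t - g t)" for f :: "'t \<Rightarrow> 'v::real_normed_vector"
  by (rule smeas_compose2[where h = "(-)"]) (auto simp: case_prod_unfold)
lemma smeas_inner: "smeas M f \<Longrightarrow> smeas M g \<Longrightarrow> smeas M (\<lambda>t. f t \<bullet> g t)" for f :: "'t \<Rightarrow> 'v::real_inner"
  by (rule smeas_compose2[where h = "(\<bullet>)"]) (auto simp: case_prod_unfold)
lemma smeas_norm: "smeas M f \<Longrightarrow> smeas M (\<lambda>t. norm (f t))" for f :: "'t \<Rightarrow> 'v::real_normed_vector"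
  by (rule smeas_compose) auto
lemma smeas_bounded_linear: "smeas M f \<Longrightarrow> bounded_linear h \<Longrightarrow> smeas M (\<lambda>t. h (f t))"
  by (rule smeas_compose) (auto intro: linear_continuous_at)

lemma (in complete_measure) borel_measurable_AE_cong:
  assumes "f \<in> borel_measurable M" "AE x in M. f x = g x"
  shows "g \<in> borel_measurable M"
proof (rule measurableI)
  fix A :: "'b set" assume "A \<in> sets borel"
  then have "f -` A \<inter> space M \<in> sets M" using assms(1) by (rule measurable_sets[rotated])
  then show "g -` A \<inter> space M \<in> sets M"
    by (rule in_sets_AE[rotated]) (use assms(2) in \<open>auto elim: eventually_mono\<close>)
qed auto

lemma complete_measure_restrict_space:
  assumes "complete_measure M" "S \<in> sets M"
  shows "complete_measure (restrict_space M S)"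
proof
  interpret complete_measure M by fact
  fix A B assume AB: "B \<subseteq> A" "A \<in> null_sets (restrict_space M S)"
  have *: "S \<inter> space M \<in> sets M" using assms(2) by auto
  then have "A \<in> null_sets M" "A \<subseteq> S" using AB(2) null_sets_restrict_space[OF assms(2)] by auto
  then have "B \<in> sets M" "B \<subseteq> S" using AB(1) complete by auto
  then show "B \<in> sets (restrict_space M S)" using assms(2) by (auto simp: sets_restrict_space_iff)
qed

lemma complete_measure_lebesgue_on: "S \<in> sets lebesgue \<Longrightarrow> complete_measure (lebesgue_on S)"
  by (intro complete_measure_restrict_space completion.complete_measure_axioms) auto

text \<open>The pointwise \<open>lim\<close> is measurable and agrees with f off a null set;
  completeness of the measure does the rest.\<close>

lemma smeas_real_measurable:
  fixes f :: "'t \<Rightarrow> real"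
  assumes "complete_measure M" "smeas M f"
  shows "f \<in> borel_measurable M"
proof -
  interpret complete_measure M by fact
  obtain s where s: "\<forall>n. simple_function M (s n)" "AE t in M. (\<lambda>n. s n t) \<longlonglongrightarrow> f t"
    by (rule smeasE[OF assms(2)])
  have "(\<lambda>t. lim (\<lambda>n. s n t)) \<in> borel_measurable M"
    by (intro borel_measurable_lim_metric borel_measurable_simple_function s(1)[rule_format])
  moreover have "AE t in M. lim (\<lambda>n. s n t) = f t"
    using s(2) by eventually_elim (rule limI)
  ultimately show ?thesis by (rule borel_measurable_AE_cong)
qed

subsection \<open>Riesz representation on a closed subspace\<close>

lemma quadratic_nonneg_linear_zero:
  fixes a b :: real
  assumes "\<And>t. 0 \<le> t * a + t\<^sup>2 * b"
  shows "a = 0"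
proof (rule ccontr)
  assume "a \<noteq> 0"
  \<comment> \<open>Any positive c > b serves: at t = -a/c the quadratic has the value -a^2/c + a^2
    b/c^2 < 0.\<close>
  define c where "c = \<bar>b\<bar> + 1"
  have c: "c > 0" "b < c" by (auto simp: c_def)
  have "0 \<le> (- a / c) * a + (- a / c)\<^sup>2 * b" by (rule assms)
  also have "\<dots> < (- a / c) * a + (- a / c)\<^sup>2 * c"
    using c \<open>a \<noteq> 0\<close> by (intro add_strict_left_mono mult_strict_left_mono) auto
  also have "\<dots> = 0" using c by (simp add: field_simps power2_eq_square)
  finally show False by simp
qed

text \<open>Direct method: \<open>J\<close> below is bounded from below on V, the parallelogram law
  makes a minimizing sequence Cauchy, and the first variation at the minimizer is the
  representation. Linearity and boundedness are asked for on V only, since functionals such as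
  \<open>\<phi> (dec x)\<close> have them only there.\<close>

theorem riesz_closed_subspace:
  fixes V :: "'v::{real_inner, complete_space} set"
  assumes V: "subspace V" "closed V"
    and add: "\<And>x y. x \<in> V \<Longrightarrow> y \<in> V \<Longrightarrow> \<phi> (x + y) = \<phi> x + \<phi> y"
    and scale: "\<And>c x. x \<in> V \<Longrightarrow> \<phi> (c *\<^sub>R x) = c * \<phi> x"
    and bound: "\<And>x. x \<in> V \<Longrightarrow> \<bar>\<phi> x\<bar> \<le> C * norm x"
  shows "\<exists>z\<in>V. \<forall>x\<in>V. \<phi> x = z \<bullet> x"
proof -
  define J where "J x = (norm x)\<^sup>2 / 2 - \<phi> x" for x
  have J_lower: "- (C\<^sup>2 / 2) \<le> J x" if "x \<in> V" for x
  proof -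
    have "\<phi> x \<le> C * norm x" using bound[OF that] by auto
    also have "\<dots> \<le> C\<^sup>2 / 2 + (norm x)\<^sup>2 / 2" using sum_squares_bound[of C "norm x"] by simp
    finally show ?thesis by (simp add: J_def)
  qed
  have "0 \<in> V" using V(1) by (rule subspace_0)
  then have ne: "J ` V \<noteq> {}" by auto
  define m where "m = Inf (J ` V)"
  have bdd: "bdd_below (J ` V)" using J_lower by (intro bdd_belowI2) auto
  have m_le: "m \<le> J x" if "x \<in> V" for x
    unfolding m_def using that by (intro cInf_lower bdd) auto
  have "\<exists>x\<in>V. J x < m + inverse (real (Suc n))" for n
    using cInf_lessD[OF ne, of "m + inverse (real (Suc n))"] by (auto simp: m_def)
  then obtain x where x: "\<And>n. x n \<in> V" "\<And>n. J (x n) < m + inverse (real (Suc n))" by metis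
  \<comment> \<open>Parallelogram law; the midpoint lies in V, so \<open>J\<close> is at least m
    there.\<close>
  have par: "(norm (a - b))\<^sup>2 \<le> 4 * (J a + J b - 2 * m)" if "a \<in> V" "b \<in> V" for a b
  proof -
    have ab: "(1/2) *\<^sub>R (a + b) \<in> V" "a + b \<in> V" using that V(1) by (auto intro: subspace_add subspace_scale)
    have "J ((1/2) *\<^sub>R (a + b)) = (norm (a + b))\<^sup>2 / 8 - (\<phi> a + \<phi> b) / 2"
      using that ab by (simp add: J_def scale add power2_eq_square)
    moreover have "(norm (a - b))\<^sup>2 = 2 * (norm a)\<^sup>2 + 2 * (norm b)\<^sup>2 - (norm (a + b))\<^sup>2"
      by (simp add: power2_norm_eq_inner inner_add_left inner_add_right inner_diff_left inner_diff_right inner_commute)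
    ultimately show ?thesis using m_le[OF ab(1)] unfolding J_def by (simp add: field_simps)
  qed
  have "Cauchy x"
  proof (rule metric_CauchyI)
    fix e :: real assume "e > 0"
    then obtain N where N: "inverse (real (Suc N)) < e\<^sup>2 / 8"
      using reals_Archimedean[of "e\<^sup>2 / 8"] by auto
    show "\<exists>M. \<forall>m\<ge>M. \<forall>n\<ge>M. dist (x m) (x n) < e"
    proof (intro exI allI impI)
      fix k n assume "N \<le> k" "N \<le> n"
      then have "inverse (real (Suc k)) \<le> inverse (real (Suc N))" "inverse (real (Suc n)) \<le> inverse (real (Suc N))"
        by (auto intro!: le_imp_inverse_le)
      then have "(norm (x k - x n))\<^sup>2 < e\<^sup>2"
      proof -
        have "P < d" if "P \<le> 4 * (a + b - 2 * m)" "a < m + i" "b < m + j" "i \<le> c" "j \<le> c" "c < d / 8"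
          for P a b i j c d m :: real
          using that by simp
        from this[OF par[OF x(1) x(1), of k n] x(2)[of k] x(2)[of n] _ _ N] show ?thesis
          using \<open>inverse (real (Suc k)) \<le> _\<close> \<open>inverse (real (Suc n)) \<le> _\<close> by blast
      qed
      then show "dist (x k) (x n) < e"
        using \<open>e > 0\<close> by (simp add: dist_norm power_less_imp_less_base)
    qed
  qed
  then obtain z where z: "x \<longlonglongrightarrow> z" using Cauchy_convergent convergent_def by blast
  then have zV: "z \<in> V" using closed_sequentially[OF V(2)] x(1) by blast
  have minus: "\<phi> (a - b) = \<phi> a - \<phi> b" if "a \<in> V" "b \<in> V" for a b
    using add[of a "(-1) *\<^sub>R b"] scale[of b "-1"] that V(1) by (simp add: subspace_neg)
  have "(\<lambda>n. \<phi> (x n)) \<longlonglongrightarrow> \<phi> z"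
  proof (rule LIM_zero_cancel, rule Lim_null_comparison)
    show "\<forall>\<^sub>F n in sequentially. norm (\<phi> (x n) - \<phi> z) \<le> C * norm (x n - z)"
    proof (rule always_eventually, rule allI)
      fix n
      have "\<bar>\<phi> (x n - z)\<bar> \<le> C * norm (x n - z)"
        by (rule bound) (rule subspace_diff[OF V(1) x(1) zV])
      then show "norm (\<phi> (x n) - \<phi> z) \<le> C * norm (x n - z)"
        by (simp add: minus[OF x(1) zV])
    qed
    have "(\<lambda>n. C * norm (x n - z)) \<longlonglongrightarrow> C * norm (z - z)"
      by (intro tendsto_intros z)
    then show "(\<lambda>n. C * norm (x n - z)) \<longlonglongrightarrow> 0" by simp
  qed
  then have "(\<lambda>n. J (x n)) \<longlonglongrightarrow> J z" unfolding J_def by (intro tendsto_intros z) simp_all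
  moreover have "(\<lambda>n. m + inverse (real (Suc n))) \<longlonglongrightarrow> m + 0"
    by (intro tendsto_intros LIMSEQ_inverse_real_of_nat)
  ultimately have "J z \<le> m + 0" by (rule LIMSEQ_le) (use x(2) in \<open>auto intro: less_imp_le\<close>)
  then have Jz: "J z \<le> m" by simp
  have "\<phi> y = z \<bullet> y" if y: "y \<in> V" for y
  proof -
    have "0 \<le> t * (z \<bullet> y - \<phi> y) + t\<^sup>2 * ((norm y)\<^sup>2 / 2)" for t
    proof -
      have ty: "t *\<^sub>R y \<in> V" "z + t *\<^sub>R y \<in> V" using y zV V(1) by (auto intro: subspace_add subspace_scale)
      have "J z \<le> J (z + t *\<^sub>R y)" using Jz m_le[OF ty(2)] by simp
      also have "J (z + t *\<^sub>R y) = J z + t * (z \<bullet> y - \<phi> y) + t\<^sup>2 * ((norm y)\<^sup>2 / 2)"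
      proof -
        have "(norm (z + t *\<^sub>R y))\<^sup>2 = (norm z)\<^sup>2 + 2 * t * (z \<bullet> y) + t\<^sup>2 * (norm y)\<^sup>2"
          by (simp only: power2_norm_eq_inner inner_add_left inner_add_right inner_scaleR_left
              inner_scaleR_right inner_commute[of y z]) (simp add: algebra_simps power2_eq_square)
        then show ?thesis
          using y zV ty by (simp add: J_def add scale algebra_simps add_divide_distrib)
      qed
      finally show ?thesis by simp
    qed
    from quadratic_nonneg_linear_zero[OF this] show ?thesis by simp
  qed
  then show ?thesis using zV by auto
qed

definition orth_proj :: "'v::real_inner set \<Rightarrow> 'v \<Rightarrow> 'v" where
  "orth_proj V x = (SOME z. z \<in> V \<and> (\<forall>y\<in>V. z \<bullet> y = x \<bullet> y))"

context
  fixes V :: "'v::{real_inner, complete_space} set"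
  assumes V: "subspace V" "closed V"
begin

lemma orth_proj: "orth_proj V x \<in> V" "y \<in> V \<Longrightarrow> orth_proj V x \<bullet> y = x \<bullet> y"
proof -
  have "\<exists>z\<in>V. \<forall>y\<in>V. x \<bullet> y = z \<bullet> y"
    by (rule riesz_closed_subspace[OF V, where C = "norm x"])
      (auto simp: inner_add_right Cauchy_Schwarz_ineq2)
  then have "\<exists>z. z \<in> V \<and> (\<forall>y\<in>V. z \<bullet> y = x \<bullet> y)" by auto
  from someI_ex[OF this] show "orth_proj V x \<in> V" "y \<in> V \<Longrightarrow> orth_proj V x \<bullet> y = x \<bullet> y"
    by (auto simp: orth_proj_def)
qed

lemma orth_proj_unique:
  assumes "z \<in> V" "\<And>y. y \<in> V \<Longrightarrow> z \<bullet> y = x \<bullet> y"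
  shows "orth_proj V x = z"
proof -
  have "orth_proj V x - z \<in> V" using assms orth_proj V by (simp add: subspace_diff)
  then have "(orth_proj V x - z) \<bullet> (orth_proj V x - z) = 0"
    using assms(2)[of "orth_proj V x - z"] orth_proj(2)[of "orth_proj V x - z" x] by (simp add: inner_diff_left)
  then show ?thesis by simp
qed

lemma orth_proj_id: "x \<in> V \<Longrightarrow> orth_proj V x = x"
  by (rule orth_proj_unique) auto

lemma orth_proj_norm_le: "norm (orth_proj V x) \<le> norm x"
proof -
  have "norm (orth_proj V x) * norm (orth_proj V x) = x \<bullet> orth_proj V x"
    using orth_proj(2)[OF orth_proj(1), of x x] by (simp add: power2_norm_eq_inner flip: power2_eq_square)
  also have "\<dots> \<le> norm x * norm (orth_proj V x)" by (rule norm_cauchy_schwarz)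
  finally show ?thesis by (cases "norm (orth_proj V x) = 0") auto
qed

lemma bounded_linear_orth_proj: "bounded_linear (orth_proj V)"
proof (rule bounded_linear_intro)
  show "orth_proj V (x + y) = orth_proj V x + orth_proj V y" for x y
    using V orth_proj by (intro orth_proj_unique) (auto simp: subspace_add inner_add_left)
  show "orth_proj V (c *\<^sub>R x) = c *\<^sub>R orth_proj V x" for c x
    using V orth_proj by (intro orth_proj_unique) (auto simp: subspace_scale)
  show "norm (orth_proj V x) \<le> norm x * 1" for x
    using orth_proj_norm_le by simp
qed

end

subsection \<open>Test functions and their derivatives\<close>

text \<open>Off K the function vanishes on an open set, hence so do its derivatives: the support
  does not grow.\<close>

lemma test_functions_frechet:
  assumes \<phi>: "\<phi> \<in> test_functions S" and b: "b \<in> Basis"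
  shows "(\<lambda>x. frechet_derivative \<phi> (at x) b) \<in> test_functions S"
proof -
  obtain K where K: "compact K" "K \<subseteq> S" "\<And>x. x \<notin> K \<Longrightarrow> \<phi> x = 0"
    using \<phi> by (auto simp: test_functions_def)
  have "frechet_derivative \<phi> (at x) b = 0" if "x \<notin> K" for x
  proof -
    have "((\<lambda>x. 0) has_derivative (\<lambda>h. 0)) (at x)" by simp
    then have "(\<phi> has_derivative (\<lambda>h. 0)) (at x)"
      by (rule has_derivative_transform_within_open[of _ _ _ _ "- K"])
        (use K that in \<open>auto simp: compact_imp_closed\<close>)
    then show ?thesis using frechet_derivative_at[of \<phi> "\<lambda>h. 0" x] by metis
  qed
  moreover have "C_k k (\<lambda>x. frechet_derivative \<phi> (at x) b)" for k
    using test_functions_Ck[OF \<phi>, of "Suc k"] b by simp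
  ultimately show ?thesis using K(1,2) by (auto simp: test_functions_def)
qed

lemma test_functions_has_derivative:
  "\<phi> \<in> test_functions S \<Longrightarrow> (\<phi> has_derivative frechet_derivative \<phi> (at x)) (at x)"
  by (rule C_k_Suc_has_derivative[of 0]) (rule test_functions_Ck)

lemma test_functions_deriv_eq:
  fixes \<eta> :: "real \<Rightarrow> real"
  assumes "\<eta> \<in> test_functions S"
  shows "deriv \<eta> x = frechet_derivative \<eta> (at x) 1" "(\<eta> has_real_derivative deriv \<eta> x) (at x)"
proof -
  have lin: "frechet_derivative \<eta> (at x) h = frechet_derivative \<eta> (at x) 1 * h" for h
    using linear_scale[OF has_derivative_linear[OF test_functions_has_derivative[OF assms]], of _ h 1] by simp
  have "(\<eta> has_derivative (\<lambda>h. frechet_derivative \<eta> (at x) 1 * h)) (at x)"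
    using test_functions_has_derivative[OF assms, of x] by (subst (asm) lin[abs_def]) 
  then have "(\<eta> has_real_derivative frechet_derivative \<eta> (at x) 1) (at x)"
    by (simp add: has_field_derivative_def)
  then show "deriv \<eta> x = frechet_derivative \<eta> (at x) 1" "(\<eta> has_real_derivative deriv \<eta> x) (at x)"
    using DERIV_imp_deriv by metis+
qed

lemma test_functions_deriv:
  fixes \<eta> :: "real \<Rightarrow> real"
  assumes "\<eta> \<in> test_functions S" shows "deriv \<eta> \<in> test_functions S"
proof -
  have "deriv \<eta> = (\<lambda>x. frechet_derivative \<eta> (at x) 1)"
    using test_functions_deriv_eq(1)[OF assms] by blast
  then show ?thesis using test_functions_frechet[OF assms, of 1] by simp
qed

subsection \<open>Indefinite integrals on a bounded interval\<close>

abbreviation time_measure :: "real \<Rightarrow> real measure" where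
  "time_measure T \<equiv> lebesgue_on {0<..<T}"

text \<open>Since the measure lives on (0,T), this is a function on the whole line, 0 for t \<le> 0
  and constant for t \<ge> T, and it is continuous everywhere.\<close>

definition cumul :: "real \<Rightarrow> (real \<Rightarrow> real) \<Rightarrow> real \<Rightarrow> real" where
  "cumul T h t = (\<integral>r. indicator {..t} r * h r \<partial>time_measure T)"

lemma time_measure_borel: "f \<in> borel_measurable borel \<Longrightarrow> f \<in> borel_measurable (time_measure T)"
  by (rule borel_measurable_lebesgue_onI)

lemma finite_time_measure: "finite_measure (time_measure T)"
  by (rule finite_measure_lebesgue_on) simp

lemma integrable_time_const [simp]: "integrable (time_measure T) (\<lambda>t. c :: real)"
proof -
  interpret finite_measure "time_measure T" by (rule finite_time_measure)
  show ?thesis by simp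
qed

lemma integrable_indicator_mult:
  fixes h :: "real \<Rightarrow> real"
  assumes "integrable (time_measure T) h" "A \<in> sets borel"
  shows "integrable (time_measure T) (\<lambda>r. indicator A r * h r)"
  by (rule integrable_mult_bounded(2)[OF assms(1), of _ 1])
    (use assms(2) in \<open>auto intro!: time_measure_borel simp: indicator_def\<close>)

lemma AE_time_neq: "AE r in time_measure T. r \<noteq> t"
proof -
  have "AE r in lebesgue. r \<noteq> t"
    by (rule AE_I'[of "{t}"]) auto
  then show ?thesis
    by (subst AE_restrict_space_iff) (auto elim: eventually_mono)
qed

lemma AE_time_space: "AE r in time_measure T. 0 < r \<and> r < T"
  using AE_space[of "time_measure T"] by (auto elim: eventually_mono)

section \<open>Increments and limits of indefinite integrals\<close>

lemma cumul_diff: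
  assumes h: "integrable (time_measure T) h" and "s \<le> t"
  shows "cumul T h t - cumul T h s = (\<integral>r. indicator {s<..t} r * h r \<partial>time_measure T)"
proof -
  have "(\<integral>r. indicator {s<..t} r * h r \<partial>time_measure T)
    = (\<integral>r. indicator {..t} r * h r - indicator {..s} r * h r \<partial>time_measure T)"
    using assms(2) by (intro Bochner_Integration.integral_cong) (auto simp: indicator_def)
  then show ?thesis
    using h by (simp add: cumul_def integrable_indicator_mult)
qed

lemma cumul_0 [simp]: "cumul T h 0 = 0"
proof -
  have "cumul T h 0 = (\<integral>r. 0 \<partial>time_measure T)"
    unfolding cumul_def by (intro Bochner_Integration.integral_cong) (auto simp: indicator_def)
  then show ?thesis by simp
qed

lemma cumul_T: "cumul T h T = (\<integral>r. h r \<partial>time_measure T)"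
  unfolding cumul_def by (intro Bochner_Integration.integral_cong) (auto simp: indicator_def)

lemma cumul_lincomb:
  assumes "integrable (time_measure T) h" "integrable (time_measure T) k"
  shows "cumul T (\<lambda>r. a * h r + b * k r) t = a * cumul T h t + b * cumul T k t"
proof -
  have "cumul T (\<lambda>r. a * h r + b * k r) t
      = (\<integral>r. a * (indicator {..t} r * h r) + b * (indicator {..t} r * k r) \<partial>time_measure T)"
    unfolding cumul_def by (intro Bochner_Integration.integral_cong) (auto simp: algebra_simps)
  then show ?thesis
    using assms by (simp add: cumul_def integrable_indicator_mult)
qed

text \<open>The comparison behind the estimates below: increments are measured against those of a
  majorant, and the pointwise inequality is asked for only between s and t.\<close>

lemma cumul_bound:
  assumes h: "integrable (time_measure T) h" and k: "integrable (time_measure T) k" and st: "s \<le> t"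
    and le: "AE r in time_measure T. s < r \<longrightarrow> r \<le> t \<longrightarrow> \<bar>h r\<bar> \<le> k r"
  shows "\<bar>cumul T h t - cumul T h s\<bar> \<le> cumul T k t - cumul T k s"
  unfolding cumul_diff[OF h st] cumul_diff[OF k st]
proof -
  have "\<bar>\<integral>r. indicator {s<..t} r * h r \<partial>time_measure T\<bar>
      \<le> (\<integral>r. \<bar>indicator {s<..t} r * h r\<bar> \<partial>time_measure T)"
    by (rule integral_abs_bound)
  also have "\<dots> \<le> (\<integral>r. indicator {s<..t} r * k r \<partial>time_measure T)"
  proof (rule integral_mono_AE)
    show "AE r in time_measure T. \<bar>indicator {s<..t} r * h r\<bar> \<le> indicator {s<..t} r * k r"
      using le by eventually_elim (auto simp: indicator_def)
  qed (use h k in \<open>auto intro!: integrable_indicator_mult integrable_abs\<close>)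
  finally show "\<bar>\<integral>r. indicator {s<..t} r * h r \<partial>time_measure T\<bar>
      \<le> (\<integral>r. indicator {s<..t} r * k r \<partial>time_measure T)" .
qed

lemma cumul_mono:
  assumes "integrable (time_measure T) h" "AE r in time_measure T. 0 \<le> h r" "s \<le> t"
  shows "cumul T h s \<le> cumul T h t"
proof -
  have "0 \<le> (\<integral>r. indicator {s<..t} r * h r \<partial>time_measure T)"
    by (rule integral_nonneg_AE) (use assms(2) in \<open>auto elim: eventually_mono\<close>)
  then show ?thesis using cumul_diff[OF assms(1,3)] by simp
qed

lemma continuous_cumul:
  assumes h: "integrable (time_measure T) h"
  shows "continuous_on UNIV (cumul T h)"
proof (rule continuous_at_imp_continuous_on, rule ballI)
  fix t
  show "isCont (cumul T h) t"
  proof (rule continuous_at_sequentiallyI)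
    fix u assume u: "u \<longlonglongrightarrow> t"
    have "(\<lambda>n. \<integral>r. indicator {..u n} r * h r \<partial>time_measure T) \<longlonglongrightarrow> (\<integral>r. indicator {..t} r * h r \<partial>time_measure T)"
    proof (rule integral_dominated_convergence[where w = "\<lambda>r. \<bar>h r\<bar>"])
      show "AE r in time_measure T. (\<lambda>n. indicator {..u n} r * h r) \<longlonglongrightarrow> indicator {..t} r * h r"
        \<comment> \<open>Away from the single time r = t the indicators are eventually
          constant.\<close>
        using AE_time_neq[of t T]
      proof eventually_elim
        case (elim r)
        have "\<forall>\<^sub>F n in sequentially. indicator {..u n} r * h r = indicator {..t} r * h r"
        proof (cases "r < t")
          case True
          then have "\<forall>\<^sub>F n in sequentially. r < u n" using u by (simp add: order_tendsto_iff)
          then show ?thesis by eventually_elim (use True in \<open>auto simp: indicator_def\<close>)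
        next
          case False
          then have "\<forall>\<^sub>F n in sequentially. u n < r" using u elim by (simp add: order_tendsto_iff)
          then show ?thesis by eventually_elim (use False elim in \<open>auto simp: indicator_def\<close>)
        qed
        then show ?case by (rule tendsto_eventually)
      qed
      show "AE r in time_measure T. norm (indicator {..u n} r * h r) \<le> \<bar>h r\<bar>" for n
        by (auto simp: indicator_def)
    qed (use h in \<open>auto intro!: borel_measurable_integrable integrable_indicator_mult integrable_abs\<close>)
    then show "(\<lambda>n. cumul T h (u n)) \<longlonglongrightarrow> cumul T h t" by (simp add: cumul_def)
  qed
qed

lemma cumul_dominated_convergence:
  assumes "integrable (time_measure T) w" "\<And>n. integrable (time_measure T) (h n)" "integrable (time_measure T) k"
    "AE r in time_measure T. (\<lambda>n. h n r) \<longlonglongrightarrow> k r" "\<And>n. AE r in time_measure T. \<bar>h n r\<bar> \<le> w r"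
  shows "(\<lambda>n. cumul T (h n) t) \<longlonglongrightarrow> cumul T k t"
  unfolding cumul_def
proof (rule integral_dominated_convergence[where w = w])
  show "AE r in time_measure T. (\<lambda>n. indicator {..t} r * h n r) \<longlonglongrightarrow> indicator {..t} r * k r"
    using assms(4) by eventually_elim (intro tendsto_intros)
  show "AE r in time_measure T. norm (indicator {..t} r * h n r) \<le> w r" for n
    using assms(5)[of n] by eventually_elim (auto simp: indicator_def)
qed (use assms in \<open>auto intro!: borel_measurable_integrable integrable_indicator_mult\<close>)

section \<open>Density of sets of full measure\<close>

lemma AE_time_dense:
  assumes G: "AE t in time_measure T. t \<in> G" and "0 \<le> a" "a < b" "b \<le> T"
  shows "\<exists>t\<in>G. a < t \<and> t < b"
proof (rule ccontr)
  assume no: "\<not> ?thesis"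
  have "AE t in lebesgue. t \<in> {0<..<T} \<longrightarrow> t \<in> G"
    using G by (subst (asm) AE_restrict_space_iff) auto
  then have "AE t in lebesgue. t \<notin> {a<..<b}"
    by eventually_elim (use no assms in auto)
  then have "negligible {t. \<not> t \<notin> {a<..<b}}"
    by (simp only: completion.AE_iff_null_sets negligible_iff_null_sets) simp
  moreover have "{t. \<not> t \<notin> {a<..<b}} = {a<..<b}" by auto
  ultimately show False
    using open_not_negligible[of "{a<..<b}"] \<open>a < b\<close> by auto
qed

lemma closure_AE_time:
  assumes G: "AE t in time_measure T. t \<in> G" and sub: "G \<subseteq> {0..T}" and T: "T > 0"
  shows "closure G = {0..T}"
proof
  show "closure G \<subseteq> {0..T}" using sub by (intro closure_minimal) auto
  show "{0..T} \<subseteq> closure G"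
  proof
    fix x assume x: "x \<in> {0..T}"
    show "x \<in> closure G"
      unfolding closure_approachable
    proof (intro allI impI)
      fix e :: real assume e: "e > 0"
      obtain a b where ab: "0 \<le> a" "a < b" "b \<le> T" "x - e < a" "b < x + e"
      proof (cases "x < T")
        case True
        show ?thesis by (rule that[of x "min T (x + e/2)"]) (use True x e in auto)
      next
        case False
        show ?thesis by (rule that[of "max 0 (x - e/2)" x]) (use False x e T in auto)
      qed
      obtain t where "t \<in> G" "a < t" "t < b" using AE_time_dense[OF G ab(1-3)] by auto
      then show "\<exists>y\<in>G. dist y x < e"
        by (intro bexI[of _ t]) (use ab in \<open>auto simp: dist_real_def\<close>)
    qed
  qed
qed

text \<open>Sum over a partition of \<open>[m a, m b]\<close> into \<open>n\<close> equal parts, whose points are only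
  approximated within \<open>m ` G\<close>; the sum is \<open>O(1/n)\<close>.\<close>
lemma quadratic_increment_const:
  fixes F m :: "real \<Rightarrow> real"
  assumes m: "continuous_on UNIV m" and ab: "a \<in> G" "b \<in> G" "a \<le> b" "m a \<le> m b"
    and dense: "{a..b} \<subseteq> closure G"
    and quad: "\<And>s t. s \<in> G \<Longrightarrow> t \<in> G \<Longrightarrow> \<bar>F t - F s\<bar> \<le> C * (m t - m s)\<^sup>2"
  shows "F a = F b"
proof (cases "m a = m b")
  case True
  then show ?thesis using quad[OF ab(1,2)] by simp
next
  case False
  define L where "L = m b - m a"
  have L: "L > 0" using False ab by (simp add: L_def)
  have C0: "C \<ge> 0"
  proof -
    have "0 \<le> C * L\<^sup>2" using quad[OF ab(1,2)] by (simp add: L_def)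
    then show ?thesis using L by (simp add: zero_le_mult_iff)
  qed
  have step: "\<bar>F b - F a\<bar> \<le> 9 * C * L\<^sup>2 / real n" if n: "n > 0" for n
  proof -
    \<comment> \<open>The partition is equidistant in the values of m, not in time, so that all
      pieces have the same increment; the intermediate value theorem finds times for the
      \<open>y i\<close>, and density moves them into G.\<close>
    define y where "y i = m a + real i * (L / real n)" for i
    have ex: "\<exists>x\<in>G. \<bar>m x - y i\<bar> \<le> L / n" if "i \<le> n" for i
    proof -
      have "real i * (L / n) \<le> real n * (L / n)" using that L by (intro mult_right_mono) auto
      then have "m a \<le> y i" "y i \<le> m b" using L n by (auto simp: y_def L_def)
      then obtain x where x: "a \<le> x" "x \<le> b" "m x = y i"
        using IVT'[of m a "y i" b] ab(3) m by (auto intro: continuous_on_subset)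
      then have "x \<in> closure G" using dense by auto
      have "isCont m x" using m by (simp add: continuous_on_eq_continuous_at)
      then obtain d where d: "d > 0" "\<And>x'. dist x' x < d \<Longrightarrow> dist (m x') (m x) < L / n"
        unfolding continuous_at_eps_delta using L n by (metis divide_pos_pos of_nat_0_less_iff)
      obtain x' where "x' \<in> G" "dist x' x < d"
        using \<open>x \<in> closure G\<close> d(1) by (auto simp: closure_approachable)
      then show ?thesis using d(2)[of x'] x(3) by (intro bexI[of _ x']) (auto simp: dist_real_def)
    qed
    then obtain \<sigma> where \<sigma>: "\<And>i. i \<le> n \<Longrightarrow> \<sigma> i \<in> G" "\<And>i. i \<le> n \<Longrightarrow> \<bar>m (\<sigma> i) - y i\<bar> \<le> L / n" by metis
    \<comment> \<open>The end points are kept exact so that the sum telescopes to F b - F a.\<close>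
    define \<tau> where "\<tau> i = (if i = 0 then a else if i = n then b else \<sigma> i)" for i
    have \<tau>: "\<tau> i \<in> G" "\<bar>m (\<tau> i) - y i\<bar> \<le> L / n" if "i \<le> n" for i
      using \<sigma>[OF that] ab L n by (auto simp: \<tau>_def y_def L_def)
    \<comment> \<open>The gap L/n plus an approximation error of at most L/n at either end.\<close>
    have inc: "\<bar>F (\<tau> (Suc i)) - F (\<tau> i)\<bar> \<le> C * (3 * L / n)\<^sup>2" if "i < n" for i
    proof -
      have "y (Suc i) - y i = L / n" by (simp add: y_def algebra_simps add_divide_distrib)
      then have "\<bar>m (\<tau> (Suc i)) - m (\<tau> i)\<bar> \<le> 3 * L / n"
        using \<tau>(2)[of i] \<tau>(2)[of "Suc i"] that by auto
      then have "(m (\<tau> (Suc i)) - m (\<tau> i))\<^sup>2 \<le> (3 * L / n)\<^sup>2"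
        by (metis abs_ge_zero power2_abs power_mono)
      then have "C * (m (\<tau> (Suc i)) - m (\<tau> i))\<^sup>2 \<le> C * (3 * L / n)\<^sup>2" using C0 by (rule mult_left_mono)
      then show ?thesis using quad[OF \<tau>(1)[of i] \<tau>(1)[of "Suc i"]] that by auto
    qed
    have "F b - F a = (\<Sum>i<n. F (\<tau> (Suc i)) - F (\<tau> i))"
      using sum_lessThan_telescope[of "\<lambda>i. F (\<tau> i)" n] n by (simp add: \<tau>_def)
    then have "\<bar>F b - F a\<bar> \<le> (\<Sum>i<n. \<bar>F (\<tau> (Suc i)) - F (\<tau> i)\<bar>)" by (simp only: sum_abs)
    also have "\<dots> \<le> (\<Sum>i<n. C * (3 * L / n)\<^sup>2)" using inc by (intro sum_mono) auto
    also have "\<dots> = 9 * C * L\<^sup>2 / n" using n by (simp add: power2_eq_square field_simps)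
    finally show ?thesis .
  qed
  have "(\<lambda>n. 9 * C * L\<^sup>2 * inverse (real (Suc n))) \<longlonglongrightarrow> 9 * C * L\<^sup>2 * 0"
    by (intro tendsto_intros LIMSEQ_inverse_real_of_nat)
  then have "(\<lambda>n. 9 * C * L\<^sup>2 * inverse (real (Suc n))) \<longlonglongrightarrow> 0" by simp
  then have "\<bar>F b - F a\<bar> \<le> 0"
  proof (rule LIMSEQ_le_const, intro exI allI impI)
    fix n :: nat
    show "\<bar>F b - F a\<bar> \<le> 9 * C * L\<^sup>2 * inverse (real (Suc n))"
      using step[of "Suc n"] by (simp add: divide_inverse)
  qed
  then show ?thesis by simp
qed

lemma cumul_FTC:
  assumes "\<And>x. (\<eta> has_real_derivative \<eta>' x) (at x)" "continuous_on UNIV \<eta>'"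
    and st: "0 \<le> s" "s \<le> t" "t \<le> T"
  shows "(\<integral>r. indicator {s<..t} r * \<eta>' r \<partial>time_measure T) = \<eta> t - \<eta> s"
proof -
  have m: "\<eta>' \<in> borel_measurable borel" by (rule borel_measurable_continuous_onI) fact
  have "(\<integral>r. indicator {s<..t} r * \<eta>' r \<partial>time_measure T)
      = (\<integral>r. indicator {0<..<T} r * (indicator {s<..t} r * \<eta>' r) \<partial>lebesgue)"
    by (subst integral_restrict_space) auto
  also have "\<dots> = (\<integral>r. indicator {0<..<T} r * (indicator {s<..t} r * \<eta>' r) \<partial>lborel)"
    using m by (intro integral_completion) auto
  \<comment> \<open>The part of the half-open interval in (0,T) and the closed interval differ at
    most in the end points.\<close>
  also have "\<dots> = (\<integral>r. \<eta>' r * indicator {s..t} r \<partial>lborel)"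
  proof (rule integral_cong_AE)
    have "AE r in lborel. r \<noteq> s" "AE r in lborel. r \<noteq> t"
      by (rule AE_lborel_singleton)+
    then show "AE r in lborel. indicator {0<..<T} r * (indicator {s<..t} r * \<eta>' r) = \<eta>' r * indicator {s..t} r"
      by eventually_elim (use st in \<open>auto simp: indicator_def\<close>)
  qed (use m in auto)
  also have "\<dots> = \<eta> t - \<eta> s"
    using assms(1,2) st
    by (intro integral_FTC_Icc_real) (auto simp: has_field_derivative_at_within continuous_on_eq_continuous_at)
  finally show ?thesis .
qed

text \<open>For merely integrable h, pointwise differentiation of \<open>cumul T h\<close> is
  avoided: the defect \<open>F\<close> in the product rule has increments quadratic in those of m,
  so \<open>quadratic_increment_const\<close> makes it constant, and \<eta> vanishes at both
  ends.\<close>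

lemma cumul_integration_by_parts:
  assumes h: "integrable (time_measure T) h" and \<eta>: "\<eta> \<in> test_functions {0<..<T}" and T: "T > 0"
  shows "(\<integral>r. deriv \<eta> r * cumul T h r \<partial>time_measure T) = - (\<integral>r. \<eta> r * h r \<partial>time_measure T)"
proof -
  let ?M = "time_measure T"
  let ?P = "cumul T h"
  obtain B where B: "B > 0" "\<And>x. \<bar>deriv \<eta> x\<bar> \<le> B"
    using test_functions_bounded[OF test_functions_deriv[OF \<eta>]] by auto
  obtain B1 where B1: "B1 > 0" "\<And>x. \<bar>\<eta> x\<bar> \<le> B1"
    using test_functions_bounded[OF \<eta>] by auto
  have dm: "deriv \<eta> \<in> borel_measurable ?M" by (rule test_functions_borel[OF test_functions_deriv[OF \<eta>]])
  have Pc: "continuous_on UNIV ?P" by (rule continuous_cumul[OF h])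
  \<comment> \<open>The summand 1 dominates increments of \<eta> up to the factor B, and |h| those
    of \<open>?P\<close>; so m controls both.\<close>
  define k where "k r = 1 + \<bar>h r\<bar>" for r
  have k: "integrable ?M k" unfolding k_def[abs_def] using h by auto
  define m where "m = cumul T k"
  have m_mono: "m s \<le> m t" if "s \<le> t" for s t
    unfolding m_def by (rule cumul_mono[OF k _ that]) (auto simp: k_def)
  have P_bound: "\<bar>?P t - ?P s\<bar> \<le> m t - m s" if "s \<le> t" for s t
    unfolding m_def by (rule cumul_bound[OF h k that]) (auto simp: k_def)
  have dP: "integrable ?M (\<lambda>r. deriv \<eta> r * ?P r)"
  proof -
    have "bounded (?P ` {0..T})"
      by (intro compact_imp_bounded compact_continuous_image continuous_on_subset[OF Pc]) auto
    then obtain D where D: "\<forall>x\<in>{0..T}. \<bar>?P x\<bar> \<le> D" by (auto simp: bounded_iff)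
    have d: "integrable ?M (deriv \<eta>)"
      by (rule Bochner_Integration.integrable_bound[where f = "\<lambda>x. B"]) (use dm B in auto)
    show ?thesis
      by (rule integrable_mult_bounded(1)[OF d continuous_borel_lebesgue_on[OF Pc], of D]) (use D in auto)
  qed
  have \<eta>h: "integrable ?M (\<lambda>r. \<eta> r * h r)"
    by (rule integrable_mult_bounded(2)[OF h test_functions_borel[OF \<eta>] B1(2)])
  have FTC: "(\<integral>r. indicator {s<..t} r * deriv \<eta> r \<partial>?M) = \<eta> t - \<eta> s" if "0 \<le> s" "s \<le> t" "t \<le> T" for s t
    by (rule cumul_FTC) (use that \<eta> in \<open>auto intro: test_functions_deriv_eq test_functions_continuous test_functions_deriv\<close>)
  have d: "integrable ?M (deriv \<eta>)"
    by (rule Bochner_Integration.integrable_bound[where f = "\<lambda>x. B"]) (use dm B in auto)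
  define F where "F t = \<eta> t * ?P t - cumul T (\<lambda>r. deriv \<eta> r * ?P r + \<eta> r * h r) t" for t
  have lip: "\<bar>\<eta> r - \<eta> s\<bar> \<le> B * (m t - m s)" if "0 \<le> s" "s \<le> r" "r \<le> t" "t \<le> T" for r s t
  proof -
    have "\<eta> r - \<eta> s = cumul T (deriv \<eta>) r - cumul T (deriv \<eta>) s"
      using FTC[of s r] that by (simp add: cumul_diff[OF d])
    also have "\<bar>\<dots>\<bar> \<le> cumul T (\<lambda>r. B * k r + 0 * k r) r - cumul T (\<lambda>r. B * k r + 0 * k r) s"
    proof (rule cumul_bound[OF d])
      have "B \<le> B * k r" for r using B by (simp add: k_def)
      then show "AE r' in ?M. s < r' \<longrightarrow> r' \<le> r \<longrightarrow> \<bar>deriv \<eta> r'\<bar> \<le> B * k r' + 0 * k r'"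
        using B(2) order_trans by (intro AE_I2) fastforce
    qed (use k that in auto)
    also have "\<dots> = B * (m r - m s)"
      unfolding cumul_lincomb[OF k k] by (simp add: m_def algebra_simps)
    also have "\<dots> \<le> B * (m t - m s)" using m_mono[of r t] that B by simp
    finally show ?thesis .
  qed
  have quad: "\<bar>F t - F s\<bar> \<le> B * (m t - m s)\<^sup>2" if st: "0 \<le> s" "s \<le> t" "t \<le> T" for s t
  proof -
    define q where "q r = deriv \<eta> r * ?P r + \<eta> r * h r" for r
    have q: "integrable ?M q" unfolding q_def[abs_def] using dP \<eta>h by simp
    \<comment> \<open>Freezing \<open>?P\<close> at t and \<eta> at s makes the discrete product
      rule exact: the increment of \<eta> times \<open>?P\<close> is the integral of p. The
      difference p - q then carries one more small factor.\<close>
    define p where "p r = ?P t * deriv \<eta> r + \<eta> s * h r" for r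
    have p: "integrable ?M p" unfolding p_def[abs_def] using d h by simp
    have pq: "integrable ?M (\<lambda>r. 1 * p r + (-1) * q r)" using p q by simp
    have "\<eta> t * ?P t - \<eta> s * ?P s = ?P t * (\<eta> t - \<eta> s) + \<eta> s * (?P t - ?P s)"
      by (simp add: algebra_simps)
    also have "\<dots> = cumul T p t - cumul T p s"
    proof -
      have "cumul T (deriv \<eta>) t - cumul T (deriv \<eta>) s = \<eta> t - \<eta> s"
        using FTC[OF st] cumul_diff[OF d st(2)] by simp
      moreover have "cumul T p t - cumul T p s
          = ?P t * (cumul T (deriv \<eta>) t - cumul T (deriv \<eta>) s) + \<eta> s * (?P t - ?P s)"
        unfolding p_def cumul_lincomb[OF d h] by (simp add: algebra_simps)
      ultimately show ?thesis by simp
    qed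
    finally have e1: "F t - F s = cumul T (\<lambda>r. 1 * p r + (-1) * q r) t - cumul T (\<lambda>r. 1 * p r + (-1) * q r) s"
      unfolding cumul_lincomb[OF p q] F_def q_def[symmetric] by (simp add: algebra_simps)
    have e2: "\<bar>F t - F s\<bar> \<le> cumul T (\<lambda>r. (B * (m t - m s)) * k r + 0 * k r) t - cumul T (\<lambda>r. (B * (m t - m s)) * k r + 0 * k r) s"
      unfolding e1
    proof (rule cumul_bound[OF pq _ st(2)])
      show "AE r in ?M. s < r \<longrightarrow> r \<le> t \<longrightarrow> \<bar>1 * p r + (-1) * q r\<bar> \<le> (B * (m t - m s)) * k r + 0 * k r"
      proof (intro AE_I2 impI)
        fix r assume r: "s < r" "r \<le> t"
        have "1 * p r + (-1) * q r = deriv \<eta> r * (?P t - ?P r) + (\<eta> s - \<eta> r) * h r"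
          by (simp add: p_def q_def algebra_simps)
        moreover have "\<bar>deriv \<eta> r * (?P t - ?P r)\<bar> \<le> B * (m t - m s)"
          unfolding abs_mult using B P_bound[OF r(2)] m_mono[of s r] r by (intro mult_mono) auto
        moreover have "\<bar>(\<eta> s - \<eta> r) * h r\<bar> \<le> (B * (m t - m s)) * \<bar>h r\<bar>"
          unfolding abs_mult using lip[of s r t] r st by (intro mult_right_mono) (auto simp: abs_minus_commute)
        ultimately show "\<bar>1 * p r + (-1) * q r\<bar> \<le> (B * (m t - m s)) * k r + 0 * k r"
          by (simp add: k_def algebra_simps)
      qed
    qed (use k in simp)
    show ?thesis
    proof -
      have *: "cumul T (\<lambda>r. c * k r + 0 * k r) x = c * m x" for c x
        unfolding cumul_lincomb[OF k k] by (simp add: m_def)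
      show ?thesis using e2 unfolding * power2_eq_square by (simp add: algebra_simps)
    qed
  qed
  have "F 0 = F T"
  proof (rule quadratic_increment_const[of m 0 "{0..T}" T F B])
    show "continuous_on UNIV m" unfolding m_def by (rule continuous_cumul[OF k])
    show "\<bar>F t - F s\<bar> \<le> B * (m t - m s)\<^sup>2" if "s \<in> {0..T}" "t \<in> {0..T}" for s t
      using quad[of s t] quad[of t s] that by (cases "s \<le> t") (auto simp: abs_minus_commute power2_commute)
  qed (use T m_mono in auto)
  moreover have "\<eta> 0 = 0" "\<eta> T = 0"
    using \<eta> by (auto simp: test_functions_def)
  ultimately have "cumul T (\<lambda>r. deriv \<eta> r * ?P r + \<eta> r * h r) T = 0" by (simp add: F_def)
  then show ?thesis using dP \<eta>h by (simp add: cumul_T)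
qed

text \<open>The zero mean is what makes the primitive vanish to the right of the support as
  well.\<close>

lemma test_function_primitive:
  assumes \<zeta>: "\<zeta> \<in> test_functions {0<..<T}" and T: "T > 0" and mean: "(\<integral>r. \<zeta> r \<partial>time_measure T) = 0"
  obtains \<eta> where "\<eta> \<in> test_functions {0<..<T}" "deriv \<eta> = \<zeta>"
proof -
  have cont: "continuous_on UNIV \<zeta>" by (rule test_functions_continuous[OF \<zeta>])
  obtain Z where "\<And>x. (Z has_vector_derivative \<zeta> x) (at x)"
    using einterval_antiderivative[of "-\<infinity>" "\<infinity>" \<zeta>] cont by (auto simp: continuous_on_eq_continuous_at)
  then have Z: "(Z has_real_derivative \<zeta> x) (at x)" for x
    by (simp add: has_real_derivative_iff_has_vector_derivative)
  define \<eta> where "\<eta> x = Z x - Z 0" for x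
  have D: "(\<eta> has_real_derivative \<zeta> x) (at x)" for x
    unfolding \<eta>_def[abs_def] using Z[of x] by (auto intro!: derivative_eq_intros)
  obtain K where K: "compact K" "K \<subseteq> {0<..<T}" "\<And>x. x \<notin> K \<Longrightarrow> \<zeta> x = 0"
    using \<zeta> by (auto simp: test_functions_def)
  obtain a b where ab: "0 < a" "b < T" "\<And>x. x < a \<or> b < x \<Longrightarrow> \<zeta> x = 0"
  proof (cases "K = {}")
    case True
    show ?thesis by (rule that[of "T/2" "T/2"]) (use True K T in auto)
  next
    case False
    obtain a where a: "a \<in> K" "\<forall>x\<in>K. a \<le> x"
      using compact_attains_inf[OF K(1) False] by blast
    obtain b where b: "b \<in> K" "\<forall>x\<in>K. x \<le> b"
      using compact_attains_sup[OF K(1) False] by blast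
    show ?thesis
    proof (rule that[of a b])
      show "0 < a" "b < T" using a(1) b(1) K(2) by auto
      fix x assume "x < a \<or> b < x"
      then have "x \<notin> K" using a(2) b(2) by force
      then show "\<zeta> x = 0" by (rule K(3))
    qed
  qed
  have "(\<integral>r. indicator {0<..T} r * \<zeta> r \<partial>time_measure T) = (\<integral>r. \<zeta> r \<partial>time_measure T)"
    by (intro Bochner_Integration.integral_cong) auto
  then have \<eta>T: "\<eta> T = 0" using cumul_FTC[OF D cont, of 0 T T] T mean by (simp add: \<eta>_def)
  have zero_left: "\<eta> x = 0" if "x < a" for x
  proof -
    have "\<eta> constant_on {..<a}"
    proof (rule has_field_derivative_0_imp_constant_on)
      fix z assume z: "z \<in> {..<a}"
      have "\<zeta> z = 0" by (rule ab(3)) (use z in simp)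
      then show "(\<eta> has_real_derivative 0) (at z)" using D[of z] by simp
    qed auto
    then have "\<eta> x = \<eta> 0" using ab(1) that unfolding constant_on_def by force
    then show ?thesis by (simp add: \<eta>_def)
  qed
  have zero_right: "\<eta> x = 0" if "b < x" for x
  proof -
    have "\<eta> constant_on {b<..}"
    proof (rule has_field_derivative_0_imp_constant_on)
      fix z assume z: "z \<in> {b<..}"
      have "\<zeta> z = 0" by (rule ab(3)) (use z in simp)
      then show "(\<eta> has_real_derivative 0) (at z)" using D[of z] by simp
    qed auto
    then have "\<eta> x = \<eta> T" using ab(2) that unfolding constant_on_def by force
    then show ?thesis using \<eta>T by simp
  qed
  have "C_k k \<eta>" for k
    by (rule C_k_SucD) (rule C_k_real_derivI[OF D test_functions_Ck[OF \<zeta>]])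
  moreover have "\<exists>K. compact K \<and> K \<subseteq> {0<..<T} \<and> (\<forall>x. x \<notin> K \<longrightarrow> \<eta> x = 0)"
    by (rule exI[of _ "{a..b}"]) (use ab zero_left zero_right in \<open>auto simp: not_le\<close>)
  ultimately have "\<eta> \<in> test_functions {0<..<T}" by (auto simp: test_functions_def)
  moreover have "deriv \<eta> = \<zeta>" using D by (auto intro!: DERIV_imp_deriv)
  ultimately show ?thesis by (rule that)
qed

text \<open>By the previous lemma p - \<open>cumul T h\<close> is orthogonal to all test functions
  of zero mean. Subtracting a multiple of a fixed bump \<beta> gives any test function zero mean, so
  after subtraction of a constant the orthogonality holds for all of them.\<close>

theorem du_Bois_Reymond:
  assumes T: "T > 0" and p: "integrable (time_measure T) p" and h: "integrable (time_measure T) h"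
    and weak: "\<And>\<eta>. \<eta> \<in> test_functions {0<..<T} \<Longrightarrow>
      (\<integral>t. deriv \<eta> t * p t \<partial>time_measure T) = - (\<integral>t. \<eta> t * h t \<partial>time_measure T)"
  shows "\<exists>c. AE t in time_measure T. p t = c + cumul T h t"
proof -
  let ?M = "time_measure T"
  have Pc: "continuous_on UNIV (cumul T h)" by (rule continuous_cumul[OF h])
  have P: "integrable ?M (cumul T h)"
  proof -
    have "bounded (cumul T h ` {0..T})"
      by (intro compact_imp_bounded compact_continuous_image continuous_on_subset[OF Pc]) auto
    then obtain D where D: "\<forall>x\<in>{0..T}. \<bar>cumul T h x\<bar> \<le> D" by (auto simp: bounded_iff)
    show ?thesis
    proof (rule Bochner_Integration.integrable_bound[where f = "\<lambda>x. D"])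
      show "cumul T h \<in> borel_measurable ?M" by (rule continuous_borel_lebesgue_on[OF Pc])
      show "AE x in ?M. norm (cumul T h x) \<le> norm D"
      proof (intro AE_I2)
        fix x assume "x \<in> space ?M"
        then have "\<bar>cumul T h x\<bar> \<le> D" using D by simp
        then show "norm (cumul T h x) \<le> norm D" by simp
      qed
    qed simp
  qed
  define q where "q t = p t - cumul T h t" for t
  have q: "integrable ?M q" unfolding q_def[abs_def] using p P by simp
  have mult: "integrable ?M (\<lambda>t. k t * \<zeta> t)" if *: "\<zeta> \<in> test_functions {0<..<T}" "integrable ?M k"
    for \<zeta> k :: "real \<Rightarrow> real"
  proof -
    obtain B where "\<And>x. \<bar>\<zeta> x\<bar> \<le> B" using test_functions_bounded[OF *(1)] by auto
    then show ?thesis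
      by (intro integrable_mult_bounded(1)[OF *(2) test_functions_borel[OF *(1)]])
  qed
  have q0: "(\<integral>t. q t * \<zeta> t \<partial>?M) = 0" if \<zeta>: "\<zeta> \<in> test_functions {0<..<T}" "(\<integral>t. \<zeta> t \<partial>?M) = 0" for \<zeta>
  proof -
    obtain \<eta> where \<eta>: "\<eta> \<in> test_functions {0<..<T}" "deriv \<eta> = \<zeta>"
      by (rule test_function_primitive[OF \<zeta>(1) T \<zeta>(2)])
    have "(\<integral>t. q t * \<zeta> t \<partial>?M) = (\<integral>t. p t * \<zeta> t - cumul T h t * \<zeta> t \<partial>?M)"
      by (intro Bochner_Integration.integral_cong) (auto simp: q_def algebra_simps)
    also have "\<dots> = (\<integral>t. p t * \<zeta> t \<partial>?M) - (\<integral>t. cumul T h t * \<zeta> t \<partial>?M)"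
      using mult[OF \<zeta>(1) p] mult[OF \<zeta>(1) P] by simp
    also have "\<dots> = 0"
      using weak[OF \<eta>(1)] cumul_integration_by_parts[OF h \<eta>(1) T] \<eta>(2) by (simp add: mult.commute)
    finally show ?thesis .
  qed
  define \<beta> where "\<beta> = box_bump (T/3) (2 * T / 3) 0"
  have \<beta>: "\<beta> \<in> test_functions {0<..<T}"
    unfolding \<beta>_def by (rule box_bump_test) (use T in auto)
  have \<beta>i: "integrable ?M \<beta>" using mult[OF \<beta>, of "\<lambda>t. 1"] by simp
  have \<beta>0: "(\<integral>t. \<beta> t \<partial>?M) \<noteq> 0"
  proof
    assume "(\<integral>t. \<beta> t \<partial>?M) = 0"
    moreover have "AE t in ?M. 0 \<le> \<beta> t" by (simp add: \<beta>_def box_bump_bounds)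
    ultimately have "AE t in ?M. \<beta> t = 0"
      using integral_nonneg_eq_0_iff_AE[OF \<beta>i] by auto
    then have "AE t in ?M. t \<in> {t. \<beta> t = 0}" by simp
    from AE_time_dense[OF this, of "T/3" "2*T/3"] T obtain t where "\<beta> t = 0" "T/3 < t" "t < 2*T/3" by auto
    then show False using box_bump_pos[of t "T/3" "2*T/3" 0] by (simp add: \<beta>_def)
  qed
  define I where "I = (\<integral>t. \<beta> t \<partial>?M)"
  \<comment> \<open>The constant can only be the average of q weighted with \<beta>.\<close>
  define c where "c = (\<integral>t. q t * \<beta> t \<partial>?M) / I"
  have "AE t in ?M. q t - c = 0"
  proof (rule fundamental_lemma)
    show "integrable ?M (\<lambda>t. q t - c)" using q by simp
    fix \<psi> :: "real \<Rightarrow> real" assume \<psi>: "\<psi> \<in> test_functions {0<..<T}"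
    have \<psi>i: "integrable ?M \<psi>" using mult[OF \<psi>, of "\<lambda>t. 1"] by simp
    define a where "a = (\<integral>t. \<psi> t \<partial>?M) / I"
    define \<zeta> where "\<zeta> t = \<psi> t + (- a) * \<beta> t" for t
    have \<zeta>: "\<zeta> \<in> test_functions {0<..<T}"
      unfolding \<zeta>_def[abs_def] by (intro test_functions_add test_functions_scale \<psi> \<beta>)
    have "(\<integral>t. \<zeta> t \<partial>?M) = (\<integral>t. \<psi> t \<partial>?M) - a * I"
      unfolding \<zeta>_def using \<psi>i \<beta>i by (simp add: I_def)
    also have "\<dots> = 0" using \<beta>0 by (simp add: a_def I_def)
    finally have "(\<integral>t. q t * \<zeta> t \<partial>?M) = 0" by (rule q0[OF \<zeta>])
    moreover have "(\<integral>t. q t * \<zeta> t \<partial>?M) = (\<integral>t. q t * \<psi> t \<partial>?M) - a * (\<integral>t. q t * \<beta> t \<partial>?M)"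
    proof -
      have "(\<integral>t. q t * \<zeta> t \<partial>?M) = (\<integral>t. q t * \<psi> t - a * (q t * \<beta> t) \<partial>?M)"
        by (intro Bochner_Integration.integral_cong) (auto simp: \<zeta>_def algebra_simps)
      then show ?thesis using mult[OF \<psi> q] mult[OF \<beta> q] by simp
    qed
    moreover have "a * (\<integral>t. q t * \<beta> t \<partial>?M) = c * (\<integral>t. \<psi> t \<partial>?M)" by (simp add: a_def c_def)
    moreover have "(\<integral>t. (q t - c) * \<psi> t \<partial>?M) = (\<integral>t. q t * \<psi> t \<partial>?M) - c * (\<integral>t. \<psi> t \<partial>?M)"
    proof -
      have "(\<integral>t. (q t - c) * \<psi> t \<partial>?M) = (\<integral>t. q t * \<psi> t - c * \<psi> t \<partial>?M)"
        by (intro Bochner_Integration.integral_cong) (auto simp: algebra_simps)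
      then show ?thesis using mult[OF \<psi> q] \<psi>i by simp
    qed
    ultimately show "(\<integral>t. (q t - c) * \<psi> t \<partial>?M) = 0" by simp
  qed auto
  then have "AE t in ?M. p t = c + cumul T h t"
    by eventually_elim (simp add: q_def)
  then show ?thesis ..
qed

subsection \<open>The Lions--Magenes lemma\<close>

text \<open>Since \<open>0 \<le> k \<le> 1\<close>, the operators \<open>S\<^sup>n\<close> with \<open>S = 1 - k\<close> converge strongly to the projection
  onto the kernel of \<open>k\<close>; so \<open>J\<^sub>n = 1 - S\<^sup>n\<close>, a multiple of \<open>k\<close>, approximates the identity.\<close>
lemma approximate_identity:
  fixes k :: "'v::{real_inner, complete_space} \<Rightarrow> 'v"
  assumes lin: "bounded_linear k" and sym: "\<And>x y. k x \<bullet> y = x \<bullet> k y"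
    and contr: "\<And>x. (norm (k x))\<^sup>2 \<le> k x \<bullet> x" and inj: "\<And>x. k x = 0 \<Longrightarrow> x = 0"
  obtains J :: "nat \<Rightarrow> 'v \<Rightarrow> 'v" where
    "\<forall>n. bounded_linear (J n)" "\<forall>n x y. J n x \<bullet> y = x \<bullet> J n y" "\<forall>n x. k (J n x) = J n (k x)"
    "\<forall>n x. norm (J n x) \<le> 2 * norm x" "\<forall>n x. norm (J n x) \<le> real n * norm (k x)"
    "\<forall>x. (\<lambda>n. J n x) \<longlonglongrightarrow> x"
proof -
  interpret k: bounded_linear k by fact
  define S where "S x = x - k x" for x
  have S: "bounded_linear S"
    unfolding S_def[abs_def] by (intro bounded_linear_sub bounded_linear_ident lin)
  interpret S: bounded_linear S by (rule S)
  have Ssym: "S x \<bullet> y = x \<bullet> S y" for x y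
    by (simp add: S_def inner_diff_left inner_diff_right sym)
  have Snorm: "(norm (S x))\<^sup>2 \<le> S x \<bullet> x" "S x \<bullet> x \<le> (norm x)\<^sup>2" for x
  proof -
    have "(norm (S x))\<^sup>2 = (norm x)\<^sup>2 - 2 * (k x \<bullet> x) + (norm (k x))\<^sup>2"
      by (simp add: S_def power2_norm_eq_inner inner_diff_left inner_diff_right inner_commute)
    moreover have "S x \<bullet> x = (norm x)\<^sup>2 - k x \<bullet> x"
      by (simp add: S_def inner_diff_left power2_norm_eq_inner)
    moreover have "0 \<le> k x \<bullet> x" using contr[of x] zero_le_power2 order_trans by blast
    ultimately show "(norm (S x))\<^sup>2 \<le> S x \<bullet> x" "S x \<bullet> x \<le> (norm x)\<^sup>2" using contr[of x] by auto
  qed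
  have Scontr: "norm (S x) \<le> norm x" for x
    by (rule power2_le_imp_le[OF order_trans[OF Snorm]]) simp
  define P where "P n = (S ^^ n)" for n
  have P0: "P 0 x = x" and PS: "P (Suc n) x = S (P n x)" for n x by (simp_all add: P_def)
  have Plin: "bounded_linear (P n)" for n
  proof (induction n)
    case 0
    have "P 0 = (\<lambda>x. x)" by (simp add: P_def fun_eq_iff)
    then show ?case by (simp add: bounded_linear_ident)
  next
    case (Suc n)
    have "P (Suc n) = (\<lambda>x. S (P n x))" by (simp add: PS fun_eq_iff)
    then show ?case using bounded_linear_compose[OF S Suc] by simp
  qed
  have Psym: "P n x \<bullet> y = x \<bullet> P n y" for n x y
    by (induction n arbitrary: x y) (simp_all add: P_def Ssym funpow_swap1)
  have Pk: "k (P n x) = P n (k x)" for n x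
    by (induction n) (simp_all add: P0 PS S_def k.diff)
  have Pnorm: "norm (P n x) \<le> norm x" for n x
    by (induction n) (auto simp: P0 PS intro: order_trans[OF Scontr])
  define J where "J n x = x - P n x" for n x
  \<comment> \<open>Telescoping of 1 - S^n with S^i - S^(i+1) = S^i k; it yields the bound by n |k
    x|.\<close>
  have Jsum: "J n x = (\<Sum>i<n. P i (k x))" for n x
  proof (induction n)
    case (Suc n)
    have "P n x - P (Suc n) x = P n (k x)" by (simp add: PS S_def Pk)
    moreover have "J (Suc n) x = J n x + (P n x - P (Suc n) x)" by (simp add: J_def)
    ultimately show ?case using Suc by simp
  qed (simp add: J_def P0)
  have conv: "(\<lambda>n. P n x) \<longlonglongrightarrow> 0" for x
  proof -
    \<comment> \<open>By self-adjointness |S^m x - S^n x|^2 = a(2m) - 2 a(m+n) + a(2n), so it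
      suffices that the real sequence a converges, and it is decreasing and nonnegative.\<close>
    define a where "a n = P n x \<bullet> x" for n
    have Padd: "P m x \<bullet> P n x = a (m + n)" for m n
    proof -
      have "P (m + n) x = P n (P m x)" by (subst add.commute) (simp add: P_def funpow_add)
      then show ?thesis by (simp add: a_def Psym)
    qed
    have even: "a (2 * n) = (norm (P n x))\<^sup>2" "a (Suc (2 * n)) = S (P n x) \<bullet> P n x" for n
    proof -
      show "a (2 * n) = (norm (P n x))\<^sup>2" using Padd[of n n] by (simp only: power2_norm_eq_inner mult_2)
      show "a (Suc (2 * n)) = S (P n x) \<bullet> P n x" using Padd[of "Suc n" n] by (simp only: PS mult_2 add_Suc)
    qed
    \<comment> \<open>Even indices use S \<le> 1, odd ones S^2 \<le> S.\<close>
    have dec: "a (Suc n) \<le> a n" for n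
    proof (cases "even n")
      case True
      then obtain i where "n = 2 * i" by (auto elim: evenE)
      then show ?thesis using even[of i] Snorm(2)[of "P i x"] by simp
    next
      case False
      then obtain i where i: "n = Suc (2 * i)" by (auto elim: oddE)
      have "a (2 * Suc i) \<le> a (Suc (2 * i))"
        unfolding even PS by (rule Snorm(1))
      then show ?thesis by (simp add: i)
    qed
    have ds: "decseq a" using dec by (simp add: decseq_Suc_iff)
    have nonneg: "0 \<le> a n" for n
    proof -
      have "0 \<le> a (2 * n)" by (simp add: even)
      also have "a (2 * n) \<le> a n" using decseqD[OF ds, of n "2 * n"] by simp
      finally show ?thesis .
    qed
    obtain l where "a \<longlonglongrightarrow> l"
      using decseq_convergent[OF ds allI[of "\<lambda>n. 0 \<le> a n", OF nonneg]] by metis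
    then have "convergent a" by (rule convergentI)
    then have Ca: "Cauchy a" by (rule convergent_Cauchy)
    have "Cauchy (\<lambda>n. P n x)"
    proof (rule metric_CauchyI)
      fix e :: real assume e: "e > 0"
      then have "e\<^sup>2 / 2 > 0" by simp
      from metric_CauchyD[OF Ca this] obtain N where N: "\<forall>m\<ge>N. \<forall>n\<ge>N. dist (a m) (a n) < e\<^sup>2 / 2" ..
      show "\<exists>M. \<forall>m\<ge>M. \<forall>n\<ge>M. dist (P m x) (P n x) < e"
      proof (intro exI allI impI)
        fix m n assume mn: "N \<le> m" "N \<le> n"
        have "(dist (P m x) (P n x))\<^sup>2 = a (2 * m) - a (m + n) + (a (2 * n) - a (m + n))"
        proof -
          have "(dist (P m x) (P n x))\<^sup>2 = P m x \<bullet> P m x - 2 * (P m x \<bullet> P n x) + P n x \<bullet> P n x"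
            by (simp add: dist_norm power2_norm_eq_inner inner_diff_left inner_diff_right inner_commute)
          then show ?thesis unfolding Padd mult_2 by linarith
        qed
        also have "\<dots> < e\<^sup>2 / 2 + e\<^sup>2 / 2"
        proof (rule add_strict_mono)
          have "dist (a (2 * m)) (a (m + n)) < e\<^sup>2 / 2" "dist (a (2 * n)) (a (m + n)) < e\<^sup>2 / 2"
            using N mn by auto
          then show "a (2 * m) - a (m + n) < e\<^sup>2 / 2" "a (2 * n) - a (m + n) < e\<^sup>2 / 2"
            unfolding dist_real_def by linarith+
        qed
        finally have "(dist (P m x) (P n x))\<^sup>2 < e\<^sup>2" by simp
        then show "dist (P m x) (P n x) < e"
          by (rule power_less_imp_less_base) (use e in simp)
      qed
    qed
    then obtain y where y: "(\<lambda>n. P n x) \<longlonglongrightarrow> y" using Cauchy_convergent convergent_def by blast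
    \<comment> \<open>The limit is a fixed point of S, so k annihilates it.\<close>
    have "(\<lambda>n. P (Suc n) x) \<longlonglongrightarrow> S y" unfolding PS by (rule S.tendsto[OF y])
    moreover have "(\<lambda>n. P (Suc n) x) \<longlonglongrightarrow> y" using y by (rule LIMSEQ_Suc)
    ultimately have "S y = y" by (rule LIMSEQ_unique)
    then have "k y = 0" by (simp add: S_def)
    then have "y = 0" by (rule inj)
    then show ?thesis using y by simp
  qed
  show ?thesis
  proof (rule that; intro allI)
    show "bounded_linear (J n)" for n
      unfolding J_def[abs_def] by (intro bounded_linear_sub bounded_linear_ident Plin)
    show "J n x \<bullet> y = x \<bullet> J n y" for n x y by (simp add: J_def inner_diff_left inner_diff_right Psym)
    show "k (J n x) = J n (k x)" for n x by (simp add: J_def k.diff Pk)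
    show "norm (J n x) \<le> 2 * norm x" for n x
      using norm_triangle_ineq4[of x "P n x"] Pnorm[of n x] by (simp add: J_def)
    show "norm (J n x) \<le> real n * norm (k x)" for n x
    proof -
      have "norm (J n x) \<le> (\<Sum>i<n. norm (P i (k x)))" unfolding Jsum by (rule norm_sum)
      also have "\<dots> \<le> (\<Sum>i<n. norm (k x))" by (intro sum_mono Pnorm)
      finally show ?thesis by simp
    qed
    have "(\<lambda>n. x - P n x) \<longlonglongrightarrow> x - 0" for x by (intro tendsto_intros conv)
    then show "(\<lambda>n. J n x) \<longlonglongrightarrow> x" for x by (simp add: J_def)
  qed
qed

section \<open>Square-integrable functions of time and the abstract evolution equation\<close>

lemma square_integrable_inner:
  fixes f h :: "real \<Rightarrow> 'v::real_inner"
  assumes "smeas (time_measure T) f" "integrable (time_measure T) (\<lambda>t. (norm (f t))\<^sup>2)"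
    and "smeas (time_measure T) h" "integrable (time_measure T) (\<lambda>t. (norm (h t))\<^sup>2)"
  shows "integrable (time_measure T) (\<lambda>t. f t \<bullet> h t)"
proof (rule Bochner_Integration.integrable_bound)
  show "integrable (time_measure T) (\<lambda>t. (norm (f t))\<^sup>2 + (norm (h t))\<^sup>2)"
    using assms by simp
  show "(\<lambda>t. f t \<bullet> h t) \<in> borel_measurable (time_measure T)"
    by (intro smeas_real_measurable complete_measure_lebesgue_on smeas_inner assms) auto
  have "\<bar>x \<bullet> y\<bar> \<le> (norm x)\<^sup>2 + (norm y)\<^sup>2" for x y :: 'v
    using Cauchy_Schwarz_ineq2[of x y] sum_squares_bound[of "norm x" "norm y"]
      mult_nonneg_nonneg[of "norm x" "norm y"] by (auto intro: order_trans)
  then show "AE t in time_measure T. norm (f t \<bullet> h t) \<le> norm ((norm (f t))\<^sup>2 + (norm (h t))\<^sup>2)"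
    by (intro AE_I2) auto
qed

lemma square_integrable_norm:
  fixes f :: "real \<Rightarrow> 'v::real_inner"
  assumes "smeas (time_measure T) f" "integrable (time_measure T) (\<lambda>t. (norm (f t))\<^sup>2)"
  shows "integrable (time_measure T) (\<lambda>t. norm (f t))"
proof (rule Bochner_Integration.integrable_bound)
  show "integrable (time_measure T) (\<lambda>t. 1 + (norm (f t))\<^sup>2)"
    using assms by simp
  show "(\<lambda>t. norm (f t)) \<in> borel_measurable (time_measure T)"
    by (intro smeas_real_measurable complete_measure_lebesgue_on smeas_norm assms) auto
  have "x \<le> 1 + x\<^sup>2" for x :: real
    using zero_le_power2[of "x - 1/2"] by (simp add: power2_eq_square algebra_simps)
  then show "AE t in time_measure T. norm (norm (f t)) \<le> norm (1 + (norm (f t))\<^sup>2)"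
    by (intro AE_I2) auto
qed

text \<open>An evolution triple with j the embedding of V into H. The time derivative is given by
  Riesz representatives \<open>g t\<close> in V, so that no dual space occurs.\<close>

locale evolution =
  fixes T :: real and j :: "'v::{real_inner, complete_space} \<Rightarrow> 'h::{real_inner, complete_space}"
    and v g :: "real \<Rightarrow> 'v"
  assumes T: "T > 0" and j: "bounded_linear j" "inj j"
    and v: "smeas (time_measure T) v" "integrable (time_measure T) (\<lambda>t. (norm (v t))\<^sup>2)"
    and g: "smeas (time_measure T) g" "integrable (time_measure T) (\<lambda>t. (norm (g t))\<^sup>2)"
    and weak: "\<And>\<eta> w. \<eta> \<in> test_functions {0<..<T} \<Longrightarrow>
      (\<integral>t. deriv \<eta> t * (j (v t) \<bullet> j w) \<partial>time_measure T) = - (\<integral>t. \<eta> t * (g t \<bullet> w) \<partial>time_measure T)"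
begin

abbreviation "M \<equiv> time_measure T"
abbreviation "A \<equiv> cumul T"

sublocale j: bounded_linear j by (rule j)

lemma g_inner: "integrable M (\<lambda>t. g t \<bullet> w)"
  by (rule square_integrable_inner[OF g smeas_const]) simp

lemma g_norm: "integrable M (\<lambda>t. norm (g t))"
  by (rule square_integrable_norm[OF g])

lemma v_inner: "integrable M (\<lambda>t. g t \<bullet> v t)"
  by (rule square_integrable_inner[OF g v])

lemma g_inner_diff: "A (\<lambda>r. g r \<bullet> (x - y)) t = A (\<lambda>r. g r \<bullet> x) t - A (\<lambda>r. g r \<bullet> y) t"
  using cumul_lincomb[OF g_inner g_inner, of 1 x "-1" y] by (simp add: inner_diff_right)

text \<open>The clock of the estimates: tested with w, the solution changes over [s,t] by at most
  |w| (m t - m s).\<close>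

definition m :: "real \<Rightarrow> real" where "m = A (\<lambda>r. norm (g r))"

lemma m_mono: "s \<le> t \<Longrightarrow> m s \<le> m t"
  unfolding m_def by (rule cumul_mono[OF g_norm]) auto

lemma g_inner_bound: "s \<le> t \<Longrightarrow> \<bar>A (\<lambda>r. g r \<bullet> w) t - A (\<lambda>r. g r \<bullet> w) s\<bar> \<le> norm w * (m t - m s)"
proof -
  assume st: "s \<le> t"
  have "\<bar>A (\<lambda>r. g r \<bullet> w) t - A (\<lambda>r. g r \<bullet> w) s\<bar>
      \<le> A (\<lambda>r. norm w * norm (g r) + 0 * norm (g r)) t - A (\<lambda>r. norm w * norm (g r) + 0 * norm (g r)) s"
    by (rule cumul_bound[OF g_inner _ st])
      (use g_norm Cauchy_Schwarz_ineq2[of _ w] in \<open>auto simp: mult.commute[of "norm w"]\<close>)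
  moreover have "A (\<lambda>r. norm w * norm (g r) + 0 * norm (g r)) x = norm w * m x" for x
    unfolding cumul_lincomb[OF g_norm g_norm] by (simp add: m_def)
  ultimately show ?thesis by (simp add: right_diff_distrib)
qed

text \<open>The weak equation tested with w, integrated between any two times of G. Having G fixed
  while w varies is what makes limits in w possible (\<open>adm_limit\<close>).\<close>

definition adm :: "real set \<Rightarrow> 'v \<Rightarrow> bool" where
  "adm G w \<longleftrightarrow> (\<forall>s\<in>G. \<forall>t\<in>G. j (v t) \<bullet> j w - j (v s) \<bullet> j w = A (\<lambda>r. g r \<bullet> w) t - A (\<lambda>r. g r \<bullet> w) s)"

lemma adm_limit:
  assumes w: "\<And>n. adm G (w n)" "w \<longlonglongrightarrow> x"
  shows "adm G x"
  unfolding adm_def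
proof (intro ballI)
  fix s t assume st: "s \<in> G" "t \<in> G"
  have lim: "(\<lambda>n. A (\<lambda>r. g r \<bullet> w n) t) \<longlonglongrightarrow> A (\<lambda>r. g r \<bullet> x) t" for t
  proof (rule LIM_zero_cancel, rule Lim_null_comparison)
    have "\<bar>A (\<lambda>r. g r \<bullet> w n) t - A (\<lambda>r. g r \<bullet> x) t\<bar> \<le> norm (w n - x) * \<bar>m t\<bar>" for n
      using g_inner_bound[of 0 t "w n - x"] g_inner_bound[of t 0 "w n - x"] m_mono[of 0 t] m_mono[of t 0]
      by (cases "0 \<le> t") (auto simp: g_inner_diff m_def)
    then show "\<forall>\<^sub>F n in sequentially. norm (A (\<lambda>r. g r \<bullet> w n) t - A (\<lambda>r. g r \<bullet> x) t) \<le> norm (w n - x) * \<bar>m t\<bar>"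
      by simp
    have "(\<lambda>n. norm (w n - x) * \<bar>m t\<bar>) \<longlonglongrightarrow> norm (x - x) * \<bar>m t\<bar>"
      by (intro tendsto_intros w)
    then show "(\<lambda>n. norm (w n - x) * \<bar>m t\<bar>) \<longlonglongrightarrow> 0" by simp
  qed
  have 1: "(\<lambda>n. j (v t) \<bullet> j (w n) - j (v s) \<bullet> j (w n)) \<longlonglongrightarrow> j (v t) \<bullet> j x - j (v s) \<bullet> j x"
    by (intro tendsto_intros j.tendsto w)
  have 2: "(\<lambda>n. A (\<lambda>r. g r \<bullet> w n) t - A (\<lambda>r. g r \<bullet> w n) s) \<longlonglongrightarrow> A (\<lambda>r. g r \<bullet> x) t - A (\<lambda>r. g r \<bullet> x) s"
    by (intro tendsto_diff lim)
  have "j (v t) \<bullet> j (w n) - j (v s) \<bullet> j (w n) = A (\<lambda>r. g r \<bullet> w n) t - A (\<lambda>r. g r \<bullet> w n) s" for n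
    using w(1)[of n] st by (simp add: adm_def)
  with 1 2 show "j (v t) \<bullet> j x - j (v s) \<bullet> j x = A (\<lambda>r. g r \<bullet> x) t - A (\<lambda>r. g r \<bullet> x) s"
    using LIMSEQ_unique by auto
qed

text \<open>k is the adjoint of j composed with j, scaled by B = 1/C^2 where C bounds j; the scaling
  yields 0 \<le> k \<le> 1, as \<open>approximate_identity\<close> wants.\<close>

lemma j_adjoint:
  obtains B k where "B > 0" "bounded_linear k" "\<forall>x y. k x \<bullet> y = B * (j x \<bullet> j y)"
    "\<forall>x y. k x \<bullet> y = x \<bullet> k y" "\<forall>x. (norm (k x))\<^sup>2 \<le> k x \<bullet> x" "\<forall>x. k x = 0 \<longrightarrow> x = 0"
proof -
  obtain C where C: "C > 0" "\<And>x. norm (j x) \<le> norm x * C" using j.pos_bounded by blast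
  define B where "B = 1 / C\<^sup>2"
  have B: "B > 0" "B * C\<^sup>2 = 1" using C by (auto simp: B_def)
  have "\<exists>z\<in>UNIV. \<forall>y\<in>UNIV. B * (j x \<bullet> j y) = z \<bullet> y" for x
  proof (rule riesz_closed_subspace)
    show "\<bar>B * (j x \<bullet> j y)\<bar> \<le> (B * norm (j x) * C) * norm y" for y
    proof -
      have "\<bar>j x \<bullet> j y\<bar> \<le> norm (j x) * norm (j y)" by (rule Cauchy_Schwarz_ineq2)
      also have "\<dots> \<le> norm (j x) * (norm y * C)" by (intro mult_left_mono C) auto
      finally have "B * \<bar>j x \<bullet> j y\<bar> \<le> B * (norm (j x) * (norm y * C))" using B by (intro mult_left_mono) auto
      then show ?thesis using B by (simp add: abs_mult mult.assoc mult.left_commute mult.commute)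
    qed
  qed (auto simp: j.add j.scaleR inner_add_right algebra_simps)
  then have "\<forall>x. \<exists>z. \<forall>y. z \<bullet> y = B * (j x \<bullet> j y)" by (metis UNIV_I)
  then obtain k where "\<forall>x y. k x \<bullet> y = B * (j x \<bullet> j y)" by (rule choice[THEN exE])
  then have k: "k x \<bullet> y = B * (j x \<bullet> j y)" for x y by blast
  have sym: "k x \<bullet> y = x \<bullet> k y" for x y by (metis k inner_commute)
  have eqI: "x = y" if "\<And>z. x \<bullet> z = y \<bullet> z" for x y :: 'v
    using that[of "x - y"] by (metis inner_diff_left inner_eq_zero_iff right_minus_eq)
  \<comment> \<open>|k x|^2 equals B times the inner product of j x and j (k x). Cauchy--Schwarz and
    |j (k x)| \<le> C |k x| bound its square by \<open>k x \<bullet> x\<close> times |k x|^2, and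
    one factor |k x|^2 cancels.\<close>
  have contr: "(norm (k x))\<^sup>2 \<le> k x \<bullet> x" for x
  proof -
    have "(norm (j x \<bullet> j (k x)))\<^sup>2 \<le> (norm (j x) * norm (j (k x)))\<^sup>2"
      by (intro power_mono) (auto simp: Cauchy_Schwarz_ineq2)
    also have "\<dots> \<le> (norm (j x))\<^sup>2 * (norm (k x) * C)\<^sup>2"
      unfolding power_mult_distrib[of "norm (j x)"] by (intro mult_left_mono power_mono C) auto
    finally have "B\<^sup>2 * (norm (j x \<bullet> j (k x)))\<^sup>2 \<le> B\<^sup>2 * ((norm (j x))\<^sup>2 * (norm (k x) * C)\<^sup>2)"
      by (rule mult_left_mono) simp
    moreover have "B\<^sup>2 * (norm (j x \<bullet> j (k x)))\<^sup>2 = (k x \<bullet> k x)\<^sup>2"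
      by (simp add: k[of x "k x"] power_mult_distrib)
    moreover have "B\<^sup>2 * ((norm (j x))\<^sup>2 * (norm (k x) * C)\<^sup>2) = (k x \<bullet> x) * (norm (k x))\<^sup>2 * (B * C\<^sup>2)"
      unfolding k[of x x] power2_norm_eq_inner[of "j x"] by (simp add: power_mult_distrib power2_eq_square)
    ultimately have "(norm (k x))\<^sup>2 * (norm (k x))\<^sup>2 \<le> (k x \<bullet> x) * (norm (k x))\<^sup>2"
      using B(2) by (simp add: power2_norm_eq_inner) (simp add: power2_eq_square)
    then show ?thesis
    proof (cases "k x = 0")
      case False
      then have "0 < (norm (k x))\<^sup>2" by simp
      with \<open>(norm (k x))\<^sup>2 * (norm (k x))\<^sup>2 \<le> _\<close> show ?thesis
        by (rule mult_right_le_imp_le)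
    qed (simp add: k B(1) less_imp_le)
  qed
  have lin: "bounded_linear k"
  proof (rule bounded_linear_intro)
    show "k (x + y) = k x + k y" for x y by (rule eqI) (simp add: k inner_add_left j.add algebra_simps)
    show "k (c *\<^sub>R x) = c *\<^sub>R k x" for c x by (rule eqI) (simp add: k j.scaleR)
    show "norm (k x) \<le> norm x * 1" for x
    proof -
      have "norm (k x) * norm (k x) \<le> norm (k x) * norm x"
        using contr[of x] norm_cauchy_schwarz[of "k x" x] by (simp add: power2_eq_square)
      then show ?thesis by (cases "norm (k x) = 0") auto
    qed
  qed
  have inj0: "x = 0" if "k x = 0" for x
  proof -
    have "B * (j x \<bullet> j x) = 0" using k[of x x] that by simp
    then have "j x = j 0" using B by (simp add: j.zero)
    with j(2) show ?thesis by (rule injD)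
  qed
  show ?thesis
  proof (rule that[OF B(1) lin]; intro allI impI)
    show "k x \<bullet> y = B * (j x \<bullet> j y)" for x y by (rule k)
    show "k x \<bullet> y = x \<bullet> k y" for x y by (rule sym)
    show "(norm (k x))\<^sup>2 \<le> k x \<bullet> x" for x by (rule contr)
    show "x = 0" if "k x = 0" for x by (rule inj0[OF that])
  qed
qed

end

context evolution
begin

lemma square_integrable_bounded_linear:
  assumes L: "bounded_linear L"
  shows "integrable M (\<lambda>t. (norm (L (v t)))\<^sup>2)"
proof -
  obtain K where K: "\<And>x. norm (L x) \<le> norm x * K" using bounded_linear.bounded[OF L] by blast
  have m: "(\<lambda>t. norm (L (v t))) \<in> borel_measurable M"
    by (rule smeas_real_measurable[OF complete_measure_lebesgue_on smeas_norm[OF smeas_bounded_linear[OF v(1) L]]])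
      simp
  show ?thesis
  proof (rule Bochner_Integration.integrable_bound)
    show "integrable M (\<lambda>t. K\<^sup>2 * (norm (v t))\<^sup>2)" using v by simp
    show "(\<lambda>t. (norm (L (v t)))\<^sup>2) \<in> borel_measurable M" using m by simp
    have "(norm (L x))\<^sup>2 \<le> K\<^sup>2 * (norm x)\<^sup>2" for x
      using power_mono[OF K[of x] norm_ge_zero, of 2] by (simp add: power_mult_distrib mult.commute)
    then show "AE t in M. norm ((norm (L (v t)))\<^sup>2) \<le> norm (K\<^sup>2 * (norm (v t))\<^sup>2)"
      by (intro AE_I2) simp
  qed
qed

text \<open>The null set on which the weak equation fails depends on the test vector; a countable set of
  test vectors, whose closure contains all those used below, gives one null set.\<close>
lemma good_times:
  fixes J :: "nat \<Rightarrow> 'v \<Rightarrow> 'v"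
  assumes k: "bounded_linear k" and J: "\<And>n. bounded_linear (J n)"
  obtains G where "G \<subseteq> {0<..<T}" "AE t in M. t \<in> G"
    "\<forall>a\<in>G. adm G (v a)" "\<forall>a\<in>G. \<forall>b\<in>G. adm G (k (v a - v b))"
    "\<forall>a\<in>G. \<forall>b\<in>G. \<forall>n. adm G (J n (v a + v b))"
proof -
  obtain s where s: "\<forall>n. simple_function M (s n)" "AE t in M. (\<lambda>n. s n t) \<longlonglongrightarrow> v t"
    by (rule smeasE[OF v(1)])
  define D where "D = (\<Union>n. s n ` space M)"
  have "countable (s n ` space M)" for n
    by (rule countable_finite) (rule simple_functionD(1)[OF s(1)[rule_format]])
  then have "countable D" unfolding D_def by (intro countable_UN) auto
  define C where "C = D \<union> ((\<Union>n. (\<lambda>(a, b). J n (a + b)) ` (D \<times> D)) \<union> (\<lambda>(a, b). k (a - b)) ` (D \<times> D))"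
  have C: "countable C" unfolding C_def
    by (intro countable_Un countable_UN countable_image countable_SIGMA \<open>countable D\<close>) auto
  have jv: "integrable M (\<lambda>t. j (v t) \<bullet> j w)" for w
    by (rule square_integrable_inner[OF smeas_bounded_linear[OF v(1) j(1)]
          square_integrable_bounded_linear[OF j(1)] smeas_const]) simp
  have "\<forall>w. \<exists>c. AE t in M. j (v t) \<bullet> j w = c + A (\<lambda>r. g r \<bullet> w) t"
    using du_Bois_Reymond[OF T jv g_inner weak] by blast
  then obtain c where c: "\<forall>w. AE t in M. j (v t) \<bullet> j w = c w + A (\<lambda>r. g r \<bullet> w) t"
    by (rule choice[THEN exE])
  then have AEC: "AE t in M. \<forall>w\<in>C. j (v t) \<bullet> j w = c w + A (\<lambda>r. g r \<bullet> w) t"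
    using C by (intro AE_ball_countable') auto
  define G where "G = {t \<in> {0<..<T}. (\<lambda>n. s n t) \<longlonglongrightarrow> v t \<and>
    (\<forall>w\<in>C. j (v t) \<bullet> j w = c w + A (\<lambda>r. g r \<bullet> w) t)}"
  have sub: "G \<subseteq> {0<..<T}" by (auto simp: G_def)
  have AEG: "AE t in M. t \<in> G"
    using s(2) AEC AE_time_space[of T] by eventually_elim (simp add: G_def)
  have lim: "(\<lambda>n. s n t) \<longlonglongrightarrow> v t" if "t \<in> G" for t using that by (simp add: G_def)
  have sD: "s n t \<in> D" if "t \<in> G" for n t using that sub by (auto simp: D_def)
  have admC: "adm G w" if "w \<in> C" for w
    unfolding adm_def using that by (auto simp: G_def)
  show ?thesis
  proof (rule that[OF sub AEG]; intro ballI allI)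
    fix a b n assume a: "a \<in> G"
    show "adm G (v a)"
      by (rule adm_limit[OF admC lim[OF a]]) (simp add: C_def sD[OF a])
    assume b: "b \<in> G"
    show "adm G (k (v a - v b))"
    proof (rule adm_limit[OF admC])
      show "k (s i a - s i b) \<in> C" for i
        unfolding C_def using sD[OF a] sD[OF b] by force
      show "(\<lambda>i. k (s i a - s i b)) \<longlonglongrightarrow> k (v a - v b)"
        by (intro bounded_linear.tendsto[OF k] tendsto_diff lim a b)
    qed
    show "adm G (J n (v a + v b))"
    proof (rule adm_limit[OF admC])
      show "J n (s i a + s i b) \<in> C" for i
        unfolding C_def using sD[OF a] sD[OF b] by force
      show "(\<lambda>i. J n (s i a + s i b)) \<longlonglongrightarrow> J n (v a + v b)"
        by (intro bounded_linear.tendsto[OF J] tendsto_add lim a b)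
    qed
  qed
qed

text \<open>With \<open>J\<^sub>n v\<close> in place of one factor \<open>v\<close> the energy identity has a quadratic error over each time
  interval, because \<open>|J\<^sub>n x| \<le> n |k x|\<close> and \<open>k v\<close> is controlled by the integral of \<open>g\<close>.\<close>
lemma energy_identity:
  obtains G where "G \<subseteq> {0<..<T}" "AE t in M. t \<in> G" "\<forall>a\<in>G. adm G (v a)"
    "\<forall>s\<in>G. \<forall>t\<in>G.
      (norm (j (v t)))\<^sup>2 - (norm (j (v s)))\<^sup>2 = 2 * (A (\<lambda>r. g r \<bullet> v r) t - A (\<lambda>r. g r \<bullet> v r) s)"
proof -
  obtain B k where B: "B > 0" and k': "bounded_linear k" "\<forall>x y. k x \<bullet> y = B * (j x \<bullet> j y)"
    "\<forall>x y. k x \<bullet> y = x \<bullet> k y" "\<forall>x. (norm (k x))\<^sup>2 \<le> k x \<bullet> x" "\<forall>x. k x = 0 \<longrightarrow> x = 0"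
    by (rule j_adjoint)
  note k = k'[rule_format]
  obtain J where J': "\<forall>n. bounded_linear (J n)" "\<forall>n x y. J n x \<bullet> y = x \<bullet> J n y" "\<forall>n x. k (J n x) = J n (k x)"
    "\<forall>n x. norm (J n x) \<le> 2 * norm x" "\<forall>n x. norm (J n x) \<le> real n * norm (k x)"
    "\<forall>x. (\<lambda>n. J n x) \<longlonglongrightarrow> x"
    by (rule approximate_identity[OF k(1,3,4,5)])
  note J = J'[rule_format]
  obtain G where G: "G \<subseteq> {0<..<T}" "AE t in M. t \<in> G" and adm': "\<forall>a\<in>G. adm G (v a)"
    "\<forall>a\<in>G. \<forall>b\<in>G. adm G (k (v a - v b))" "\<forall>a\<in>G. \<forall>b\<in>G. \<forall>n. adm G (J n (v a + v b))"
    by (rule good_times[OF k(1) J(1)])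
  note admk = adm'(2)[rule_format] and admJ = adm'(3)[rule_format]
  have G': "G \<subseteq> {0..T}" using G(1) by auto
  have clG: "closure G = {0..T}" by (rule closure_AE_time[OF G(2) G' T])
  \<comment> \<open>This form in x and y is symmetric because \<open>J n\<close> is self-adjoint and
    commutes with k.\<close>
  have jJ: "j x \<bullet> j (J n y) = j y \<bullet> j (J n x)" for x y n
  proof -
    have "B * (j x \<bullet> j (J n y)) = k x \<bullet> J n y" by (rule k(2)[symmetric])
    also have "\<dots> = J n (k x) \<bullet> y" by (rule J(2)[symmetric])
    also have "\<dots> = k (J n x) \<bullet> y" by (simp only: J(3))
    also have "\<dots> = B * (j (J n x) \<bullet> j y)" by (rule k(2))
    also have "\<dots> = B * (j y \<bullet> j (J n x))" by (simp only: inner_commute)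
    finally have "B * (j x \<bullet> j (J n y)) = B * (j y \<bullet> j (J n x))" .
    then show ?thesis using B by simp
  qed
  have Jadd: "J n (x + y) = J n x + J n y" "J n (x - y) = J n x - J n y" for n x y
    using linear_add[OF bounded_linear.linear[OF J(1)]] linear_diff[OF bounded_linear.linear[OF J(1)]] by auto
  \<comment> \<open>Tested with y = k (v t - v r) itself, the weak equation bounds |y|^2 by B |y|
    times the increment of m.\<close>
  have kb: "norm (k (v t - v r)) \<le> B * \<bar>m t - m r\<bar>" if "r \<in> G" "t \<in> G" for r t
  proof -
    define y where "y = k (v t - v r)"
    have "adm G y" unfolding y_def by (rule admk[OF that(2,1)])
    then have "j (v t) \<bullet> j y - j (v r) \<bullet> j y = A (\<lambda>r. g r \<bullet> y) t - A (\<lambda>r. g r \<bullet> y) r"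
      using that by (simp add: adm_def)
    moreover have "norm y * norm y = B * (j (v t) \<bullet> j y - j (v r) \<bullet> j y)"
      using k(2)[of "v t - v r" y] by (simp add: y_def[symmetric] j.diff inner_diff_left power2_norm_eq_inner flip: power2_eq_square)
    moreover have "\<bar>A (\<lambda>r. g r \<bullet> y) t - A (\<lambda>r. g r \<bullet> y) r\<bar> \<le> norm y * \<bar>m t - m r\<bar>"
      using g_inner_bound[of r t y] g_inner_bound[of t r y] m_mono[of r t] m_mono[of t r]
      by (cases "r \<le> t") (simp_all add: abs_minus_commute)
    ultimately have "norm y * norm y \<le> B * (norm y * \<bar>m t - m r\<bar>)"
      using B by (simp add: mult_left_mono) 
    then have "norm y * norm y \<le> norm y * (B * \<bar>m t - m r\<bar>)" by (simp only: mult.left_commute)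
    then have "norm y \<le> B * \<bar>m t - m r\<bar>"
      using B by (cases "norm y = 0") (auto intro: mult_left_le_imp_le[of "norm y"])
    then show ?thesis by (simp only: y_def)
  qed
  have gJ: "integrable M (\<lambda>r. g r \<bullet> J n (v r))" for n
    by (rule square_integrable_inner[OF g smeas_bounded_linear[OF v(1) J(1)]
          square_integrable_bounded_linear[OF J(1)]])
  define F where "F n t = j (v t) \<bullet> j (J n (v t)) - 2 * A (\<lambda>r. g r \<bullet> J n (v r)) t" for n t
  have quad: "\<bar>F n t - F n s\<bar> \<le> (2 * real n * B) * (m t - m s)\<^sup>2" if st: "s \<in> G" "t \<in> G" "s \<le> t" for n s t
  proof -
    define w where "w = J n (v t + v s)"
    define q where "q r = 1 * (g r \<bullet> w) + (-2) * (g r \<bullet> J n (v r))" for r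
    have q: "integrable M q" unfolding q_def[abs_def] using g_inner[of w] gJ[of n] by simp
    \<comment> \<open>For a symmetric form, b(x,x) - b(y,y) = b(x - y, x + y); this is why
      \<open>J n (v t + v s)\<close> is the test vector.\<close>
    have "j (v t) \<bullet> j (J n (v t)) - j (v s) \<bullet> j (J n (v s)) = j (v t) \<bullet> j w - j (v s) \<bullet> j w"
      using jJ[of "v t" n "v s"] by (simp add: w_def Jadd j.add inner_add_right)
    moreover have "j (v t) \<bullet> j w - j (v s) \<bullet> j w = A (\<lambda>r. g r \<bullet> w) t - A (\<lambda>r. g r \<bullet> w) s"
      using admJ[OF st(2,1), of n] st by (simp add: adm_def w_def)
    moreover have "A q x = A (\<lambda>r. g r \<bullet> w) x - 2 * A (\<lambda>r. g r \<bullet> J n (v r)) x" for x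
      unfolding q_def[abs_def] cumul_lincomb[OF g_inner gJ] by simp
    ultimately have Fq: "F n t - F n s = A q t - A q s"
      by (simp add: F_def)
    \<comment> \<open>The two differences v t - v r and v s - v r each contribute n B times the
      increment of m.\<close>
    define c where "c = 2 * real n * B * (m t - m s)"
    have le: "\<bar>A q t - A q s\<bar> \<le> A (\<lambda>r. c * norm (g r) + 0 * norm (g r)) t - A (\<lambda>r. c * norm (g r) + 0 * norm (g r)) s"
    proof (rule cumul_bound[OF q _ st(3)])
      show "integrable M (\<lambda>r. c * norm (g r) + 0 * norm (g r))" using g_norm by simp
      show "AE r in M. s < r \<longrightarrow> r \<le> t \<longrightarrow> \<bar>q r\<bar> \<le> c * norm (g r) + 0 * norm (g r)"
        using G(2)
      proof (eventually_elim, intro impI)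
        fix r assume r: "r \<in> G" "s < r" "r \<le> t"
        have mm: "\<bar>m t - m r\<bar> \<le> m t - m s" "\<bar>m s - m r\<bar> \<le> m t - m s"
          using m_mono[of s r] m_mono[of r t] r by auto
        have Jb: "norm (J n (v x - v r)) \<le> real n * (B * (m t - m s))"
          if "x \<in> G" "\<bar>m x - m r\<bar> \<le> m t - m s" for x
        proof -
          have "norm (J n (v x - v r)) \<le> real n * norm (k (v x - v r))" by (rule J(5))
          also have "\<dots> \<le> real n * (B * \<bar>m x - m r\<bar>)" by (intro mult_left_mono kb r(1) that(1)) simp
          also have "\<dots> \<le> real n * (B * (m t - m s))" using that(2) B by (intro mult_left_mono) auto
          finally show ?thesis .
        qed
        have "q r = g r \<bullet> (J n (v t - v r) + J n (v s - v r))"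
          by (simp add: q_def w_def Jadd inner_add_right inner_diff_right)
        then have "\<bar>q r\<bar> \<le> norm (g r) * norm (J n (v t - v r) + J n (v s - v r))"
          by (simp add: Cauchy_Schwarz_ineq2)
        also have "\<dots> \<le> norm (g r) * (real n * (B * (m t - m s)) + real n * (B * (m t - m s)))"
          by (intro mult_left_mono order_trans[OF norm_triangle_ineq] add_mono Jb st mm) simp
        also have "\<dots> = c * norm (g r) + 0 * norm (g r)" by (simp add: c_def)
        finally show "\<bar>q r\<bar> \<le> c * norm (g r) + 0 * norm (g r)" .
      qed
    qed
    have Ac: "A (\<lambda>r. c * norm (g r) + 0 * norm (g r)) x = c * m x" for x
      unfolding cumul_lincomb[OF g_norm g_norm] by (simp add: m_def)
    have "\<bar>F n t - F n s\<bar> \<le> c * m t - c * m s" using le unfolding Fq Ac .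
    also have "c * m t - c * m s = (2 * real n * B) * (m t - m s)\<^sup>2"
      by (simp add: c_def power2_eq_square algebra_simps)
    finally show ?thesis .
  qed
  have const: "F n s = F n t" if st: "s \<in> G" "t \<in> G" "s \<le> t" for n s t
  proof (rule quadratic_increment_const[of m s G t "F n" "2 * real n * B"])
    show "continuous_on UNIV m" unfolding m_def by (rule continuous_cumul[OF g_norm])
    show "{s..t} \<subseteq> closure G" using st G' unfolding clG by auto
    show "\<bar>F n y - F n x\<bar> \<le> 2 * real n * B * (m y - m x)\<^sup>2" if "x \<in> G" "y \<in> G" for x y
      using quad[OF that, of n] quad[OF that(2,1), of n]
      by (cases "x \<le> y") (simp_all add: abs_minus_commute power2_commute)
  qed (use st m_mono in auto)
  have limA: "(\<lambda>n. A (\<lambda>r. g r \<bullet> J n (v r)) t) \<longlonglongrightarrow> A (\<lambda>r. g r \<bullet> v r) t" for t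
  proof (rule cumul_dominated_convergence[OF _ gJ v_inner])
    \<comment> \<open>The bound |J n x| \<le> 2 |x| and 2ab \<le> a^2 + b^2 give a majorant
      independent of n.\<close>
    show "integrable M (\<lambda>r. (norm (g r))\<^sup>2 + (norm (v r))\<^sup>2)" using g v by simp
    show "AE r in M. (\<lambda>n. g r \<bullet> J n (v r)) \<longlonglongrightarrow> g r \<bullet> v r"
      by (intro AE_I2 tendsto_intros J(6))
    have "\<bar>x \<bullet> J n y\<bar> \<le> (norm x)\<^sup>2 + (norm y)\<^sup>2" for x y n
    proof -
      have "\<bar>x \<bullet> J n y\<bar> \<le> norm x * norm (J n y)" by (rule Cauchy_Schwarz_ineq2)
      also have "\<dots> \<le> norm x * (2 * norm y)" by (intro mult_left_mono J(4)) simp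
      also have "\<dots> \<le> (norm x)\<^sup>2 + (norm y)\<^sup>2" using sum_squares_bound[of "norm x" "norm y"] by simp
      finally show ?thesis .
    qed
    then show "AE r in M. \<bar>g r \<bullet> J n (v r)\<bar> \<le> (norm (g r))\<^sup>2 + (norm (v r))\<^sup>2" for n
      by (intro AE_I2)
  qed
  have lim: "(\<lambda>n. F n t) \<longlonglongrightarrow> j (v t) \<bullet> j (v t) - 2 * A (\<lambda>r. g r \<bullet> v r) t" for t
    unfolding F_def by (intro tendsto_intros j.tendsto J(6) limA)
  have "(norm (j (v t)))\<^sup>2 - (norm (j (v s)))\<^sup>2 = 2 * (A (\<lambda>r. g r \<bullet> v r) t - A (\<lambda>r. g r \<bullet> v r) s)"
    if st: "s \<in> G" "t \<in> G" for s t
  proof -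
    have eq: "F n s = F n t" for n
    proof (cases "s \<le> t")
      case True
      show ?thesis by (rule const[OF st True])
    next
      case False
      then show ?thesis by (intro const[OF st(2,1), symmetric]) simp
    qed
    have "(\<lambda>n. F n t) \<longlonglongrightarrow> j (v s) \<bullet> j (v s) - 2 * A (\<lambda>r. g r \<bullet> v r) s"
      using lim[of s] by (simp only: eq)
    from LIMSEQ_unique[OF this lim]
    have "j (v s) \<bullet> j (v s) - 2 * A (\<lambda>r. g r \<bullet> v r) s = j (v t) \<bullet> j (v t) - 2 * A (\<lambda>r. g r \<bullet> v r) t" .
    then show ?thesis by (simp add: power2_norm_eq_inner algebra_simps)
  qed
  then show ?thesis by (intro that[OF G adm'(1)] ballI)
qed

text \<open>Continuity into H is shown on the good times G first. Between s < t some time \<tau> has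
  v(\<tau>) not much larger in V than the mean; the energy identity and the weak equation tested
  with v(\<tau>) then bound |j (v x) - j (v \<tau>)|^2 by increments of one continuous function
  \<psi>. Uniform continuity gives an extension to the closure of G, which is [0,T], and the energy
  identity follows along.\<close>

theorem continuous_representative:
  "\<exists>c. continuous_on {0..T} c \<and> (AE t in M. c t = j (v t)) \<and>
     (norm (c T))\<^sup>2 - (norm (c 0))\<^sup>2 = 2 * (\<integral>t. g t \<bullet> v t \<partial>M)"
proof -
  obtain G where G: "G \<subseteq> {0<..<T}" "AE t in M. t \<in> G" and adm': "\<forall>a\<in>G. adm G (v a)"
    and energy': "\<forall>s\<in>G. \<forall>t\<in>G.
      (norm (j (v t)))\<^sup>2 - (norm (j (v s)))\<^sup>2 = 2 * (A (\<lambda>r. g r \<bullet> v r) t - A (\<lambda>r. g r \<bullet> v r) s)"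
    by (rule energy_identity)
  note admv = adm'[rule_format] and energy = energy'[rule_format]
  have G': "G \<subseteq> {0..T}" using G(1) by auto
  have clG: "closure G = {0..T}" by (rule closure_AE_time[OF G(2) G' T])
  define gg where "gg r = (norm (g r))\<^sup>2" for r
  define vv where "vv r = (norm (v r))\<^sup>2" for r
  have gg: "integrable M gg" and vv: "integrable M vv" using g(2) v(2) by (simp_all add: gg_def[abs_def] vv_def[abs_def])
  define \<psi> where "\<psi> t = t + A gg t + A vv t" for t
  have one: "A (\<lambda>r. c) t - A (\<lambda>r. c) s = c * (t - s)" if "0 \<le> s" "s \<le> t" "t \<le> T" for s t and c :: real
    using cumul_FTC[of "\<lambda>x. c * x" "\<lambda>x. c" s t T] that cumul_diff[of T "\<lambda>r. c" s t]
    by (auto intro!: derivative_eq_intros simp: right_diff_distrib)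
  \<comment> \<open>Otherwise |v|^2 would exceed its mean over (s,t) by more than 1 at almost every
    time of the interval. The slack t - s makes the non-strict comparison of integrals
    contradictory.\<close>
  have tau: "\<exists>\<tau>\<in>G. s < \<tau> \<and> \<tau> < t \<and> (norm (v \<tau>))\<^sup>2 * (t - s) \<le> (A vv t - A vv s) + (t - s)"
    if st: "s \<in> G" "t \<in> G" "s < t" for s t
  proof (rule ccontr)
    assume no: "\<not> ?thesis"
    have st': "0 \<le> s" "t \<le> T" "s \<le> t" using st G' by auto
    define c where "c = ((A vv t - A vv s) + (t - s)) / (t - s)"
    have Avv: "A vv s \<le> A vv t" by (rule cumul_mono[OF vv _ st'(3)]) (simp add: vv_def)
    have c0: "c \<ge> 0" using Avv st(3) by (simp add: c_def)
    have ct: "c * (t - s) = (A vv t - A vv s) + (t - s)" using st(3) by (simp add: c_def)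
    have "\<bar>A (\<lambda>r. c) t - A (\<lambda>r. c) s\<bar> \<le> A vv t - A vv s"
    proof (rule cumul_bound[OF _ vv st'(3)])
      show "AE r in M. s < r \<longrightarrow> r \<le> t \<longrightarrow> \<bar>c\<bar> \<le> vv r"
        using G(2) AE_time_neq[of t T]
      proof (eventually_elim, intro impI)
        fix r assume r: "r \<in> G" "r \<noteq> t" "s < r" "r \<le> t"
        then have "\<not> (norm (v r))\<^sup>2 * (t - s) \<le> c * (t - s)" using no unfolding ct by auto
        then have "c < vv r" using st(3) by (simp add: vv_def)
        then show "\<bar>c\<bar> \<le> vv r" using c0 by simp
      qed
    qed simp
    then have "c * (t - s) \<le> A vv t - A vv s" using one[OF st'(1,3,2), of c] by simp
    then show False using ct st(3) by simp
  qed
  have close: "(norm (j (v x) - j (v \<tau>)))\<^sup>2 \<le> 2 * (\<psi> t - \<psi> s)"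
    if st: "s \<in> G" "t \<in> G" "s < t" and x: "x \<in> G" "s \<le> x" "x \<le> t"
      and \<tau>: "\<tau> \<in> G" "s < \<tau>" "\<tau> < t" "(norm (v \<tau>))\<^sup>2 * (t - s) \<le> (A vv t - A vv s) + (t - s)" for s t x \<tau>
  proof -
    have st': "0 \<le> s" "t \<le> T" "s \<le> t" using st G' by auto
    define q where "q r = 1 * (g r \<bullet> v r) + (-1) * (g r \<bullet> v \<tau>)" for r
    have q: "integrable M q" unfolding q_def[abs_def] using v_inner g_inner[of "v \<tau>"] by simp
    have Aq: "A q y = A (\<lambda>r. g r \<bullet> v r) y - A (\<lambda>r. g r \<bullet> v \<tau>) y" for y
      unfolding q_def[abs_def] cumul_lincomb[OF v_inner g_inner] by simp
    have "j (v x) \<bullet> j (v \<tau>) - j (v \<tau>) \<bullet> j (v \<tau>) = A (\<lambda>r. g r \<bullet> v \<tau>) x - A (\<lambda>r. g r \<bullet> v \<tau>) \<tau>"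
      using admv[OF \<tau>(1)] x(1) \<tau>(1) by (simp add: adm_def)
    \<comment> \<open>The difference of squared norms is covered by the energy identity, the
      remaining product by the weak equation tested with v(\<tau>).\<close>
    moreover have "(norm (j (v x) - j (v \<tau>)))\<^sup>2
        = ((norm (j (v x)))\<^sup>2 - (norm (j (v \<tau>)))\<^sup>2) - 2 * (j (v x) \<bullet> j (v \<tau>) - j (v \<tau>) \<bullet> j (v \<tau>))"
      by (simp add: power2_norm_eq_inner inner_diff_left inner_diff_right inner_commute)
    ultimately have eq: "(norm (j (v x) - j (v \<tau>)))\<^sup>2 = 2 * (A q x - A q \<tau>)"
      using energy[OF \<tau>(1) x(1)] by (simp add: Aq)
    \<comment> \<open>Young's inequality on both products in q leaves the constant |v(\<tau>)|^2 /
      2, whose integral over (s,t) the choice of \<tau> controls.\<close>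
    define c where "c = (norm (v \<tau>))\<^sup>2 / 2"
    define p where "p r = 1 * gg r + (1/2) * vv r" for r
    define \<kappa> where "\<kappa> r = 1 * p r + 1 * c" for r
    have p: "integrable M p" unfolding p_def[abs_def] using gg vv by simp
    have \<kappa>: "integrable M \<kappa>" unfolding \<kappa>_def[abs_def] using p by simp
    have A\<kappa>: "A \<kappa> y = A gg y + (1/2) * A vv y + A (\<lambda>r. c) y" for y
      unfolding \<kappa>_def[abs_def] cumul_lincomb[OF p integrable_time_const]
      unfolding p_def[abs_def] cumul_lincomb[OF gg vv] by simp
    have q\<kappa>: "\<bar>q r\<bar> \<le> \<kappa> r" for r
    proof -
      have "\<bar>q r\<bar> \<le> \<bar>g r \<bullet> v r\<bar> + \<bar>g r \<bullet> v \<tau>\<bar>" by (simp add: q_def)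
      also have "\<dots> \<le> norm (g r) * norm (v r) + norm (g r) * norm (v \<tau>)"
        by (intro add_mono Cauchy_Schwarz_ineq2)
      also have "\<dots> \<le> \<kappa> r"
        using sum_squares_bound[of "norm (g r)" "norm (v r)"] sum_squares_bound[of "norm (g r)" "norm (v \<tau>)"]
        by (simp add: \<kappa>_def p_def c_def gg_def vv_def)
      finally show ?thesis .
    qed
    have mono: "A \<kappa> y \<le> A \<kappa> z" if "y \<le> z" for y z
    proof (rule cumul_mono[OF \<kappa> _ that])
      have "0 \<le> \<kappa> r" for r using q\<kappa>[of r] by linarith
      then show "AE r in M. 0 \<le> \<kappa> r" by simp
    qed
    have "\<bar>A q x - A q \<tau>\<bar> \<le> A \<kappa> t - A \<kappa> s"
    proof (cases "\<tau> \<le> x")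
      case True
      have "\<bar>A q x - A q \<tau>\<bar> \<le> A \<kappa> x - A \<kappa> \<tau>" by (rule cumul_bound[OF q \<kappa> True]) (simp add: q\<kappa>)
      then show ?thesis using mono[of x t] mono[of s \<tau>] x \<tau> by simp
    next
      case False
      then have "x \<le> \<tau>" by simp
      have "\<bar>A q \<tau> - A q x\<bar> \<le> A \<kappa> \<tau> - A \<kappa> x" by (rule cumul_bound[OF q \<kappa> \<open>x \<le> \<tau>\<close>]) (simp add: q\<kappa>)
      then show ?thesis using mono[of \<tau> t] mono[of s x] x \<tau> by simp
    qed
    moreover have "A \<kappa> t - A \<kappa> s = (A gg t - A gg s) + (A vv t - A vv s) / 2 + c * (t - s)"
      using one[OF st'(1,3,2), of c] A\<kappa>[of t] A\<kappa>[of s] by argo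
    moreover have "c * (t - s) \<le> ((A vv t - A vv s) + (t - s)) / 2" using \<tau>(4) by (simp add: c_def)
    ultimately show ?thesis unfolding eq \<psi>_def using st(3) by argo
  qed
  have \<psi>c: "uniformly_continuous_on {0..T} \<psi>"
    unfolding \<psi>_def[abs_def]
    by (intro compact_uniformly_continuous continuous_intros continuous_on_subset[OF continuous_cumul] gg vv) auto
  have "uniformly_continuous_on G (\<lambda>t. j (v t))"
    unfolding uniformly_continuous_on_def
  proof (intro allI impI)
    fix e :: real assume e: "e > 0"
    \<comment> \<open>Through \<tau> the squared distance is at most 2 (2 \<delta>) + 2 (2 \<delta>)
      = 8 \<delta>, where \<delta> is the increment of \<psi>.\<close>
    then have "e\<^sup>2 / 8 > 0" by simp
    then obtain d where d: "d > 0" "\<forall>x\<in>{0..T}. \<forall>x'\<in>{0..T}. dist x' x < d \<longrightarrow> dist (\<psi> x') (\<psi> x) < e\<^sup>2 / 8"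
      using \<psi>c unfolding uniformly_continuous_on_def by blast
    have main: "dist (j (v t)) (j (v s)) < e" if st: "s \<in> G" "t \<in> G" "s < t" "dist t s < d" for s t
    proof -
      obtain \<tau> where \<tau>: "\<tau> \<in> G" "s < \<tau>" "\<tau> < t" "(norm (v \<tau>))\<^sup>2 * (t - s) \<le> (A vv t - A vv s) + (t - s)"
        using tau[OF st(1-3)] by blast
      have "dist (\<psi> t) (\<psi> s) < e\<^sup>2 / 8" using d(2) st G' by blast
      then have \<psi>e: "\<psi> t - \<psi> s < e\<^sup>2 / 8" unfolding dist_real_def by linarith
      have "(norm (j (v t) - j (v s)))\<^sup>2 \<le> 2 * (norm (j (v t) - j (v \<tau>)))\<^sup>2 + 2 * (norm (j (v \<tau>) - j (v s)))\<^sup>2"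
        using norm_add_sqr_le[of "j (v t) - j (v \<tau>)" "j (v \<tau>) - j (v s)"] by simp
      moreover have "(norm (j (v t) - j (v \<tau>)))\<^sup>2 \<le> 2 * (\<psi> t - \<psi> s)"
        using close[OF st(1-3) st(2) _ _ \<tau>] st(3) by simp
      moreover have "(norm (j (v \<tau>) - j (v s)))\<^sup>2 \<le> 2 * (\<psi> t - \<psi> s)"
        using close[OF st(1-3) st(1) _ _ \<tau>] st(3) by (simp add: norm_minus_commute)
      ultimately have "(norm (j (v t) - j (v s)))\<^sup>2 < e\<^sup>2" using \<psi>e by argo
      then show ?thesis unfolding dist_norm by (rule power_less_imp_less_base) (use e in simp)
    qed
    show "\<exists>d>0. \<forall>x\<in>G. \<forall>x'\<in>G. dist x' x < d \<longrightarrow> dist (j (v x')) (j (v x)) < e"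
    proof (intro exI[of _ d] conjI ballI impI d(1))
      fix s t assume st: "s \<in> G" "t \<in> G" "dist t s < d"
      show "dist (j (v t)) (j (v s)) < e"
      proof (cases s t rule: linorder_cases)
        case less
        then show ?thesis using main st by simp
      next
        case equal
        then show ?thesis using e by simp
      next
        case greater
        then show ?thesis using main[of t s] st by (simp add: dist_commute)
      qed
    qed
  qed
  then obtain c where c: "uniformly_continuous_on (closure G) c" "\<And>x. x \<in> G \<Longrightarrow> j (v x) = c x"
    by (rule uniformly_continuous_on_extension_on_closure) metis
  have cont: "continuous_on {0..T} c" using uniformly_continuous_imp_continuous[OF c(1)] by (simp add: clG)
  have AEc: "AE t in M. c t = j (v t)" using G(2) by eventually_elim (simp add: c(2))
  obtain s0 where s0: "s0 \<in> G" using AE_time_dense[OF G(2), of 0 T] T by auto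
  \<comment> \<open>The balance is constant on G and continuous, hence constant up to the end points
    0 and T, which G does not contain.\<close>
  define h where "h t = (norm (c t))\<^sup>2 - 2 * A (\<lambda>r. g r \<bullet> v r) t" for t
  have hc: "continuous_on (closure G) h"
    unfolding h_def[abs_def] clG
    by (intro continuous_intros cont continuous_on_subset[OF continuous_cumul[OF v_inner]]) auto
  have hG: "h t = h s0" if "t \<in> G" for t
    using energy[OF s0 that] c(2)[OF s0] c(2)[OF that] by (simp add: h_def)
  have "h t = h s0" if "t \<in> {0..T}" for t
    by (rule continuous_constant_on_closure[OF hc hG]) (use that clG in auto)
  then have "h T = h 0" using T by simp
  then have "(norm (c T))\<^sup>2 - (norm (c 0))\<^sup>2 = 2 * (\<integral>t. g t \<bullet> v t \<partial>M)"
    by (simp add: h_def cumul_T)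
  with cont AEc show ?thesis by blast
qed

end

subsection \<open>Integration by parts for test functions\<close>

lemma C_k_translate:
  shows "C_k k \<phi> \<Longrightarrow> C_k k (\<lambda>x. \<phi> (x + c))"
proof (induction k arbitrary: \<phi>)
  case 0
  have "continuous_on UNIV (\<phi> \<circ> (\<lambda>x. x + c))"
    using 0 by (intro continuous_on_compose continuous_intros) (auto intro: continuous_on_subset)
  then show ?case by (simp add: comp_def)
next
  case (Suc k)
  show ?case
  proof (rule C_k_cong_fd)
    fix x
    have "((\<lambda>x. x + c) has_derivative (\<lambda>h. h)) (at x)" by (auto intro!: derivative_eq_intros)
    from has_derivative_compose[OF this C_k_Suc_has_derivative[OF Suc.prems]]
    show "((\<lambda>x. \<phi> (x + c)) has_derivative frechet_derivative \<phi> (at (x + c))) (at x)" by simp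
  next
    fix b :: 'a assume "b \<in> Basis"
    with Suc.prems have "C_k k (\<lambda>x. frechet_derivative \<phi> (at x) b)" by simp
    from Suc.IH[OF this] show "C_k k (\<lambda>x. frechet_derivative \<phi> (at (x + c)) b)" .
  qed
qed

lemma test_functions_mono: "\<phi> \<in> test_functions S \<Longrightarrow> S \<subseteq> S' \<Longrightarrow> \<phi> \<in> test_functions S'"
  by (auto simp: test_functions_def)

lemma test_functions_UNIV: "\<phi> \<in> test_functions S \<Longrightarrow> \<phi> \<in> test_functions UNIV"
  by (rule test_functions_mono) auto

lemma test_functions_translate:
  assumes "\<phi> \<in> test_functions UNIV" shows "(\<lambda>x. \<phi> (x + c)) \<in> test_functions UNIV"
proof -
  obtain K where K: "compact K" "\<And>x. x \<notin> K \<Longrightarrow> \<phi> x = 0"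
    using assms by (auto simp: test_functions_def)
  have "compact ((\<lambda>x. x - c) ` K)" using compact_translation[OF K(1), of "- c"] by (simp add: add.commute)
  moreover have "\<phi> (x + c) = 0" if "x \<notin> (\<lambda>x. x - c) ` K" for x
  proof (rule K(2))
    show "x + c \<notin> K" using that by (auto simp: image_iff)
  qed
  ultimately show ?thesis
    using C_k_translate[OF test_functions_Ck[OF assms]] by (auto simp: test_functions_def)
qed

lemma test_functions_bounded_support:
  assumes "\<phi> \<in> test_functions S" obtains R where "R > 0" "\<And>x. norm x > R \<Longrightarrow> \<phi> x = 0"
proof -
  obtain K where K: "compact K" "\<And>x. x \<notin> K \<Longrightarrow> \<phi> x = 0"
    using assms by (auto simp: test_functions_def)
  obtain R where "R > 0" "\<forall>x\<in>K. norm x \<le> R" using compact_imp_bounded[OF K(1)] bounded_pos by blast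
  then show ?thesis using that K(2) by (metis not_le)
qed

lemma test_functions_integrable_mult:
  fixes \<phi> \<theta> :: "'a::euclidean_space \<Rightarrow> real"
  assumes \<phi>: "\<phi> \<in> test_functions S" and \<theta>: "continuous_on UNIV \<theta>"
  shows "integrable lborel (\<lambda>x. \<theta> x * \<phi> x)"
proof -
  obtain K where K: "compact K" "\<And>x. x \<notin> K \<Longrightarrow> \<phi> x = 0"
    using \<phi> by (auto simp: test_functions_def)
  have "integrable lborel (\<lambda>x. indicator K x *\<^sub>R (\<theta> x * \<phi> x))"
    by (intro borel_integrable_compact K continuous_intros test_functions_continuous[OF \<phi>]
        continuous_on_subset[OF \<theta>]) auto
  moreover have "(\<lambda>x. indicator K x *\<^sub>R (\<theta> x * \<phi> x)) = (\<lambda>x. \<theta> x * \<phi> x)"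
    using K(2) by (auto simp: indicator_def fun_eq_iff)
  ultimately show ?thesis by (simp only:)
qed

lemma lborel_integral_translate:
  fixes f :: "'a::euclidean_space \<Rightarrow> real"
  assumes "f \<in> borel_measurable borel"
  shows "(\<integral>x. f (x + c) \<partial>lborel) = (\<integral>x. f x \<partial>lborel)"
proof -
  have "(\<integral>x. f x \<partial>lborel) = (\<integral>x. f x \<partial>distr lborel borel ((+) c))"
    by (simp add: lborel_distr_plus)
  also have "\<dots> = (\<integral>x. f (c + x) \<partial>lborel)"
    using assms by (intro integral_distr) auto
  finally show ?thesis by (simp add: add.commute)
qed

lemma test_functions_frechet_uminus:
  assumes "\<phi> \<in> test_functions S"
  shows "frechet_derivative \<phi> (at x) (- b) = - frechet_derivative \<phi> (at x) b"
  by (rule linear_neg) (rule has_derivative_linear[OF test_functions_has_derivative[OF assms]])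

text \<open>Dominated convergence: the mean value theorem bounds the quotients uniformly, and shifts
  of length at most 1 keep them supported in one ball. Negative coordinate directions are included
  because moving a quotient to the other factor reverses the shift.\<close>

lemma difference_quotient_tendsto:
  fixes \<phi> \<theta> :: "'a::euclidean_space \<Rightarrow> real"
  assumes \<phi>: "\<phi> \<in> test_functions UNIV" and \<theta>: "continuous_on UNIV \<theta>" "\<And>x. \<bar>\<theta> x\<bar> \<le> C"
    and u: "u \<in> Basis \<or> - u \<in> Basis"
  shows "(\<lambda>n. \<integral>x. \<theta> x * ((\<phi> (x + (1 / real (Suc n)) *\<^sub>R u) - \<phi> x) * real (Suc n)) \<partial>lborel)
    \<longlonglongrightarrow> (\<integral>x. \<theta> x * frechet_derivative \<phi> (at x) u \<partial>lborel)"
proof -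
  let ?D = "\<lambda>x. frechet_derivative \<phi> (at x) u"
  have Dtest: "?D \<in> test_functions UNIV \<or> (\<lambda>x. - ?D x) \<in> test_functions UNIV"
    using u
  proof
    assume "- u \<in> Basis"
    then have "(\<lambda>x. frechet_derivative \<phi> (at x) (- u)) \<in> test_functions UNIV"
      by (rule test_functions_frechet[OF \<phi>])
    then show ?thesis by (simp add: test_functions_frechet_uminus[OF \<phi>])
  qed (simp add: test_functions_frechet[OF \<phi>])
  then obtain B where B: "B > 0" "\<And>x. \<bar>?D x\<bar> \<le> B"
  proof
    assume "?D \<in> test_functions UNIV"
    then show ?thesis using that test_functions_bounded by (metis real_norm_def)
  next
    assume "(\<lambda>x. - ?D x) \<in> test_functions UNIV"
    then obtain B where "B > 0" "\<And>x. norm (- ?D x) \<le> B" by (rule test_functions_bounded) blast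
    then show ?thesis using that by simp
  qed
  have Dm: "?D \<in> borel_measurable borel"
  proof -
    have "?D \<in> borel_measurable borel \<or> (\<lambda>x. - ?D x) \<in> borel_measurable borel"
      using Dtest test_functions_continuous borel_measurable_continuous_onI by metis
    then show ?thesis by (auto dest: borel_measurable_uminus)
  qed
  have \<theta>m: "\<theta> \<in> borel_measurable borel" using \<theta>(1) by (rule borel_measurable_continuous_onI)
  have \<phi>m: "\<phi> \<in> borel_measurable borel"
    using test_functions_continuous[OF \<phi>] by (rule borel_measurable_continuous_onI)
  obtain R where R: "R > 0" "\<And>x. norm x > R \<Longrightarrow> \<phi> x = 0" by (rule test_functions_bounded_support[OF \<phi>]) blast
  have nu: "norm u = 1" using u norm_Basis[of u] norm_Basis[of "- u"] by auto
  have line: "((\<lambda>t. \<phi> (x + t *\<^sub>R u)) has_real_derivative ?D (x + t *\<^sub>R u)) (at t)" for x t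
  proof -
    have lin: "frechet_derivative \<phi> (at y) (h *\<^sub>R u) = ?D y * h" for y h
      using linear_scale[OF has_derivative_linear[OF test_functions_has_derivative[OF \<phi>]], of y h u]
      by simp
    have "((\<lambda>t. x + t *\<^sub>R u) has_derivative (\<lambda>h. h *\<^sub>R u)) (at t)"
      by (auto intro!: derivative_eq_intros)
    from has_derivative_compose[OF this test_functions_has_derivative[OF \<phi>]]
    show ?thesis unfolding lin by (simp add: has_field_derivative_def)
  qed
  let ?q = "\<lambda>n x. (\<phi> (x + (1 / real (Suc n)) *\<^sub>R u) - \<phi> x) * real (Suc n)"
  have qlim: "(\<lambda>n. ?q n x) \<longlonglongrightarrow> ?D x" for x
  proof -
    have "((\<lambda>h. (\<phi> (x + h *\<^sub>R u) - \<phi> x) / h) \<longlongrightarrow> ?D x) (at 0)"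
      using line[of x 0] by (simp add: DERIV_def)
    moreover have "filterlim (\<lambda>n. 1 / real (Suc n)) (at 0) sequentially"
      using LIMSEQ_inverse_real_of_nat by (simp add: filterlim_at inverse_eq_divide)
    ultimately have "(\<lambda>n. (\<phi> (x + (1 / real (Suc n)) *\<^sub>R u) - \<phi> x) / (1 / real (Suc n))) \<longlonglongrightarrow> ?D x"
      by (rule filterlim_compose)
    then show ?thesis by simp
  qed
  have qB: "\<bar>?q n x\<bar> \<le> B" for n x
  proof -
    have "\<exists>z::real. z > 0 \<and> z < 1 / real (Suc n) \<and>
        \<phi> (x + (1 / real (Suc n)) *\<^sub>R u) - \<phi> (x + 0 *\<^sub>R u) = (1 / real (Suc n) - 0) * ?D (x + z *\<^sub>R u)"
      by (rule MVT2) (use line in auto)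
    then obtain z where "\<phi> (x + (1 / real (Suc n)) *\<^sub>R u) - \<phi> x = (1 / real (Suc n)) * ?D (x + z *\<^sub>R u)"
      by auto
    then have "?q n x = ?D (x + z *\<^sub>R u)" by simp
    then show ?thesis using B(2) by simp
  qed
  have q0: "?q n x = 0" if "norm x > R + 1" for n x
  proof -
    define h where "h = (1 / real (Suc n)) *\<^sub>R u"
    have "norm h \<le> 1" using nu by (simp add: h_def)
    then have "norm (x + h) > R"
      using norm_triangle_ineq4[of "x + h" h] that by simp
    then have "norm (x + (1 / real (Suc n)) *\<^sub>R u) > R" by (simp only: h_def)
    then show ?thesis using R(2)[of x] R(2)[of "x + (1 / real (Suc n)) *\<^sub>R u"] that by simp
  qed
  show ?thesis
  proof (rule integral_dominated_convergence[where w = "\<lambda>x. C * B * indicator (cball 0 (R + 1)) x"])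
    show "integrable lborel (\<lambda>x::'a. C * B * indicator (cball 0 (R + 1)) x)"
      using emeasure_bounded_finite[of "cball (0::'a) (R + 1)"] by (auto simp: integrable_indicator_iff)
    show "AE x in lborel. (\<lambda>n. \<theta> x * ?q n x) \<longlonglongrightarrow> \<theta> x * ?D x"
      by (intro AE_I2 tendsto_mult tendsto_const qlim)
    show "AE x in lborel. norm (\<theta> x * ?q n x) \<le> C * B * indicator (cball 0 (R + 1)) x" for n
    proof (intro AE_I2)
      fix x
      show "norm (\<theta> x * ?q n x) \<le> C * B * indicator (cball 0 (R + 1)) x"
      proof (cases "norm x > R + 1")
        case True
        then show ?thesis by (simp only: q0[OF True]) simp
      next
        case False
        have "\<bar>\<theta> x\<bar> * \<bar>?q n x\<bar> \<le> C * B" by (rule mult_mono[OF \<theta>(2) qB]) (use \<theta>(2)[of x] in auto)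
        then show ?thesis using False by (simp add: abs_mult)
      qed
    qed
    show "(\<lambda>x. \<theta> x * ?D x) \<in> borel_measurable lborel" using Dm \<theta>m by simp
    show "(\<lambda>x. \<theta> x * ?q n x) \<in> borel_measurable lborel" for n using \<phi>m \<theta>m by measurable
  qed
qed

text \<open>Translation invariance makes the integral of every difference quotient 0.\<close>

lemma integral_partial_deriv_0:
  fixes \<phi> :: "'a::euclidean_space \<Rightarrow> real"
  assumes \<phi>: "\<phi> \<in> test_functions S" and b: "b \<in> Basis"
  shows "(\<integral>x. frechet_derivative \<phi> (at x) b \<partial>lborel) = 0"
proof -
  have \<phi>U: "\<phi> \<in> test_functions UNIV" by (rule test_functions_UNIV[OF \<phi>])
  have int: "integrable lborel \<psi>" if "\<psi> \<in> test_functions UNIV" for \<psi> :: "'a \<Rightarrow> real"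
    using test_functions_integrable_mult[OF that, of "\<lambda>x. 1"] by simp
  have m: "\<phi> \<in> borel_measurable borel"
    using test_functions_continuous[OF \<phi>] by (rule borel_measurable_continuous_onI)
  have "(\<lambda>n. \<integral>x. 1 * ((\<phi> (x + (1 / real (Suc n)) *\<^sub>R b) - \<phi> x) * real (Suc n)) \<partial>lborel)
    \<longlonglongrightarrow> (\<integral>x. 1 * frechet_derivative \<phi> (at x) b \<partial>lborel)"
    by (rule difference_quotient_tendsto[OF \<phi>U, of _ 1]) (use b in auto)
  moreover have "(\<integral>x. 1 * ((\<phi> (x + c) - \<phi> x) * k) \<partial>lborel) = 0" for c k
    using int[OF \<phi>U] int[OF test_functions_translate[OF \<phi>U, of c]] lborel_integral_translate[OF m, of c]
    by simp
  ultimately have "(\<lambda>n::nat. 0) \<longlonglongrightarrow> (\<integral>x. 1 * frechet_derivative \<phi> (at x) b \<partial>lborel)"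
    by (simp only:)
  then show ?thesis by (simp add: LIMSEQ_const_iff)
qed

lemma frechet_derivative_mult:
  fixes \<phi> \<psi> :: "'a::euclidean_space \<Rightarrow> real"
  assumes "\<phi> differentiable at x" "\<psi> differentiable at x"
  shows "frechet_derivative (\<lambda>x. \<phi> x * \<psi> x) (at x) b
    = \<phi> x * frechet_derivative \<psi> (at x) b + frechet_derivative \<phi> (at x) b * \<psi> x"
proof -
  have "((\<lambda>x. \<phi> x * \<psi> x) has_derivative
      (\<lambda>h. \<phi> x * frechet_derivative \<psi> (at x) h + frechet_derivative \<phi> (at x) h * \<psi> x)) (at x)"
    by (intro has_derivative_mult) (use assms frechet_derivative_works in auto)
  from frechet_derivative_at[OF this] show ?thesis by metis
qed

lemma test_functions_differentiable: "\<phi> \<in> test_functions S \<Longrightarrow> \<phi> differentiable at x"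
  using test_functions_has_derivative differentiable_def by blast

text \<open>Compact support is asked of one factor only; the other is the coordinate function in the
  proof of Poincare's inequality.\<close>

lemma partial_integration:
  fixes \<phi> \<psi> :: "'a::euclidean_space \<Rightarrow> real"
  assumes \<phi>: "\<phi> \<in> test_functions S" and \<psi>: "\<And>k. C_k k \<psi>" and b: "b \<in> Basis"
  shows "(\<integral>x. frechet_derivative \<psi> (at x) b * \<phi> x \<partial>lborel)
    = - (\<integral>x. \<psi> x * frechet_derivative \<phi> (at x) b \<partial>lborel)"
proof -
  have \<psi>d: "\<psi> differentiable at x" for x using \<psi>[of "Suc 0"] by simp
  have \<psi>c: "continuous_on UNIV \<psi>" using \<psi>[of 0] by simp
  have \<psi>'c: "continuous_on UNIV (\<lambda>x. frechet_derivative \<psi> (at x) b)"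
    using \<psi>[of "Suc 0"] b by simp
  have "(\<integral>x. frechet_derivative (\<lambda>x. \<psi> x * \<phi> x) (at x) b \<partial>lborel) = 0"
    by (rule integral_partial_deriv_0[OF test_functions_mult[OF \<phi> \<psi>] b])
  then have "(\<integral>x. \<psi> x * frechet_derivative \<phi> (at x) b + frechet_derivative \<psi> (at x) b * \<phi> x \<partial>lborel) = 0"
    by (simp only: frechet_derivative_mult[OF \<psi>d test_functions_differentiable[OF \<phi>]])
  moreover have "integrable lborel (\<lambda>x. \<psi> x * frechet_derivative \<phi> (at x) b)"
    by (rule test_functions_integrable_mult[OF test_functions_frechet[OF \<phi> b] \<psi>c])
  moreover have "integrable lborel (\<lambda>x. frechet_derivative \<psi> (at x) b * \<phi> x)"
    by (rule test_functions_integrable_mult[OF \<phi> \<psi>'c])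
  ultimately show ?thesis by simp
qed

text \<open>A difference quotient is moved from one factor to the other.\<close>
lemma integral_partial_derivs_swap:
  fixes \<phi> \<psi> :: "'a::euclidean_space \<Rightarrow> real"
  assumes \<phi>': "\<phi> \<in> test_functions S" and \<psi>': "\<psi> \<in> test_functions S" and a: "a \<in> Basis" and b: "b \<in> Basis"
  shows "(\<integral>x. frechet_derivative \<phi> (at x) a * frechet_derivative \<psi> (at x) b \<partial>lborel)
    = (\<integral>x. frechet_derivative \<phi> (at x) b * frechet_derivative \<psi> (at x) a \<partial>lborel)"
proof -
  have \<phi>: "\<phi> \<in> test_functions UNIV" and \<psi>: "\<psi> \<in> test_functions UNIV"
    using \<phi>' \<psi>' test_functions_UNIV by auto
  let ?\<phi>a = "\<lambda>x. frechet_derivative \<phi> (at x) a" and ?\<psi>a = "\<lambda>x. frechet_derivative \<psi> (at x) a"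
  have \<phi>a: "?\<phi>a \<in> test_functions UNIV" and \<psi>a: "?\<psi>a \<in> test_functions UNIV"
    by (rule test_functions_frechet[OF \<phi> a] test_functions_frechet[OF \<psi> a])+
  obtain C1 where C1: "C1 > 0" "\<And>x. norm (?\<phi>a x) \<le> C1" by (rule test_functions_bounded[OF \<phi>a]) blast
  obtain C2 where C2: "C2 > 0" "\<And>x. norm (?\<psi>a x) \<le> C2" by (rule test_functions_bounded[OF \<psi>a]) blast
  have lim1: "(\<lambda>n. \<integral>x. ?\<phi>a x * ((\<psi> (x + (1 / real (Suc n)) *\<^sub>R b) - \<psi> x) * real (Suc n)) \<partial>lborel)
    \<longlonglongrightarrow> (\<integral>x. ?\<phi>a x * frechet_derivative \<psi> (at x) b \<partial>lborel)"
    by (rule difference_quotient_tendsto[OF \<psi> test_functions_continuous[OF \<phi>a]]) (use b C1 in auto)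
  have lim2: "(\<lambda>n. \<integral>x. ?\<psi>a x * ((\<phi> (x + (1 / real (Suc n)) *\<^sub>R (- b)) - \<phi> x) * real (Suc n)) \<partial>lborel)
    \<longlonglongrightarrow> (\<integral>x. ?\<psi>a x * frechet_derivative \<phi> (at x) (- b) \<partial>lborel)"
    by (rule difference_quotient_tendsto[OF \<phi> test_functions_continuous[OF \<psi>a]]) (use b C2 in auto)
  \<comment> \<open>Partial integration in direction a before and after a translation by h; the
    derivative in direction b is still a difference quotient, so no second derivatives
    appear.\<close>
  have eq: "(\<integral>x. ?\<phi>a x * ((\<psi> (x + h) - \<psi> x) * k) \<partial>lborel)
      = - (\<integral>x. ?\<psi>a x * ((\<phi> (x - h) - \<phi> x) * k) \<partial>lborel)" for h k
  proof -
    define \<psi>h where "\<psi>h x = \<psi> (x + h)" for x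
    have \<psi>h: "\<psi>h \<in> test_functions UNIV"
      unfolding \<psi>h_def[abs_def] by (rule test_functions_translate[OF \<psi>])
    have d\<psi>h: "frechet_derivative \<psi>h (at x) a = ?\<psi>a (x + h)" for x
    proof -
      have "((\<lambda>x. x + h) has_derivative (\<lambda>h. h)) (at x)" by (auto intro!: derivative_eq_intros)
      from has_derivative_compose[OF this test_functions_has_derivative[OF \<psi>]]
      have "(\<psi>h has_derivative frechet_derivative \<psi> (at (x + h))) (at x)" by (simp add: \<psi>h_def[abs_def])
      from frechet_derivative_at[OF this] show ?thesis by metis
    qed
    have int: "integrable lborel (\<lambda>x. \<alpha> x * \<beta> x)" if "\<alpha> \<in> test_functions UNIV" "\<beta> \<in> test_functions UNIV"
      for \<alpha> \<beta> :: "'a \<Rightarrow> real"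
      by (rule test_functions_integrable_mult[OF that(2) test_functions_continuous[OF that(1)]])
    have \<phi>h: "(\<lambda>x. \<phi> (x - h)) \<in> test_functions UNIV"
      using test_functions_translate[OF \<phi>, of "- h"] by simp
    have p1: "(\<integral>x. ?\<phi>a x * \<psi>h x \<partial>lborel) = - (\<integral>x. ?\<psi>a x * \<phi> (x - h) \<partial>lborel)"
    proof -
      have "(\<integral>x. ?\<phi>a x * \<psi>h x \<partial>lborel) = - (\<integral>x. \<phi> x * ?\<psi>a (x + h) \<partial>lborel)"
        using partial_integration[OF \<psi>h test_functions_Ck[OF \<phi>] a] by (simp only: d\<psi>h)
      also have "(\<integral>x. \<phi> x * ?\<psi>a (x + h) \<partial>lborel) = (\<integral>x. \<phi> (x + h - h) * ?\<psi>a (x + h) \<partial>lborel)" by simp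
      also have "\<dots> = (\<integral>x. \<phi> (x - h) * ?\<psi>a x \<partial>lborel)"
        by (rule lborel_integral_translate)
          (intro borel_measurable_continuous_onI continuous_on_mult test_functions_continuous[OF \<phi>h] test_functions_continuous[OF \<psi>a])
      finally show ?thesis by (simp only: mult.commute)
    qed
    have p2: "(\<integral>x. ?\<phi>a x * \<psi> x \<partial>lborel) = - (\<integral>x. ?\<psi>a x * \<phi> x \<partial>lborel)"
      using partial_integration[OF \<psi> test_functions_Ck[OF \<phi>] a] by (simp only: mult.commute)
    have "(\<integral>x. ?\<phi>a x * ((\<psi> (x + h) - \<psi> x) * k) \<partial>lborel) = (\<integral>x. k * (?\<phi>a x * \<psi>h x - ?\<phi>a x * \<psi> x) \<partial>lborel)"
      by (intro Bochner_Integration.integral_cong) (auto simp: \<psi>h_def algebra_simps)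
    also have "\<dots> = k * ((\<integral>x. ?\<phi>a x * \<psi>h x \<partial>lborel) - (\<integral>x. ?\<phi>a x * \<psi> x \<partial>lborel))"
      using int[OF \<phi>a \<psi>h] int[OF \<phi>a \<psi>] by simp
    also have "\<dots> = - (k * ((\<integral>x. ?\<psi>a x * \<phi> (x - h) \<partial>lborel) - (\<integral>x. ?\<psi>a x * \<phi> x \<partial>lborel)))"
      unfolding p1 p2 by (simp add: algebra_simps)
    also have "k * ((\<integral>x. ?\<psi>a x * \<phi> (x - h) \<partial>lborel) - (\<integral>x. ?\<psi>a x * \<phi> x \<partial>lborel))
        = (\<integral>x. k * (?\<psi>a x * \<phi> (x - h) - ?\<psi>a x * \<phi> x) \<partial>lborel)"
      using int[OF \<psi>a \<phi>h] int[OF \<psi>a \<phi>] by simp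
    also have "\<dots> = (\<integral>x. ?\<psi>a x * ((\<phi> (x - h) - \<phi> x) * k) \<partial>lborel)"
      by (intro Bochner_Integration.integral_cong) (auto simp: algebra_simps)
    finally show ?thesis .
  qed
  have "(\<lambda>n. - (\<integral>x. ?\<psi>a x * ((\<phi> (x + (1 / real (Suc n)) *\<^sub>R (- b)) - \<phi> x) * real (Suc n)) \<partial>lborel))
    \<longlonglongrightarrow> (\<integral>x. ?\<phi>a x * frechet_derivative \<psi> (at x) b \<partial>lborel)"
    using lim1 unfolding eq by simp
  from LIMSEQ_unique[OF this tendsto_minus[OF lim2]]
  have "(\<integral>x. ?\<phi>a x * frechet_derivative \<psi> (at x) b \<partial>lborel)
      = - (\<integral>x. ?\<psi>a x * frechet_derivative \<phi> (at x) (- b) \<partial>lborel)" .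
  then show ?thesis
    by (simp add: test_functions_frechet_uminus[OF \<phi>] mult.commute)
qed

text \<open>The vector field \<open>x \<mapsto> (x \<bullet> b) b\<close> has divergence \<open>1\<close>, so
  \<open>\<integral>\<phi>\<^sup>2 = - 2 \<integral> \<phi> (\<partial>\<^sub>b \<phi>) (x \<bullet> b)\<close>.\<close>
lemma Poincare_test:
  fixes \<phi> :: "'a::euclidean_space \<Rightarrow> real"
  assumes \<phi>: "\<phi> \<in> test_functions S" and S: "S \<subseteq> cball 0 R" and b: "b \<in> Basis"
  shows "(\<integral>x. (\<phi> x)\<^sup>2 \<partial>lborel) \<le> 4 * R\<^sup>2 * (\<integral>x. (frechet_derivative \<phi> (at x) b)\<^sup>2 \<partial>lborel)"
proof -
  let ?D = "\<lambda>x. frechet_derivative \<phi> (at x) b"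
  have D: "?D \<in> test_functions S" by (rule test_functions_frechet[OF \<phi> b])
  have int: "integrable lborel (\<lambda>x. \<alpha> x * \<beta> x)" if "\<alpha> \<in> test_functions S" "\<beta> \<in> test_functions S"
    for \<alpha> \<beta> :: "'a \<Rightarrow> real"
    by (rule test_functions_integrable_mult[OF that(2) test_functions_continuous[OF that(1)]])
  define l where "l x = x \<bullet> b" for x :: 'a
  have "C_k k (\<lambda>x::real. x)" for k
    by (rule C_k_SucD) (rule C_k_real_derivI[where f' = "\<lambda>x. 1"], auto intro: C_k_const)
  from C_k_affine[OF this, of _ b 0] have l: "C_k k l" for k by (simp add: l_def[abs_def])
  have "(l has_derivative (\<lambda>h. h \<bullet> b)) (at x)" for x
    unfolding l_def[abs_def] by (auto intro!: derivative_eq_intros)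
  then have dl: "frechet_derivative l (at x) b = 1" for x
    using frechet_derivative_at[of l "\<lambda>h. h \<bullet> b" x] b by (metis inner_same_Basis)
  define \<phi>2 where "\<phi>2 x = \<phi> x * \<phi> x" for x
  have \<phi>2: "\<phi>2 \<in> test_functions S"
    unfolding \<phi>2_def[abs_def] by (rule test_functions_mult[OF \<phi> test_functions_Ck[OF \<phi>]])
  have d\<phi>2: "frechet_derivative \<phi>2 (at x) b = 2 * (\<phi> x * ?D x)" for x
    unfolding \<phi>2_def[abs_def]
    by (subst frechet_derivative_mult) (simp_all add: test_functions_differentiable[OF \<phi>])
  have "(\<integral>x. frechet_derivative l (at x) b * \<phi>2 x \<partial>lborel) = - (\<integral>x. l x * frechet_derivative \<phi>2 (at x) b \<partial>lborel)"
    by (rule partial_integration[OF \<phi>2 l b])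
  then have eq: "(\<integral>x. (\<phi> x)\<^sup>2 \<partial>lborel) = (\<integral>x. - (l x * (2 * (\<phi> x * ?D x))) \<partial>lborel)"
    by (simp add: dl d\<phi>2 \<phi>2_def power2_eq_square)
  have i1: "integrable lborel (\<lambda>x. (\<phi> x)\<^sup>2)" using int[OF \<phi> \<phi>] by (simp add: power2_eq_square)
  have i2: "integrable lborel (\<lambda>x. (?D x)\<^sup>2)" using int[OF D D] by (simp add: power2_eq_square)
  have "integrable lborel (\<lambda>x. l x * (?D x * \<phi> x))"
  proof -
    have "(\<lambda>x. ?D x * \<phi> x) \<in> test_functions S" by (rule test_functions_mult[OF \<phi> test_functions_Ck[OF D]])
    moreover have "continuous_on UNIV l" using l[of 0] by simp
    ultimately show ?thesis by (rule test_functions_integrable_mult)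
  qed
  then have i3: "integrable lborel (\<lambda>x. - (l x * (2 * (\<phi> x * ?D x))))"
    using integrable_mult_right[of "-2" lborel "\<lambda>x. l x * (?D x * \<phi> x)"] by (simp add: ac_simps)
  \<comment> \<open>Young's inequality with weights 1/2 and 2: half of the integral of \<phi>^2 is
    absorbed on the left, which doubles 2 R^2 to 4 R^2.\<close>
  have "(\<integral>x. - (l x * (2 * (\<phi> x * ?D x))) \<partial>lborel) \<le> (\<integral>x. (\<phi> x)\<^sup>2 / 2 + 2 * R\<^sup>2 * (?D x)\<^sup>2 \<partial>lborel)"
  proof (rule integral_mono[OF i3])
    show "integrable lborel (\<lambda>x. (\<phi> x)\<^sup>2 / 2 + 2 * R\<^sup>2 * (?D x)\<^sup>2)" using i1 i2 by simp
    fix x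
    show "- (l x * (2 * (\<phi> x * ?D x))) \<le> (\<phi> x)\<^sup>2 / 2 + 2 * R\<^sup>2 * (?D x)\<^sup>2"
    proof (cases "x \<in> S")
      case True
      then have "norm x \<le> R" using S by auto
      then have "\<bar>l x\<bar> \<le> R" using Basis_le_norm[OF b, of x] by (simp add: l_def)
      then have "(l x)\<^sup>2 \<le> R\<^sup>2" by (simp add: power2_le_iff_abs_le)
      then have "2 * (l x)\<^sup>2 * (?D x)\<^sup>2 \<le> 2 * R\<^sup>2 * (?D x)\<^sup>2" by (intro mult_right_mono) auto
      moreover have "0 \<le> (\<phi> x + 2 * l x * ?D x)\<^sup>2 / 2" by simp
      ultimately show ?thesis by (simp add: power2_sum power_mult_distrib algebra_simps)
    next
      case False
      then have "\<phi> x = 0" using \<phi> by (auto simp: test_functions_def)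
      then show ?thesis by simp
    qed
  qed
  also have "\<dots> = (\<integral>x. (\<phi> x)\<^sup>2 \<partial>lborel) / 2 + 2 * R\<^sup>2 * (\<integral>x. (?D x)\<^sup>2 \<partial>lborel)"
    using i1 i2 by simp
  finally show ?thesis unfolding eq[symmetric] by simp
qed

subsection \<open>Weak gradients\<close>

lemma axis_in_Basis [simp]: "axis i (1::real) \<in> Basis"
  by (simp add: axis_in_Basis_iff)

lemma inner_matrix_unit: "A \<bullet> axis i (axis k (1::real)) = A $ i $ k"
  by (simp add: inner_axis)

lemma C_k_vec_nth:
  fixes \<phi> :: "'a::euclidean_space \<Rightarrow> real^'n"
  shows "C_k k \<phi> \<Longrightarrow> C_k k (\<lambda>x. \<phi> x $ i)"
proof (induction k arbitrary: \<phi>)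
  case 0
  then show ?case by (auto intro!: continuous_intros)
next
  case (Suc k)
  show ?case
  proof (rule C_k_cong_fd)
    show "((\<lambda>x. \<phi> x $ i) has_derivative (\<lambda>h. frechet_derivative \<phi> (at x) h $ i)) (at x)" for x
      by (rule bounded_linear.has_derivative[OF bounded_linear_vec_nth C_k_Suc_has_derivative[OF Suc.prems]])
  next
    fix b :: 'a assume "b \<in> Basis"
    with Suc.prems have "C_k k (\<lambda>x. frechet_derivative \<phi> (at x) b)" by simp
    from Suc.IH[OF this] show "C_k k (\<lambda>x. frechet_derivative \<phi> (at x) b $ i)" .
  qed
qed

lemma test_functions_vec_nth:
  fixes \<phi> :: "'a::euclidean_space \<Rightarrow> real^'n"
  assumes "\<phi> \<in> test_functions S"
  shows "(\<lambda>x. \<phi> x $ i) \<in> test_functions S"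
proof -
  obtain K where "compact K" "K \<subseteq> S" "\<forall>x. x \<notin> K \<longrightarrow> \<phi> x = 0"
    using assms by (auto simp: test_functions_def)
  then have "\<exists>K. compact K \<and> K \<subseteq> S \<and> (\<forall>x. x \<notin> K \<longrightarrow> \<phi> x $ i = 0)"
    by (intro exI[of _ K]) auto
  then show ?thesis using C_k_vec_nth[OF test_functions_Ck[OF assms]] by (simp add: test_functions_def)
qed

definition classical_grad :: "(real^'d \<Rightarrow> real^'d) \<Rightarrow> real^'d \<Rightarrow> real^'d^'d" where
  "classical_grad \<phi> x = (\<chi> i k. frechet_derivative (\<lambda>x. \<phi> x $ i) (at x) (axis k 1))"

locale bounded_open =
  fixes \<Omega> :: "(real^'d) set"
  assumes open_dom: "open \<Omega>" and bounded_dom: "bounded \<Omega>"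
begin

abbreviation "L \<equiv> lebesgue_on \<Omega>"

lemma dom: "\<Omega> \<in> sets lebesgue"
  using open_dom by simp

lemma finite_L: "finite_measure L"
  using bounded_dom dom by (intro finite_measure_lebesgue_on bounded_set_imp_lmeasurable)

lemma L2_integrable:
  fixes f :: "real^'d \<Rightarrow> real"
  assumes "f \<in> L2_space L"
  shows "integrable L f"
proof -
  interpret finite_measure L by (rule finite_L)
  have "(\<lambda>x. 1::real) \<in> L2_space L" by (simp add: L2_space_def)
  from L2_space_inner_integrable[OF assms this] show ?thesis by simp
qed

lemma bounded_L2:
  fixes f :: "real^'d \<Rightarrow> 'b::euclidean_space"
  assumes "f \<in> borel_measurable L" "\<And>x. norm (f x) \<le> B"
  shows "f \<in> L2_space L"
proof (rule L2_space_bound[OF assms(1)])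
  interpret finite_measure L by (rule finite_L)
  show "integrable L (\<lambda>x. B\<^sup>2)" by simp
  show "AE x in L. (norm (f x))\<^sup>2 \<le> B\<^sup>2" using assms(2) by (intro AE_I2 power_mono) auto
qed

lemma test_L2:
  assumes "\<phi> \<in> test_functions S" shows "\<phi> \<in> L2_space L"
proof -
  obtain B where "\<forall>x. norm (\<phi> x) \<le> B" using test_functions_bounded[OF assms] by metis
  then show ?thesis by (intro bounded_L2[OF test_functions_borel[OF assms]]) auto
qed

lemma integral_L_lborel:
  fixes f :: "real^'d \<Rightarrow> real"
  assumes "f \<in> borel_measurable borel" "\<And>x. x \<notin> \<Omega> \<Longrightarrow> f x = 0"
  shows "(\<integral>x. f x \<partial>L) = (\<integral>x. f x \<partial>lborel)"
proof -
  have "(\<integral>x. f x \<partial>L) = (\<integral>x. indicator \<Omega> x *\<^sub>R f x \<partial>lebesgue)"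
    using dom by (intro integral_restrict_space) auto
  also have "\<dots> = (\<integral>x. f x \<partial>lebesgue)"
    using assms(2) by (intro Bochner_Integration.integral_cong) (auto simp: indicator_def)
  also have "\<dots> = (\<integral>x. f x \<partial>lborel)" using assms(1) by (intro integral_completion) simp
  finally show ?thesis .
qed

text \<open>\<open>test_mat\<close> is \<psi> times the matrix unit at (i,k), and this is its
  row-wise divergence; with both, weak gradients are expressed by inner products in
  \<open>l2\<close>.\<close>

definition test_div :: "(real^'d \<Rightarrow> real) \<Rightarrow> 'd \<Rightarrow> 'd \<Rightarrow> real^'d \<Rightarrow> real^'d" where
  "test_div \<psi> i k x = frechet_derivative \<psi> (at x) (axis k 1) *\<^sub>R axis i 1"

definition test_mat :: "(real^'d \<Rightarrow> real) \<Rightarrow> 'd \<Rightarrow> 'd \<Rightarrow> real^'d \<Rightarrow> real^'d^'d" where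
  "test_mat \<psi> i k x = \<psi> x *\<^sub>R axis i (axis k 1)"

lemma scaleR_const_L2:
  fixes f :: "real^'d \<Rightarrow> real" and c :: "'b::euclidean_space"
  assumes "f \<in> L2_space L" shows "(\<lambda>x. f x *\<^sub>R c) \<in> L2_space L"
proof -
  have "linear (\<lambda>t::real. t *\<^sub>R c)" by (rule linearI) (auto simp: scaleR_add_left)
  then show ?thesis by (rule L2_space_linear[OF assms])
qed

lemma test_div_L2: "\<psi> \<in> test_functions \<Omega> \<Longrightarrow> test_div \<psi> i k \<in> L2_space L"
  unfolding test_div_def[abs_def] by (intro scaleR_const_L2 test_L2[OF test_functions_frechet]) auto

lemma test_mat_L2: "\<psi> \<in> test_functions \<Omega> \<Longrightarrow> test_mat \<psi> i k \<in> L2_space L"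
  unfolding test_mat_def[abs_def] by (intro scaleR_const_L2 test_L2)

text \<open>As equations between inner products, weak gradients depend on classes only and pass to
  limits; uniqueness, linearity and closedness below rest on this.\<close>

lemma weak_gradient_iff:
  assumes "w \<in> L2_space L" "G \<in> L2_space L"
  shows "has_weak_gradient \<Omega> w G \<longleftrightarrow> (\<forall>\<psi>\<in>test_functions \<Omega>. \<forall>i k.
    cls \<Omega> w \<bullet> cls \<Omega> (test_div \<psi> i k) = - (cls \<Omega> G \<bullet> cls \<Omega> (test_mat \<psi> i k)))"
proof -
  have "cls \<Omega> w \<bullet> cls \<Omega> (test_div \<psi> i k) = (\<integral>x. w x $ i * frechet_derivative \<psi> (at x) (axis k 1) \<partial>L)"
    if "\<psi> \<in> test_functions \<Omega>" for \<psi> i k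
    by (subst inner_cls[OF dom assms(1) test_div_L2[OF that]])
      (simp add: test_div_def inner_axis mult.commute)
  moreover have "cls \<Omega> G \<bullet> cls \<Omega> (test_mat \<psi> i k) = (\<integral>x. G x $ i $ k * \<psi> x \<partial>L)"
    if "\<psi> \<in> test_functions \<Omega>" for \<psi> i k
    by (subst inner_cls[OF dom assms(2) test_mat_L2[OF that]])
      (simp add: test_mat_def inner_matrix_unit mult.commute)
  ultimately show ?thesis by (simp add: has_weak_gradient_def)
qed

lemma weak_gradient_unique:
  assumes w: "w \<in> L2_space L" "w' \<in> L2_space L" "cls \<Omega> w = cls \<Omega> w'"
    and G: "G \<in> L2_space L" "G' \<in> L2_space L"
    and wg: "has_weak_gradient \<Omega> w G" "has_weak_gradient \<Omega> w' G'"
  shows "cls \<Omega> G = cls \<Omega> G'"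
proof -
  have comp: "AE x in L. (G x - G' x) $ i $ k = 0" for i k
  proof (rule fundamental_lemma[OF open_dom])
    have D: "(\<lambda>x. G x - G' x) \<in> L2_space L" by (intro L2_space_diff G)
    have "linear (\<lambda>A::real^'d^'d. A $ i $ k)" by (rule linearI) auto
    from L2_space_linear[OF D this] show "integrable L (\<lambda>x. (G x - G' x) $ i $ k)" by (rule L2_integrable)
    fix \<psi> :: "real^'d \<Rightarrow> real" assume \<psi>: "\<psi> \<in> test_functions \<Omega>"
    have "(\<integral>x. (G x - G' x) $ i $ k * \<psi> x \<partial>L) = (\<integral>x. (G x - G' x) \<bullet> test_mat \<psi> i k x \<partial>L)"
      by (simp add: test_mat_def inner_matrix_unit mult.commute inner_diff_left)
    also have "\<dots> = (cls \<Omega> G - cls \<Omega> G') \<bullet> cls \<Omega> (test_mat \<psi> i k)"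
      by (simp only: inner_cls[OF dom D test_mat_L2[OF \<psi>], symmetric] cls_diff[OF dom G])
    also have "\<dots> = 0"
      using wg \<psi> w(3) by (simp add: weak_gradient_iff w G inner_diff_left)
    finally show "(\<integral>x. (G x - G' x) $ i $ k * \<psi> x \<partial>L) = 0" .
  qed
  have "AE x in L. \<forall>i k. (G x - G' x) $ i $ k = 0"
    using comp by (simp add: eventually_all_finite)
  then have "AE x in L. G x = G' x" by eventually_elim (simp add: vec_eq_iff)
  then show ?thesis using cls_eq_iff[OF dom G] by simp
qed

section \<open>The space W^(1,2) and its norm\<close>

lemma W12_D:
  assumes "w \<in> W12 \<Omega>"
  shows "w \<in> L2_space L" "weak_grad \<Omega> w \<in> L2_space L" "has_weak_gradient \<Omega> w (weak_grad \<Omega> w)"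
proof -
  show "w \<in> L2_space L" using assms by (simp add: W12_def)
  have "\<exists>G. G \<in> L2_space L \<and> has_weak_gradient \<Omega> w G" using assms by (auto simp: W12_def)
  from someI_ex[OF this] show "weak_grad \<Omega> w \<in> L2_space L" "has_weak_gradient \<Omega> w (weak_grad \<Omega> w)"
    by (simp_all add: weak_grad_def)
qed

lemma W12_I:
  assumes "w \<in> L2_space L" "G \<in> L2_space L" "has_weak_gradient \<Omega> w G"
  shows "w \<in> W12 \<Omega>" "cls \<Omega> (weak_grad \<Omega> w) = cls \<Omega> G"
proof -
  show "w \<in> W12 \<Omega>" using assms by (auto simp: W12_def)
  from W12_D[OF this] show "cls \<Omega> (weak_grad \<Omega> w) = cls \<Omega> G"
    using assms by (intro weak_gradient_unique[of w w]) auto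
qed

lemma W12_lincomb:
  assumes v: "v \<in> W12 \<Omega>" and w: "w \<in> W12 \<Omega>"
  shows "(\<lambda>x. a *\<^sub>R v x + b *\<^sub>R w x) \<in> W12 \<Omega>"
    "cls \<Omega> (weak_grad \<Omega> (\<lambda>x. a *\<^sub>R v x + b *\<^sub>R w x))
      = a *\<^sub>R cls \<Omega> (weak_grad \<Omega> v) + b *\<^sub>R cls \<Omega> (weak_grad \<Omega> w)"
proof -
  note vD = W12_D[OF v] and wD = W12_D[OF w]
  have u: "(\<lambda>x. a *\<^sub>R v x + b *\<^sub>R w x) \<in> L2_space L" by (intro L2_space_lincomb vD wD)
  have G: "(\<lambda>x. a *\<^sub>R weak_grad \<Omega> v x + b *\<^sub>R weak_grad \<Omega> w x) \<in> L2_space L" by (intro L2_space_lincomb vD wD)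
  have "has_weak_gradient \<Omega> (\<lambda>x. a *\<^sub>R v x + b *\<^sub>R w x) (\<lambda>x. a *\<^sub>R weak_grad \<Omega> v x + b *\<^sub>R weak_grad \<Omega> w x)"
    using vD(3) wD(3)
    by (simp add: weak_gradient_iff[OF u G] weak_gradient_iff[OF vD(1,2)] weak_gradient_iff[OF wD(1,2)]
        cls_lincomb[OF dom vD(1) wD(1)] cls_lincomb[OF dom vD(2) wD(2)] inner_add_left)
  from W12_I[OF u G this] show "(\<lambda>x. a *\<^sub>R v x + b *\<^sub>R w x) \<in> W12 \<Omega>"
    "cls \<Omega> (weak_grad \<Omega> (\<lambda>x. a *\<^sub>R v x + b *\<^sub>R w x))
      = a *\<^sub>R cls \<Omega> (weak_grad \<Omega> v) + b *\<^sub>R cls \<Omega> (weak_grad \<Omega> w)"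
    by (simp_all add: cls_lincomb[OF dom vD(2) wD(2)])
qed

lemma W12_norm_cls:
  assumes "w \<in> W12 \<Omega>"
  shows "(W12_norm \<Omega> w)\<^sup>2 = (norm (cls \<Omega> w))\<^sup>2 + (norm (cls \<Omega> (weak_grad \<Omega> w)))\<^sup>2"
  using W12_D[OF assms] by (simp add: W12_norm_def norm_cls[OF dom])

lemma W12_norm_nonneg: "0 \<le> W12_norm \<Omega> w"
  by (simp add: W12_norm_def)

lemma W12_norm_ge:
  assumes "w \<in> W12 \<Omega>"
  shows "norm (cls \<Omega> w) \<le> W12_norm \<Omega> w" "norm (cls \<Omega> (weak_grad \<Omega> w)) \<le> W12_norm \<Omega> w"
  by (rule power2_le_imp_le[OF _ W12_norm_nonneg], simp add: W12_norm_cls[OF assms])+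

lemma W12_norm_le:
  assumes "w \<in> W12 \<Omega>"
  shows "W12_norm \<Omega> w \<le> norm (cls \<Omega> w) + norm (cls \<Omega> (weak_grad \<Omega> w))"
  by (rule power2_le_imp_le) (simp_all add: W12_norm_cls[OF assms] power2_sum)

lemma W12_diff:
  assumes "v \<in> W12 \<Omega>" "w \<in> W12 \<Omega>"
  shows "v - w \<in> W12 \<Omega>" "cls \<Omega> (v - w) = cls \<Omega> v - cls \<Omega> w"
    "cls \<Omega> (weak_grad \<Omega> (v - w)) = cls \<Omega> (weak_grad \<Omega> v) - cls \<Omega> (weak_grad \<Omega> w)"
proof -
  have "v - w = (\<lambda>x. 1 *\<^sub>R v x + (-1) *\<^sub>R w x)" by (simp add: fun_eq_iff)
  then show "v - w \<in> W12 \<Omega>" "cls \<Omega> (v - w) = cls \<Omega> v - cls \<Omega> w"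
    "cls \<Omega> (weak_grad \<Omega> (v - w)) = cls \<Omega> (weak_grad \<Omega> v) - cls \<Omega> (weak_grad \<Omega> w)"
    using W12_lincomb[OF assms, of 1 "-1"] cls_lincomb[OF dom W12_D(1)[OF assms(1)] W12_D(1)[OF assms(2)], of 1 "-1"]
    by simp_all
qed

lemma classical_grad_component:
  "classical_grad \<phi> x $ i $ k = frechet_derivative (\<lambda>x. \<phi> x $ i) (at x) (axis k 1)"
  by (simp add: classical_grad_def)

lemma classical_grad_component_test:
  assumes "\<phi> \<in> test_functions \<Omega>"
  shows "(\<lambda>x. classical_grad \<phi> x $ i $ k) \<in> test_functions \<Omega>"
  unfolding classical_grad_component
  by (rule test_functions_frechet[OF test_functions_vec_nth[OF assms] axis_in_Basis])

lemma classical_grad_L2: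
  assumes "\<phi> \<in> test_functions \<Omega>" shows "classical_grad \<phi> \<in> L2_space L"
proof -
  have c: "(\<lambda>x. classical_grad \<phi> x $ i $ k) \<in> L2_space L" for i k
    by (rule test_L2[OF classical_grad_component_test[OF assms]])
  have "classical_grad \<phi> \<in> borel_measurable L"
  proof (rule borel_measurable_euclidean_space[THEN iffD2], rule ballI)
    fix b :: "real^'d^'d" assume "b \<in> Basis"
    then obtain i k where "b = axis i (axis k 1)" by (auto simp: Basis_vec_def)
    then show "(\<lambda>x. classical_grad \<phi> x \<bullet> b) \<in> borel_measurable L"
      using L2_space_measurable[OF c[of i k]] by (simp add: inner_matrix_unit)
  qed
  moreover have "integrable L (\<lambda>x. \<Sum>i\<in>UNIV. \<Sum>k\<in>UNIV. (classical_grad \<phi> x $ i $ k)\<^sup>2)"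
    using L2_space_integrable[OF c] by (intro Bochner_Integration.integrable_sum) simp
  moreover have "(norm (classical_grad \<phi> x))\<^sup>2 = (\<Sum>i\<in>UNIV. \<Sum>k\<in>UNIV. (classical_grad \<phi> x $ i $ k)\<^sup>2)" for x
    unfolding power2_norm_eq_inner by (simp add: inner_vec_def power2_eq_square)
  ultimately show ?thesis by (intro L2_space_bound) auto
qed

lemma test_W12:
  assumes \<phi>: "\<phi> \<in> test_functions \<Omega>"
  shows "\<phi> \<in> W12 \<Omega>" "cls \<Omega> (weak_grad \<Omega> \<phi>) = cls \<Omega> (classical_grad \<phi>)"
proof -
  have wg: "has_weak_gradient \<Omega> \<phi> (classical_grad \<phi>)"
    unfolding has_weak_gradient_def
  proof (intro ballI allI)
    fix \<psi> :: "real^'d \<Rightarrow> real" and i k assume \<psi>: "\<psi> \<in> test_functions \<Omega>"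
    let ?f = "\<lambda>x. \<phi> x $ i" let ?D = "\<lambda>x. frechet_derivative \<psi> (at x) (axis k 1)"
    have f: "?f \<in> test_functions \<Omega>" by (rule test_functions_vec_nth[OF \<phi>])
    have D: "?D \<in> test_functions \<Omega>" by (rule test_functions_frechet[OF \<psi> axis_in_Basis])
    have prod: "(\<integral>x. \<alpha> x * \<beta> x \<partial>L) = (\<integral>x. \<alpha> x * \<beta> x \<partial>lborel)"
      if "\<alpha> \<in> test_functions \<Omega>" "\<beta> \<in> test_functions \<Omega>" for \<alpha> \<beta> :: "real^'d \<Rightarrow> real"
      using that by (intro integral_L_lborel borel_measurable_continuous_onI continuous_on_mult
          test_functions_continuous) (auto simp: test_functions_def)
    have "(\<integral>x. classical_grad \<phi> x $ i $ k * \<psi> x \<partial>lborel) = - (\<integral>x. ?f x * ?D x \<partial>lborel)"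
      unfolding classical_grad_component
      by (rule partial_integration[OF \<psi> test_functions_Ck[OF f] axis_in_Basis])
    then show "(\<integral>x. ?f x * ?D x \<partial>L) = - (\<integral>x. classical_grad \<phi> x $ i $ k * \<psi> x \<partial>L)"
      by (simp add: prod[OF f D] prod[OF classical_grad_component_test[OF \<phi>] \<psi>])
  qed
  show "\<phi> \<in> W12 \<Omega>" "cls \<Omega> (weak_grad \<Omega> \<phi>) = cls \<Omega> (classical_grad \<phi>)"
    by (rule W12_I[OF test_L2[OF \<phi>] classical_grad_L2[OF \<phi>] wg])+
qed

section \<open>The closure V of the test functions\<close>

lemma V_space_W12: "w \<in> V_space \<Omega> \<Longrightarrow> w \<in> W12 \<Omega>"
  by (simp add: V_space_def)

lemma V_space_iff:
  assumes "w \<in> W12 \<Omega>"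
  shows "w \<in> V_space \<Omega> \<longleftrightarrow> (\<forall>e>0. \<exists>\<phi>\<in>test_functions \<Omega>. W12_norm \<Omega> (\<phi> - w) < e)"
proof
  assume "w \<in> V_space \<Omega>"
  then obtain \<phi> where \<phi>: "\<forall>n. \<phi> n \<in> test_functions \<Omega>" "(\<lambda>n. W12_norm \<Omega> (\<phi> n - w)) \<longlonglongrightarrow> 0"
    by (auto simp: V_space_def)
  show "\<forall>e>0. \<exists>\<phi>\<in>test_functions \<Omega>. W12_norm \<Omega> (\<phi> - w) < e"
  proof (intro allI impI)
    fix e :: real assume "e > 0"
    then have "\<forall>\<^sub>F n in sequentially. W12_norm \<Omega> (\<phi> n - w) < e" using \<phi>(2) by (simp add: order_tendsto_iff)
    then obtain n where "W12_norm \<Omega> (\<phi> n - w) < e" by (auto simp: eventually_sequentially)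
    then show "\<exists>\<phi>\<in>test_functions \<Omega>. W12_norm \<Omega> (\<phi> - w) < e" using \<phi>(1) by blast
  qed
next
  assume *: "\<forall>e>0. \<exists>\<phi>\<in>test_functions \<Omega>. W12_norm \<Omega> (\<phi> - w) < e"
  have "\<forall>n. \<exists>\<phi>. \<phi> \<in> test_functions \<Omega> \<and> W12_norm \<Omega> (\<phi> - w) < inverse (real (Suc n))"
    using * by (metis inverse_positive_iff_positive of_nat_0_less_iff zero_less_Suc)
  then obtain \<phi> where \<phi>: "\<forall>n. \<phi> n \<in> test_functions \<Omega> \<and> W12_norm \<Omega> (\<phi> n - w) < inverse (real (Suc n))"
    by (rule choice[THEN exE])
  have "(\<lambda>n. W12_norm \<Omega> (\<phi> n - w)) \<longlonglongrightarrow> 0"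
    by (rule tendsto_sandwich[OF _ _ tendsto_const LIMSEQ_inverse_real_of_nat])
      (use \<phi> in \<open>auto intro!: always_eventually less_imp_le simp: W12_norm_nonneg\<close>)
  then show "w \<in> V_space \<Omega>" using assms \<phi> by (auto simp: V_space_def)
qed

lemma test_functions_lincomb:
  fixes \<phi> \<psi> :: "real^'d \<Rightarrow> real^'d"
  assumes "\<phi> \<in> test_functions \<Omega>" "\<psi> \<in> test_functions \<Omega>"
  shows "(\<lambda>x. a *\<^sub>R \<phi> x + b *\<^sub>R \<psi> x) \<in> test_functions \<Omega>"
proof -
  have C_k_scaleR: "C_k k (\<lambda>x. c *\<^sub>R f x)" if "C_k k f" for c :: real and f :: "real^'d \<Rightarrow> real^'d" and k
    using that
  proof (induction k arbitrary: f)
    case 0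
    then show ?case by (auto intro!: continuous_intros)
  next
    case (Suc k)
    show ?case
    proof (rule C_k_cong_fd)
      show "((\<lambda>x. c *\<^sub>R f x) has_derivative (\<lambda>h. c *\<^sub>R frechet_derivative f (at x) h)) (at x)" for x
        by (intro has_derivative_scaleR_right C_k_Suc_has_derivative[OF Suc.prems])
    qed (use Suc in auto)
  qed
  have scale: "(\<lambda>x. c *\<^sub>R f x) \<in> test_functions \<Omega>" if f: "f \<in> test_functions \<Omega>" for c :: real and f :: "real^'d \<Rightarrow> real^'d"
  proof -
    obtain K where "compact K" "K \<subseteq> \<Omega>" "\<forall>x. x \<notin> K \<longrightarrow> f x = 0"
      using f by (auto simp: test_functions_def)
    then have "\<exists>K. compact K \<and> K \<subseteq> \<Omega> \<and> (\<forall>x. x \<notin> K \<longrightarrow> c *\<^sub>R f x = 0)" by (intro exI[of _ K]) auto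
    then show ?thesis using C_k_scaleR[OF test_functions_Ck[OF f]] by (simp add: test_functions_def)
  qed
  show ?thesis by (intro test_functions_add scale assms)
qed

lemma V_space_lincomb:
  assumes v: "v \<in> V_space \<Omega>" and w: "w \<in> V_space \<Omega>"
  shows "(\<lambda>x. a *\<^sub>R v x + b *\<^sub>R w x) \<in> V_space \<Omega>"
proof -
  note W = V_space_W12[OF v] V_space_W12[OF w]
  let ?u = "\<lambda>x. a *\<^sub>R v x + b *\<^sub>R w x"
  have u: "?u \<in> W12 \<Omega>" by (rule W12_lincomb[OF W])
  show ?thesis
    unfolding V_space_iff[OF u]
  proof (intro allI impI)
    fix e :: real assume e: "e > 0"
    \<comment> \<open>The factor 2 accounts for the function and gradient parts of the norm, the
      added 1 for a = b = 0.\<close>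
    define d where "d = e / (2 * (\<bar>a\<bar> + \<bar>b\<bar> + 1))"
    have d: "d > 0" using e by (simp add: d_def add_nonneg_pos)
    obtain \<phi> where \<phi>: "\<phi> \<in> test_functions \<Omega>" "W12_norm \<Omega> (\<phi> - v) < d"
      using v d V_space_iff[OF W(1)] by blast
    obtain \<psi> where \<psi>: "\<psi> \<in> test_functions \<Omega>" "W12_norm \<Omega> (\<psi> - w) < d"
      using w d V_space_iff[OF W(2)] by blast
    define \<theta> where "\<theta> = (\<lambda>x. a *\<^sub>R \<phi> x + b *\<^sub>R \<psi> x)"
    have \<theta>: "\<theta> \<in> test_functions \<Omega>" unfolding \<theta>_def by (rule test_functions_lincomb[OF \<phi>(1) \<psi>(1)])
    have D: "\<phi> - v \<in> W12 \<Omega>" "\<psi> - w \<in> W12 \<Omega>" using W12_diff(1) test_W12(1) \<phi>(1) \<psi>(1) W by blast+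
    have eq: "\<theta> - ?u = (\<lambda>x. a *\<^sub>R (\<phi> - v) x + b *\<^sub>R (\<psi> - w) x)"
      by (simp add: \<theta>_def fun_eq_iff algebra_simps)
    have n1: "norm (a *\<^sub>R X + b *\<^sub>R Y) \<le> (\<bar>a\<bar> + \<bar>b\<bar>) * d"
      if "norm X \<le> d" "norm Y \<le> d" for X Y :: "'z::real_normed_vector"
    proof -
      have "norm (a *\<^sub>R X + b *\<^sub>R Y) \<le> \<bar>a\<bar> * norm X + \<bar>b\<bar> * norm Y"
        using norm_triangle_ineq[of "a *\<^sub>R X" "b *\<^sub>R Y"] by simp
      also have "\<dots> \<le> \<bar>a\<bar> * d + \<bar>b\<bar> * d" using that by (intro add_mono mult_left_mono) auto
      finally show ?thesis by (simp add: algebra_simps)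
    qed
    have "W12_norm \<Omega> (\<theta> - ?u) \<le> norm (cls \<Omega> (\<theta> - ?u)) + norm (cls \<Omega> (weak_grad \<Omega> (\<theta> - ?u)))"
      unfolding eq by (rule W12_norm_le[OF W12_lincomb(1)[OF D]])
    also have "\<dots> \<le> (\<bar>a\<bar> + \<bar>b\<bar>) * d + (\<bar>a\<bar> + \<bar>b\<bar>) * d"
      unfolding eq W12_lincomb(2)[OF D] cls_lincomb[OF dom W12_D(1)[OF D(1)] W12_D(1)[OF D(2)]]
      using W12_norm_ge[OF D(1)] W12_norm_ge[OF D(2)] \<phi>(2) \<psi>(2) by (intro add_mono n1) auto
    also have "\<dots> < e"
    proof -
      have "(\<bar>a\<bar> + \<bar>b\<bar> + 1) * (2 * d) = e" using e by (simp add: d_def add_nonneg_pos field_simps)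
      moreover have "(\<bar>a\<bar> + \<bar>b\<bar>) * d + (\<bar>a\<bar> + \<bar>b\<bar>) * d = (\<bar>a\<bar> + \<bar>b\<bar> + 1) * (2 * d) - 2 * d"
        by (simp add: algebra_simps)
      ultimately show ?thesis using d by simp
    qed
    finally show "\<exists>\<phi>\<in>test_functions \<Omega>. W12_norm \<Omega> (\<phi> - ?u) < e" using \<theta> by blast
  qed
qed

text \<open>Completeness of V in terms of classes: the weak gradient equation and the approximation
  by test functions both pass to the limit.\<close>

lemma V_space_closed:
  assumes w: "\<And>n. w n \<in> V_space \<Omega>"
    and lim: "(\<lambda>n. cls \<Omega> (w n)) \<longlonglongrightarrow> X" "(\<lambda>n. cls \<Omega> (weak_grad \<Omega> (w n))) \<longlonglongrightarrow> Y"
  shows "rep_l2 X \<in> V_space \<Omega>" "cls \<Omega> (rep_l2 X) = X" "cls \<Omega> (weak_grad \<Omega> (rep_l2 X)) = Y"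
proof -
  note W = V_space_W12[OF w] note D = W12_D[OF W]
  \<comment> \<open>Restriction to \<Omega> is a contraction that fixes every class of the sequence,
    hence also the limit.\<close>
  have rr: "cls \<Omega> (rep_l2 Z) = Z" if "\<And>n. f n \<in> L2_space L" "(\<lambda>n. cls \<Omega> (f n)) \<longlonglongrightarrow> Z"
    for f :: "nat \<Rightarrow> real^'d \<Rightarrow> 'b::euclidean_space" and Z
  proof (rule LIMSEQ_unique[OF _ that(2)])
    have "(\<lambda>n. cls \<Omega> (rep_l2 (cls \<Omega> (f n)))) \<longlonglongrightarrow> cls \<Omega> (rep_l2 Z)"
    proof (rule LIM_zero_cancel, rule Lim_null_comparison)
      show "\<forall>\<^sub>F n in sequentially. norm (cls \<Omega> (rep_l2 (cls \<Omega> (f n))) - cls \<Omega> (rep_l2 Z)) \<le> norm (cls \<Omega> (f n) - Z)"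
        by (simp add: cls_rep_dist[OF dom])
      have "(\<lambda>n. norm (cls \<Omega> (f n) - Z)) \<longlonglongrightarrow> norm (Z - Z)" by (intro tendsto_intros that)
      then show "(\<lambda>n. norm (cls \<Omega> (f n) - Z)) \<longlonglongrightarrow> 0" by simp
    qed
    then show "(\<lambda>n. cls \<Omega> (f n)) \<longlonglongrightarrow> cls \<Omega> (rep_l2 Z)" by (simp only: cls_rep_cls[OF dom that(1)])
  qed
  have X: "cls \<Omega> (rep_l2 X) = X" by (rule rr[OF D(1) lim(1)])
  have Y: "cls \<Omega> (rep_l2 Y) = Y" by (rule rr[OF D(2) lim(2)])
  have XL: "rep_l2 X \<in> L2_space L" and YL: "rep_l2 Y \<in> L2_space L" by (rule rep_l2_restrict[OF dom])+
  have "has_weak_gradient \<Omega> (rep_l2 X) (rep_l2 Y)"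
    unfolding weak_gradient_iff[OF XL YL] X Y
  proof (intro ballI allI)
    fix \<psi> :: "real^'d \<Rightarrow> real" and i k assume \<psi>: "\<psi> \<in> test_functions \<Omega>"
    have "(\<lambda>n. cls \<Omega> (w n) \<bullet> cls \<Omega> (test_div \<psi> i k)) \<longlonglongrightarrow> X \<bullet> cls \<Omega> (test_div \<psi> i k)"
      by (intro tendsto_intros lim)
    moreover have "cls \<Omega> (w n) \<bullet> cls \<Omega> (test_div \<psi> i k)
        = - (cls \<Omega> (weak_grad \<Omega> (w n)) \<bullet> cls \<Omega> (test_mat \<psi> i k))" for n
      using D(3)[of n] \<psi> unfolding weak_gradient_iff[OF D(1) D(2)] by blast
    ultimately have "(\<lambda>n. - (cls \<Omega> (weak_grad \<Omega> (w n)) \<bullet> cls \<Omega> (test_mat \<psi> i k))) \<longlonglongrightarrow> X \<bullet> cls \<Omega> (test_div \<psi> i k)"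
      by (simp only:)
    moreover have "(\<lambda>n. - (cls \<Omega> (weak_grad \<Omega> (w n)) \<bullet> cls \<Omega> (test_mat \<psi> i k))) \<longlonglongrightarrow> - (Y \<bullet> cls \<Omega> (test_mat \<psi> i k))"
      by (intro tendsto_intros lim)
    ultimately show "X \<bullet> cls \<Omega> (test_div \<psi> i k) = - (Y \<bullet> cls \<Omega> (test_mat \<psi> i k))" by (rule LIMSEQ_unique)
  qed
  from W12_I[OF XL YL this] have RW: "rep_l2 X \<in> W12 \<Omega>" and G: "cls \<Omega> (weak_grad \<Omega> (rep_l2 X)) = Y"
    by (simp_all add: Y)
  show "cls \<Omega> (rep_l2 X) = X" by (rule X)
  show "cls \<Omega> (weak_grad \<Omega> (rep_l2 X)) = Y" by (rule G)
  show "rep_l2 X \<in> V_space \<Omega>"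
    unfolding V_space_iff[OF RW]
  proof (intro allI impI)
    fix e :: real assume e: "e > 0"
    \<comment> \<open>Four errors of e/4: two from \<open>w n\<close> to the limits, two from the
      test function to \<open>w n\<close>.\<close>
    have "\<forall>\<^sub>F n in sequentially. dist (cls \<Omega> (w n)) X < e / 4" "\<forall>\<^sub>F n in sequentially. dist (cls \<Omega> (weak_grad \<Omega> (w n))) Y < e / 4"
      by (rule tendstoD[OF lim(1)], use e in simp, rule tendstoD[OF lim(2)], use e in simp)
    then have "\<forall>\<^sub>F n in sequentially. dist (cls \<Omega> (w n)) X < e / 4 \<and> dist (cls \<Omega> (weak_grad \<Omega> (w n))) Y < e / 4"
      by (rule eventually_conj)
    then obtain n where n: "dist (cls \<Omega> (w n)) X < e / 4" "dist (cls \<Omega> (weak_grad \<Omega> (w n))) Y < e / 4"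
      by (auto simp: eventually_sequentially)
    obtain \<phi> where \<phi>: "\<phi> \<in> test_functions \<Omega>" "W12_norm \<Omega> (\<phi> - w n) < e / 4"
      using w[of n] e V_space_iff[OF W[of n]] by (metis zero_less_divide_iff zero_less_numeral)
    note \<phi>W = test_W12(1)[OF \<phi>(1)]
    have b: "norm (cls \<Omega> \<phi> - cls \<Omega> (w n)) < e / 4" "norm (cls \<Omega> (weak_grad \<Omega> \<phi>) - cls \<Omega> (weak_grad \<Omega> (w n))) < e / 4"
      using W12_norm_ge[OF W12_diff(1)[OF \<phi>W W[of n]]] \<phi>(2) unfolding W12_diff(2,3)[OF \<phi>W W[of n]] by linarith+
    have "W12_norm \<Omega> (\<phi> - rep_l2 X) \<le> norm (cls \<Omega> \<phi> - X) + norm (cls \<Omega> (weak_grad \<Omega> \<phi>) - Y)"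
      using W12_norm_le[OF W12_diff(1)[OF \<phi>W RW]] unfolding W12_diff(2,3)[OF \<phi>W RW] X G .
    also have "\<dots> < e"
      using norm_triangle_ineq[of "cls \<Omega> \<phi> - cls \<Omega> (w n)" "cls \<Omega> (w n) - X"]
        norm_triangle_ineq[of "cls \<Omega> (weak_grad \<Omega> \<phi>) - cls \<Omega> (weak_grad \<Omega> (w n))" "cls \<Omega> (weak_grad \<Omega> (w n)) - Y"] n b
      by (simp add: dist_norm)
    finally show "\<exists>\<phi>\<in>test_functions \<Omega>. W12_norm \<Omega> (\<phi> - rep_l2 X) < e" using \<phi>(1) by blast
  qed
qed

text \<open>Reduces inequalities on V to test functions, whose weak gradient is the classical
  one.\<close>

lemma V_space_approx:
  assumes w: "w \<in> V_space \<Omega>"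
  obtains \<phi> where "\<forall>n. \<phi> n \<in> test_functions \<Omega>" "(\<lambda>n. cls \<Omega> (\<phi> n)) \<longlonglongrightarrow> cls \<Omega> w"
    "(\<lambda>n. cls \<Omega> (classical_grad (\<phi> n))) \<longlonglongrightarrow> cls \<Omega> (weak_grad \<Omega> w)"
proof -
  note W = V_space_W12[OF w]
  obtain \<phi> where \<phi>: "\<forall>n. \<phi> n \<in> test_functions \<Omega>" "(\<lambda>n. W12_norm \<Omega> (\<phi> n - w)) \<longlonglongrightarrow> 0"
    using w by (auto simp: V_space_def)
  note P = test_W12[OF \<phi>(1)[rule_format]]
  note D = W12_diff[OF P(1) W]
  show ?thesis
  proof (rule that[OF \<phi>(1)])
    show "(\<lambda>n. cls \<Omega> (\<phi> n)) \<longlonglongrightarrow> cls \<Omega> w"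
    proof (rule LIM_zero_cancel, rule Lim_null_comparison[OF _ \<phi>(2)])
      show "\<forall>\<^sub>F n in sequentially. norm (cls \<Omega> (\<phi> n) - cls \<Omega> w) \<le> W12_norm \<Omega> (\<phi> n - w)"
        using W12_norm_ge(1)[OF D(1)] unfolding D(2) by (intro always_eventually allI)
    qed
    show "(\<lambda>n. cls \<Omega> (classical_grad (\<phi> n))) \<longlonglongrightarrow> cls \<Omega> (weak_grad \<Omega> w)"
    proof (rule LIM_zero_cancel, rule Lim_null_comparison[OF _ \<phi>(2)])
      show "\<forall>\<^sub>F n in sequentially. norm (cls \<Omega> (classical_grad (\<phi> n)) - cls \<Omega> (weak_grad \<Omega> w)) \<le> W12_norm \<Omega> (\<phi> n - w)"
        using W12_norm_ge(2)[OF D(1)] unfolding D(3) P(2) by (intro always_eventually allI)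
    qed
  qed
qed

lemma cls_linear_tendsto:
  fixes A :: "'b::euclidean_space \<Rightarrow> 'c::euclidean_space"
  assumes f: "\<And>n. f n \<in> L2_space L" "h \<in> L2_space L" "(\<lambda>n. cls \<Omega> (f n)) \<longlonglongrightarrow> cls \<Omega> h" and A: "linear A"
  shows "(\<lambda>n. cls \<Omega> (\<lambda>x. A (f n x))) \<longlonglongrightarrow> cls \<Omega> (\<lambda>x. A (h x))"
proof -
  obtain K where K: "K > 0" "\<forall>x. norm (A x) \<le> K * norm x"
    using linear_bounded_pos[OF A] by metis
  show ?thesis
  proof (rule LIM_zero_cancel, rule Lim_null_comparison)
    have "norm (cls \<Omega> (\<lambda>x. A (f n x)) - cls \<Omega> (\<lambda>x. A (h x))) \<le> K * norm (cls \<Omega> (f n) - cls \<Omega> h)" for n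
    proof -
      have "cls \<Omega> (\<lambda>x. A (f n x)) - cls \<Omega> (\<lambda>x. A (h x)) = cls \<Omega> (\<lambda>x. A (f n x - h x))"
        by (simp add: linear_diff[OF A] cls_diff[OF dom L2_space_linear[OF f(1) A] L2_space_linear[OF f(2) A]])
      also have "norm \<dots> \<le> K * norm (cls \<Omega> (\<lambda>x. f n x - h x))"
        by (rule norm_cls_linear_le[OF dom L2_space_diff[OF f(1,2)] A K(2)[rule_format]]) (use K(1) in simp)
      finally show ?thesis by (simp only: cls_diff[OF dom f(1,2)])
    qed
    then show "\<forall>\<^sub>F n in sequentially. norm (cls \<Omega> (\<lambda>x. A (f n x)) - cls \<Omega> (\<lambda>x. A (h x))) \<le> K * norm (cls \<Omega> (f n) - cls \<Omega> h)"
      by (intro always_eventually allI)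
    have "(\<lambda>n. K * norm (cls \<Omega> (f n) - cls \<Omega> h)) \<longlonglongrightarrow> K * norm (cls \<Omega> h - cls \<Omega> h)" by (intro tendsto_intros f)
    then show "(\<lambda>n. K * norm (cls \<Omega> (f n) - cls \<Omega> h)) \<longlonglongrightarrow> 0" by simp
  qed
qed

lemma linear_sym_part: "linear (sym_part :: real^'d^'d \<Rightarrow> _)"
  by (rule linearI) (auto simp: sym_part_def transpose_def vec_eq_iff algebra_simps)

subsection \<open>Korn's and Poincare's inequalities\<close>

lemma component_integral:
  fixes \<alpha> \<beta> :: "real^'d \<Rightarrow> real"
  assumes "\<alpha> \<in> test_functions \<Omega>" "\<beta> \<in> test_functions \<Omega>"
  shows "(\<integral>x. \<alpha> x * \<beta> x \<partial>L) = (\<integral>x. \<alpha> x * \<beta> x \<partial>lborel)" "integrable L (\<lambda>x. \<alpha> x * \<beta> x)"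
proof -
  show "(\<integral>x. \<alpha> x * \<beta> x \<partial>L) = (\<integral>x. \<alpha> x * \<beta> x \<partial>lborel)"
    using assms by (intro integral_L_lborel borel_measurable_continuous_onI continuous_on_mult
        test_functions_continuous) (auto simp: test_functions_def)
  show "integrable L (\<lambda>x. \<alpha> x * \<beta> x)"
    using L2_space_inner_integrable[OF test_L2[OF assms(1)] test_L2[OF assms(2)]] by simp
qed

text \<open>\<open>2 |sym A|\<^sup>2 = |A|\<^sup>2 + A : A\<^sup>T\<close>, and \<open>\<integral> \<nabla> \<phi> : (\<nabla> \<phi>)\<^sup>T = \<integral> (div \<phi>)\<^sup>2\<close>.\<close>
lemma Korn_test:
  assumes \<phi>: "\<phi> \<in> test_functions \<Omega>"
  shows "(norm (cls \<Omega> (classical_grad \<phi>)))\<^sup>2 \<le> 2 * (norm (cls \<Omega> (\<lambda>x. sym_part (classical_grad \<phi> x))))\<^sup>2"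
proof -
  let ?G = "classical_grad \<phi>"
  note c = classical_grad_component_test[OF \<phi>]
  have GL: "?G \<in> L2_space L" by (rule classical_grad_L2[OF \<phi>])
  have SL: "(\<lambda>x. sym_part (?G x)) \<in> L2_space L" by (rule L2_space_linear[OF GL linear_sym_part])
  have alg: "2 * (sym_part A \<bullet> sym_part A) = A \<bullet> A + (\<Sum>i\<in>UNIV. \<Sum>k\<in>UNIV. A $ i $ k * A $ k $ i)"
    for A :: "real^'d^'d"
  proof -
    have t1: "transpose A \<bullet> transpose A = A \<bullet> A"
      by (simp add: inner_vec_def transpose_def sum.swap[of "\<lambda>i k. A $ k $ i * A $ k $ i"])
    have t2: "A \<bullet> transpose A = (\<Sum>i\<in>UNIV. \<Sum>k\<in>UNIV. A $ i $ k * A $ k $ i)"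
      by (simp add: inner_vec_def transpose_def)
    have "sym_part A \<bullet> sym_part A = (1/4) * (A \<bullet> A + 2 * (A \<bullet> transpose A) + transpose A \<bullet> transpose A)"
      by (simp add: sym_part_def inner_add_left inner_add_right inner_commute)
    then show ?thesis unfolding t1 t2 by simp
  qed
  have "0 \<le> (\<integral>x. (\<Sum>i\<in>UNIV. ?G x $ i $ i) * (\<Sum>i\<in>UNIV. ?G x $ i $ i) \<partial>L)"
    by (rule integral_nonneg_AE) simp
  also have "\<dots> = (\<Sum>i\<in>UNIV. \<Sum>k\<in>UNIV. \<integral>x. ?G x $ i $ i * ?G x $ k $ k \<partial>L)"
    using component_integral(2)[OF c c]
    by (simp add: sum_product Bochner_Integration.integral_sum Bochner_Integration.integrable_sum)
  also have "\<dots> = (\<Sum>i\<in>UNIV. \<Sum>k\<in>UNIV. \<integral>x. ?G x $ i $ k * ?G x $ k $ i \<partial>L)"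
  proof (intro sum.cong refl)
    fix i k
    have "(\<integral>x. ?G x $ i $ i * ?G x $ k $ k \<partial>lborel) = (\<integral>x. ?G x $ i $ k * ?G x $ k $ i \<partial>lborel)"
      unfolding classical_grad_component
      by (rule integral_partial_derivs_swap[OF test_functions_vec_nth[OF \<phi>] test_functions_vec_nth[OF \<phi>]]) simp_all
    then show "(\<integral>x. ?G x $ i $ i * ?G x $ k $ k \<partial>L) = (\<integral>x. ?G x $ i $ k * ?G x $ k $ i \<partial>L)"
      by (simp only: component_integral(1)[OF c c])
  qed
  also have "\<dots> = (\<integral>x. (\<Sum>i\<in>UNIV. \<Sum>k\<in>UNIV. ?G x $ i $ k * ?G x $ k $ i) \<partial>L)"
    using component_integral(2)[OF c c]
    by (simp add: Bochner_Integration.integral_sum Bochner_Integration.integrable_sum)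
  also have "\<dots> = (\<integral>x. 2 * (sym_part (?G x) \<bullet> sym_part (?G x)) - ?G x \<bullet> ?G x \<partial>L)"
    by (simp add: alg)
  also have "\<dots> = 2 * (\<integral>x. sym_part (?G x) \<bullet> sym_part (?G x) \<partial>L) - (\<integral>x. ?G x \<bullet> ?G x \<partial>L)"
    using L2_space_inner_integrable[OF SL SL] L2_space_inner_integrable[OF GL GL] by simp
  finally show ?thesis
    by (simp add: power2_norm_eq_inner inner_cls[OF dom SL SL] inner_cls[OF dom GL GL])
qed

lemma Poincare_V:
  obtains C where "C > 0" "\<forall>w\<in>V_space \<Omega>. norm (cls \<Omega> w) \<le> C * norm (cls \<Omega> (weak_grad \<Omega> w))"
proof -
  obtain R where R: "R > 0" "\<Omega> \<subseteq> cball 0 R"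
    using bounded_dom unfolding bounded_pos by (auto simp: subset_iff)
  have test: "norm (cls \<Omega> \<phi>) \<le> 2 * R * norm (cls \<Omega> (classical_grad \<phi>))" if \<phi>: "\<phi> \<in> test_functions \<Omega>" for \<phi>
  proof (rule power2_le_imp_le)
    let ?G = "classical_grad \<phi>"
    note c = classical_grad_component_test[OF \<phi>] and f = test_functions_vec_nth[OF \<phi>]
    have GL: "?G \<in> L2_space L" by (rule classical_grad_L2[OF \<phi>])
    \<comment> \<open>Poincare's inequality is applied in a single, arbitrary coordinate direction;
      index types are nonempty.\<close>
    obtain k0 :: 'd where True by simp
    have "(norm (cls \<Omega> \<phi>))\<^sup>2 = (\<Sum>i\<in>UNIV. \<integral>x. \<phi> x $ i * \<phi> x $ i \<partial>L)"
      using component_integral(2)[OF f f]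
      by (simp add: power2_norm_eq_inner inner_cls[OF dom test_L2[OF \<phi>] test_L2[OF \<phi>]] inner_vec_def
          Bochner_Integration.integral_sum)
    also have "\<dots> \<le> (\<Sum>i\<in>UNIV. 4 * R\<^sup>2 * (\<integral>x. ?G x $ i $ k0 * ?G x $ i $ k0 \<partial>L))"
    proof (rule sum_mono)
      fix i
      show "(\<integral>x. \<phi> x $ i * \<phi> x $ i \<partial>L) \<le> 4 * R\<^sup>2 * (\<integral>x. ?G x $ i $ k0 * ?G x $ i $ k0 \<partial>L)"
        using Poincare_test[OF f[of i] R(2) axis_in_Basis[of k0]]
        unfolding component_integral(1)[OF f f] component_integral(1)[OF c c]
        by (simp add: power2_eq_square classical_grad_component)
    qed
    also have "\<dots> \<le> (\<Sum>i\<in>UNIV. 4 * R\<^sup>2 * (\<Sum>k\<in>UNIV. \<integral>x. ?G x $ i $ k * ?G x $ i $ k \<partial>L))"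
      by (intro sum_mono mult_left_mono member_le_sum) auto
    also have "\<dots> = 4 * R\<^sup>2 * (\<integral>x. ?G x \<bullet> ?G x \<partial>L)"
      using component_integral(2)[OF c c]
      by (simp add: inner_vec_def Bochner_Integration.integral_sum Bochner_Integration.integrable_sum sum_distrib_left)
    also have "\<dots> = (2 * R * norm (cls \<Omega> ?G))\<^sup>2"
      by (simp add: power_mult_distrib power2_norm_eq_inner inner_cls[OF dom GL GL])
    finally show "(norm (cls \<Omega> \<phi>))\<^sup>2 \<le> (2 * R * norm (cls \<Omega> ?G))\<^sup>2" .
  qed (use R in simp)
  have "norm (cls \<Omega> w) \<le> 2 * R * norm (cls \<Omega> (weak_grad \<Omega> w))" if w: "w \<in> V_space \<Omega>" for w
  proof -
    obtain \<phi> where \<phi>: "\<forall>n. \<phi> n \<in> test_functions \<Omega>" "(\<lambda>n. cls \<Omega> (\<phi> n)) \<longlonglongrightarrow> cls \<Omega> w"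
      "(\<lambda>n. cls \<Omega> (classical_grad (\<phi> n))) \<longlonglongrightarrow> cls \<Omega> (weak_grad \<Omega> w)"
      by (rule V_space_approx[OF w])
    show ?thesis
    proof (rule LIMSEQ_le)
      show "(\<lambda>n. norm (cls \<Omega> (\<phi> n))) \<longlonglongrightarrow> norm (cls \<Omega> w)" by (intro tendsto_intros \<phi>)
      show "(\<lambda>n. 2 * R * norm (cls \<Omega> (classical_grad (\<phi> n)))) \<longlonglongrightarrow> 2 * R * norm (cls \<Omega> (weak_grad \<Omega> w))"
        by (intro tendsto_intros \<phi>)
      show "\<exists>N. \<forall>n\<ge>N. norm (cls \<Omega> (\<phi> n)) \<le> 2 * R * norm (cls \<Omega> (classical_grad (\<phi> n)))"
        using test \<phi>(1) by blast
    qed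
  qed
  then show ?thesis using that[of "2 * R"] R(1) by simp
qed

lemma Korn_V:
  assumes w: "w \<in> V_space \<Omega>"
  shows "(norm (cls \<Omega> (weak_grad \<Omega> w)))\<^sup>2 \<le> 2 * (norm (cls \<Omega> (sym_grad \<Omega> w)))\<^sup>2"
proof -
  obtain \<phi> where \<phi>: "\<forall>n. \<phi> n \<in> test_functions \<Omega>" "(\<lambda>n. cls \<Omega> (\<phi> n)) \<longlonglongrightarrow> cls \<Omega> w"
    "(\<lambda>n. cls \<Omega> (classical_grad (\<phi> n))) \<longlonglongrightarrow> cls \<Omega> (weak_grad \<Omega> w)"
    by (rule V_space_approx[OF w])
  have S: "(\<lambda>n. cls \<Omega> (\<lambda>x. sym_part (classical_grad (\<phi> n) x))) \<longlonglongrightarrow> cls \<Omega> (\<lambda>x. sym_part (weak_grad \<Omega> w x))"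
    by (rule cls_linear_tendsto[OF classical_grad_L2[OF \<phi>(1)[rule_format]] W12_D(2)[OF V_space_W12[OF w]] \<phi>(3) linear_sym_part])
  have "(norm (cls \<Omega> (weak_grad \<Omega> w)))\<^sup>2 \<le> 2 * (norm (cls \<Omega> (\<lambda>x. sym_part (weak_grad \<Omega> w x))))\<^sup>2"
  proof (rule LIMSEQ_le)
    show "(\<lambda>n. (norm (cls \<Omega> (classical_grad (\<phi> n))))\<^sup>2) \<longlonglongrightarrow> (norm (cls \<Omega> (weak_grad \<Omega> w)))\<^sup>2"
      by (intro tendsto_intros \<phi>)
    show "(\<lambda>n. 2 * (norm (cls \<Omega> (\<lambda>x. sym_part (classical_grad (\<phi> n) x))))\<^sup>2)
      \<longlonglongrightarrow> 2 * (norm (cls \<Omega> (\<lambda>x. sym_part (weak_grad \<Omega> w x))))\<^sup>2"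
      by (intro tendsto_intros S)
    show "\<exists>N. \<forall>n\<ge>N. (norm (cls \<Omega> (classical_grad (\<phi> n))))\<^sup>2
        \<le> 2 * (norm (cls \<Omega> (\<lambda>x. sym_part (classical_grad (\<phi> n) x))))\<^sup>2"
      using Korn_test \<phi>(1) by blast
  qed
  then show ?thesis by (simp only: sym_grad_def[abs_def])
qed

end

subsection \<open>The elasticity tensor and the energy space\<close>

text \<open>Absolute values, because neither N nor the constant is known to be nonnegative.\<close>

lemma dual_space_D:
  assumes "\<phi> \<in> dual_space X N"
  shows "v \<in> X \<Longrightarrow> w \<in> X \<Longrightarrow> \<phi> (\<lambda>x. a *\<^sub>R v x + b *\<^sub>R w x) = a * \<phi> v + b * \<phi> w"
    "\<exists>C\<ge>0. \<forall>w\<in>X. \<bar>\<phi> w\<bar> \<le> C * \<bar>N w\<bar>"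
proof -
  show "v \<in> X \<Longrightarrow> w \<in> X \<Longrightarrow> \<phi> (\<lambda>x. a *\<^sub>R v x + b *\<^sub>R w x) = a * \<phi> v + b * \<phi> w"
    using assms by (simp add: dual_space_def)
  obtain C where C: "\<forall>w\<in>X. \<bar>\<phi> w\<bar> \<le> C * N w" using assms by (auto simp: dual_space_def)
  have "\<bar>\<phi> w\<bar> \<le> \<bar>C\<bar> * \<bar>N w\<bar>" if "w \<in> X" for w
  proof -
    have "\<bar>\<phi> w\<bar> \<le> \<bar>C * N w\<bar>" using C that by (meson abs_ge_self order_trans)
    then show ?thesis by (simp only: abs_mult)
  qed
  then show "\<exists>C\<ge>0. \<forall>w\<in>X. \<bar>\<phi> w\<bar> \<le> C * \<bar>N w\<bar>" by (intro exI[of _ "\<bar>C\<bar>"]) simp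
qed

locale lame = bounded_open \<Omega> for \<Omega> :: "(real^'d) set" +
  fixes mu lam :: real
  assumes mu: "mu > 0" and lam: "lam > - (2 / real CARD('d)) * mu"
begin

abbreviation "half \<equiv> elast_half mu lam :: real^'d^'d \<Rightarrow> real^'d^'d"
abbreviation "neg_half \<equiv> elast_neg_half mu lam :: real^'d^'d \<Rightarrow> real^'d^'d"
abbreviation "Sym \<equiv> sym_matrices :: (real^'d^'d) set"

lemma sqrt_half: "is_pos_sqrt_on Sym (elast mu lam) half"
  by (rule elast_half_eq(1)[OF mu lam, of 0]) (simp add: subspace_0 subspace_sym_matrices)

lemma half_Sym: "S \<in> Sym \<Longrightarrow> half S \<in> Sym" and half_half: "S \<in> Sym \<Longrightarrow> half (half S) = elast mu lam S"
  and half_lincomb: "S \<in> Sym \<Longrightarrow> S' \<in> Sym \<Longrightarrow> half (a *\<^sub>R S + b *\<^sub>R S') = a *\<^sub>R half S + b *\<^sub>R half S'"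
  and half_self_adjoint: "S \<in> Sym \<Longrightarrow> S' \<in> Sym \<Longrightarrow> half S \<bullet> S' = S \<bullet> half S'"
  and half_pos: "S \<in> Sym \<Longrightarrow> S \<noteq> 0 \<Longrightarrow> 0 < half S \<bullet> S"
  using sqrt_half unfolding is_pos_sqrt_on_def by blast+

lemma Sym_lincomb: "S \<in> Sym \<Longrightarrow> S' \<in> Sym \<Longrightarrow> a *\<^sub>R S + b *\<^sub>R S' \<in> Sym"
  by (intro subspace_add subspace_scale subspace_sym_matrices)

lemma sym_part_Sym: "sym_part A \<in> Sym"
  by (simp add: sym_part_def sym_matrices_def transpose_def vec_eq_iff)

lemma sym_part_id: "S \<in> Sym \<Longrightarrow> sym_part S = S"
  by (simp add: sym_part_def sym_matrices_def flip: scaleR_2)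

lemma inner_sym_part: "S \<in> Sym \<Longrightarrow> S \<bullet> A = S \<bullet> sym_part A"
proof -
  assume S: "S \<in> Sym"
  have "S \<bullet> transpose A = transpose S \<bullet> A"
    unfolding inner_vec_def transpose_def by (simp, subst sum.swap, rule refl)
  then have "S \<bullet> transpose A = S \<bullet> A" using S by (simp add: sym_matrices_def)
  then show ?thesis by (simp add: sym_part_def inner_add_right)
qed

text \<open>\<open>half\<close> is specified on symmetric matrices only. Composed with
  \<open>sym_part\<close> it is linear on all matrices, which brings measurability and bounds with
  it.\<close>

lemma linear_half_sym: "linear (\<lambda>A. half (sym_part A))"
proof (rule linearI)
  show "half (sym_part (A + B)) = half (sym_part A) + half (sym_part B)" for A B :: "real^'d^'d"
    using half_lincomb[OF sym_part_Sym sym_part_Sym, of 1 A 1 B] by (simp add: linear_add[OF linear_sym_part])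
  show "half (sym_part (c *\<^sub>R A)) = c *\<^sub>R half (sym_part A)" for c and A :: "real^'d^'d"
    using half_lincomb[OF sym_part_Sym sym_part_Sym, of c A 0 A] by (simp add: linear_scale[OF linear_sym_part])
qed

lemma half_inj: "inj_on half Sym"
proof (rule inj_onI)
  fix S S' assume S: "S \<in> Sym" "S' \<in> Sym" "half S = half S'"
  have "half (S - S') = 0" using half_lincomb[OF S(1,2), of 1 "-1"] S(3) by simp
  moreover have "S - S' \<in> Sym" using Sym_lincomb[OF S(1,2), of 1 "-1"] by simp
  ultimately show "S = S'" using half_pos[of "S - S'"] by (cases "S - S' = 0") auto
qed

text \<open>Injectivity and finite dimension; \<open>neg_half\<close> is thereby a two-sided inverse
  on \<open>Sym\<close>.\<close>

lemma half_surj: "half ` Sym = Sym"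
proof -
  let ?f = "\<lambda>A. half (sym_part A)"
  have eq: "?f ` Sym = half ` Sym" by (intro image_cong refl) (simp add: sym_part_id)
  have sp: "span Sym = Sym" by (rule span_eq_iff[THEN iffD2, OF subspace_sym_matrices])
  have inj: "inj_on ?f Sym"
    using half_inj by (simp add: inj_on_def sym_part_id)
  have "?f ` Sym = Sym"
  proof (rule subspace_dim_equal)
    show "subspace (?f ` Sym)" by (rule linear_subspace_image[OF linear_half_sym subspace_sym_matrices])
    show "?f ` Sym \<subseteq> Sym" by (auto intro: half_Sym sym_part_Sym)
    show "dim Sym \<le> dim (?f ` Sym)"
      using dim_image_eq[OF linear_half_sym, of Sym] inj by (simp add: sp)
  qed (rule subspace_sym_matrices)
  then show ?thesis using eq by simp
qed

lemma neg_half_half: "S \<in> Sym \<Longrightarrow> neg_half (half S) = S"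
  unfolding elast_neg_half_def by (rule inv_into_f_f[OF half_inj])

lemma half_neg_half: "S \<in> Sym \<Longrightarrow> half (neg_half S) = S"
  unfolding elast_neg_half_def by (rule f_inv_into_f) (simp add: half_surj)

lemma neg_half_Sym: "S \<in> Sym \<Longrightarrow> neg_half S \<in> Sym"
  unfolding elast_neg_half_def by (rule inv_into_into) (simp add: half_surj)

lemma neg_half_lincomb:
  assumes "S \<in> Sym" "S' \<in> Sym"
  shows "neg_half (a *\<^sub>R S + b *\<^sub>R S') = a *\<^sub>R neg_half S + b *\<^sub>R neg_half S'"
proof -
  have "half (a *\<^sub>R neg_half S + b *\<^sub>R neg_half S') = a *\<^sub>R S + b *\<^sub>R S'"
    by (simp add: half_lincomb neg_half_Sym half_neg_half assms)
  from neg_half_half[OF Sym_lincomb[OF neg_half_Sym[OF assms(1)] neg_half_Sym[OF assms(2)]], of a b, unfolded this]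
  show ?thesis .
qed

lemma linear_neg_half_sym: "linear (\<lambda>A. neg_half (sym_part A))"
proof (rule linearI)
  show "neg_half (sym_part (A + B)) = neg_half (sym_part A) + neg_half (sym_part B)" for A B :: "real^'d^'d"
    using neg_half_lincomb[OF sym_part_Sym sym_part_Sym, of 1 A 1 B] by (simp add: linear_add[OF linear_sym_part])
  show "neg_half (sym_part (c *\<^sub>R A)) = c *\<^sub>R neg_half (sym_part A)" for c and A :: "real^'d^'d"
    using neg_half_lincomb[OF sym_part_Sym sym_part_Sym, of c A 0 A] by (simp add: linear_scale[OF linear_sym_part])
qed

lemma elast_inner: "S \<in> Sym \<Longrightarrow> S' \<in> Sym \<Longrightarrow> elast mu lam S \<bullet> S' = half S \<bullet> half S'"
  using half_self_adjoint[of "half S" S'] by (simp add: half_half half_Sym)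

lemma sym_grad_Sym: "sym_grad \<Omega> w x \<in> Sym"
  by (simp add: sym_grad_def sym_part_Sym)

text \<open>\<open>E\<close> is an isometry of \<open>V\<^sub>\<C>\<close> into \<open>L\<^sup>2\<close>. So \<open>V\<^sub>\<C>\<close> is handled through the closed subspace
  \<open>VV\<close> below, of which \<open>dec\<close> picks representatives, and \<open>rho\<close> is the Riesz isomorphism.\<close>
definition E :: "(real^'d \<Rightarrow> real^'d) \<Rightarrow> (real^'d, real^'d^'d) l2" where
  "E w = cls \<Omega> (\<lambda>x. half (sym_grad \<Omega> w x))"

lemma half_sym_grad_L2:
  assumes "w \<in> W12 \<Omega>" shows "(\<lambda>x. half (sym_grad \<Omega> w x)) \<in> L2_space L"
  using L2_space_linear[OF W12_D(2)[OF assms] linear_half_sym] by (simp add: sym_grad_def)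

lemma VC_norm_E: "w \<in> W12 \<Omega> \<Longrightarrow> VC_norm \<Omega> mu lam w = norm (E w)"
  by (simp add: VC_norm_def E_def norm_cls[OF dom half_sym_grad_L2])

lemma lame_op_E:
  assumes "v \<in> W12 \<Omega>" "w \<in> W12 \<Omega>" shows "lame_op \<Omega> mu lam v w = E v \<bullet> E w"
  by (simp add: lame_op_def E_def inner_cls[OF dom half_sym_grad_L2[OF assms(1)] half_sym_grad_L2[OF assms(2)]]
      elast_inner sym_grad_Sym)

text \<open>\<open>weak_grad\<close> is a choice, so it is linear only almost everywhere. Here such
  relations between classes are carried through a pointwise linear map.\<close>

lemma cls_linear_lincomb:
  fixes A :: "'b::euclidean_space \<Rightarrow> 'c::euclidean_space"
  assumes f: "f \<in> L2_space L" and h: "h \<in> L2_space L" and k: "k \<in> L2_space L" and A: "linear A"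
    and eq: "cls \<Omega> k = a *\<^sub>R cls \<Omega> f + b *\<^sub>R cls \<Omega> h"
  shows "cls \<Omega> (\<lambda>x. A (k x)) = a *\<^sub>R cls \<Omega> (\<lambda>x. A (f x)) + b *\<^sub>R cls \<Omega> (\<lambda>x. A (h x))"
proof -
  have "cls \<Omega> k = cls \<Omega> (\<lambda>x. a *\<^sub>R f x + b *\<^sub>R h x)" by (simp add: eq cls_lincomb[OF dom f h])
  then have "AE x in L. k x = a *\<^sub>R f x + b *\<^sub>R h x"
    by (simp add: cls_eq_iff[OF dom k L2_space_lincomb[OF f h]])
  then have "AE x in L. A (k x) = a *\<^sub>R A (f x) + b *\<^sub>R A (h x)"
    by eventually_elim (simp add: linear_add[OF A] linear_scale[OF A])
  then have "cls \<Omega> (\<lambda>x. A (k x)) = cls \<Omega> (\<lambda>x. a *\<^sub>R A (f x) + b *\<^sub>R A (h x))"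
    by (simp add: cls_eq_iff[OF dom L2_space_linear[OF k A] L2_space_lincomb[OF L2_space_linear[OF f A] L2_space_linear[OF h A]]])
  then show ?thesis by (simp add: cls_lincomb[OF dom L2_space_linear[OF f A] L2_space_linear[OF h A]])
qed

lemma E_lincomb:
  assumes v: "v \<in> W12 \<Omega>" and w: "w \<in> W12 \<Omega>"
  shows "E (\<lambda>x. a *\<^sub>R v x + b *\<^sub>R w x) = a *\<^sub>R E v + b *\<^sub>R E w"
  unfolding E_def sym_grad_def
  by (rule cls_linear_lincomb[OF W12_D(2)[OF v] W12_D(2)[OF w] W12_D(2)[OF W12_lincomb(1)[OF v w]] linear_half_sym
        W12_lincomb(2)[OF v w]])

lemma E_diff: "v \<in> W12 \<Omega> \<Longrightarrow> w \<in> W12 \<Omega> \<Longrightarrow> E (v - w) = E v - E w"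
  using E_lincomb[of v w 1 "-1"] by (simp add: fun_diff_def)

lemma E_bounded:
  obtains K where "K > 0" "\<forall>w\<in>W12 \<Omega>. norm (E w) \<le> K * W12_norm \<Omega> w"
proof -
  obtain K where K: "K > 0" "\<forall>A. norm (half (sym_part A)) \<le> K * norm (A :: real^'d^'d)"
    using linear_bounded_pos[OF linear_half_sym] by metis
  have "norm (E w) \<le> K * W12_norm \<Omega> w" if w: "w \<in> W12 \<Omega>" for w
  proof -
    have "norm (E w) \<le> K * norm (cls \<Omega> (weak_grad \<Omega> w))"
      unfolding E_def sym_grad_def
      by (rule norm_cls_linear_le[OF dom W12_D(2)[OF w] linear_half_sym K(2)[rule_format]]) (use K in simp)
    also have "\<dots> \<le> K * W12_norm \<Omega> w" using K(1) W12_norm_ge(2)[OF w] by simp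
    finally show ?thesis .
  qed
  then show ?thesis using that K(1) by blast
qed

text \<open>Boundedness of the power -1/2 of the elasticity tensor, then Korn, then Poincare. With
  \<open>E_bounded\<close>, the energy norm and \<open>W12_norm\<close> are equivalent on V.\<close>

lemma coercive:
  obtains C where "C > 0" "\<forall>w\<in>V_space \<Omega>. W12_norm \<Omega> w \<le> C * norm (E w)"
proof -
  obtain C1 where C1: "C1 > 0" "\<forall>w\<in>V_space \<Omega>. norm (cls \<Omega> w) \<le> C1 * norm (cls \<Omega> (weak_grad \<Omega> w))"
    by (rule Poincare_V)
  obtain K where K: "K > 0" "\<forall>A. norm (neg_half (sym_part A)) \<le> K * norm (A :: real^'d^'d)"
    using linear_bounded_pos[OF linear_neg_half_sym] by metis
  have "W12_norm \<Omega> w \<le> ((C1 + 1) * (2 * K)) * norm (E w)" if w: "w \<in> V_space \<Omega>" for w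
  proof -
    note W = V_space_W12[OF w]
    have "cls \<Omega> (sym_grad \<Omega> w) = cls \<Omega> (\<lambda>x. neg_half (sym_part (half (sym_grad \<Omega> w x))))"
      by (simp add: sym_part_id half_Sym sym_grad_Sym neg_half_half)
    also have "norm \<dots> \<le> K * norm (E w)"
      unfolding E_def
      by (rule norm_cls_linear_le[OF dom half_sym_grad_L2[OF W] linear_neg_half_sym K(2)[rule_format]]) (use K in simp)
    finally have s: "norm (cls \<Omega> (sym_grad \<Omega> w)) \<le> K * norm (E w)" .
    have g: "norm (cls \<Omega> (weak_grad \<Omega> w)) \<le> 2 * K * norm (E w)"
    proof (rule power2_le_imp_le)
      have "(norm (cls \<Omega> (weak_grad \<Omega> w)))\<^sup>2 \<le> 2 * (norm (cls \<Omega> (sym_grad \<Omega> w)))\<^sup>2" by (rule Korn_V[OF w])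
      \<comment> \<open>Weakened from 2 to 4 so that the square root is rational.\<close>
      also have "\<dots> \<le> 4 * (norm (cls \<Omega> (sym_grad \<Omega> w)))\<^sup>2" by simp
      also have "\<dots> \<le> 4 * (K * norm (E w))\<^sup>2" using power_mono[OF s norm_ge_zero, of 2] by simp
      finally show "(norm (cls \<Omega> (weak_grad \<Omega> w)))\<^sup>2 \<le> (2 * K * norm (E w))\<^sup>2" by (simp add: power_mult_distrib)
    qed (use K in simp)
    have "W12_norm \<Omega> w \<le> norm (cls \<Omega> w) + norm (cls \<Omega> (weak_grad \<Omega> w))" by (rule W12_norm_le[OF W])
    also have "\<dots> \<le> (C1 + 1) * norm (cls \<Omega> (weak_grad \<Omega> w))" using C1(2) w by (simp add: algebra_simps)
    also have "\<dots> \<le> (C1 + 1) * (2 * K * norm (E w))" using g C1(1) by (intro mult_left_mono) auto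
    finally show ?thesis by (simp only: mult.assoc)
  qed
  moreover have "(C1 + 1) * (2 * K) > 0" using C1(1) K(1) by simp
  ultimately show ?thesis using that by blast
qed

section \<open>The energy space as a closed subspace of \<open>l2\<close>\<close>

definition VV :: "(real^'d, real^'d^'d) l2 set" where "VV = E ` V_space \<Omega>"

lemma V_space_0: "(\<lambda>x. 0) \<in> V_space \<Omega>"
proof -
  have t: "(\<lambda>x. 0) \<in> test_functions \<Omega>"
    by (auto simp: test_functions_def C_k_const intro!: exI[of _ "{}"])
  have z: "(\<lambda>x. 0) - (\<lambda>x. 0) = (\<lambda>x::real^'d. 0::real^'d)" by (simp add: fun_eq_iff)
  have "W12_norm \<Omega> ((\<lambda>x. 0) - (\<lambda>x. 0)) \<le> 0"
    using W12_norm_le[OF W12_diff(1)[OF test_W12(1)[OF t] test_W12(1)[OF t]]]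
    unfolding W12_diff(2,3)[OF test_W12(1)[OF t] test_W12(1)[OF t]] by simp
  then have "W12_norm \<Omega> ((\<lambda>x. 0) - (\<lambda>x. 0)) = 0" using W12_norm_nonneg by (rule order_antisym)
  then show ?thesis
    unfolding V_space_iff[OF test_W12(1)[OF t]]
    by (intro allI impI bexI[of _ "\<lambda>x. 0"]) (use t in simp_all)
qed

lemma V_space_diff: "v \<in> V_space \<Omega> \<Longrightarrow> w \<in> V_space \<Omega> \<Longrightarrow> v - w \<in> V_space \<Omega>"
  using V_space_lincomb[of v w 1 "-1"] by (simp add: fun_diff_def)

lemma subspace_VV: "subspace VV"
proof (rule subspaceI)
  have "E (\<lambda>x. 0) = 0"
    using E_lincomb[OF V_space_W12[OF V_space_0] V_space_W12[OF V_space_0], of 0 0] by simp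
  then show "0 \<in> VV" using V_space_0 by (force simp: VV_def)
  fix x y assume "x \<in> VV" "y \<in> VV"
  then obtain v w where vw: "v \<in> V_space \<Omega>" "w \<in> V_space \<Omega>" "x = E v" "y = E w" by (auto simp: VV_def)
  have *: "a *\<^sub>R x + b *\<^sub>R y \<in> VV" for a b
    unfolding VV_def vw(3,4) E_lincomb[OF V_space_W12[OF vw(1)] V_space_W12[OF vw(2)], symmetric]
    by (rule imageI[OF V_space_lincomb[OF vw(1,2)]])
  show "x + y \<in> VV" using *[of 1 1] by simp
  show "c *\<^sub>R x \<in> VV" for c using *[of c 0] by simp
qed

text \<open>Coercivity turns a Cauchy sequence of images under E into Cauchy sequences of functions
  and of gradients, to which \<open>V_space_closed\<close> applies.\<close>

lemma closed_VV: "closed VV"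
  unfolding closed_sequential_limits
proof (intro allI impI, elim conjE)
  fix x l assume x: "\<forall>n. x n \<in> VV" "x \<longlonglongrightarrow> l"
  obtain C where C: "C > 0" "\<forall>w\<in>V_space \<Omega>. W12_norm \<Omega> w \<le> C * norm (E w)" by (rule coercive)
  have "\<forall>n. \<exists>w. w \<in> V_space \<Omega> \<and> x n = E w" using x(1) by (auto simp: VV_def)
  then obtain w where w: "\<forall>n. w n \<in> V_space \<Omega> \<and> x n = E (w n)" by (rule choice[THEN exE])
  have wV: "w n \<in> V_space \<Omega>" and xE: "x n = E (w n)" for n using w by auto
  note W = V_space_W12[OF wV]
  have Cx: "Cauchy x" using x(2) by (rule LIMSEQ_imp_Cauchy)
  have le: "W12_norm \<Omega> (w m - w n) \<le> C * norm (x m - x n)" for m n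
    unfolding xE E_diff[OF W W, symmetric] using C(2) V_space_diff[OF wV wV] by blast
  have Cau: "Cauchy f" if f: "\<And>m n. norm (f m - f n) \<le> W12_norm \<Omega> (w m - w n)"
    for f :: "nat \<Rightarrow> 'z::real_normed_vector"
  proof (rule metric_CauchyI)
    fix e :: real assume "e > 0"
    then have "e / C > 0" using C(1) by simp
    from metric_CauchyD[OF Cx this] obtain N where N: "\<forall>m\<ge>N. \<forall>n\<ge>N. dist (x m) (x n) < e / C" ..
    show "\<exists>M. \<forall>m\<ge>M. \<forall>n\<ge>M. dist (f m) (f n) < e"
    proof (intro exI allI impI)
      fix m n assume "N \<le> m" "N \<le> n"
      then have "norm (x m - x n) < e / C" using N by (simp add: dist_norm)
      then have "C * norm (x m - x n) < e" using C(1) by (simp add: field_simps)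
      then show "dist (f m) (f n) < e" using f[of m n] le[of m n] by (simp add: dist_norm)
    qed
  qed
  have "Cauchy (\<lambda>n. cls \<Omega> (w n))"
    by (rule Cau) (use W12_norm_ge(1)[OF W12_diff(1)[OF W W]] W12_diff(2)[OF W W] in simp)
  then obtain X where X: "(\<lambda>n. cls \<Omega> (w n)) \<longlonglongrightarrow> X" using Cauchy_convergent convergent_def by blast
  have "Cauchy (\<lambda>n. cls \<Omega> (weak_grad \<Omega> (w n)))"
    by (rule Cau) (use W12_norm_ge(2)[OF W12_diff(1)[OF W W]] W12_diff(3)[OF W W] in simp)
  then obtain Y where Y: "(\<lambda>n. cls \<Omega> (weak_grad \<Omega> (w n))) \<longlonglongrightarrow> Y" using Cauchy_convergent convergent_def by blast
  note R = V_space_closed[OF wV X Y]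
  have "(\<lambda>n. E (w n)) \<longlonglongrightarrow> E (rep_l2 X)"
    unfolding E_def sym_grad_def
    by (rule cls_linear_tendsto[OF W12_D(2)[OF W] W12_D(2)[OF V_space_W12[OF R(1)]] _ linear_half_sym])
      (use Y R(3) in simp)
  then have "x \<longlonglongrightarrow> E (rep_l2 X)" by (simp add: xE[symmetric])
  then have "l = E (rep_l2 X)" by (rule LIMSEQ_unique[OF x(2)])
  then show "l \<in> VV" using R(1) by (simp add: VV_def)
qed

definition dec :: "(real^'d, real^'d^'d) l2 \<Rightarrow> real^'d \<Rightarrow> real^'d" where
  "dec x = (SOME w. w \<in> V_space \<Omega> \<and> E w = x)"

lemma dec: assumes "x \<in> VV" shows "dec x \<in> V_space \<Omega>" "E (dec x) = x"
proof -
  have "\<exists>w. w \<in> V_space \<Omega> \<and> E w = x" using assms by (auto simp: VV_def)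
  from someI_ex[OF this] show "dec x \<in> V_space \<Omega>" "E (dec x) = x" by (simp_all add: dec_def)
qed

lemma E_VV: "w \<in> V_space \<Omega> \<Longrightarrow> E w \<in> VV"
  by (simp add: VV_def)

text \<open>By coercivity E is injective up to null functions. Hence neither the class of
  \<open>dec x\<close> nor the value of a bounded functional at it depends on the choice
  made.\<close>

lemma E_eq_D:
  assumes v: "v \<in> V_space \<Omega>" and w: "w \<in> V_space \<Omega>" and eq: "E v = E w"
  shows "W12_norm \<Omega> (v - w) = 0" "cls \<Omega> v = cls \<Omega> w"
proof -
  note W = V_space_W12[OF v] V_space_W12[OF w]
  obtain C where C: "C > 0" "\<forall>w\<in>V_space \<Omega>. W12_norm \<Omega> w \<le> C * norm (E w)" by (rule coercive)
  have "W12_norm \<Omega> (v - w) \<le> C * norm (E (v - w))" using C(2) V_space_diff[OF v w] by blast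
  also have "\<dots> = 0" by (simp add: E_diff[OF W] eq)
  finally show 0: "W12_norm \<Omega> (v - w) = 0" using W12_norm_nonneg[of "v - w"] by simp
  show "cls \<Omega> v = cls \<Omega> w"
    using W12_norm_ge(1)[OF W12_diff(1)[OF W]] unfolding 0 W12_diff(2)[OF W] by simp
qed

subsection \<open>Riesz representation of functionals on \<open>V\<close>\<close>

abbreviation "VD \<equiv> dual_space (V_space \<Omega>) (W12_norm \<Omega>)"

lemma VD_diff:
  assumes "\<phi> \<in> VD" "v \<in> V_space \<Omega>" "w \<in> V_space \<Omega>" shows "\<phi> (v - w) = \<phi> v - \<phi> w"
  using dual_space_D(1)[OF assms, of 1 "-1"] by (simp add: fun_diff_def)

lemma VD_E_eq:
  assumes \<phi>: "\<phi> \<in> VD" and vw: "v \<in> V_space \<Omega>" "w \<in> V_space \<Omega>" "E v = E w" shows "\<phi> v = \<phi> w"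
proof -
  obtain C where "\<forall>w\<in>V_space \<Omega>. \<bar>\<phi> w\<bar> \<le> C * \<bar>W12_norm \<Omega> w\<bar>" using dual_space_D(2)[OF \<phi>] by blast
  then have "\<bar>\<phi> (v - w)\<bar> \<le> C * \<bar>W12_norm \<Omega> (v - w)\<bar>" using V_space_diff[OF vw(1,2)] by blast
  then show ?thesis by (simp add: E_eq_D(1)[OF vw] VD_diff[OF \<phi> vw(1,2)])
qed

definition rho :: "((real^'d \<Rightarrow> real^'d) \<Rightarrow> real) \<Rightarrow> (real^'d, real^'d^'d) l2" where
  "rho \<phi> = (SOME z. z \<in> VV \<and> (\<forall>w\<in>V_space \<Omega>. \<phi> w = z \<bullet> E w))"

text \<open>Riesz' theorem for the functional \<open>\<phi> (dec x)\<close> of x in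
  \<open>VV\<close>; it is linear there because \<phi> does not see the choice in
  \<open>dec\<close>, and bounded by coercivity.\<close>

lemma rho:
  assumes \<phi>: "\<phi> \<in> VD" shows "rho \<phi> \<in> VV" "w \<in> V_space \<Omega> \<Longrightarrow> \<phi> w = rho \<phi> \<bullet> E w"
proof -
  obtain C where C: "C > 0" "\<forall>w\<in>V_space \<Omega>. W12_norm \<Omega> w \<le> C * norm (E w)" by (rule coercive)
  obtain D where D: "D \<ge> 0" "\<forall>w\<in>V_space \<Omega>. \<bar>\<phi> w\<bar> \<le> D * \<bar>W12_norm \<Omega> w\<bar>" using dual_space_D(2)[OF \<phi>] by blast
  have decE: "\<phi> (dec (E w)) = \<phi> w" if "w \<in> V_space \<Omega>" for w
    by (rule VD_E_eq[OF \<phi> dec(1)[OF E_VV[OF that]] that dec(2)[OF E_VV[OF that]]])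
  have lc: "\<phi> (dec (a *\<^sub>R x + b *\<^sub>R y)) = a * \<phi> (dec x) + b * \<phi> (dec y)" if x: "x \<in> VV" and y: "y \<in> VV" for x y a b
  proof -
    let ?w = "\<lambda>z. a *\<^sub>R dec x z + b *\<^sub>R dec y z"
    have "E ?w = a *\<^sub>R x + b *\<^sub>R y"
      by (simp add: E_lincomb[OF V_space_W12[OF dec(1)[OF x]] V_space_W12[OF dec(1)[OF y]]] dec(2)[OF x] dec(2)[OF y])
    then have "\<phi> (dec (a *\<^sub>R x + b *\<^sub>R y)) = \<phi> ?w"
      using decE[OF V_space_lincomb[OF dec(1)[OF x] dec(1)[OF y], of a b]] by simp
    also have "\<dots> = a * \<phi> (dec x) + b * \<phi> (dec y)" by (rule dual_space_D(1)[OF \<phi> dec(1)[OF x] dec(1)[OF y]])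
    finally show ?thesis .
  qed
  have "\<exists>z\<in>VV. \<forall>x\<in>VV. \<phi> (dec x) = z \<bullet> x"
  proof (rule riesz_closed_subspace[OF subspace_VV closed_VV])
    show "\<phi> (dec (x + y)) = \<phi> (dec x) + \<phi> (dec y)" if "x \<in> VV" "y \<in> VV" for x y
      using lc[OF that, of 1 1] by simp
    show "\<phi> (dec (c *\<^sub>R x)) = c * \<phi> (dec x)" if "x \<in> VV" for c x
      using lc[OF that that, of c 0] by simp
    show "\<bar>\<phi> (dec x)\<bar> \<le> (D * C) * norm x" if "x \<in> VV" for x
    proof -
      have "\<bar>\<phi> (dec x)\<bar> \<le> D * \<bar>W12_norm \<Omega> (dec x)\<bar>" using D(2) dec(1)[OF that] by blast
      also have "\<dots> \<le> D * (C * norm x)"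
        using C(2)[rule_format, OF dec(1)[OF that]] D(1) dec(2)[OF that] W12_norm_nonneg[of "dec x"]
        by (intro mult_left_mono) auto
      finally show ?thesis by (simp only: mult.assoc)
    qed
  qed
  then obtain z where z: "z \<in> VV" "\<forall>x\<in>VV. \<phi> (dec x) = z \<bullet> x" by blast
  have "\<phi> w = z \<bullet> E w" if "w \<in> V_space \<Omega>" for w
    using z(2) E_VV[OF that] decE[OF that] by simp
  then have "\<exists>z. z \<in> VV \<and> (\<forall>w\<in>V_space \<Omega>. \<phi> w = z \<bullet> E w)" using z(1) by blast
  from someI_ex[OF this] show "rho \<phi> \<in> VV" "w \<in> V_space \<Omega> \<Longrightarrow> \<phi> w = rho \<phi> \<bullet> E w"
    unfolding rho_def by blast+
qed

lemma VV_eqI: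
  assumes "x \<in> VV" "y \<in> VV" "\<And>w. w \<in> V_space \<Omega> \<Longrightarrow> x \<bullet> E w = y \<bullet> E w" shows "x = y"
proof -
  have d: "x - y \<in> VV" using assms subspace_VV by (simp add: subspace_diff)
  have "(x - y) \<bullet> (x - y) = 0"
    using assms(3)[OF dec(1)[OF d]] by (simp add: dec(2)[OF d] inner_diff_left)
  then show ?thesis by simp
qed

lemma rho_eqI:
  assumes "\<phi> \<in> VD" "x \<in> VV" "\<And>w. w \<in> V_space \<Omega> \<Longrightarrow> \<phi> w = x \<bullet> E w" shows "rho \<phi> = x"
  by (rule VV_eqI[OF rho(1)[OF assms(1)] assms(2)]) (use rho(2)[OF assms(1)] assms(3) in simp)

text \<open>Boundedness of E in the norm of V; x may lie outside \<open>VV\<close>, as it does for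
  the function \<open>Q\<close> further below.\<close>

lemma VD_of_VV:
  assumes "\<And>w. w \<in> V_space \<Omega> \<Longrightarrow> \<phi> w = x \<bullet> E w" shows "\<phi> \<in> VD"
proof -
  obtain K where K: "K > 0" "\<forall>w\<in>W12 \<Omega>. norm (E w) \<le> K * W12_norm \<Omega> w" by (rule E_bounded)
  have "\<bar>\<phi> w\<bar> \<le> (norm x * K) * W12_norm \<Omega> w" if w: "w \<in> V_space \<Omega>" for w
  proof -
    have "\<bar>\<phi> w\<bar> \<le> norm x * norm (E w)" using assms[OF w] Cauchy_Schwarz_ineq2 by simp
    also have "\<dots> \<le> norm x * (K * W12_norm \<Omega> w)" using K(2) V_space_W12[OF w] by (intro mult_left_mono) auto
    finally show ?thesis by (simp only: mult.assoc)
  qed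
  then show ?thesis
    unfolding dual_space_def
    using assms V_space_lincomb E_lincomb V_space_W12 by (auto simp: inner_add_right)
qed

lemma VD_sub:
  assumes "\<phi> \<in> VD" "\<psi> \<in> VD" shows "\<phi> - \<psi> \<in> VD" "rho (\<phi> - \<psi>) = rho \<phi> - rho \<psi>"
proof -
  have *: "(\<phi> - \<psi>) w = (rho \<phi> - rho \<psi>) \<bullet> E w" if "w \<in> V_space \<Omega>" for w
    using rho(2)[OF assms(1) that] rho(2)[OF assms(2) that] by (simp add: inner_diff_left)
  show d: "\<phi> - \<psi> \<in> VD" by (rule VD_of_VV[OF *])
  show "rho (\<phi> - \<psi>) = rho \<phi> - rho \<psi>"
    by (rule rho_eqI[OF d _ *]) (use rho(1) assms subspace_VV in \<open>auto intro: subspace_diff\<close>)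
qed

text \<open>A real supremum is meaningful for nonempty bounded sets only: the zero function provides
  a member, and C a bound.\<close>

lemma dual_norm_bound:
  fixes N :: "(real^'d \<Rightarrow> real^'d) \<Rightarrow> real"
  assumes \<phi>: "\<And>w. w \<in> V_space \<Omega> \<Longrightarrow> \<bar>\<phi> w\<bar> \<le> C * N w" and C: "C \<ge> 0" and N: "N (\<lambda>x. 0) \<le> 1"
  shows "dual_norm (V_space \<Omega>) N \<phi> \<le> C" "w \<in> V_space \<Omega> \<Longrightarrow> N w \<le> 1 \<Longrightarrow> \<bar>\<phi> w\<bar> \<le> dual_norm (V_space \<Omega>) N \<phi>"
proof -
  have le: "\<bar>\<phi> w\<bar> \<le> C" if "w \<in> {w \<in> V_space \<Omega>. N w \<le> 1}" for w
    using \<phi>[of w] mult_left_mono[of "N w" 1 C] C that by simp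
  show "dual_norm (V_space \<Omega>) N \<phi> \<le> C"
    unfolding dual_norm_def by (rule cSUP_least) (use N V_space_0 le in auto)
  show "w \<in> V_space \<Omega> \<Longrightarrow> N w \<le> 1 \<Longrightarrow> \<bar>\<phi> w\<bar> \<le> dual_norm (V_space \<Omega>) N \<phi>"
    unfolding dual_norm_def by (rule cSUP_upper) (use le in \<open>auto intro: bdd_aboveI2[of _ _ C]\<close>)
qed

lemma W12_norm_0: "W12_norm \<Omega> (\<lambda>x. 0) = 0"
proof -
  have "(\<lambda>x. 0) - (\<lambda>x. 0) = (\<lambda>x::real^'d. 0::real^'d)" by (simp add: fun_eq_iff)
  then show ?thesis using E_eq_D(1)[OF V_space_0 V_space_0 refl] by metis
qed

lemma dual_norm_VC:
  assumes \<phi>: "\<And>w. w \<in> V_space \<Omega> \<Longrightarrow> \<phi> w = x \<bullet> E w" and x: "x \<in> VV"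
  shows "dual_norm (V_space \<Omega>) (VC_norm \<Omega> mu lam) \<phi> = norm x"
proof (rule order_antisym)
  have VC: "VC_norm \<Omega> mu lam w = norm (E w)" if "w \<in> V_space \<Omega>" for w
    by (rule VC_norm_E[OF V_space_W12[OF that]])
  have b: "\<bar>\<phi> w\<bar> \<le> norm x * VC_norm \<Omega> mu lam w" if "w \<in> V_space \<Omega>" for w
    using Cauchy_Schwarz_ineq2[of x "E w"] by (simp add: \<phi>[OF that] VC[OF that])
  have E0: "E (\<lambda>x. 0) = 0"
    using E_lincomb[OF V_space_W12[OF V_space_0] V_space_W12[OF V_space_0], of 0 0] by simp
  have N0: "VC_norm \<Omega> mu lam (\<lambda>x. 0) \<le> 1" by (simp add: VC[OF V_space_0] E0)
  show "dual_norm (V_space \<Omega>) (VC_norm \<Omega> mu lam) \<phi> \<le> norm x"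
    by (rule dual_norm_bound(1)[where \<phi> = \<phi> and N = "VC_norm \<Omega> mu lam", OF b _ N0]) simp_all
  show "norm x \<le> dual_norm (V_space \<Omega>) (VC_norm \<Omega> mu lam) \<phi>"
  proof -
    \<comment> \<open>For x = 0 the quotient is 0 by convention, so \<open>?y\<close> is 0 and no
      case distinction arises.\<close>
    let ?y = "(1 / norm x) *\<^sub>R x"
    have y: "?y \<in> VV" using x subspace_VV by (simp add: subspace_scale)
    have "norm ?y \<le> 1" by simp
    then have "\<bar>\<phi> (dec ?y)\<bar> \<le> dual_norm (V_space \<Omega>) (VC_norm \<Omega> mu lam) \<phi>"
      by (intro dual_norm_bound(2)[where \<phi> = \<phi> and N = "VC_norm \<Omega> mu lam", OF b _ N0]) (simp_all add: dec[OF y] VC)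
    moreover have "\<phi> (dec ?y) = norm x"
      by (simp add: \<phi>[OF dec(1)[OF y]] dec(2)[OF y] dot_square_norm power2_eq_square)
    ultimately show ?thesis by simp
  qed
qed

text \<open>The norm dual to \<open>W12_norm\<close> and the norm of the Riesz representative are
  equivalent: the bound of E gives one direction, the coercivity constant the other.\<close>

lemma dual_norm_W12:
  obtains C where "C > 0" "\<forall>\<phi>\<in>VD. norm (rho \<phi>) \<le> C * dual_norm (V_space \<Omega>) (W12_norm \<Omega>) \<phi>"
    "\<forall>\<phi>\<in>VD. dual_norm (V_space \<Omega>) (W12_norm \<Omega>) \<phi> \<le> C * norm (rho \<phi>)"
    "\<forall>\<phi>\<in>VD. 0 \<le> dual_norm (V_space \<Omega>) (W12_norm \<Omega>) \<phi>"
proof -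
  let ?D = "dual_norm (V_space \<Omega>) (W12_norm \<Omega>)"
  obtain K where K: "K > 0" "\<forall>w\<in>W12 \<Omega>. norm (E w) \<le> K * W12_norm \<Omega> w" by (rule E_bounded)
  obtain C where C: "C > 0" "\<forall>w\<in>V_space \<Omega>. W12_norm \<Omega> w \<le> C * norm (E w)" by (rule coercive)
  have b: "\<bar>\<phi> w\<bar> \<le> (K * norm (rho \<phi>)) * W12_norm \<Omega> w" if "\<phi> \<in> VD" "w \<in> V_space \<Omega>" for \<phi> w
  proof -
    have "\<bar>\<phi> w\<bar> \<le> norm (rho \<phi>) * norm (E w)" using rho(2)[OF that] Cauchy_Schwarz_ineq2 by simp
    also have "\<dots> \<le> norm (rho \<phi>) * (K * W12_norm \<Omega> w)"
      using K(2) V_space_W12[OF that(2)] by (intro mult_left_mono) auto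
    finally show ?thesis by (simp only: mult.commute mult.left_commute)
  qed
  have up: "?D \<phi> \<le> K * norm (rho \<phi>)" if "\<phi> \<in> VD" for \<phi>
    by (rule dual_norm_bound(1)[where \<phi> = \<phi> and N = "W12_norm \<Omega>", OF b[OF that]]) (use K W12_norm_0 in auto)
  have sup: "\<bar>\<phi> w\<bar> \<le> ?D \<phi>" if "\<phi> \<in> VD" "w \<in> V_space \<Omega>" "W12_norm \<Omega> w \<le> 1" for \<phi> w
    by (rule dual_norm_bound(2)[where \<phi> = \<phi> and N = "W12_norm \<Omega>", OF b[OF that(1)] _ _ that(2,3)])
      (use K W12_norm_0 in auto)
  have nn: "0 \<le> ?D \<phi>" if "\<phi> \<in> VD" for \<phi>
    using sup[OF that V_space_0] W12_norm_0 by (simp add: order_trans[OF abs_ge_zero])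
  have low: "norm (rho \<phi>) \<le> C * ?D \<phi>" if \<phi>: "\<phi> \<in> VD" for \<phi>
  proof (cases "rho \<phi> = 0")
    case True
    then show ?thesis using nn[OF \<phi>] C(1) by simp
  next
    case False
    define r where "r = norm (rho \<phi>)"
    have r: "r > 0" using False by (simp add: r_def)
    \<comment> \<open>Dividing by C as well puts the representative into the unit ball of
      \<open>W12_norm\<close>.\<close>
    let ?y = "(1 / (C * r)) *\<^sub>R rho \<phi>"
    have y: "?y \<in> VV" using rho(1)[OF \<phi>] subspace_VV by (simp add: subspace_scale)
    have "norm ?y = 1 / C" using r C(1) by (simp add: r_def[symmetric])
    then have "W12_norm \<Omega> (dec ?y) \<le> 1"
      using C(2)[rule_format, OF dec(1)[OF y]] C(1) by (simp add: dec(2)[OF y])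
    then have "\<bar>\<phi> (dec ?y)\<bar> \<le> ?D \<phi>" by (rule sup[OF \<phi> dec(1)[OF y]])
    moreover have "\<phi> (dec ?y) = r / C"
      unfolding rho(2)[OF \<phi> dec(1)[OF y]] dec(2)[OF y]
      using r C(1) by (simp add: dot_square_norm r_def[symmetric] power2_eq_square)
    ultimately have "r / C \<le> ?D \<phi>" by (metis abs_ge_self order_trans)
    then show ?thesis using C(1) by (simp add: r_def field_simps)
  qed
  show ?thesis
  proof (rule that[of "max C K"])
    show "max C K > 0" using C(1) by simp
    show "\<forall>\<phi>\<in>VD. norm (rho \<phi>) \<le> max C K * ?D \<phi>"
    proof
      fix \<phi> assume p: "\<phi> \<in> VD"
      show "norm (rho \<phi>) \<le> max C K * ?D \<phi>"
        by (rule order_trans[OF low[OF p] mult_right_mono[OF _ nn[OF p]]]) simp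
    qed
    show "\<forall>\<phi>\<in>VD. ?D \<phi> \<le> max C K * norm (rho \<phi>)"
    proof
      fix \<phi> assume p: "\<phi> \<in> VD"
      show "?D \<phi> \<le> max C K * norm (rho \<phi>)"
        by (rule order_trans[OF up[OF p] mult_right_mono]) simp_all
    qed
    show "\<forall>\<phi>\<in>VD. 0 \<le> ?D \<phi>" using nn by blast
  qed
qed

end

subsection \<open>Time-dependent functions\<close>

lemma (in complete_measure) integrable_AE_cong:
  fixes f h :: "'a \<Rightarrow> real"
  assumes "integrable M f" "AE t in M. f t = h t"
  shows "integrable M h" "integral\<^sup>L M h = integral\<^sup>L M f"
proof -
  have fm: "f \<in> borel_measurable M" using assms(1) by auto
  have hm: "h \<in> borel_measurable M" by (rule borel_measurable_AE_cong[OF fm assms(2)])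
  show "integrable M h" using integrable_cong_AE[OF fm hm assms(2)] assms(1) by simp
  show "integral\<^sup>L M h = integral\<^sup>L M f" using integral_cong_AE[OF fm hm assms(2)] by simp
qed

text \<open>Holds without measurability: if one side is not integrable, neither is the other, and
  both integrals have the default value 0.\<close>

lemma (in complete_measure) integral_AE_cong:
  fixes f h :: "'a \<Rightarrow> real"
  assumes "AE t in M. f t = h t"
  shows "integral\<^sup>L M f = integral\<^sup>L M h"
proof (cases "integrable M f")
  case True
  then show ?thesis using integrable_AE_cong[OF True assms] by simp
next
  case False
  have "AE t in M. h t = f t" using assms by eventually_elim simp
  then have "\<not> integrable M h" using integrable_AE_cong(1)[of h f] False by blast
  with False show ?thesis by (simp add: not_integrable_integral_eq)
qed

lemma continuous_AE_eq:
  fixes f h :: "real \<Rightarrow> 'a::real_normed_vector"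
  assumes T: "T > 0" and f: "continuous_on {0..T} f" and h: "continuous_on {0..T} h"
    and eq: "AE t in time_measure T. f t = h t" and t: "t \<in> {0..T}"
  shows "f t = h t"
proof -
  define G where "G = {t \<in> {0..T}. f t = h t}"
  have "AE t in time_measure T. t \<in> G"
    using eq AE_time_space[of T] by eventually_elim (simp add: G_def)
  then have cl: "closure G = {0..T}" by (rule closure_AE_time[OF _ _ T]) (auto simp: G_def)
  have "f t - h t = 0"
  proof (rule continuous_constant_on_closure[where S = G])
    show "continuous_on (closure G) (\<lambda>t. f t - h t)" unfolding cl by (intro continuous_intros f h)
  qed (use t cl in \<open>auto simp: G_def\<close>)
  then show ?thesis by simp
qed

locale lame_time = lame \<Omega> mu lam for \<Omega> :: "(real^'d) set" and mu lam :: real +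
  fixes T :: real
  assumes T: "T > 0"
begin

abbreviation "I \<equiv> time_measure T"

lemma complete_I: "complete_measure I"
  by (rule complete_measure_lebesgue_on) simp

lemma smeas_measurable: "smeas I f \<Longrightarrow> f \<in> borel_measurable I" for f :: "real \<Rightarrow> real"
  by (rule smeas_real_measurable[OF complete_I])

section \<open>Bochner functions as functions with values in \<open>l2\<close>\<close>

lemma L2_Bochner_D:
  assumes "v \<in> L2_Bochner M X N"
  obtains s where "AE t in M. v t \<in> X" "\<forall>n. simple_function M (s n)" "\<forall>n. s n ` space M \<subseteq> X"
    "AE t in M. (\<lambda>n. N (s n t - v t)) \<longlonglongrightarrow> 0" "integrable M (\<lambda>t. (N (v t))\<^sup>2)"
  using assms unfolding L2_Bochner_def mem_Collect_eq by (elim conjE exE) (blast intro: that)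

lemma L2_Bochner_AE: "v \<in> L2_Bochner M X N \<Longrightarrow> AE t in M. v t \<in> X"
  by (simp add: L2_Bochner_def)

text \<open>A map F that is Lipschitz for the seminorm N carries the approximating simple functions
  along; F is not assumed linear, hence the separate growth bound \<open>F0\<close>. Applied to
  \<open>E\<close>, \<open>cls\<close>, gradients, \<open>rho\<close> and
  \<open>flux\<close>.\<close>

lemma L2_Bochner_smeas:
  fixes F :: "('a \<Rightarrow> 'b::real_vector) \<Rightarrow> 'v::real_normed_vector"
  assumes v: "v \<in> L2_Bochner I X N"
    and F: "\<And>x y. x \<in> X \<Longrightarrow> y \<in> X \<Longrightarrow> norm (F x - F y) \<le> K * N (x - y)"
    and F0: "\<And>x. x \<in> X \<Longrightarrow> norm (F x) \<le> K * N x"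
  shows "smeas I (\<lambda>t. F (v t))" "integrable I (\<lambda>t. (norm (F (v t)))\<^sup>2)"
proof -
  obtain s where s: "AE t in I. v t \<in> X" "\<forall>n. simple_function I (s n)" "\<forall>n. s n ` space I \<subseteq> X"
    "AE t in I. (\<lambda>n. N (s n t - v t)) \<longlonglongrightarrow> 0" "integrable I (\<lambda>t. (N (v t))\<^sup>2)"
    by (rule L2_Bochner_D[OF v])
  show sm: "smeas I (\<lambda>t. F (v t))"
  proof (rule smeasI)
    show "simple_function I (\<lambda>t. F (s n t))" for n by (rule simple_function_compose1[OF s(2)[rule_format]])
    show "AE t in I. (\<lambda>n. F (s n t)) \<longlonglongrightarrow> F (v t)"
      using s(1,4) AE_space
    proof eventually_elim
      case (elim t)
      have sX: "s n t \<in> X" for n using s(3) elim(3) by blast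
      show ?case
      proof (rule LIM_zero_cancel, rule Lim_null_comparison)
        show "\<forall>\<^sub>F n in sequentially. norm (F (s n t) - F (v t)) \<le> K * N (s n t - v t)"
          by (intro always_eventually allI F sX elim(1))
        show "(\<lambda>n. K * N (s n t - v t)) \<longlonglongrightarrow> 0" using tendsto_mult_right_zero[OF elim(2)] .
      qed
    qed
  qed
  show "integrable I (\<lambda>t. (norm (F (v t)))\<^sup>2)"
  proof (rule Bochner_Integration.integrable_bound)
    show "integrable I (\<lambda>t. K\<^sup>2 * (N (v t))\<^sup>2)" using s(5) by simp
    show "(\<lambda>t. (norm (F (v t)))\<^sup>2) \<in> borel_measurable I"
      using smeas_measurable[OF smeas_norm[OF sm]] by simp
    show "AE t in I. norm ((norm (F (v t)))\<^sup>2) \<le> norm (K\<^sup>2 * (N (v t))\<^sup>2)"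
      using s(1)
    proof eventually_elim
      case (elim t)
      have "(norm (F (v t)))\<^sup>2 \<le> (K * N (v t))\<^sup>2" by (intro power_mono F0 elim) simp
      then show ?case by (simp add: power_mult_distrib)
    qed
  qed
qed

lemma L2V_E:
  assumes "v \<in> L2V \<Omega> T"
  shows "smeas I (\<lambda>t. E (v t))" "integrable I (\<lambda>t. (norm (E (v t)))\<^sup>2)"
proof -
  obtain K where K: "K > 0" "\<forall>w\<in>W12 \<Omega>. norm (E w) \<le> K * W12_norm \<Omega> w" by (rule E_bounded)
  have 1: "norm (E x - E y) \<le> K * W12_norm \<Omega> (x - y)" if "x \<in> V_space \<Omega>" "y \<in> V_space \<Omega>" for x y
    using K(2) W12_diff(1)[OF V_space_W12[OF that(1)] V_space_W12[OF that(2)]]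
    by (simp add: E_diff V_space_W12 that flip: E_diff)
  have 2: "norm (E x) \<le> K * W12_norm \<Omega> x" if "x \<in> V_space \<Omega>" for x
    using K(2) V_space_W12[OF that] by blast
  show "smeas I (\<lambda>t. E (v t))" by (rule L2_Bochner_smeas(1)[where F = E and K = K, OF assms 1 2])
  show "integrable I (\<lambda>t. (norm (E (v t)))\<^sup>2)"
    by (rule L2_Bochner_smeas(2)[where F = E and K = K, OF assms 1 2])
qed

lemma L2V_cls:
  assumes "v \<in> L2V \<Omega> T"
  shows "smeas I (\<lambda>t. cls \<Omega> (v t))" "integrable I (\<lambda>t. (norm (cls \<Omega> (v t)))\<^sup>2)"
    "smeas I (\<lambda>t. cls \<Omega> (weak_grad \<Omega> (v t)))" "integrable I (\<lambda>t. (norm (cls \<Omega> (weak_grad \<Omega> (v t))))\<^sup>2)"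
proof -
  have 1: "norm (cls \<Omega> x - cls \<Omega> y) \<le> 1 * W12_norm \<Omega> (x - y)"
    "norm (cls \<Omega> (weak_grad \<Omega> x) - cls \<Omega> (weak_grad \<Omega> y)) \<le> 1 * W12_norm \<Omega> (x - y)"
    if "x \<in> V_space \<Omega>" "y \<in> V_space \<Omega>" for x y
    using W12_norm_ge[OF W12_diff(1)[OF V_space_W12[OF that(1)] V_space_W12[OF that(2)]]]
    unfolding W12_diff(2,3)[OF V_space_W12[OF that(1)] V_space_W12[OF that(2)]] by simp_all
  have 2: "norm (cls \<Omega> x) \<le> 1 * W12_norm \<Omega> x" "norm (cls \<Omega> (weak_grad \<Omega> x)) \<le> 1 * W12_norm \<Omega> x"
    if "x \<in> V_space \<Omega>" for x
    using W12_norm_ge[OF V_space_W12[OF that]] by simp_all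
  show "smeas I (\<lambda>t. cls \<Omega> (v t))"
    by (rule L2_Bochner_smeas(1)[where F = "cls \<Omega>" and K = 1, OF assms 1(1) 2(1)])
  show "integrable I (\<lambda>t. (norm (cls \<Omega> (v t)))\<^sup>2)"
    by (rule L2_Bochner_smeas(2)[where F = "cls \<Omega>" and K = 1, OF assms 1(1) 2(1)])
  show "smeas I (\<lambda>t. cls \<Omega> (weak_grad \<Omega> (v t)))"
    by (rule L2_Bochner_smeas(1)[where F = "\<lambda>w. cls \<Omega> (weak_grad \<Omega> w)" and K = 1, OF assms 1(2) 2(2)])
  show "integrable I (\<lambda>t. (norm (cls \<Omega> (weak_grad \<Omega> (v t))))\<^sup>2)"
    by (rule L2_Bochner_smeas(2)[where F = "\<lambda>w. cls \<Omega> (weak_grad \<Omega> w)" and K = 1, OF assms 1(2) 2(2)])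
qed

lemma L2V_dual_rho:
  assumes "g \<in> L2V_dual \<Omega> T"
  shows "smeas I (\<lambda>t. rho (g t))" "integrable I (\<lambda>t. (norm (rho (g t)))\<^sup>2)"
proof -
  obtain C where C: "C > 0" "\<forall>\<phi>\<in>VD. norm (rho \<phi>) \<le> C * dual_norm (V_space \<Omega>) (W12_norm \<Omega>) \<phi>"
    "\<forall>\<phi>\<in>VD. dual_norm (V_space \<Omega>) (W12_norm \<Omega>) \<phi> \<le> C * norm (rho \<phi>)"
    "\<forall>\<phi>\<in>VD. 0 \<le> dual_norm (V_space \<Omega>) (W12_norm \<Omega>) \<phi>"
    by (rule dual_norm_W12)
  have 1: "norm (rho x - rho y) \<le> C * dual_norm (V_space \<Omega>) (W12_norm \<Omega>) (x - y)" if "x \<in> VD" "y \<in> VD" for x y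
    using C(2) VD_sub(1)[OF that] unfolding VD_sub(2)[OF that, symmetric] by blast
  have 2: "norm (rho x) \<le> C * dual_norm (V_space \<Omega>) (W12_norm \<Omega>) x" if "x \<in> VD" for x
    using C(2) that by blast
  show "smeas I (\<lambda>t. rho (g t))" by (rule L2_Bochner_smeas(1)[where F = rho and K = C, OF assms 1 2])
  show "integrable I (\<lambda>t. (norm (rho (g t)))\<^sup>2)"
    by (rule L2_Bochner_smeas(2)[where F = rho and K = C, OF assms 1 2])
qed

lemma square_integrable_diff:
  fixes a b :: "real \<Rightarrow> 'z::real_normed_vector"
  assumes "smeas I a" "integrable I (\<lambda>t. (norm (a t))\<^sup>2)" "smeas I b" "integrable I (\<lambda>t. (norm (b t))\<^sup>2)"
  shows "integrable I (\<lambda>t. (norm (a t - b t))\<^sup>2)"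
proof (rule Bochner_Integration.integrable_bound)
  show "integrable I (\<lambda>t. 2 * (norm (a t))\<^sup>2 + 2 * (norm (b t))\<^sup>2)" using assms by simp
  show "(\<lambda>t. (norm (a t - b t))\<^sup>2) \<in> borel_measurable I"
    using smeas_measurable[OF smeas_norm[OF smeas_diff[OF assms(1,3)]]] by simp
  show "AE t in I. norm ((norm (a t - b t))\<^sup>2) \<le> norm (2 * (norm (a t))\<^sup>2 + 2 * (norm (b t))\<^sup>2)"
  proof (intro AE_I2)
    fix t show "norm ((norm (a t - b t))\<^sup>2) \<le> norm (2 * (norm (a t))\<^sup>2 + 2 * (norm (b t))\<^sup>2)"
      using norm_add_sqr_le[of "a t" "- b t"] by simp
  qed
qed

lemma L2V_diff:
  assumes v: "v \<in> L2V \<Omega> T" and u: "u \<in> L2V \<Omega> T" shows "v - u \<in> L2V \<Omega> T"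
proof -
  obtain s where s: "AE t in I. v t \<in> V_space \<Omega>" "\<forall>n. simple_function I (s n)" "\<forall>n. s n ` space I \<subseteq> V_space \<Omega>"
    "AE t in I. (\<lambda>n. W12_norm \<Omega> (s n t - v t)) \<longlonglongrightarrow> 0" "integrable I (\<lambda>t. (W12_norm \<Omega> (v t))\<^sup>2)"
    by (rule L2_Bochner_D[OF v])
  obtain r where r: "AE t in I. u t \<in> V_space \<Omega>" "\<forall>n. simple_function I (r n)" "\<forall>n. r n ` space I \<subseteq> V_space \<Omega>"
    "AE t in I. (\<lambda>n. W12_norm \<Omega> (r n t - u t)) \<longlonglongrightarrow> 0" "integrable I (\<lambda>t. (W12_norm \<Omega> (u t))\<^sup>2)"
    by (rule L2_Bochner_D[OF u])
  \<comment> \<open>A crude factor 2 is enough, since only convergence to 0 is at stake.\<close>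
  have tri: "W12_norm \<Omega> (x - y) \<le> 2 * (W12_norm \<Omega> x + W12_norm \<Omega> y)" if "x \<in> W12 \<Omega>" "y \<in> W12 \<Omega>" for x y
  proof -
    have "W12_norm \<Omega> (x - y) \<le> norm (cls \<Omega> x - cls \<Omega> y) + norm (cls \<Omega> (weak_grad \<Omega> x) - cls \<Omega> (weak_grad \<Omega> y))"
      using W12_norm_le[OF W12_diff(1)[OF that]] unfolding W12_diff(2,3)[OF that] .
    also have "\<dots> \<le> (norm (cls \<Omega> x) + norm (cls \<Omega> y)) + (norm (cls \<Omega> (weak_grad \<Omega> x)) + norm (cls \<Omega> (weak_grad \<Omega> y)))"
      by (intro add_mono norm_triangle_ineq4)
    also have "\<dots> \<le> (W12_norm \<Omega> x + W12_norm \<Omega> y) + (W12_norm \<Omega> x + W12_norm \<Omega> y)"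
      by (intro add_mono W12_norm_ge that)
    finally show ?thesis by simp
  qed
  have AEV: "AE t in I. (v - u) t \<in> V_space \<Omega>"
    using s(1) r(1) by eventually_elim (simp add: V_space_diff)
  have conv: "AE t in I. (\<lambda>n. W12_norm \<Omega> ((s n - r n) t - (v - u) t)) \<longlonglongrightarrow> 0"
    using s(1,4) r(1,4) AE_space
  proof eventually_elim
    case (elim t)
    have sV: "s n t \<in> V_space \<Omega>" and rV: "r n t \<in> V_space \<Omega>" for n using s(3) r(3) elim(5) by blast+
    show ?case
    proof (rule Lim_null_comparison)
      have "W12_norm \<Omega> ((s n - r n) t - (v - u) t) \<le> 2 * (W12_norm \<Omega> (s n t - v t) + W12_norm \<Omega> (r n t - u t))" for n
      proof -
        have "(s n - r n) t - (v - u) t = (s n t - v t) - (r n t - u t)" by (simp add: fun_eq_iff)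
        then show ?thesis
          using tri[OF V_space_W12[OF V_space_diff[OF sV[of n] elim(1)]] V_space_W12[OF V_space_diff[OF rV[of n] elim(3)]]]
          by simp
      qed
      then show "\<forall>\<^sub>F n in sequentially. norm (W12_norm \<Omega> ((s n - r n) t - (v - u) t))
          \<le> 2 * (W12_norm \<Omega> (s n t - v t) + W12_norm \<Omega> (r n t - u t))"
        by (intro always_eventually allI) (simp add: W12_norm_nonneg)
      have "(\<lambda>n. 2 * (W12_norm \<Omega> (s n t - v t) + W12_norm \<Omega> (r n t - u t))) \<longlonglongrightarrow> 2 * (0 + 0)"
        by (intro tendsto_intros elim)
      then show "(\<lambda>n. 2 * (W12_norm \<Omega> (s n t - v t) + W12_norm \<Omega> (r n t - u t))) \<longlonglongrightarrow> 0" by simp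
    qed
  qed
  have simp_fn: "simple_function I (s n - r n)" for n
    using simple_function_compose2[where h = "(-)", OF s(2)[rule_format, of n] r(2)[rule_format, of n]]
    by (simp add: fun_diff_def)
  have img: "(s n - r n) ` space I \<subseteq> V_space \<Omega>" for n
  proof
    fix x assume "x \<in> (s n - r n) ` space I"
    then obtain t where t: "t \<in> space I" "x = s n t - r n t" by (auto simp: fun_diff_def)
    then have "s n t \<in> V_space \<Omega>" "r n t \<in> V_space \<Omega>" using s(3) r(3) by blast+
    then show "x \<in> V_space \<Omega>" unfolding t(2) by (rule V_space_diff)
  qed
  \<comment> \<open>Expresses the squared norm by differences of strongly measurable classes, which
    gives its measurability in time.\<close>
  have D: "AE t in I. (W12_norm \<Omega> ((v - u) t))\<^sup>2 = (norm (cls \<Omega> (v t) - cls \<Omega> (u t)))\<^sup>2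
      + (norm (cls \<Omega> (weak_grad \<Omega> (v t)) - cls \<Omega> (weak_grad \<Omega> (u t))))\<^sup>2"
    using s(1) r(1)
  proof eventually_elim
    case (elim t)
    show ?case
      using W12_norm_cls[OF W12_diff(1)[OF V_space_W12[OF elim(1)] V_space_W12[OF elim(2)]]]
      unfolding W12_diff(2,3)[OF V_space_W12[OF elim(1)] V_space_W12[OF elim(2)]] by simp
  qed
  have "integrable I (\<lambda>t. (norm (cls \<Omega> (v t) - cls \<Omega> (u t)))\<^sup>2
      + (norm (cls \<Omega> (weak_grad \<Omega> (v t)) - cls \<Omega> (weak_grad \<Omega> (u t))))\<^sup>2)"
    by (intro Bochner_Integration.integrable_add square_integrable_diff L2V_cls[OF v] L2V_cls[OF u])
  then have "integrable I (\<lambda>t. (W12_norm \<Omega> ((v - u) t))\<^sup>2)"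
    by (rule complete_measure.integrable_AE_cong(1)[OF complete_I]) (use D in \<open>auto elim: eventually_mono\<close>)
  then show ?thesis
    unfolding L2_Bochner_def mem_Collect_eq using AEV conv simp_fn img by (intro conjI exI[of _ "\<lambda>n. s n - r n"] allI)
qed

lemma L2V_dual_diff:
  assumes g: "g \<in> L2V_dual \<Omega> T" and h: "h \<in> L2V_dual \<Omega> T" shows "g - h \<in> L2V_dual \<Omega> T"
proof -
  let ?N = "dual_norm (V_space \<Omega>) (W12_norm \<Omega>)"
  obtain s where s: "AE t in I. g t \<in> VD" "\<forall>n. simple_function I (s n)" "\<forall>n. s n ` space I \<subseteq> VD"
    "AE t in I. (\<lambda>n. ?N (s n t - g t)) \<longlonglongrightarrow> 0" "integrable I (\<lambda>t. (?N (g t))\<^sup>2)"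
    by (rule L2_Bochner_D[OF g])
  obtain r where r: "AE t in I. h t \<in> VD" "\<forall>n. simple_function I (r n)" "\<forall>n. r n ` space I \<subseteq> VD"
    "AE t in I. (\<lambda>n. ?N (r n t - h t)) \<longlonglongrightarrow> 0" "integrable I (\<lambda>t. (?N (h t))\<^sup>2)"
    by (rule L2_Bochner_D[OF h])
  obtain C where C: "C > 0" "\<forall>\<phi>\<in>VD. norm (rho \<phi>) \<le> C * ?N \<phi>" "\<forall>\<phi>\<in>VD. ?N \<phi> \<le> C * norm (rho \<phi>)" "\<forall>\<phi>\<in>VD. 0 \<le> ?N \<phi>"
    by (rule dual_norm_W12)
  \<comment> \<open>The triangle inequality is used for the Riesz representatives; passing there and
    back costs the constant C twice.\<close>
  have tri: "\<bar>?N (x - y)\<bar> \<le> C * (C * ?N x + C * ?N y)" if "x \<in> VD" "y \<in> VD" for x y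
  proof -
    have "?N (x - y) \<le> C * norm (rho x - rho y)" using C(3) VD_sub[OF that] by metis
    also have "\<dots> \<le> C * (norm (rho x) + norm (rho y))" using C(1) by (intro mult_left_mono norm_triangle_ineq4) simp
    also have "\<dots> \<le> C * (C * ?N x + C * ?N y)" using C(1,2) that by (intro mult_left_mono add_mono) auto
    finally show ?thesis using C(4) VD_sub(1)[OF that] by simp
  qed
  have AEV: "AE t in I. (g - h) t \<in> VD"
    using s(1) r(1) by eventually_elim (simp add: VD_sub)
  have conv: "AE t in I. (\<lambda>n. ?N ((s n - r n) t - (g - h) t)) \<longlonglongrightarrow> 0"
    using s(1,4) r(1,4) AE_space
  proof eventually_elim
    case (elim t)
    have sV: "s n t \<in> VD" and rV: "r n t \<in> VD" for n using s(3) r(3) elim(5) by blast+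
    show ?case
    proof (rule Lim_null_comparison)
      have "\<bar>?N ((s n - r n) t - (g - h) t)\<bar> \<le> C * (C * ?N (s n t - g t) + C * ?N (r n t - h t))" for n
      proof -
        have "(s n - r n) t - (g - h) t = (s n t - g t) - (r n t - h t)" by (simp add: fun_eq_iff)
        then show ?thesis
          using tri[OF VD_sub(1)[OF sV[of n] elim(1)] VD_sub(1)[OF rV[of n] elim(3)]] by simp
      qed
      then show "\<forall>\<^sub>F n in sequentially. norm (?N ((s n - r n) t - (g - h) t))
          \<le> C * (C * ?N (s n t - g t) + C * ?N (r n t - h t))"
        by (intro always_eventually allI) simp
      have "(\<lambda>n. C * (C * ?N (s n t - g t) + C * ?N (r n t - h t))) \<longlonglongrightarrow> C * (C * 0 + C * 0)"
        by (intro tendsto_intros elim)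
      then show "(\<lambda>n. C * (C * ?N (s n t - g t) + C * ?N (r n t - h t))) \<longlonglongrightarrow> 0" by simp
    qed
  qed
  have simp_fn: "simple_function I (s n - r n)" for n
    using simple_function_compose2[where h = "(-)", OF s(2)[rule_format, of n] r(2)[rule_format, of n]]
    by (simp add: fun_diff_def)
  have img: "(s n - r n) ` space I \<subseteq> VD" for n
  proof
    fix x assume "x \<in> (s n - r n) ` space I"
    then obtain t where t: "t \<in> space I" "x = s n t - r n t" by (auto simp: fun_diff_def)
    then have "s n t \<in> VD" "r n t \<in> VD" using s(3) r(3) by blast+
    then show "x \<in> VD" unfolding t(2) by (rule VD_sub)
  qed
  text \<open>The dual norm is a Lipschitz function of the Riesz representative, hence measurable in time.\<close>
  define Q where "Q x = ?N (\<lambda>w. x \<bullet> E w)" for x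
  have QV: "(\<lambda>w. x \<bullet> E w) \<in> VD" for x by (rule VD_of_VV) simp
  have N_E: "?N (\<lambda>w. x \<bullet> E w) = ?N \<phi>" if "\<phi> \<in> VD" "x = rho \<phi>" for \<phi> x
    unfolding dual_norm_def by (intro SUP_cong refl) (use rho(2)[OF that(1)] that(2) in auto)
  obtain K where K: "K > 0" "\<forall>w\<in>W12 \<Omega>. norm (E w) \<le> K * W12_norm \<Omega> w" by (rule E_bounded)
  have b: "\<bar>x \<bullet> E w\<bar> \<le> (norm x * K) * W12_norm \<Omega> w" if "w \<in> V_space \<Omega>" for x w
  proof -
    have "\<bar>x \<bullet> E w\<bar> \<le> norm x * norm (E w)" by (rule Cauchy_Schwarz_ineq2)
    also have "\<dots> \<le> norm x * (K * W12_norm \<Omega> w)" using K(2) V_space_W12[OF that] by (intro mult_left_mono) auto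
    finally show ?thesis by (simp only: mult.assoc)
  qed
  have nK: "0 \<le> norm x * K" for x :: "(real^'d, real^'d^'d) l2" using K(1) by simp
  have N1: "W12_norm \<Omega> (\<lambda>x. 0) \<le> 1" by (simp add: W12_norm_0)
  have Qlip: "Q x \<le> Q y + K * norm (x - y)" for x y
  proof -
    have "\<bar>x \<bullet> E w\<bar> \<le> Q y + K * norm (x - y)" if w: "w \<in> V_space \<Omega>" "W12_norm \<Omega> w \<le> 1" for w
    proof -
      have "\<bar>x \<bullet> E w\<bar> \<le> \<bar>y \<bullet> E w\<bar> + \<bar>(x - y) \<bullet> E w\<bar>" by (simp add: inner_diff_left)
      moreover have "\<bar>y \<bullet> E w\<bar> \<le> Q y"
        unfolding Q_def by (rule dual_norm_bound(2)[where \<phi> = "\<lambda>w. y \<bullet> E w" and N = "W12_norm \<Omega>", OF b nK N1 w])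
      moreover have "\<bar>(x - y) \<bullet> E w\<bar> \<le> (norm (x - y) * K) * 1"
        by (rule order_trans[OF b[OF w(1)] mult_left_mono[OF w(2) nK]])
      ultimately show ?thesis by (simp add: mult.commute)
    qed
    then show ?thesis
      unfolding Q_def[of x] dual_norm_def by (intro cSUP_least) (use V_space_0 N1 in auto)
  qed
  have Qc: "isCont Q a" for a
    unfolding isCont_def
  proof (rule LIM_zero_cancel, rule Lim_null_comparison)
    have "\<bar>Q x - Q a\<bar> \<le> K * norm (x - a)" for x
      using Qlip[of x a] Qlip[of a x] by (simp add: norm_minus_commute abs_le_iff)
    then show "\<forall>\<^sub>F x in at a. norm (Q x - Q a) \<le> K * norm (x - a)" by simp
    have "((\<lambda>x. K * norm (x - a)) \<longlongrightarrow> K * norm (a - a)) (at a)" by (intro tendsto_intros)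
    then show "((\<lambda>x. K * norm (x - a)) \<longlongrightarrow> 0) (at a)" by simp
  qed
  have sQ: "smeas I (\<lambda>t. Q (rho (g t) - rho (h t)))"
    by (rule smeas_compose[OF smeas_diff[OF L2V_dual_rho(1)[OF g] L2V_dual_rho(1)[OF h]] Qc])
  have QN: "AE t in I. Q (rho (g t) - rho (h t)) = ?N ((g - h) t)"
    using s(1) r(1)
  proof eventually_elim
    case (elim t)
    show ?case unfolding Q_def using N_E[OF VD_sub(1)[OF elim]] VD_sub(2)[OF elim] by simp
  qed
  have "integrable I (\<lambda>t. (Q (rho (g t) - rho (h t)))\<^sup>2)"
  proof (rule Bochner_Integration.integrable_bound)
    show "integrable I (\<lambda>t. 2 * (C * C)\<^sup>2 * (?N (g t))\<^sup>2 + 2 * (C * C)\<^sup>2 * (?N (h t))\<^sup>2)" using s(5) r(5) by simp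
    show "(\<lambda>t. (Q (rho (g t) - rho (h t)))\<^sup>2) \<in> borel_measurable I" using smeas_measurable[OF sQ] by simp
    show "AE t in I. norm ((Q (rho (g t) - rho (h t)))\<^sup>2)
        \<le> norm (2 * (C * C)\<^sup>2 * (?N (g t))\<^sup>2 + 2 * (C * C)\<^sup>2 * (?N (h t))\<^sup>2)"
      using QN s(1) r(1)
    proof eventually_elim
      case (elim t)
      have "\<bar>?N ((g - h) t)\<bar> \<le> C * C * ?N (g t) + C * C * ?N (h t)"
        using tri[OF elim(2,3)] by (simp add: algebra_simps)
      then have "\<bar>?N ((g - h) t)\<bar>\<^sup>2 \<le> (C * C * ?N (g t) + C * C * ?N (h t))\<^sup>2" by (rule power_mono) simp
      also have "\<dots> \<le> 2 * (C * C * ?N (g t))\<^sup>2 + 2 * (C * C * ?N (h t))\<^sup>2"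
        using norm_add_sqr_le[of "C * C * ?N (g t)" "C * C * ?N (h t)"] by simp
      finally show ?case unfolding elim(1) by (simp add: power_mult_distrib)
    qed
  qed
  then have "integrable I (\<lambda>t. (?N ((g - h) t))\<^sup>2)"
    by (rule complete_measure.integrable_AE_cong(1)[OF complete_I]) (use QN in \<open>auto elim: eventually_mono\<close>)
  then show ?thesis
    unfolding L2_Bochner_def mem_Collect_eq using AEV conv simp_fn img by (intro conjI exI[of _ "\<lambda>n. s n - r n"] allI)
qed

end

context lame_time
begin

text \<open>The exceptional null set depends on x. It suffices to use the countably many projections
  of values of the simple functions approximating d: in the limit \<open>d t\<close> is orthogonal
  to its own projection, which is \<open>d t\<close>.\<close>

lemma VV_AE_zero:
  assumes d: "smeas I d" "AE t in I. d t \<in> VV" and zero: "\<And>x. x \<in> VV \<Longrightarrow> AE t in I. d t \<bullet> x = 0"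
  shows "AE t in I. d t = 0"
proof -
  obtain s where s: "\<forall>n. simple_function I (s n)" "AE t in I. (\<lambda>n. s n t) \<longlonglongrightarrow> d t"
    by (rule smeasE[OF d(1)])
  let ?P = "orth_proj VV"
  note P = orth_proj(1)[OF subspace_VV closed_VV]
  define D where "D = (\<Union>n. ?P ` (s n ` space I))"
  have "countable (?P ` (s n ` space I))" for n
    by (rule countable_image, rule countable_finite, rule simple_functionD(1)[OF s(1)[rule_format]])
  then have "countable D" unfolding D_def by (intro countable_UN) auto
  moreover have "D \<subseteq> VV" using P by (auto simp: D_def)
  ultimately have "AE t in I. \<forall>x\<in>D. d t \<bullet> x = 0" using zero by (intro AE_ball_countable') auto
  then show ?thesis
    using s(2) d(2) AE_space
  proof eventually_elim
    case (elim t)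
    have 1: "(\<lambda>n. d t \<bullet> ?P (s n t)) \<longlonglongrightarrow> d t \<bullet> ?P (d t)"
      by (intro tendsto_inner tendsto_const
          bounded_linear.tendsto[OF bounded_linear_orth_proj[OF subspace_VV closed_VV]] elim(2))
    have "d t \<bullet> ?P (s n t) = 0" for n
    proof -
      have "?P (s n t) \<in> D" unfolding D_def using elim(4) by blast
      then show ?thesis using elim(1) by blast
    qed
    then have "d t \<bullet> ?P (d t) = 0" using 1 by (simp add: LIMSEQ_const_iff)
    then show ?case by (simp add: orth_proj_id[OF subspace_VV closed_VV elim(3)])
  qed
qed

section \<open>Time derivatives in terms of Riesz representatives\<close>

lemma test_mult_integrable:
  fixes \<eta> p :: "real \<Rightarrow> real"
  assumes "\<eta> \<in> test_functions {0<..<T}" "integrable I p"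
  shows "integrable I (\<lambda>t. \<eta> t * p t)"
proof -
  obtain B where "\<forall>x. \<bar>\<eta> x\<bar> \<le> B" using test_functions_bounded[OF assms(1)] by (metis real_norm_def)
  then show ?thesis by (intro integrable_mult_bounded(2)[OF assms(2) test_functions_borel[OF assms(1)]]) blast
qed

lemma cls_inner_integrable: "w \<in> L2V \<Omega> T \<Longrightarrow> integrable I (\<lambda>t. cls \<Omega> (w t) \<bullet> X)"
  by (rule square_integrable_inner[OF L2V_cls(1,2) smeas_const]) simp_all

lemma rho_inner_integrable: "g \<in> L2V_dual \<Omega> T \<Longrightarrow> integrable I (\<lambda>t. rho (g t) \<bullet> X)"
  by (rule square_integrable_inner[OF L2V_dual_rho(1,2) smeas_const]) simp_all

lemma has_time_deriv_iff:
  assumes w: "w \<in> L2V \<Omega> T" and g: "g \<in> L2V_dual \<Omega> T"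
  shows "has_time_deriv \<Omega> T w g \<longleftrightarrow> (\<forall>\<eta>\<in>test_functions {0<..<T}. \<forall>x\<in>V_space \<Omega>.
    (\<integral>t. deriv \<eta> t * (cls \<Omega> (w t) \<bullet> cls \<Omega> x) \<partial>I) = - (\<integral>t. \<eta> t * (rho (g t) \<bullet> E x) \<partial>I))"
proof -
  have 1: "(\<integral>t. k t * (\<integral>z. w t z \<bullet> x z \<partial>L) \<partial>I) = (\<integral>t. k t * (cls \<Omega> (w t) \<bullet> cls \<Omega> x) \<partial>I)"
    if x: "x \<in> V_space \<Omega>" for x k
  proof (rule complete_measure.integral_AE_cong[OF complete_I])
    show "AE t in I. k t * (\<integral>z. w t z \<bullet> x z \<partial>L) = k t * (cls \<Omega> (w t) \<bullet> cls \<Omega> x)"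
      using L2_Bochner_AE[OF w]
    proof eventually_elim
      case (elim t)
      show ?case
        by (simp add: inner_cls[OF dom W12_D(1)[OF V_space_W12[OF elim]] W12_D(1)[OF V_space_W12[OF x]]])
    qed
  qed
  have 2: "(\<integral>t. k t * g t x \<partial>I) = (\<integral>t. k t * (rho (g t) \<bullet> E x) \<partial>I)" if x: "x \<in> V_space \<Omega>" for x k
  proof (rule complete_measure.integral_AE_cong[OF complete_I])
    show "AE t in I. k t * g t x = k t * (rho (g t) \<bullet> E x)"
      using L2_Bochner_AE[OF g] by eventually_elim (simp add: rho(2)[OF _ x])
  qed
  show ?thesis unfolding has_time_deriv_def by (simp add: 1 2)
qed

lemma time_deriv_D:
  assumes "w \<in> W_space \<Omega> T"
  shows "w \<in> L2V \<Omega> T" "time_deriv \<Omega> T w \<in> L2V_dual \<Omega> T" "has_time_deriv \<Omega> T w (time_deriv \<Omega> T w)"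
proof -
  show "w \<in> L2V \<Omega> T" using assms by (simp add: W_space_def)
  have "\<exists>g. g \<in> L2V_dual \<Omega> T \<and> has_time_deriv \<Omega> T w g" using assms by (auto simp: W_space_def)
  from someI_ex[OF this]
  show "time_deriv \<Omega> T w \<in> L2V_dual \<Omega> T" "has_time_deriv \<Omega> T w (time_deriv \<Omega> T w)"
    by (simp_all add: time_deriv_def)
qed

lemma time_deriv_unique:
  assumes w: "w \<in> L2V \<Omega> T" and g: "g \<in> L2V_dual \<Omega> T" "g' \<in> L2V_dual \<Omega> T"
    and td: "has_time_deriv \<Omega> T w g" "has_time_deriv \<Omega> T w g'"
  shows "AE t in I. rho (g t) = rho (g' t)"
proof -
  have "AE t in I. rho (g t) - rho (g' t) = 0"
  proof (rule VV_AE_zero)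
    show "smeas I (\<lambda>t. rho (g t) - rho (g' t))" by (rule smeas_diff[OF L2V_dual_rho(1)[OF g(1)] L2V_dual_rho(1)[OF g(2)]])
    show "AE t in I. rho (g t) - rho (g' t) \<in> VV"
      using L2_Bochner_AE[OF g(1)] L2_Bochner_AE[OF g(2)]
      by eventually_elim (intro subspace_diff[OF subspace_VV] rho)
    fix X assume X: "X \<in> VV"
    show "AE t in I. (rho (g t) - rho (g' t)) \<bullet> X = 0"
    proof (rule fundamental_lemma)
      show "integrable I (\<lambda>t. (rho (g t) - rho (g' t)) \<bullet> X)"
        using rho_inner_integrable[OF g(1)] rho_inner_integrable[OF g(2)] by (simp add: inner_diff_left)
      fix \<eta> :: "real \<Rightarrow> real" assume \<eta>: "\<eta> \<in> test_functions {0<..<T}"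
      have "(\<integral>t. \<eta> t * (rho (g t) \<bullet> E (dec X)) \<partial>I) = (\<integral>t. \<eta> t * (rho (g' t) \<bullet> E (dec X)) \<partial>I)"
        using td \<eta> dec(1)[OF X] unfolding has_time_deriv_iff[OF w g(1)] has_time_deriv_iff[OF w g(2)] by fastforce
      then have "(\<integral>t. \<eta> t * (rho (g t) \<bullet> X) - \<eta> t * (rho (g' t) \<bullet> X) \<partial>I) = 0"
        using test_mult_integrable[OF \<eta> rho_inner_integrable[OF g(1)]] test_mult_integrable[OF \<eta> rho_inner_integrable[OF g(2)]]
        by (simp add: dec(2)[OF X])
      then show "(\<integral>t. (rho (g t) - rho (g' t)) \<bullet> X * \<eta> t \<partial>I) = 0"
        by (simp add: inner_diff_left algebra_simps)
    qed auto
  qed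
  then show ?thesis by eventually_elim simp
qed

text \<open>\<open>time_deriv\<close> is chosen anew for the difference; uniqueness identifies its
  Riesz representative at almost every time.\<close>

lemma W_space_diff:
  assumes v: "v \<in> W_space \<Omega> T" and u: "u \<in> W_space \<Omega> T"
  shows "v - u \<in> W_space \<Omega> T"
    "AE t in I. rho (time_deriv \<Omega> T (v - u) t) = rho (time_deriv \<Omega> T v t) - rho (time_deriv \<Omega> T u t)"
proof -
  let ?g = "time_deriv \<Omega> T v" and ?h = "time_deriv \<Omega> T u"
  note vD = time_deriv_D[OF v] and uD = time_deriv_D[OF u]
  have L: "v - u \<in> L2V \<Omega> T" by (rule L2V_diff[OF vD(1) uD(1)])
  have G: "?g - ?h \<in> L2V_dual \<Omega> T" by (rule L2V_dual_diff[OF vD(2) uD(2)])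
  have cd: "AE t in I. cls \<Omega> ((v - u) t) = cls \<Omega> (v t) - cls \<Omega> (u t)"
    using L2_Bochner_AE[OF vD(1)] L2_Bochner_AE[OF uD(1)]
    by eventually_elim (simp add: W12_diff V_space_W12)
  have rd: "AE t in I. rho ((?g - ?h) t) = rho (?g t) - rho (?h t)"
    using L2_Bochner_AE[OF vD(2)] L2_Bochner_AE[OF uD(2)]
    by eventually_elim (simp add: VD_sub)
  have td: "has_time_deriv \<Omega> T (v - u) (?g - ?h)"
    unfolding has_time_deriv_iff[OF L G]
  proof (intro ballI)
    fix \<eta> :: "real \<Rightarrow> real" and x assume \<eta>: "\<eta> \<in> test_functions {0<..<T}" and x: "x \<in> V_space \<Omega>"
    have "(\<integral>t. deriv \<eta> t * (cls \<Omega> ((v - u) t) \<bullet> cls \<Omega> x) \<partial>I)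
        = (\<integral>t. deriv \<eta> t * (cls \<Omega> (v t) \<bullet> cls \<Omega> x) - deriv \<eta> t * (cls \<Omega> (u t) \<bullet> cls \<Omega> x) \<partial>I)"
      by (rule complete_measure.integral_AE_cong[OF complete_I])
        (use cd in \<open>eventually_elim, simp add: inner_diff_left right_diff_distrib\<close>)
    also have "\<dots> = (\<integral>t. deriv \<eta> t * (cls \<Omega> (v t) \<bullet> cls \<Omega> x) \<partial>I) - (\<integral>t. deriv \<eta> t * (cls \<Omega> (u t) \<bullet> cls \<Omega> x) \<partial>I)"
      by (intro Bochner_Integration.integral_diff test_mult_integrable[OF test_functions_deriv[OF \<eta>]]
          cls_inner_integrable vD(1) uD(1))
    also have "\<dots> = - (\<integral>t. \<eta> t * (rho (?g t) \<bullet> E x) \<partial>I) - - (\<integral>t. \<eta> t * (rho (?h t) \<bullet> E x) \<partial>I)"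
      using vD(3) uD(3) \<eta> x unfolding has_time_deriv_iff[OF vD(1,2)] has_time_deriv_iff[OF uD(1,2)] by simp
    also have "\<dots> = - ((\<integral>t. \<eta> t * (rho (?g t) \<bullet> E x) \<partial>I) - (\<integral>t. \<eta> t * (rho (?h t) \<bullet> E x) \<partial>I))" by simp
    also have "(\<integral>t. \<eta> t * (rho (?g t) \<bullet> E x) \<partial>I) - (\<integral>t. \<eta> t * (rho (?h t) \<bullet> E x) \<partial>I)
        = (\<integral>t. \<eta> t * (rho (?g t) \<bullet> E x) - \<eta> t * (rho (?h t) \<bullet> E x) \<partial>I)"
      by (intro Bochner_Integration.integral_diff[symmetric] test_mult_integrable[OF \<eta>]
          rho_inner_integrable vD(2) uD(2))
    also have "\<dots> = (\<integral>t. \<eta> t * (rho ((?g - ?h) t) \<bullet> E x) \<partial>I)"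
      by (rule complete_measure.integral_AE_cong[OF complete_I])
        (use rd in \<open>eventually_elim, simp add: inner_diff_left right_diff_distrib\<close>)
    finally show "(\<integral>t. deriv \<eta> t * (cls \<Omega> ((v - u) t) \<bullet> cls \<Omega> x) \<partial>I) = - (\<integral>t. \<eta> t * (rho ((?g - ?h) t) \<bullet> E x) \<partial>I)" .
  qed
  show W: "v - u \<in> W_space \<Omega> T" using L G td by (auto simp: W_space_def)
  note eD = time_deriv_D[OF W]
  have "AE t in I. rho (time_deriv \<Omega> T (v - u) t) = rho ((?g - ?h) t)"
    by (rule time_deriv_unique[OF eD(1,2) G eD(3) td])
  then show "AE t in I. rho (time_deriv \<Omega> T (v - u) t) = rho (?g t) - rho (?h t)"
    using rd by eventually_elim simp
qed

text \<open>The embedding of V into H, read on \<open>VV\<close> and extended by the orthogonal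
  projection, because \<open>evolution\<close> takes a map on a whole type.\<close>

definition val :: "(real^'d, real^'d^'d) l2 \<Rightarrow> (real^'d, real^'d) l2" where
  "val x = cls \<Omega> (dec (orth_proj VV x))"

lemma val_E: "w \<in> V_space \<Omega> \<Longrightarrow> val (E w) = cls \<Omega> w"
  unfolding val_def orth_proj_id[OF subspace_VV closed_VV E_VV]
  by (rule E_eq_D(2)[OF dec(1)[OF E_VV] _ dec(2)[OF E_VV]])

lemma bounded_linear_val: "bounded_linear val"
proof -
  let ?P = "orth_proj VV"
  note P = orth_proj(1)[OF subspace_VV closed_VV]
  have lc: "val (a *\<^sub>R x + b *\<^sub>R y) = a *\<^sub>R val x + b *\<^sub>R val y" for a b x y
  proof -
    note D = dec[OF P, of x] dec[OF P, of y]
    have "?P (a *\<^sub>R x + b *\<^sub>R y) = a *\<^sub>R ?P x + b *\<^sub>R ?P y"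
      using bounded_linear.linear[OF bounded_linear_orth_proj[OF subspace_VV closed_VV]]
      by (simp add: linear_add linear_scale)
    also have "\<dots> = E (\<lambda>z. a *\<^sub>R dec (?P x) z + b *\<^sub>R dec (?P y) z)"
      by (simp add: E_lincomb[OF V_space_W12[OF D(1)] V_space_W12[OF D(3)]] D)
    finally have eq: "?P (a *\<^sub>R x + b *\<^sub>R y) = E (\<lambda>z. a *\<^sub>R dec (?P x) z + b *\<^sub>R dec (?P y) z)" .
    have V: "(\<lambda>z. a *\<^sub>R dec (?P x) z + b *\<^sub>R dec (?P y) z) \<in> V_space \<Omega>" by (rule V_space_lincomb[OF D(1,3)])
    have "val (a *\<^sub>R x + b *\<^sub>R y) = cls \<Omega> (\<lambda>z. a *\<^sub>R dec (?P x) z + b *\<^sub>R dec (?P y) z)"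
      unfolding val_def eq by (rule E_eq_D(2)[OF dec(1)[OF E_VV[OF V]] V dec(2)[OF E_VV[OF V]]])
    then show ?thesis
      by (simp add: val_def cls_lincomb[OF dom W12_D(1)[OF V_space_W12[OF D(1)]] W12_D(1)[OF V_space_W12[OF D(3)]]])
  qed
  obtain C where C: "C > 0" "\<forall>w\<in>V_space \<Omega>. W12_norm \<Omega> w \<le> C * norm (E w)" by (rule coercive)
  show ?thesis
  proof (rule bounded_linear_intro)
    show "val (x + y) = val x + val y" for x y using lc[of 1 x 1 y] by simp
    show "val (c *\<^sub>R x) = c *\<^sub>R val x" for c x using lc[of c x 0 x] by simp
    show "norm (val x) \<le> norm x * C" for x
    proof -
      note D = dec[OF P, of x]
      have "norm (val x) \<le> W12_norm \<Omega> (dec (?P x))" unfolding val_def by (rule W12_norm_ge(1)[OF V_space_W12[OF D(1)]])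
      also have "\<dots> \<le> C * norm (?P x)" using C(2) D by metis
      also have "\<dots> \<le> C * norm x" using C(1) orth_proj_norm_le[OF subspace_VV closed_VV] by simp
      finally show ?thesis by (simp only: mult.commute)
    qed
  qed
qed

lemma W_space_energy:
  assumes w: "w \<in> W_space \<Omega> T"
  obtains c where "continuous_on {0..T} c" "AE t in I. c t = cls \<Omega> (w t)"
    "(norm (c T))\<^sup>2 - (norm (c 0))\<^sup>2 = 2 * (\<integral>t. rho (time_deriv \<Omega> T w t) \<bullet> E (w t) \<partial>I)"
proof -
  let ?P = "orth_proj VV"
  let ?g = "time_deriv \<Omega> T w"
  note wD = time_deriv_D[OF w]
  note P = orth_proj[OF subspace_VV closed_VV]
  text \<open>The second component makes the embedding of \<open>V\<close> into \<open>H\<close> an injective map on the ambient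
    Hilbert space of \<open>V\<close>.\<close>
  define j where "j x = (val x, x - ?P x)" for x
  have "bounded_linear j"
    unfolding j_def[abs_def]
    by (intro bounded_linear_Pair bounded_linear_val bounded_linear_sub bounded_linear_ident
        bounded_linear_orth_proj[OF subspace_VV closed_VV])
  have inj: "inj j"
    unfolding linear_injective_0[OF bounded_linear.linear[OF \<open>bounded_linear j\<close>]]
  proof (intro allI impI)
    fix x assume "j x = 0"
    then have 1: "val x = 0" "x = ?P x" by (simp_all add: j_def zero_prod_def)
    then have x: "x \<in> VV" using P(1)[of x] by simp
    \<comment> \<open>A function that is 0 in H has weak gradient 0 by uniqueness, so its image
      under E is 0 too.\<close>
    have "cls \<Omega> (dec x) = cls \<Omega> (\<lambda>z. 0)"
    proof -
      have "cls \<Omega> (\<lambda>z. 0 :: real^'d) = 0" using cls_lincomb[OF dom L2_space_0 L2_space_0, of 0 0] by simp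
      then show ?thesis using 1 by (simp add: val_def)
    qed
    moreover note DW = W12_D[OF V_space_W12[OF dec(1)[OF x]]] and ZW = W12_D[OF V_space_W12[OF V_space_0]]
    ultimately have g0: "cls \<Omega> (weak_grad \<Omega> (dec x)) = cls \<Omega> (weak_grad \<Omega> (\<lambda>z. 0))"
      by (intro weak_gradient_unique[OF DW(1) ZW(1) _ DW(2) ZW(2) DW(3) ZW(3)])
    have "E (dec x) = 1 *\<^sub>R E (\<lambda>z. 0) + 0 *\<^sub>R E (\<lambda>z. 0)"
      unfolding E_def sym_grad_def
      by (rule cls_linear_lincomb[OF ZW(2) ZW(2) DW(2) linear_half_sym]) (simp add: g0)
    also have "E (\<lambda>z. 0) = 0"
      using E_lincomb[OF V_space_W12[OF V_space_0] V_space_W12[OF V_space_0], of 0 0] by simp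
    finally show "x = 0" by (simp add: dec(2)[OF x])
  qed
  have jE: "j (E x) = (cls \<Omega> x, 0)" if "x \<in> V_space \<Omega>" for x
    by (simp add: j_def val_E[OF that] orth_proj_id[OF subspace_VV closed_VV E_VV[OF that]])
  interpret ev: evolution T j "\<lambda>t. E (w t)" "\<lambda>t. rho (?g t)"
  proof (rule evolution.intro)
    show "T > 0" by (rule T)
    show "bounded_linear j" by fact
    show "inj j" by (rule inj)
    show "smeas I (\<lambda>t. E (w t))" "integrable I (\<lambda>t. (norm (E (w t)))\<^sup>2)" by (rule L2V_E[OF wD(1)])+
    show "smeas I (\<lambda>t. rho (?g t))" "integrable I (\<lambda>t. (norm (rho (?g t)))\<^sup>2)" by (rule L2V_dual_rho[OF wD(2)])+
    fix \<eta> :: "real \<Rightarrow> real" and X assume \<eta>: "\<eta> \<in> test_functions {0<..<T}"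
    \<comment> \<open>A test vector X outside \<open>VV\<close> may be replaced by its projection:
      on the left \<open>j (E (w t))\<close> has second component 0, and on the right
      \<open>rho (?g t)\<close> lies in \<open>VV\<close>.\<close>
    let ?x = "dec (?P X)"
    note D = dec[OF P(1), of X]
    have "(\<integral>t. deriv \<eta> t * (j (E (w t)) \<bullet> j X) \<partial>I) = (\<integral>t. deriv \<eta> t * (cls \<Omega> (w t) \<bullet> cls \<Omega> ?x) \<partial>I)"
      by (rule complete_measure.integral_AE_cong[OF complete_I])
        (use L2_Bochner_AE[OF wD(1)] in \<open>eventually_elim, simp add: jE, simp add: j_def val_def inner_prod_def\<close>)
    also have "\<dots> = - (\<integral>t. \<eta> t * (rho (?g t) \<bullet> E ?x) \<partial>I)"
      using wD(3) \<eta> D(1) unfolding has_time_deriv_iff[OF wD(1,2)] by blast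
    also have "(\<integral>t. \<eta> t * (rho (?g t) \<bullet> E ?x) \<partial>I) = (\<integral>t. \<eta> t * (rho (?g t) \<bullet> X) \<partial>I)"
    proof (rule complete_measure.integral_AE_cong[OF complete_I])
      show "AE t in I. \<eta> t * (rho (?g t) \<bullet> E ?x) = \<eta> t * (rho (?g t) \<bullet> X)"
        using L2_Bochner_AE[OF wD(2)]
      proof eventually_elim
        case (elim t)
        show ?case using P(2)[OF rho(1)[OF elim], of X] by (simp add: D(2) inner_commute)
      qed
    qed
    finally show "(\<integral>t. deriv \<eta> t * (j (E (w t)) \<bullet> j X) \<partial>I) = - (\<integral>t. \<eta> t * (rho (?g t) \<bullet> X) \<partial>I)" .
  qed
  obtain c where c: "continuous_on {0..T} c" "AE t in I. c t = j (E (w t))"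
    "(norm (c T))\<^sup>2 - (norm (c 0))\<^sup>2 = 2 * (\<integral>t. rho (?g t) \<bullet> E (w t) \<partial>I)"
    using ev.continuous_representative by blast
  have cj: "AE t in I. c t = (cls \<Omega> (w t), 0)"
    using c(2) L2_Bochner_AE[OF wD(1)] by eventually_elim (simp add: jE)
  have snd_AE: "AE t in I. snd (c t) = 0" using cj by eventually_elim simp
  \<comment> \<open>The auxiliary component is continuous and vanishes almost everywhere, hence
    always; it does not affect the norms at 0 and T.\<close>
  have snd0: "snd (c t) = 0" if "t \<in> {0..T}" for t
    by (rule continuous_AE_eq[OF T _ continuous_on_const snd_AE that]) (intro continuous_intros c)
  have nrm: "(norm (c t))\<^sup>2 = (norm (fst (c t)))\<^sup>2" if "t \<in> {0..T}" for t
    by (simp add: power2_norm_eq_inner inner_prod_def snd0[OF that])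
  show ?thesis
  proof (rule that[of "\<lambda>t. fst (c t)"])
    show "continuous_on {0..T} (\<lambda>t. fst (c t))" by (intro continuous_intros c)
    show "AE t in I. fst (c t) = cls \<Omega> (w t)" using cj by eventually_elim simp
    show "(norm (fst (c T)))\<^sup>2 - (norm (fst (c 0)))\<^sup>2 = 2 * (\<integral>t. rho (?g t) \<bullet> E (w t) \<partial>I)"
      using c(3) T by (simp add: nrm)
  qed
qed

text \<open>Representatives of c satisfy the specification behind \<open>cont_rep\<close>, so its
  choice is legitimate; two continuous curves of classes that agree almost everywhere then agree on
  all of [0,T].\<close>

lemma cont_rep_cls:
  assumes w: "w \<in> W_space \<Omega> T" and c: "continuous_on {0..T} c" "AE t in I. c t = cls \<Omega> (w t)"
    and t: "t \<in> {0..T}"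
  shows "cont_rep \<Omega> T w t \<in> L2_space L" "cls \<Omega> (cont_rep \<Omega> T w t) = c t"
proof -
  let ?spec = "\<lambda>c. (\<forall>t\<in>{0..T}. c t \<in> L2_space L \<and> ((\<lambda>s. L2_norm L (c s - c t)) \<longlongrightarrow> 0) (at t within {0..T})) \<and>
     (AE t in I. AE x in L. c t x = w t x)"
  note wV = L2_Bochner_AE[OF time_deriv_D(1)[OF w]]
  have nrm: "L2_norm L (a - b) = norm (cls \<Omega> a - cls \<Omega> b)" if "a \<in> L2_space L" "b \<in> L2_space L" for a b :: "real^'d \<Rightarrow> real^'d"
    unfolding cls_diff[OF dom that, symmetric] norm_cls[OF dom L2_space_diff[OF that]] by (simp add: fun_diff_def)
  have "?spec (\<lambda>t. rep_l2 (c t))"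
  proof (intro conjI ballI)
    fix t assume t: "t \<in> {0..T}"
    show "rep_l2 (c t) \<in> L2_space L" by (rule rep_l2_restrict[OF dom])
    show "((\<lambda>s. L2_norm L (rep_l2 (c s) - rep_l2 (c t))) \<longlongrightarrow> 0) (at t within {0..T})"
    proof (rule Lim_null_comparison)
      show "\<forall>\<^sub>F s in at t within {0..T}. norm (L2_norm L (rep_l2 (c s) - rep_l2 (c t))) \<le> norm (c s - c t)"
        by (simp add: nrm rep_l2_restrict[OF dom] cls_rep_dist[OF dom])
      have "(c \<longlongrightarrow> c t) (at t within {0..T})" using c(1) t by (simp add: continuous_on_def)
      then have "((\<lambda>s. norm (c s - c t)) \<longlongrightarrow> norm (c t - c t)) (at t within {0..T})" by (intro tendsto_intros)
      then show "((\<lambda>s. norm (c s - c t)) \<longlongrightarrow> 0) (at t within {0..T})" by simp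
    qed
  next
    show "AE t in I. AE x in L. rep_l2 (c t) x = w t x"
      using c(2) wV by eventually_elim (simp add: rep_l2_AE[OF dom W12_D(1)[OF V_space_W12]])
  qed
  then have spec: "?spec (cont_rep \<Omega> T w)"
    unfolding cont_rep_def by (rule someI[where P = ?spec])
  let ?r = "cont_rep \<Omega> T w"
  have rL: "?r t \<in> L2_space L" if "t \<in> {0..T}" for t using spec that by blast
  show "?r t \<in> L2_space L" by (rule rL[OF t])
  have cont: "continuous_on {0..T} (\<lambda>t. cls \<Omega> (?r t))"
    unfolding continuous_on_def
  proof
    fix t assume t: "t \<in> {0..T}"
    show "((\<lambda>t. cls \<Omega> (?r t)) \<longlongrightarrow> cls \<Omega> (?r t)) (at t within {0..T})"
    proof (rule LIM_zero_cancel, rule Lim_null_comparison)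
      show "\<forall>\<^sub>F s in at t within {0..T}. norm (cls \<Omega> (?r s) - cls \<Omega> (?r t)) \<le> L2_norm L (?r s - ?r t)"
        unfolding eventually_at_topological
        by (intro exI[of _ UNIV]) (use t in \<open>auto intro!: eq_refl[OF nrm[symmetric]] rL\<close>)
      show "((\<lambda>s. L2_norm L (?r s - ?r t)) \<longlongrightarrow> 0) (at t within {0..T})" using spec t by blast
    qed
  qed
  have "AE t in I. cls \<Omega> (?r t) = c t"
    using conjunct2[OF spec] c(2) wV AE_time_space[of T]
  proof eventually_elim
    case (elim t)
    then have "?r t \<in> L2_space L" by (intro rL) simp
    then show ?case
      using elim cls_eq_iff[OF dom _ W12_D(1)[OF V_space_W12[OF elim(3)]]] by simp
  qed
  from continuous_AE_eq[OF T cont c(1) this t] show "cls \<Omega> (?r t) = c t" .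
qed

end

subsection \<open>The energy identity\<close>

context lame_time
begin

lemma norm_cls_sqr:
  fixes f :: "real^'d \<Rightarrow> 'b::euclidean_space"
  assumes "f \<in> L2_space L" shows "(\<integral>x. (norm (f x))\<^sup>2 \<partial>L) = (norm (cls \<Omega> f))\<^sup>2"
  by (simp add: norm_cls[OF dom assms] L2_norm_def)

lemma Q_norm_sqr:
  assumes "AE t in I. (\<integral>x. (norm (F t x))\<^sup>2 \<partial>L) = p t"
  shows "(Q_norm \<Omega> T F)\<^sup>2 = (\<integral>t. p t \<partial>I)"
proof -
  have "(\<integral>t. (\<integral>x. (norm (F t x))\<^sup>2 \<partial>L) \<partial>I) = (\<integral>t. p t \<partial>I)"
    by (rule complete_measure.integral_AE_cong[OF complete_I assms])
  moreover have "0 \<le> (\<integral>t. (\<integral>x. (norm (F t x))\<^sup>2 \<partial>L) \<partial>I)" by simp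
  ultimately show ?thesis by (simp add: Q_norm_def)
qed

lemma L2VC_dual_norm_sqr:
  assumes "AE t in I. x t \<in> VV \<and> (\<forall>w\<in>V_space \<Omega>. \<phi> t w = x t \<bullet> E w)"
  shows "(L2VC_dual_norm \<Omega> T mu lam \<phi>)\<^sup>2 = (\<integral>t. (norm (x t))\<^sup>2 \<partial>I)"
proof -
  let ?N = "dual_norm (V_space \<Omega>) (VC_norm \<Omega> mu lam)"
  have "AE t in I. (?N (\<phi> t))\<^sup>2 = (norm (x t))\<^sup>2"
    using assms by eventually_elim (simp add: dual_norm_VC)
  then have "(\<integral>t. (?N (\<phi> t))\<^sup>2 \<partial>I) = (\<integral>t. (norm (x t))\<^sup>2 \<partial>I)"
    by (rule complete_measure.integral_AE_cong[OF complete_I])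
  moreover have "0 \<le> (\<integral>t. (?N (\<phi> t))\<^sup>2 \<partial>I)" by simp
  ultimately show ?thesis by (simp add: L2VC_dual_norm_def L2_Bochner_norm_def)
qed

lemma energy_identity_diff:
  assumes v: "v \<in> W_space \<Omega> T" and u: "u \<in> W_space \<Omega> T"
    and init: "AE x in L. cont_rep \<Omega> T v 0 x = cont_rep \<Omega> T u 0 x"
  shows "(Q_norm \<Omega> T (\<lambda>t x. half (sym_grad \<Omega> ((v - u) t) x)))\<^sup>2
      + (L2VC_dual_norm \<Omega> T mu lam (time_deriv \<Omega> T (v - u)))\<^sup>2
      + (L2_norm L (cont_rep \<Omega> T (v - u) T))\<^sup>2
    = (\<integral>t. (norm (rho (time_deriv \<Omega> T (v - u) t) + E ((v - u) t)))\<^sup>2 \<partial>I)"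
proof -
  define e where "e = v - u"
  have eW: "e \<in> W_space \<Omega> T" unfolding e_def by (rule W_space_diff(1)[OF v u])
  note eD = time_deriv_D[OF eW]
  let ?d = "\<lambda>t. rho (time_deriv \<Omega> T e t)" and ?a = "\<lambda>t. E (e t)"
  obtain c where c: "continuous_on {0..T} c" "AE t in I. c t = cls \<Omega> (e t)"
    "(norm (c T))\<^sup>2 - (norm (c 0))\<^sup>2 = 2 * (\<integral>t. ?d t \<bullet> ?a t \<partial>I)" by (rule W_space_energy[OF eW])
  obtain b where b: "continuous_on {0..T} b" "AE t in I. b t = cls \<Omega> (v t)" by (rule W_space_energy[OF v])
  obtain a where a: "continuous_on {0..T} a" "AE t in I. a t = cls \<Omega> (u t)" by (rule W_space_energy[OF u])
  have T0: "0 \<in> {0..T}" "T \<in> {0..T}" using T by auto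
  \<comment> \<open>\<open>cont_rep\<close> is chosen separately for v, u and v - u; the three are
    compared through their continuous classes, whose relation extends from almost all times to t =
    0.\<close>
  have eq: "AE t in I. c t = b t - a t"
    using c(2) b(2) a(2) L2_Bochner_AE[OF time_deriv_D(1)[OF v]] L2_Bochner_AE[OF time_deriv_D(1)[OF u]]
    by eventually_elim (simp add: e_def W12_diff V_space_W12)
  have "c 0 = b 0 - a 0"
    by (rule continuous_AE_eq[OF T c(1) continuous_on_diff[OF b(1) a(1)] eq T0(1)])
  also have "b 0 = a 0"
    using init cls_eq_iff[OF dom cont_rep_cls(1)[OF v b T0(1)] cont_rep_cls(1)[OF u a T0(1)]]
    by (simp add: cont_rep_cls(2)[OF v b T0(1)] cont_rep_cls(2)[OF u a T0(1)])
  finally have c0: "c 0 = 0" by simp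
  have cT: "L2_norm L (cont_rep \<Omega> T e T) = norm (c T)"
    by (simp add: norm_cls[OF dom cont_rep_cls(1)[OF eW c(1,2) T0(2)], symmetric] cont_rep_cls(2)[OF eW c(1,2) T0(2)])
  have q: "(Q_norm \<Omega> T (\<lambda>t x. half (sym_grad \<Omega> (e t) x)))\<^sup>2 = (\<integral>t. (norm (?a t))\<^sup>2 \<partial>I)"
    by (rule Q_norm_sqr)
      (use L2_Bochner_AE[OF eD(1)] in \<open>eventually_elim, simp add: norm_cls_sqr half_sym_grad_L2 V_space_W12 E_def\<close>)
  have d: "(L2VC_dual_norm \<Omega> T mu lam (time_deriv \<Omega> T e))\<^sup>2 = (\<integral>t. (norm (?d t))\<^sup>2 \<partial>I)"
    by (rule L2VC_dual_norm_sqr)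
      (use L2_Bochner_AE[OF eD(2)] in \<open>eventually_elim, simp add: rho\<close>)
  note ai = L2V_E[OF eD(1)] and di = L2V_dual_rho[OF eD(2)]
  have di': "integrable I (\<lambda>t. ?d t \<bullet> ?a t)" by (rule square_integrable_inner[OF di ai])
  have "(\<integral>t. (norm (?d t + ?a t))\<^sup>2 \<partial>I) = (\<integral>t. ((norm (?a t))\<^sup>2 + (norm (?d t))\<^sup>2) + 2 * (?d t \<bullet> ?a t) \<partial>I)"
    by (intro Bochner_Integration.integral_cong refl)
      (simp add: power2_norm_eq_inner inner_add_left inner_add_right inner_commute)
  also have "\<dots> = ((\<integral>t. (norm (?a t))\<^sup>2 \<partial>I) + (\<integral>t. (norm (?d t))\<^sup>2 \<partial>I)) + 2 * (\<integral>t. ?d t \<bullet> ?a t \<partial>I)"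
    using ai(2) di(2) di' by simp
  finally show ?thesis using c(3) by (simp add: c0 cT q d flip: e_def)
qed

subsection \<open>Admissible fluxes\<close>

text \<open>The class of the elasticity tensor to the power -1/2 applied to y; for y in
  \<open>Y_sym\<close>, \<open>sym_part\<close> changes nothing almost everywhere and makes the
  pointwise map linear.\<close>

definition flux :: "(real^'d \<Rightarrow> real^'d^'d) \<Rightarrow> (real^'d, real^'d^'d) l2" where
  "flux y = cls \<Omega> (\<lambda>x. neg_half (sym_part (y x)))"

lemma Y_sym_D: "y \<in> Y_sym \<Omega> \<Longrightarrow> y \<in> L2_space L" "y \<in> Y_sym \<Omega> \<Longrightarrow> AE x in L. y x \<in> Sym"
  by (auto simp: Y_sym_def sym_matrices_def elim!: eventually_mono)

lemma flux_L2: "y \<in> L2_space L \<Longrightarrow> (\<lambda>x. neg_half (sym_part (y x))) \<in> L2_space L"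
  by (rule L2_space_linear[OF _ linear_neg_half_sym])

lemma flux_defect:
  assumes y: "y \<in> Y_sym \<Omega>" and w: "w \<in> W12 \<Omega>"
  shows "(\<integral>x. (norm (neg_half (y x - elast mu lam (sym_grad \<Omega> w x))))\<^sup>2 \<partial>L) = (norm (flux y - E w))\<^sup>2"
proof -
  let ?F = "\<lambda>x. neg_half (sym_part (y x)) - half (sym_grad \<Omega> w x)"
  note F = flux_L2[OF Y_sym_D(1)[OF y]] half_sym_grad_L2[OF w]
  have "AE x in L. (norm (neg_half (y x - elast mu lam (sym_grad \<Omega> w x))))\<^sup>2 = (norm (?F x))\<^sup>2"
    using Y_sym_D(2)[OF y]
  proof eventually_elim
    case (elim x)
    \<comment> \<open>The elasticity tensor is \<open>half\<close> applied twice, and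
      \<open>neg_half\<close> cancels one of the two.\<close>
    have "neg_half (1 *\<^sub>R y x + (-1) *\<^sub>R half (half (sym_grad \<Omega> w x))) = ?F x"
      unfolding neg_half_lincomb[OF elim half_Sym[OF half_Sym[OF sym_grad_Sym]]]
      by (simp add: neg_half_half half_Sym sym_grad_Sym sym_part_id elim)
    then show ?case by (simp add: half_half sym_grad_Sym)
  qed
  then have "(\<integral>x. (norm (neg_half (y x - elast mu lam (sym_grad \<Omega> w x))))\<^sup>2 \<partial>L) = (\<integral>x. (norm (?F x))\<^sup>2 \<partial>L)"
    by (rule complete_measure.integral_AE_cong[OF complete_measure_lebesgue_on[OF dom]])
  also have "\<dots> = (norm (cls \<Omega> ?F))\<^sup>2" by (rule norm_cls_sqr[OF L2_space_diff[OF F]])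
  finally show ?thesis by (simp add: flux_def E_def cls_diff[OF dom F])
qed

text \<open>A symmetric y sees only the symmetric part of the gradient; inserting
  \<open>half (neg_half (y x))\<close> and moving \<open>half\<close> to the other side gives an
  inner product in \<open>l2\<close>.\<close>

lemma grad_adj_flux:
  assumes y: "y \<in> Y_sym \<Omega>" and w: "w \<in> W12 \<Omega>" shows "grad_adj \<Omega> y w = flux y \<bullet> E w"
proof -
  have "AE x in L. y x \<bullet> weak_grad \<Omega> w x = neg_half (sym_part (y x)) \<bullet> half (sym_grad \<Omega> w x)"
    using Y_sym_D(2)[OF y]
  proof eventually_elim
    case (elim x)
    have "y x \<bullet> weak_grad \<Omega> w x = half (neg_half (y x)) \<bullet> sym_grad \<Omega> w x"
      using inner_sym_part[OF elim, of "weak_grad \<Omega> w x"] by (simp add: half_neg_half[OF elim] sym_grad_def)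
    also have "\<dots> = neg_half (y x) \<bullet> half (sym_grad \<Omega> w x)"
      by (rule half_self_adjoint[OF neg_half_Sym[OF elim] sym_grad_Sym])
    finally show ?case by (simp add: sym_part_id elim)
  qed
  then have "grad_adj \<Omega> y w = (\<integral>x. neg_half (sym_part (y x)) \<bullet> half (sym_grad \<Omega> w x) \<partial>L)"
    unfolding grad_adj_def by (rule complete_measure.integral_AE_cong[OF complete_measure_lebesgue_on[OF dom]])
  also have "\<dots> = flux y \<bullet> E w"
    by (simp add: flux_def E_def inner_cls[OF dom flux_L2[OF Y_sym_D(1)[OF y]] half_sym_grad_L2[OF w]])
  finally show ?thesis .
qed

section \<open>Fluxes depending on time, and the optimal flux\<close>

lemma L2Y_flux:
  assumes "y \<in> L2Y_sym \<Omega> T"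
  shows "smeas I (\<lambda>t. flux (y t))" "integrable I (\<lambda>t. (norm (flux (y t)))\<^sup>2)"
proof -
  obtain K where K: "K > 0" "\<forall>A. norm (neg_half (sym_part A)) \<le> K * norm (A :: real^'d^'d)"
    using linear_bounded_pos[OF linear_neg_half_sym] by metis
  have le: "norm (flux z) \<le> K * L2_norm L z" if "z \<in> L2_space L" for z
    unfolding flux_def norm_cls[OF dom that, symmetric]
    by (rule norm_cls_linear_le[OF dom that linear_neg_half_sym K(2)[rule_format]]) (use K in simp)
  have d: "flux x - flux z = flux (x - z)" if "x \<in> L2_space L" "z \<in> L2_space L" for x z
    by (simp add: flux_def cls_diff[OF dom flux_L2[OF that(1)] flux_L2[OF that(2)], symmetric]
        linear_diff[OF linear_neg_half_sym])
  have 1: "norm (flux x - flux z) \<le> K * L2_norm L (x - z)" if "x \<in> Y_sym \<Omega>" "z \<in> Y_sym \<Omega>" for x z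
    unfolding d[OF Y_sym_D(1)[OF that(1)] Y_sym_D(1)[OF that(2)]]
    using L2_space_diff[OF Y_sym_D(1)[OF that(1)] Y_sym_D(1)[OF that(2)]] by (intro le) (simp add: fun_diff_def)
  have 2: "norm (flux x) \<le> K * L2_norm L x" if "x \<in> Y_sym \<Omega>" for x by (rule le[OF Y_sym_D(1)[OF that]])
  show "smeas I (\<lambda>t. flux (y t))" by (rule L2_Bochner_smeas(1)[where F = flux and K = K, OF assms 1 2])
  show "integrable I (\<lambda>t. (norm (flux (y t)))\<^sup>2)"
    by (rule L2_Bochner_smeas(2)[where F = flux and K = K, OF assms 1 2])
qed

text \<open>The elasticity tensor applied to the symmetric gradient of some \<xi> in V for which E
  \<xi> is the projection of x. The projection makes sense of it on all of \<open>l2\<close>, hence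
  for simple functions with values outside \<open>VV\<close>.\<close>

definition opt_flux :: "(real^'d, real^'d^'d) l2 \<Rightarrow> real^'d \<Rightarrow> real^'d^'d" where
  "opt_flux x z = half (half (sym_grad \<Omega> (dec (orth_proj VV x)) z))"

lemma opt_flux:
  shows "opt_flux x \<in> Y_sym \<Omega>" and "x \<in> VV \<Longrightarrow> flux (opt_flux x) = x"
proof -
  have D: "dec (orth_proj VV x) \<in> V_space \<Omega>" by (rule dec(1)[OF orth_proj(1)[OF subspace_VV closed_VV]])
  have "(\<lambda>z. half (sym_part (half (sym_grad \<Omega> (dec (orth_proj VV x)) z)))) \<in> L2_space L"
    by (rule L2_space_linear[OF half_sym_grad_L2[OF V_space_W12[OF D]] linear_half_sym])
  then have "opt_flux x \<in> L2_space L"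
    by (simp add: opt_flux_def[abs_def] sym_part_id half_Sym sym_grad_Sym)
  moreover have "opt_flux x z \<in> Sym" for z by (simp add: opt_flux_def half_Sym sym_grad_Sym)
  ultimately show "opt_flux x \<in> Y_sym \<Omega>" by (simp add: Y_sym_def sym_matrices_def)
  show "flux (opt_flux x) = x" if "x \<in> VV"
  proof -
    have "flux (opt_flux x) = E (dec (orth_proj VV x))"
      by (simp add: flux_def opt_flux_def E_def sym_part_id half_Sym sym_grad_Sym neg_half_half)
    then show ?thesis by (simp add: orth_proj_id[OF subspace_VV closed_VV that] dec[OF that])
  qed
qed

text \<open>Although \<open>opt_flux\<close> involves choices, almost everywhere it is
  \<open>half\<close> applied to a representative of the projection, hence linear and bounded as a
  map of classes.\<close>

lemma opt_flux_Lipschitz: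
  obtains K where "K > 0" "\<forall>x y. L2_norm L (opt_flux x - opt_flux y) \<le> K * norm (x - y)"
    "\<forall>x. L2_norm L (opt_flux x) \<le> K * norm x"
proof -
  let ?P = "orth_proj VV"
  note P = orth_proj(1)[OF subspace_VV closed_VV]
  obtain K where K: "K > 0" "\<forall>A. norm (half (sym_part A)) \<le> K * norm (A :: real^'d^'d)"
    using linear_bounded_pos[OF linear_half_sym] by metis
  let ?h = "\<lambda>x z. half (sym_grad \<Omega> (dec (?P x)) z)"
  have hL: "?h x \<in> L2_space L" and hc: "cls \<Omega> (?h x) = ?P x" for x
    using half_sym_grad_L2[OF V_space_W12[OF dec(1)[OF P]]] dec(2)[OF P] by (simp_all add: E_def)
  have opt: "opt_flux x = (\<lambda>z. half (sym_part (?h x z)))" for x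
    by (simp add: opt_flux_def[abs_def] sym_part_id half_Sym sym_grad_Sym)
  have le: "L2_norm L (\<lambda>z. half (sym_part (k z))) \<le> K * norm (cls \<Omega> k)" if "k \<in> L2_space L" for k
    unfolding norm_cls[OF dom L2_space_linear[OF that linear_half_sym], symmetric]
    by (rule norm_cls_linear_le[OF dom that linear_half_sym K(2)[rule_format]]) (use K in simp)
  have "L2_norm L (opt_flux x - opt_flux y) \<le> K * norm (x - y)" for x y
  proof -
    have "opt_flux x - opt_flux y = (\<lambda>z. half (sym_part (?h x z - ?h y z)))"
      by (simp add: opt fun_diff_def linear_diff[OF linear_half_sym])
    then have "L2_norm L (opt_flux x - opt_flux y) \<le> K * norm (cls \<Omega> (\<lambda>z. ?h x z - ?h y z))"
      using le[OF L2_space_diff[OF hL hL]] by simp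
    also have "cls \<Omega> (\<lambda>z. ?h x z - ?h y z) = ?P (x - y)"
      by (simp add: cls_diff[OF dom hL hL] hc
          linear_diff[OF bounded_linear.linear[OF bounded_linear_orth_proj[OF subspace_VV closed_VV]]])
    also have "K * norm (?P (x - y)) \<le> K * norm (x - y)"
      using K(1) orth_proj_norm_le[OF subspace_VV closed_VV] by simp
    finally show ?thesis .
  qed
  moreover have "L2_norm L (opt_flux x) \<le> K * norm x" for x
  proof -
    have "L2_norm L (opt_flux x) \<le> K * norm (?P x)" using le[OF hL[of x]] by (simp add: opt hc)
    also have "\<dots> \<le> K * norm x" using K(1) orth_proj_norm_le[OF subspace_VV closed_VV] by simp
    finally show ?thesis .
  qed
  ultimately show ?thesis using that K(1) by blast
qed

text \<open>Lipschitz continuity turns simple functions approximating q into simple functions with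
  values in \<open>Y_sym\<close> approximating the flux.\<close>

lemma opt_flux_L2Y:
  assumes q: "smeas I q" "integrable I (\<lambda>t. (norm (q t))\<^sup>2)"
  shows "(\<lambda>t. opt_flux (q t)) \<in> L2Y_sym \<Omega> T"
proof -
  obtain K where K: "K > 0" "\<forall>x y. L2_norm L (opt_flux x - opt_flux y) \<le> K * norm (x - y)"
    "\<forall>x. L2_norm L (opt_flux x) \<le> K * norm x" by (rule opt_flux_Lipschitz)
  note oL = Y_sym_D(1)[OF opt_flux(1)]
  obtain s where s: "\<forall>n. simple_function I (s n)" "AE t in I. (\<lambda>n. s n t) \<longlonglongrightarrow> q t"
    by (rule smeasE[OF q(1)])
  have simp_fn: "simple_function I (\<lambda>t. opt_flux (s n t))" for n
    by (rule simple_function_compose1[OF s(1)[rule_format]])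
  have img: "(\<lambda>t. opt_flux (s n t)) ` space I \<subseteq> Y_sym \<Omega>" for n using opt_flux(1) by blast
  have conv: "AE t in I. (\<lambda>n. L2_norm L (opt_flux (s n t) - opt_flux (q t))) \<longlonglongrightarrow> 0"
    using s(2)
  proof eventually_elim
    case (elim t)
    have "(\<lambda>n. s n t - q t) \<longlonglongrightarrow> 0" using LIM_zero[OF elim] .
    then have lim: "(\<lambda>n. K * norm (s n t - q t)) \<longlonglongrightarrow> 0" by (intro tendsto_mult_right_zero tendsto_norm_zero)
    show ?case
    proof (rule Lim_null_comparison[OF _ lim], intro always_eventually allI)
      show "norm (L2_norm L (opt_flux (s n t) - opt_flux (q t))) \<le> K * norm (s n t - q t)" for n
        using K(2) by (simp add: L2_norm_def)
    qed
  qed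
  have "smeas I (\<lambda>t. cls \<Omega> (opt_flux (q t)))"
  proof (rule smeas_compose[OF q(1)])
    have "K-lipschitz_on UNIV (\<lambda>x. cls \<Omega> (opt_flux x))"
    proof (rule lipschitz_onI)
      show "dist (cls \<Omega> (opt_flux x)) (cls \<Omega> (opt_flux y)) \<le> K * dist x y" for x y
        using K(2) norm_cls[OF dom L2_space_diff[OF oL oL], of x y]
        by (simp add: dist_norm cls_diff[OF dom oL oL] fun_diff_def)
    qed (use K in simp)
    then show "isCont (\<lambda>x. cls \<Omega> (opt_flux x)) x" for x
      using lipschitz_on_continuous_on continuous_on_eq_continuous_at open_UNIV by blast
  qed
  from smeas_measurable[OF smeas_norm[OF this]]
  have meas: "(\<lambda>t. L2_norm L (opt_flux (q t))) \<in> borel_measurable I" by (simp add: norm_cls[OF dom oL])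
  have int: "integrable I (\<lambda>t. (L2_norm L (opt_flux (q t)))\<^sup>2)"
  proof (rule Bochner_Integration.integrable_bound)
    show "integrable I (\<lambda>t. K\<^sup>2 * (norm (q t))\<^sup>2)" using q(2) by simp
    show "(\<lambda>t. (L2_norm L (opt_flux (q t)))\<^sup>2) \<in> borel_measurable I" using meas by simp
    have "(L2_norm L (opt_flux (q t)))\<^sup>2 \<le> (K * norm (q t))\<^sup>2" for t
      using K(3) by (intro power_mono) (simp_all add: L2_norm_def)
    then show "AE t in I. norm ((L2_norm L (opt_flux (q t)))\<^sup>2) \<le> norm (K\<^sup>2 * (norm (q t))\<^sup>2)"
      by (simp add: power_mult_distrib)
  qed
  show ?thesis
    unfolding L2_Bochner_def mem_Collect_eq
    using conv simp_fn img int opt_flux(1)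
    by (intro conjI exI[of _ "\<lambda>n t. opt_flux (s n t)"] allI) auto
qed

subsection \<open>Duality\<close>

text \<open>The load, the representative of f minus the time derivative of v, is kept together
  because it is the argument of \<open>opt_flux\<close> for the optimal flux.\<close>

definition residual :: "(real \<Rightarrow> (real^'d \<Rightarrow> real^'d) \<Rightarrow> real) \<Rightarrow> (real \<Rightarrow> real^'d \<Rightarrow> real^'d) \<Rightarrow>
    real \<Rightarrow> (real^'d, real^'d^'d) l2" where
  "residual f v t = E (v t) - (rho (f t) - rho (time_deriv \<Omega> T v t))"

context
  fixes f v
  assumes f: "f \<in> L2V_dual \<Omega> T" and v: "v \<in> W_space \<Omega> T"
begin

lemma load_square_integrable:
  "smeas I (\<lambda>t. rho (f t) - rho (time_deriv \<Omega> T v t))"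
  "integrable I (\<lambda>t. (norm (rho (f t) - rho (time_deriv \<Omega> T v t)))\<^sup>2)"
  using L2V_dual_rho[OF f] L2V_dual_rho[OF time_deriv_D(2)[OF v]]
  by (auto intro: smeas_diff square_integrable_diff)

lemma residual_integrable: "integrable I (\<lambda>t. (norm (residual f v t))\<^sup>2)"
  unfolding residual_def
  by (rule square_integrable_diff[OF L2V_E[OF time_deriv_D(1)[OF v]] load_square_integrable])

lemma residual_AE:
  "AE t in I. v t \<in> V_space \<Omega> \<and> rho (f t) - rho (time_deriv \<Omega> T v t) \<in> VV \<and> residual f v t \<in> VV \<and>
    (\<forall>w\<in>V_space \<Omega>. f t w - time_deriv \<Omega> T v t w = (rho (f t) - rho (time_deriv \<Omega> T v t)) \<bullet> E w)"
  using L2_Bochner_AE[OF f] L2_Bochner_AE[OF time_deriv_D(1)[OF v]] L2_Bochner_AE[OF time_deriv_D(2)[OF v]]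
proof eventually_elim
  case (elim t)
  have "rho (f t) - rho (time_deriv \<Omega> T v t) \<in> VV"
    by (rule subspace_diff[OF subspace_VV rho(1)[OF elim(1)] rho(1)[OF elim(3)]])
  moreover from this have "residual f v t \<in> VV"
    unfolding residual_def by (rule subspace_diff[OF subspace_VV E_VV[OF elim(2)]])
  ultimately show ?case
    using elim by (simp add: rho(2)[OF elim(1)] rho(2)[OF elim(3)] inner_diff_left)
qed

lemma residual_norm:
  "(L2VC_dual_norm \<Omega> T mu lam (\<lambda>t w. time_deriv \<Omega> T v t w + lame_op \<Omega> mu lam (v t) w - f t w))\<^sup>2
    = (\<integral>t. (norm (residual f v t))\<^sup>2 \<partial>I)"
proof (rule L2VC_dual_norm_sqr)
  show "AE t in I. residual f v t \<in> VV \<and> (\<forall>w\<in>V_space \<Omega>.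
      time_deriv \<Omega> T v t w + lame_op \<Omega> mu lam (v t) w - f t w = residual f v t \<bullet> E w)"
    using residual_AE
  proof eventually_elim
    case (elim t)
    have "time_deriv \<Omega> T v t w + lame_op \<Omega> mu lam (v t) w - f t w = residual f v t \<bullet> E w"
      if w: "w \<in> V_space \<Omega>" for w
    proof -
      have "f t w - time_deriv \<Omega> T v t w = (rho (f t) - rho (time_deriv \<Omega> T v t)) \<bullet> E w" using elim w by blast
      moreover have "lame_op \<Omega> mu lam (v t) w = E (v t) \<bullet> E w"
        using elim by (intro lame_op_E V_space_W12 w) blast
      ultimately show ?thesis by (simp add: residual_def inner_diff_left)
    qed
    then show ?case using elim by blast
  qed
qed

lemma flux_bound:
  assumes y: "y \<in> admissible_fluxes \<Omega> T f v"
  shows "(\<integral>t. (norm (residual f v t))\<^sup>2 \<partial>I)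
    \<le> (Q_norm \<Omega> T (\<lambda>t x. neg_half (y t x - elast mu lam (sym_grad \<Omega> (v t) x))))\<^sup>2"
proof -
  have yL: "y \<in> L2Y_sym \<Omega> T"
    and adm: "AE t in I. \<forall>w\<in>V_space \<Omega>. grad_adj \<Omega> (y t) w = f t w - time_deriv \<Omega> T v t w"
    using y by (auto simp: admissible_fluxes_def)
  have "(\<integral>t. (norm (residual f v t))\<^sup>2 \<partial>I) \<le> (\<integral>t. (norm (flux (y t) - E (v t)))\<^sup>2 \<partial>I)"
  proof (rule integral_mono_AE[OF residual_integrable])
    show "integrable I (\<lambda>t. (norm (flux (y t) - E (v t)))\<^sup>2)"
      by (rule square_integrable_diff[OF L2Y_flux[OF yL] L2V_E[OF time_deriv_D(1)[OF v]]])
    show "AE t in I. (norm (residual f v t))\<^sup>2 \<le> (norm (flux (y t) - E (v t)))\<^sup>2"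
      using residual_AE adm L2_Bochner_AE[OF yL]
    proof eventually_elim
      case (elim t)
      have r: "residual f v t \<in> VV" using elim(1) by blast
      \<comment> \<open>Orthogonality of the remainder to \<open>VV\<close> is exactly the
        admissibility of \<open>y t\<close>, read through \<open>grad_adj_flux\<close>.\<close>
      have "orth_proj VV (E (v t) - flux (y t)) = residual f v t"
      proof (rule orth_proj_unique[OF subspace_VV closed_VV r])
        fix x assume x: "x \<in> VV"
        let ?w = "dec x"
        note w = dec[OF x]
        have "flux (y t) \<bullet> E ?w = f t ?w - time_deriv \<Omega> T v t ?w"
          using elim(2) w(1) grad_adj_flux[OF elim(3) V_space_W12[OF w(1)]] by simp
        also have "\<dots> = (rho (f t) - rho (time_deriv \<Omega> T v t)) \<bullet> E ?w" using elim(1) w(1) by blast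
        finally show "residual f v t \<bullet> x = (E (v t) - flux (y t)) \<bullet> x"
          by (simp add: w(2) residual_def inner_diff_left)
      qed
      then have "norm (residual f v t) \<le> norm (E (v t) - flux (y t))"
        using orth_proj_norm_le[OF subspace_VV closed_VV] by metis
      then show ?case by (intro power_mono) (simp_all add: norm_minus_commute)
    qed
  qed
  also have "(\<integral>t. (norm (flux (y t) - E (v t)))\<^sup>2 \<partial>I)
      = (Q_norm \<Omega> T (\<lambda>t x. neg_half (y t x - elast mu lam (sym_grad \<Omega> (v t) x))))\<^sup>2"
    by (rule Q_norm_sqr[symmetric])
      (use L2_Bochner_AE[OF yL] residual_AE in \<open>eventually_elim, simp add: flux_defect V_space_W12\<close>)
  finally show ?thesis .
qed

lemma flux_attained:
  obtains y where "y \<in> admissible_fluxes \<Omega> T f v"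
    "(Q_norm \<Omega> T (\<lambda>t x. neg_half (y t x - elast mu lam (sym_grad \<Omega> (v t) x))))\<^sup>2
      = (\<integral>t. (norm (residual f v t))\<^sup>2 \<partial>I)"
proof
  let ?q = "\<lambda>t. rho (f t) - rho (time_deriv \<Omega> T v t)"
  let ?y = "\<lambda>t. opt_flux (?q t)"
  have "AE t in I. \<forall>w\<in>V_space \<Omega>. grad_adj \<Omega> (?y t) w = f t w - time_deriv \<Omega> T v t w"
    using residual_AE
    by eventually_elim (simp add: grad_adj_flux[OF opt_flux(1) V_space_W12] opt_flux(2))
  then show "?y \<in> admissible_fluxes \<Omega> T f v"
    by (simp add: admissible_fluxes_def opt_flux_L2Y[OF load_square_integrable])
  show "(Q_norm \<Omega> T (\<lambda>t x. neg_half (?y t x - elast mu lam (sym_grad \<Omega> (v t) x))))\<^sup>2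
      = (\<integral>t. (norm (residual f v t))\<^sup>2 \<partial>I)"
  proof (rule Q_norm_sqr)
    show "AE t in I. (\<integral>x. (norm (neg_half (?y t x - elast mu lam (sym_grad \<Omega> (v t) x))))\<^sup>2 \<partial>L)
        = (norm (residual f v t))\<^sup>2"
      using residual_AE
      by eventually_elim
        (simp add: flux_defect[OF opt_flux(1) V_space_W12] opt_flux(2) residual_def norm_minus_commute)
  qed
qed

text \<open>The infimum is taken in the extended reals, where it would be infinite over an empty
  set; \<open>flux_attained\<close> gives one inequality, \<open>flux_bound\<close> the
  other.\<close>

lemma flux_duality:
  "(INF y\<in>admissible_fluxes \<Omega> T f v.
      ereal (1/2 * (Q_norm \<Omega> T (\<lambda>t x. neg_half (y t x - elast mu lam (sym_grad \<Omega> (v t) x))))\<^sup>2))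
    = ereal (1/2 * (\<integral>t. (norm (residual f v t))\<^sup>2 \<partial>I))"
proof (rule antisym)
  obtain y where y: "y \<in> admissible_fluxes \<Omega> T f v"
    "(Q_norm \<Omega> T (\<lambda>t x. neg_half (y t x - elast mu lam (sym_grad \<Omega> (v t) x))))\<^sup>2
      = (\<integral>t. (norm (residual f v t))\<^sup>2 \<partial>I)" by (rule flux_attained)
  show "(INF y\<in>admissible_fluxes \<Omega> T f v.
      ereal (1/2 * (Q_norm \<Omega> T (\<lambda>t x. neg_half (y t x - elast mu lam (sym_grad \<Omega> (v t) x))))\<^sup>2))
    \<le> ereal (1/2 * (\<integral>t. (norm (residual f v t))\<^sup>2 \<partial>I))"
    by (rule INF_lower2[OF y(1)]) (simp add: y(2))
  show "ereal (1/2 * (\<integral>t. (norm (residual f v t))\<^sup>2 \<partial>I)) \<le> (INF y\<in>admissible_fluxes \<Omega> T f v.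
      ereal (1/2 * (Q_norm \<Omega> T (\<lambda>t x. neg_half (y t x - elast mu lam (sym_grad \<Omega> (v t) x))))\<^sup>2))"
    by (rule INF_greatest) (use flux_bound in simp)
qed

text \<open>The equation for u says that \<open>rho (f t)\<close> is \<open>rho\<close> of the time
  derivative of u plus \<open>E (u t)\<close>; inserted into the residual of v, it leaves the
  corresponding expression for v - u.\<close>

lemma residual_solution:
  assumes u: "navier_lame_solution \<Omega> T mu lam f u0 u"
  shows "AE t in I. residual f v t = rho (time_deriv \<Omega> T (v - u) t) + E ((v - u) t)"
proof -
  have uW: "u \<in> W_space \<Omega> T"
    and eq: "AE t in I. \<forall>w\<in>V_space \<Omega>. time_deriv \<Omega> T u t w + lame_op \<Omega> mu lam (u t) w = f t w"
    using u by (auto simp: navier_lame_solution_def)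
  note uD = time_deriv_D[OF uW]
  show ?thesis
    using eq L2_Bochner_AE[OF f] L2_Bochner_AE[OF uD(1)] L2_Bochner_AE[OF uD(2)]
      L2_Bochner_AE[OF time_deriv_D(1)[OF v]] W_space_diff(2)[OF v uW]
  proof eventually_elim
    case (elim t)
    have "rho (f t) = rho (time_deriv \<Omega> T u t) + E (u t)"
    proof (rule rho_eqI[OF elim(2)])
      show "rho (time_deriv \<Omega> T u t) + E (u t) \<in> VV"
        by (rule subspace_add[OF subspace_VV rho(1)[OF elim(4)] E_VV[OF elim(3)]])
      fix w assume w: "w \<in> V_space \<Omega>"
      have "f t w = time_deriv \<Omega> T u t w + lame_op \<Omega> mu lam (u t) w" using elim(1) w by simp
      then show "f t w = (rho (time_deriv \<Omega> T u t) + E (u t)) \<bullet> E w"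
        by (simp add: rho(2)[OF elim(4) w] lame_op_E[OF V_space_W12[OF elim(3)] V_space_W12[OF w]] inner_add_left)
    qed
    then show ?case
      by (simp add: residual_def elim(6) E_diff[OF V_space_W12[OF elim(5)] V_space_W12[OF elim(3)]])
  qed
qed

end

end

theorem lemma5p5:
  fixes \<Omega> :: "(real^'d) set"
    and T mu lam :: real
    and f :: "real \<Rightarrow> (real^'d \<Rightarrow> real^'d) \<Rightarrow> real"
    and u0 :: "real^'d \<Rightarrow> real^'d"
    and u v :: "real \<Rightarrow> real^'d \<Rightarrow> real^'d"
  assumes "bounded_lipschitz_domain \<Omega>"
    and "T > 0"
    and "mu > 0" and "lam > - (2 / real CARD('d)) * mu"
    and "f \<in> L2V_dual \<Omega> T"
    and "u0 \<in> L2_space (lebesgue_on \<Omega>)"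
    and "navier_lame_solution \<Omega> T mu lam f u0 u"
    and "v \<in> W_space \<Omega> T"
    and "AE x in lebesgue_on \<Omega>. cont_rep \<Omega> T v 0 x = u0 x"
  shows "ereal (1/2 * (Q_norm \<Omega> T (\<lambda>t x. elast_half mu lam (sym_grad \<Omega> ((v - u) t) x)))\<^sup>2
           + 1/2 * (L2VC_dual_norm \<Omega> T mu lam (time_deriv \<Omega> T (v - u)))\<^sup>2
           + 1/2 * (L2_norm (lebesgue_on \<Omega>) (cont_rep \<Omega> T (v - u) T))\<^sup>2)
       = (INF y\<in>admissible_fluxes \<Omega> T f v.
            ereal (1/2 * (Q_norm \<Omega> T (\<lambda>t x. elast_neg_half mu lam
                            (y t x - elast mu lam (sym_grad \<Omega> (v t) x))))\<^sup>2))
     \<and> (INF y\<in>admissible_fluxes \<Omega> T f v.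
            ereal (1/2 * (Q_norm \<Omega> T (\<lambda>t x. elast_neg_half mu lam
                            (y t x - elast mu lam (sym_grad \<Omega> (v t) x))))\<^sup>2))
       = ereal (1/2 * (L2VC_dual_norm \<Omega> T mu lam
           (\<lambda>t w. time_deriv \<Omega> T v t w + lame_op \<Omega> mu lam (v t) w - f t w))\<^sup>2)"
proof -
  interpret lame_time \<Omega> mu lam T
    by (intro lame_time.intro lame.intro bounded_open.intro lame_axioms.intro lame_time_axioms.intro)
      (use assms(1-4) in \<open>simp_all add: bounded_lipschitz_domain_def\<close>)
  note fv = assms(5) assms(8)
  have u: "u \<in> W_space \<Omega> T" "AE x in L. cont_rep \<Omega> T u 0 x = u0 x"
    using assms(7) by (auto simp: navier_lame_solution_def)
  have init: "AE x in L. cont_rep \<Omega> T v 0 x = cont_rep \<Omega> T u 0 x"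
    using assms(9) u(2) by eventually_elim simp
  have "AE t in I. (norm (rho (time_deriv \<Omega> T (v - u) t) + E ((v - u) t)))\<^sup>2 = (norm (residual f v t))\<^sup>2"
    using residual_solution[OF fv assms(7)] by eventually_elim simp
  then have eq: "(\<integral>t. (norm (rho (time_deriv \<Omega> T (v - u) t) + E ((v - u) t)))\<^sup>2 \<partial>I)
      = (\<integral>t. (norm (residual f v t))\<^sup>2 \<partial>I)"
    by (rule complete_measure.integral_AE_cong[OF complete_I])
  \<comment> \<open>Each of the three quantities in the theorem is half the integral of the squared
    norm of \<open>residual f v\<close>.\<close>
  note energy = trans[OF energy_identity_diff[OF fv(2) u(1) init] eq]
  show ?thesis
    unfolding flux_duality[OF fv] residual_norm[OF fv] distrib_left[symmetric] energy by simp
qed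

end
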